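(* Let $M^3$ be a three-dimensional connected Riemannian manifold. Then $M^3$ is a space form (i.e., has constant sectional curvature) if and only if every closed curve $\alpha:I\to G(p,R)$ on a geodesic sphere $G(p,R)$ with sufficiently small radius $R$ has vanishing total torsion.
   Context: For $p\in M$ and sufficiently small $R>0$, the geodesic sphere with center $p$ and radius $R$ is the surface $G(p,R)=\{\exp_p(RV): V\in T_pM,\ \Vert V\Vert=1\}$ ("sufficiently small radius" means: for each $p$ there is $R_0(p)>0$ such that the condition is imposed for all $0<R<R_0(p)$, where $G(p,R)$ is a smooth surface). Curves are regular, of class $C^3$, and parametrized by arc-length $s$; a curve $\alpha:[a,b]\to M^3$ is closed if $\alpha$ and its derivatives up to order three agree at $a$ and $b$. The torsion $\tau$ is that of the Frenet frame $\{\mathbf{t},\mathbf{n},\mathbf{b}\}$ of $\alpha$ in $M^3$ (defined where the curvature $\kappa=\Vert\nabla_{\mathbf{t}}\mathbf{t}\Vert$ is nonzero): $\nabla_{\mathbf{t}}\mathbf{t}=\kappa\mathbf{n}$, $\nabla_{\mathbf{t}}\mathbf{n}=-\kappa\mathbf{t}+\tau\mathbf{b}$, $\nabla_{\mathbf{t}}\mathbf{b}=-\tau\mathbf{n}$; the statement concerns closed curves for which the Frenet frame is defined. The total torsion is $T=\int_a^b\tau(s)\,\mathrm{d}s$. *)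

theory Defs
  imports "HOL-Analysis.Analysis"
begin

section \<open>Smooth maps between Euclidean spaces\<close>

text \<open>
  To be used on open sets only. Class \<open>C\<^sup>k\<close> is expressed through the directional derivatives.
\<close>

primrec Ck_on :: "nat \<Rightarrow> ('a::euclidean_space \<Rightarrow> 'b::real_normed_vector) \<Rightarrow> 'a set \<Rightarrow> bool" where
  "Ck_on 0 f S \<longleftrightarrow> continuous_on S f"
| "Ck_on (Suc k) f S \<longleftrightarrow>
     (\<forall>x\<in>S. f differentiable (at x)) \<and>
     (\<forall>v. Ck_on k (\<lambda>x. frechet_derivative f (at x) v) S)"

definition smooth_on :: "('a::euclidean_space \<Rightarrow> 'b::real_normed_vector) \<Rightarrow> 'a set \<Rightarrow> bool" where
  "smooth_on f S \<longleftrightarrow> (\<forall>k. Ck_on k f S)"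

definition partial :: "3 \<Rightarrow> (real^3 \<Rightarrow> real) \<Rightarrow> real^3 \<Rightarrow> real" where
  "partial i f x = frechet_derivative f (at x) (axis i 1)"

text \<open>Derivatives of curves are taken within the parameter set, hence one-sided at end points.\<close>

primrec iter_vderiv :: "nat \<Rightarrow> real set \<Rightarrow> (real \<Rightarrow> 'a::real_normed_vector) \<Rightarrow> real \<Rightarrow> 'a" where
  "iter_vderiv 0 I f = f"
| "iter_vderiv (Suc k) I f = (\<lambda>t. vector_derivative (iter_vderiv k I f) (at t within I))"


section \<open>Charts and tangent vectors\<close>

text \<open>
  A chart is a domain together with a coordinate map; the values of the map
  outside the domain are irrelevant.
\<close>

type_synonym 'a chart = "'a set \<times> ('a \<Rightarrow> real^3)"

abbreviation chart_dom :: "'a chart \<Rightarrow> 'a set" where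
  "chart_dom c \<equiv> fst c"

abbreviation chart_map :: "'a chart \<Rightarrow> 'a \<Rightarrow> real^3" where
  "chart_map c \<equiv> snd c"

definition chart_cod :: "'a chart \<Rightarrow> (real^3) set" where
  "chart_cod c = chart_map c ` chart_dom c"

definition chart_inv :: "'a chart \<Rightarrow> real^3 \<Rightarrow> 'a" where
  "chart_inv c = inv_into (chart_dom c) (chart_map c)"

definition transition :: "'a chart \<Rightarrow> 'a chart \<Rightarrow> real^3 \<Rightarrow> real^3" where
  "transition c d = (\<lambda>x. chart_map d (chart_inv c x))"

definition is_chart :: "'a topology \<Rightarrow> 'a chart \<Rightarrow> bool" where
  "is_chart X c \<longleftrightarrow>
     openin X (chart_dom c) \<and> open (chart_cod c) \<and>
     homeomorphic_map (subtopology X (chart_dom c)) (top_of_set (chart_cod c)) (chart_map c)"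

definition smooth_atlas :: "'a topology \<Rightarrow> 'a chart set \<Rightarrow> bool" where
  "smooth_atlas X A \<longleftrightarrow>
     (\<forall>c\<in>A. is_chart X c) \<and> (\<Union>c\<in>A. chart_dom c) = topspace X \<and>
     (\<forall>c\<in>A. \<forall>d\<in>A. smooth_on (transition c d) (chart_map c ` (chart_dom c \<inter> chart_dom d)))"

text \<open>
  A tangent vector at \<open>p\<close> is the family of its component vectors in the charts of the atlas
  around \<open>p\<close>, subject to the usual transformation law; components in all other charts are
  \<open>0\<close> by convention. The linear operations are the chartwise ones.
\<close>

type_synonym 'a tvec = "'a chart \<Rightarrow> real^3"

record 'a riem =
  rtop :: "'a topology"
  charts :: "'a chart set"
  rmetric :: "'a \<Rightarrow> 'a tvec \<Rightarrow> 'a tvec \<Rightarrow> real"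

definition charts_at :: "('a, 'z) riem_scheme \<Rightarrow> 'a \<Rightarrow> 'a chart set" where
  "charts_at M p = {c \<in> charts M. p \<in> chart_dom c}"

definition tangent_space :: "('a, 'z) riem_scheme \<Rightarrow> 'a \<Rightarrow> 'a tvec set" where
  "tangent_space M p =
     {v. (\<forall>c. c \<notin> charts_at M p \<longrightarrow> v c = 0) \<and>
         (\<forall>c\<in>charts_at M p. \<forall>d\<in>charts_at M p.
            v d = frechet_derivative (transition c d) (at (chart_map c p)) (v c))}"

definition coord_vec :: "('a, 'z) riem_scheme \<Rightarrow> 'a chart \<Rightarrow> 3 \<Rightarrow> 'a \<Rightarrow> 'a tvec" where
  "coord_vec M c i p =
     (\<lambda>d. if d \<in> charts_at M p
          then frechet_derivative (transition c d) (at (chart_map c p)) (axis i 1) else 0)"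

definition metric_coeff :: "('a, 'z) riem_scheme \<Rightarrow> 'a chart \<Rightarrow> 3 \<Rightarrow> 3 \<Rightarrow> real^3 \<Rightarrow> real" where
  "metric_coeff M c i j x =
     rmetric M (chart_inv c x) (coord_vec M c i (chart_inv c x)) (coord_vec M c j (chart_inv c x))"

definition inner_product_on_tangent :: "('a, 'z) riem_scheme \<Rightarrow> 'a \<Rightarrow> bool" where
  "inner_product_on_tangent M p \<longleftrightarrow>
     (\<forall>u\<in>tangent_space M p. \<forall>v\<in>tangent_space M p. rmetric M p u v = rmetric M p v u) \<and>
     (\<forall>u\<in>tangent_space M p. \<forall>v\<in>tangent_space M p. \<forall>w\<in>tangent_space M p. \<forall>r s.
        rmetric M p (\<lambda>c. r *\<^sub>R u c + s *\<^sub>R v c) w = r * rmetric M p u w + s * rmetric M p v w) \<and>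
     (\<forall>u\<in>tangent_space M p. u \<noteq> (\<lambda>c. 0) \<longrightarrow> rmetric M p u u > 0)"

definition riemannian_3_manifold :: "('a, 'z) riem_scheme \<Rightarrow> bool" where
  "riemannian_3_manifold M \<longleftrightarrow>
     Hausdorff_space (rtop M) \<and> second_countable (rtop M) \<and>
     smooth_atlas (rtop M) (charts M) \<and>
     (\<forall>p\<in>topspace (rtop M). inner_product_on_tangent M p) \<and>
     (\<forall>c\<in>charts M. \<forall>i j. smooth_on (metric_coeff M c i j) (chart_cod c))"

definition tnorm :: "('a, 'z) riem_scheme \<Rightarrow> 'a \<Rightarrow> 'a tvec \<Rightarrow> real" where
  "tnorm M p v = sqrt (rmetric M p v v)"


section \<open>Levi-Civita connection and sectional curvature\<close>

definition inverse_metric_coeff :: "('a, 'z) riem_scheme \<Rightarrow> 'a chart \<Rightarrow> 3 \<Rightarrow> 3 \<Rightarrow> real^3 \<Rightarrow> real" where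
  "inverse_metric_coeff M c i j x = matrix_inv (\<chi> k l. metric_coeff M c k l x) $ i $ j"

text \<open>\<open>christoffel M c k i j\<close> is the symbol with upper index \<open>k\<close> and lower indices \<open>i\<close>, \<open>j\<close>.\<close>

definition christoffel :: "('a, 'z) riem_scheme \<Rightarrow> 'a chart \<Rightarrow> 3 \<Rightarrow> 3 \<Rightarrow> 3 \<Rightarrow> real^3 \<Rightarrow> real" where
  "christoffel M c k i j x =
     (1/2) * (\<Sum>l\<in>UNIV. inverse_metric_coeff M c k l x *
        (partial i (metric_coeff M c j l) x + partial j (metric_coeff M c i l) x
         - partial l (metric_coeff M c i j) x))"

text \<open>
  \<open>curv_coeff M c l i j k\<close> is the \<open>l\<close>-th component of
  \<open>R(\<partial>\<^sub>i,\<partial>\<^sub>j)\<partial>\<^sub>k\<close>, where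
  \<open>R(X,Y)Z = \<nabla>\<^sub>X\<nabla>\<^sub>YZ - \<nabla>\<^sub>Y\<nabla>\<^sub>XZ - \<nabla>\<^bsub>[X,Y]\<^esub>Z\<close>.
\<close>

definition curv_coeff :: "('a, 'z) riem_scheme \<Rightarrow> 'a chart \<Rightarrow> 3 \<Rightarrow> 3 \<Rightarrow> 3 \<Rightarrow> 3 \<Rightarrow> real^3 \<Rightarrow> real" where
  "curv_coeff M c l i j k x =
     partial i (christoffel M c l j k) x - partial j (christoffel M c l i k) x
     + (\<Sum>m\<in>UNIV. christoffel M c l i m x * christoffel M c m j k x
                  - christoffel M c l j m x * christoffel M c m i k x)"

definition riem_curv :: "('a, 'z) riem_scheme \<Rightarrow> 'a \<Rightarrow> 'a tvec \<Rightarrow> 'a tvec \<Rightarrow> 'a tvec \<Rightarrow> 'a tvec" where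
  "riem_curv M p u v w =
     (\<lambda>c. if c \<in> charts_at M p
          then (\<chi> l. \<Sum>i\<in>UNIV. \<Sum>j\<in>UNIV. \<Sum>k\<in>UNIV.
                  curv_coeff M c l i j k (chart_map c p) * u c $ i * v c $ j * w c $ k)
          else 0)"

definition sectional_curv :: "('a, 'z) riem_scheme \<Rightarrow> 'a \<Rightarrow> 'a tvec \<Rightarrow> 'a tvec \<Rightarrow> real" where
  "sectional_curv M p u v =
     rmetric M p (riem_curv M p u v v) u /
     (rmetric M p u u * rmetric M p v v - (rmetric M p u v)\<^sup>2)"

definition lin_indep2 :: "'a tvec \<Rightarrow> 'a tvec \<Rightarrow> bool" where
  "lin_indep2 u v \<longleftrightarrow> (\<forall>r s. (\<lambda>c. r *\<^sub>R u c + s *\<^sub>R v c) = (\<lambda>c. 0) \<longrightarrow> r = 0 \<and> s = 0)"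

definition space_form :: "('a, 'z) riem_scheme \<Rightarrow> bool" where
  "space_form M \<longleftrightarrow>
     (\<exists>K. \<forall>p\<in>topspace (rtop M). \<forall>u\<in>tangent_space M p. \<forall>v\<in>tangent_space M p.
        lin_indep2 u v \<longrightarrow> sectional_curv M p u v = K)"


section \<open>Curves, geodesics and geodesic spheres\<close>

definition Ck_curve :: "('a, 'z) riem_scheme \<Rightarrow> nat \<Rightarrow> real set \<Rightarrow> (real \<Rightarrow> 'a) \<Rightarrow> bool" where
  "Ck_curve M k I \<alpha> \<longleftrightarrow>
     continuous_map (top_of_set I) (rtop M) \<alpha> \<and>
     (\<forall>t\<in>I. \<forall>c\<in>charts_at M (\<alpha> t).
        (\<forall>j<k. iter_vderiv j I (chart_map c \<circ> \<alpha>) differentiable (at t within I)) \<and>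
        continuous (at t within I) (iter_vderiv k I (chart_map c \<circ> \<alpha>)))"

definition velocity :: "('a, 'z) riem_scheme \<Rightarrow> real set \<Rightarrow> (real \<Rightarrow> 'a) \<Rightarrow> real \<Rightarrow> 'a tvec" where
  "velocity M I \<alpha> t =
     (\<lambda>c. if c \<in> charts_at M (\<alpha> t)
          then vector_derivative (chart_map c \<circ> \<alpha>) (at t within I) else 0)"

definition field_along :: "('a, 'z) riem_scheme \<Rightarrow> real set \<Rightarrow> (real \<Rightarrow> 'a) \<Rightarrow> (real \<Rightarrow> 'a tvec) \<Rightarrow> bool" where
  "field_along M I \<alpha> V \<longleftrightarrow> (\<forall>t\<in>I. V t \<in> tangent_space M (\<alpha> t))"

definition diff_field_along :: "('a, 'z) riem_scheme \<Rightarrow> real set \<Rightarrow> (real \<Rightarrow> 'a) \<Rightarrow> (real \<Rightarrow> 'a tvec) \<Rightarrow> bool" where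
  "diff_field_along M I \<alpha> V \<longleftrightarrow>
     field_along M I \<alpha> V \<and>
     (\<forall>t\<in>I. \<forall>c\<in>charts_at M (\<alpha> t). (\<lambda>s. V s c) differentiable (at t within I))"

text \<open>Covariant derivative \<open>\<nabla>\<^bsub>\<alpha>'\<^esub>V\<close> of a vector field \<open>V\<close> along \<open>\<alpha>\<close>.\<close>

definition cov_deriv ::
  "('a, 'z) riem_scheme \<Rightarrow> real set \<Rightarrow> (real \<Rightarrow> 'a) \<Rightarrow> (real \<Rightarrow> 'a tvec) \<Rightarrow> real \<Rightarrow> 'a tvec" where
  "cov_deriv M I \<alpha> V t =
     (\<lambda>c. if c \<in> charts_at M (\<alpha> t)
          then (\<chi> k. vector_derivative (\<lambda>s. V s c) (at t within I) $ k
                 + (\<Sum>i\<in>UNIV. \<Sum>j\<in>UNIV. christoffel M c k i j (chart_map c (\<alpha> t))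
                      * velocity M I \<alpha> t c $ i * V t c $ j))
          else 0)"

definition geodesic :: "('a, 'z) riem_scheme \<Rightarrow> real set \<Rightarrow> (real \<Rightarrow> 'a) \<Rightarrow> bool" where
  "geodesic M I \<gamma> \<longleftrightarrow>
     Ck_curve M 2 I \<gamma> \<and> (\<forall>t\<in>I. cov_deriv M I \<gamma> (velocity M I \<gamma>) t = (\<lambda>c. 0))"

definition exp_dom :: "('a, 'z) riem_scheme \<Rightarrow> 'a \<Rightarrow> 'a tvec set" where
  "exp_dom M p =
     {v \<in> tangent_space M p. \<exists>\<gamma>. geodesic M {0..1} \<gamma> \<and> \<gamma> 0 = p \<and> velocity M {0..1} \<gamma> 0 = v}"

definition exp_map :: "('a, 'z) riem_scheme \<Rightarrow> 'a \<Rightarrow> 'a tvec \<Rightarrow> 'a" where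
  "exp_map M p v =
     (THE q. \<exists>\<gamma>. geodesic M {0..1} \<gamma> \<and> \<gamma> 0 = p \<and> velocity M {0..1} \<gamma> 0 = v \<and> \<gamma> 1 = q)"

definition unit_vectors :: "('a, 'z) riem_scheme \<Rightarrow> 'a \<Rightarrow> 'a tvec set" where
  "unit_vectors M p = {V \<in> tangent_space M p. tnorm M p V = 1}"

definition geodesic_sphere :: "('a, 'z) riem_scheme \<Rightarrow> 'a \<Rightarrow> real \<Rightarrow> 'a set" where
  "geodesic_sphere M p R = {exp_map M p (\<lambda>c. R *\<^sub>R V c) | V. V \<in> unit_vectors M p}"

text \<open>Smooth embedded surfaces, described as local regular zero sets of smooth functions.\<close>

definition smooth_surface :: "('a, 'z) riem_scheme \<Rightarrow> 'a set \<Rightarrow> bool" where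
  "smooth_surface M S \<longleftrightarrow>
     S \<subseteq> topspace (rtop M) \<and>
     (\<forall>q\<in>S. \<exists>c\<in>charts_at M q. \<exists>W h.
        open W \<and> chart_map c q \<in> W \<and> W \<subseteq> chart_cod c \<and>
        smooth_on (h :: real^3 \<Rightarrow> real) W \<and>
        (\<forall>x\<in>W. frechet_derivative h (at x) \<noteq> (\<lambda>v. 0)) \<and>
        chart_map c ` (S \<inter> chart_dom c) \<inter> W = {x\<in>W. h x = 0})"

definition sphere_radius_bound :: "('a, 'z) riem_scheme \<Rightarrow> 'a \<Rightarrow> real \<Rightarrow> bool" where
  "sphere_radius_bound M p R0 \<longleftrightarrow>
     R0 > 0 \<and>
     (\<forall>R. 0 < R \<and> R < R0 \<longrightarrow>
        (\<forall>V\<in>unit_vectors M p. (\<lambda>c. R *\<^sub>R V c) \<in> exp_dom M p) \<and>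
        smooth_surface M (geodesic_sphere M p R))"


section \<open>Closed curves, Frenet frame and total torsion\<close>

definition closed_C3_curve :: "('a, 'z) riem_scheme \<Rightarrow> real \<Rightarrow> real \<Rightarrow> (real \<Rightarrow> 'a) \<Rightarrow> bool" where
  "closed_C3_curve M a b \<alpha> \<longleftrightarrow>
     a < b \<and> Ck_curve M 3 {a..b} \<alpha> \<and> \<alpha> a = \<alpha> b \<and>
     (\<forall>c\<in>charts_at M (\<alpha> a). \<forall>k\<in>{1,2,3}.
        iter_vderiv k {a..b} (chart_map c \<circ> \<alpha>) a = iter_vderiv k {a..b} (chart_map c \<circ> \<alpha>) b)"

definition arc_length_param :: "('a, 'z) riem_scheme \<Rightarrow> real \<Rightarrow> real \<Rightarrow> (real \<Rightarrow> 'a) \<Rightarrow> bool" where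
  "arc_length_param M a b \<alpha> \<longleftrightarrow> (\<forall>s\<in>{a..b}. tnorm M (\<alpha> s) (velocity M {a..b} \<alpha> s) = 1)"

definition orthonormal3 :: "('a, 'z) riem_scheme \<Rightarrow> 'a \<Rightarrow> 'a tvec \<Rightarrow> 'a tvec \<Rightarrow> 'a tvec \<Rightarrow> bool" where
  "orthonormal3 M p u v w \<longleftrightarrow>
     rmetric M p u u = 1 \<and> rmetric M p v v = 1 \<and> rmetric M p w w = 1 \<and>
     rmetric M p u v = 0 \<and> rmetric M p u w = 0 \<and> rmetric M p v w = 0"

definition curve_curvature :: "('a, 'z) riem_scheme \<Rightarrow> real \<Rightarrow> real \<Rightarrow> (real \<Rightarrow> 'a) \<Rightarrow> real \<Rightarrow> real" where
  "curve_curvature M a b \<alpha> s =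
     tnorm M (\<alpha> s) (cov_deriv M {a..b} \<alpha> (velocity M {a..b} \<alpha>) s)"

text \<open>
  The frame of a unit speed curve consists of its velocity \<open>t\<close> and of \<open>n\<close>, \<open>b\<close>; the torsion
  is \<open>\<tau>\<close>. As the manifold carries no orientation, the frame may have either handedness;
  exchanging \<open>b\<close> and \<open>-b\<close> changes the sign of \<open>\<tau>\<close> on the whole interval.
\<close>

definition frenet_frame ::
  "('a, 'z) riem_scheme \<Rightarrow> real \<Rightarrow> real \<Rightarrow> (real \<Rightarrow> 'a) \<Rightarrow>
   (real \<Rightarrow> 'a tvec) \<Rightarrow> (real \<Rightarrow> 'a tvec) \<Rightarrow> (real \<Rightarrow> 'a tvec) \<Rightarrow> (real \<Rightarrow> real) \<Rightarrow> bool" where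
  "frenet_frame M a b \<alpha> tt nn bb \<tau> \<longleftrightarrow>
     tt = velocity M {a..b} \<alpha> \<and>
     diff_field_along M {a..b} \<alpha> tt \<and>
     diff_field_along M {a..b} \<alpha> nn \<and>
     diff_field_along M {a..b} \<alpha> bb \<and>
     (\<forall>s\<in>{a..b}.
        curve_curvature M a b \<alpha> s \<noteq> 0 \<and>
        orthonormal3 M (\<alpha> s) (tt s) (nn s) (bb s) \<and>
        cov_deriv M {a..b} \<alpha> tt s = (\<lambda>c. curve_curvature M a b \<alpha> s *\<^sub>R nn s c) \<and>
        cov_deriv M {a..b} \<alpha> nn s =
          (\<lambda>c. - curve_curvature M a b \<alpha> s *\<^sub>R tt s c + \<tau> s *\<^sub>R bb s c) \<and>
        cov_deriv M {a..b} \<alpha> bb s = (\<lambda>c. - \<tau> s *\<^sub>R nn s c))"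

text \<open>
  Vanishing is expressed by \<open>has_integral\<close> because \<open>integral\<close> is \<open>0\<close> on functions
  that are not integrable.
\<close>

definition vanishing_total_torsion ::
  "('a, 'z) riem_scheme \<Rightarrow> real \<Rightarrow> real \<Rightarrow> (real \<Rightarrow> 'a) \<Rightarrow> bool" where
  "vanishing_total_torsion M a b \<alpha> \<longleftrightarrow>
     (\<forall>tt nn bb \<tau>. frenet_frame M a b \<alpha> tt nn bb \<tau> \<longrightarrow> (\<tau> has_integral 0) {a..b})"

end

theory Submission
  imports Defs
begin

text \<open>
  Let \<open>N\<close> be the outer unit normal of a small geodesic sphere. Small spheres are strictly convex, so along a
  curve on the sphere \<open>N\<close> is never orthogonal to the principal normal, and the angle between the two is a
  closed function whose derivative compares \<open>\<tau>\<close> with the rotation of \<open>N\<close>. Hence, up to sign, the total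
  torsion is the integral of \<open>vol(N, t, \<nabla>\<^sub>t N)\<close>. By the Jacobi equation along the radii this integrand is governed by
  \<open>vol(N, t, R(t, N)N)\<close>, which vanishes in constant curvature.
  Conversely, applying the formula to suitable small loops around a direction \<open>x\<close> on spheres of radius
  tending to zero yields \<open>\<langle>R(e, x)x, f\<rangle> = 0\<close> for all orthonormal \<open>e, x, f\<close> in \<open>T\<^sub>pM\<close>. So the sectional curvature at \<open>p\<close>
  does not depend on the plane, and Schur's lemma together with connectedness gives a space form.
\<close>

section \<open>Calculus of \<open>C\<^sup>k\<close> maps\<close>

text \<open>All analysis takes place on open subsets of R^3 with a metric (\<open>patch\<close>);
  isometries carry the results to the manifold, whose tangent vectors are families of chart
  components. The centre of a sphere is put at the origin of normal coordinates, where the sphere is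
  Euclidean and the Gauss lemma makes x / R its unit normal. This needs an exponential map depending
  smoothly on its argument, hence the ODE part; and since \<open>exp_map\<close> is a definite
  description, it also needs uniqueness of geodesics. In the converse a loop of angular size
  \<epsilon> on the sphere of radius \<epsilon> gives an integral of order \<epsilon>^5. Its leading
  coefficient integrates the quadratic form v -> vol(x, v, R(v, x)x) over the directions v of the
  loop. That form has trace zero, because R(., x)x is self-adjoint, so a round circle detects
  nothing; this is why the loop is weighted by a second harmonic. There is no orientation to rely
  on: the volume form is that of the coordinates, its value on a Frenet frame is a constant sign,
  and only the square of that sign enters.\<close>

abbreviation fd :: "('a::real_normed_vector \<Rightarrow> 'b::real_normed_vector) \<Rightarrow> 'a \<Rightarrow> 'a \<Rightarrow> 'b" where
  "fd f x \<equiv> frechet_derivative f (at x)"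

lemma has_derivative_fd: "f differentiable (at x) \<Longrightarrow> (f has_derivative fd f x) (at x)"
  by (simp add: frechet_derivative_works)

lemma fd_eq: "(f has_derivative f') (at x) \<Longrightarrow> fd f x = f'"
  using frechet_derivative_at by metis

lemma fd_cong_open:
  assumes "open S" "x \<in> S" "\<And>y. y \<in> S \<Longrightarrow> f y = g y"
  shows "fd f x = fd g x"
proof -
  have "(f has_derivative h) (at x) \<longleftrightarrow> (g has_derivative h) (at x)" for h
    using has_derivative_transform_within_open[of f h x UNIV S g]
      has_derivative_transform_within_open[of g h x UNIV S f] assms by auto
  then show ?thesis unfolding frechet_derivative_def by simp
qed

lemma differentiable_cong_open:
  assumes "open S" "x \<in> S" "\<And>y. y \<in> S \<Longrightarrow> f y = g y"
  shows "f differentiable (at x) \<longleftrightarrow> g differentiable (at x)"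
  using has_derivative_transform_within_open[of f _ x UNIV S g]
      has_derivative_transform_within_open[of g _ x UNIV S f] assms
  unfolding differentiable_def by auto

lemma Ck_on_cong:
  assumes "open S" "\<And>x. x \<in> S \<Longrightarrow> f x = g x"
  shows "Ck_on k f S \<longleftrightarrow> Ck_on k g S"
  using assms(2)
proof (induction k arbitrary: f g)
  case 0
  then show ?case using continuous_on_cong[of S S f g] by simp
next
  case (Suc k)
  have "Ck_on k (\<lambda>x. fd f x v) S \<longleftrightarrow> Ck_on k (\<lambda>x. fd g x v) S" for v
    by (rule Suc.IH) (metis fd_cong_open assms(1) Suc.prems)
  moreover have "\<forall>x\<in>S. f differentiable (at x) \<longleftrightarrow> g differentiable (at x)"
    using differentiable_cong_open[OF assms(1), of _ f g] Suc.prems by blast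
  ultimately show ?case by auto
qed

text \<open>Replaces the chosen \<open>frechet_derivative\<close> by any explicit formula for the
  derivative. The closure properties below are inductions on \<open>k\<close> in which the formula
  is built from maps already known to be of class \<open>k\<close>.\<close>

lemma Ck_on_SucI:
  assumes "open S" "\<And>x. x \<in> S \<Longrightarrow> (f has_derivative f' x) (at x)"
    and "\<And>v. Ck_on k (\<lambda>x. f' x v) S"
  shows "Ck_on (Suc k) f S"
proof -
  have "Ck_on k (\<lambda>x. fd f x v) S" for v
    using Ck_on_cong[OF assms(1), of "\<lambda>x. fd f x v" "\<lambda>x. f' x v" k] assms(2,3) fd_eq by metis
  then show ?thesis using assms(2) by (auto simp: differentiable_def)
qed

lemma Ck_on_SucD: "Ck_on (Suc k) f S \<Longrightarrow> Ck_on k f S"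
proof (induction k arbitrary: f)
  case 0
  then show ?case
    by (simp add: continuous_at_imp_continuous_on differentiable_imp_continuous_within)
next
  case (Suc k)
  then show ?case using Ck_on.simps(2) by metis
qed

lemma Ck_on_le: "Ck_on m f S \<Longrightarrow> k \<le> m \<Longrightarrow> Ck_on k f S"
proof (induction m)
  case (Suc m)
  then show ?case using Ck_on_SucD le_Suc_eq by metis
qed simp

lemma Ck_on_subset: "Ck_on k f T \<Longrightarrow> S \<subseteq> T \<Longrightarrow> Ck_on k f S"
  by (induction k arbitrary: f) (auto intro: continuous_on_subset)

lemma Ck_on_const: "Ck_on k (\<lambda>x. c) S"
  by (induction k arbitrary: c) auto

lemma Ck_on_linear:
  assumes "bounded_linear L" "open S" "Ck_on k g S"
  shows "Ck_on k (\<lambda>x. L (g x)) S"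
  using assms(3)
proof (induction k arbitrary: g)
  case 0
  then show ?case using assms(1) by (auto intro: bounded_linear.continuous_on)
next
  case (Suc k)
  show ?case
  proof (rule Ck_on_SucI[OF assms(2)])
    show "((\<lambda>x. L (g x)) has_derivative (\<lambda>v. L (fd g x v))) (at x)" if "x \<in> S" for x
      using Suc.prems that has_derivative_fd by (auto intro: bounded_linear.has_derivative[OF assms(1)])
    show "Ck_on k (\<lambda>x. L (fd g x v)) S" for v
      by (rule Suc.IH) (use Suc.prems in auto)
  qed
qed

lemma Ck_on_ident: "Ck_on k (\<lambda>x. x) S"
proof (cases k)
  case (Suc m)
  then show ?thesis using Ck_on_const by auto
qed auto

lemma Ck_on_bounded_linear: "bounded_linear L \<Longrightarrow> Ck_on k L S"
  using Ck_on_subset[OF Ck_on_linear[of L UNIV k "\<lambda>x. x"]] Ck_on_ident by auto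

lemma Ck_on_add:
  assumes "open S" "Ck_on k f S" "Ck_on k g S"
  shows "Ck_on k (\<lambda>x. f x + g x) S"
  using assms(2,3)
proof (induction k arbitrary: f g)
  case 0
  then show ?case by (auto intro: continuous_intros)
next
  case (Suc k)
  show ?case
  proof (rule Ck_on_SucI[OF assms(1)])
    show "((\<lambda>x. f x + g x) has_derivative (\<lambda>v. fd f x v + fd g x v)) (at x)" if "x \<in> S" for x
      using Suc.prems that by (intro has_derivative_add has_derivative_fd) auto
    show "Ck_on k (\<lambda>x. fd f x v + fd g x v) S" for v
      by (rule Suc.IH) (use Suc.prems in auto)
  qed
qed

lemma Ck_on_bilinear:
  assumes "bounded_bilinear pr" "open S" "Ck_on k f S" "Ck_on k g S"
  shows "Ck_on k (\<lambda>x. pr (f x) (g x)) S"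
  using assms(3,4)
proof (induction k arbitrary: f g)
  case 0
  then show ?case using bounded_bilinear.continuous_on[OF assms(1)] by auto
next
  case (Suc k)
  show ?case
  proof (rule Ck_on_SucI[OF assms(2)])
    show "((\<lambda>x. pr (f x) (g x)) has_derivative (\<lambda>v. pr (f x) (fd g x v) + pr (fd f x v) (g x))) (at x)"
      if "x \<in> S" for x
      using Suc.prems that by (intro bounded_bilinear.FDERIV[OF assms(1)] has_derivative_fd) auto
    have "Ck_on k f S" "Ck_on k g S" using Suc.prems Ck_on_SucD by auto
    then show "Ck_on k (\<lambda>x. pr (f x) (fd g x v) + pr (fd f x v) (g x)) S" for v
      using Suc.prems by (intro Ck_on_add[OF assms(2)] Suc.IH) auto
  qed
qed

lemma Ck_on_sum:
  assumes "open S" "\<And>i. i \<in> A \<Longrightarrow> Ck_on k (f i) S"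
  shows "Ck_on k (\<lambda>x. \<Sum>i\<in>A. f i x) S"
  using assms(2)
  by (induction A rule: infinite_finite_induct) (auto intro: Ck_on_const Ck_on_add[OF assms(1)])

lemma linear_eq_sum_Basis:
  fixes L :: "'a::euclidean_space \<Rightarrow> 'b::real_normed_vector"
  assumes "linear L"
  shows "L v = (\<Sum>b\<in>Basis. (v \<bullet> b) *\<^sub>R L b)"
proof -
  have "L v = L (\<Sum>b\<in>Basis. (v \<bullet> b) *\<^sub>R b)" by (simp add: euclidean_representation)
  also have "\<dots> = (\<Sum>b\<in>Basis. (v \<bullet> b) *\<^sub>R L b)"
    by (simp add: linear_sum[OF assms] linear_scale[OF assms])
  finally show ?thesis .
qed

lemma linear_fd: "f differentiable (at x) \<Longrightarrow> linear (fd f x)"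
  using has_derivative_fd has_derivative_linear by blast

text \<open>The induction hypothesis controls the derivative of \<open>f\<close> only in a fixed
  direction, while the chain rule feeds it the moving direction \<open>fd g x v\<close>. Expanding
  that direction in \<open>Basis\<close> leaves sums of products of maps of class
  \<open>k\<close>.\<close>

lemma Ck_on_compose:
  assumes "open S" "open T" "g ` S \<subseteq> T" "Ck_on k f T" "Ck_on k g S"
  shows "Ck_on k (\<lambda>x. f (g x)) S"
  using assms(4,5)
proof (induction k arbitrary: f)
  case 0
  then show ?case using continuous_on_compose2 assms(3) by (metis Ck_on.simps(1))
next
  case (Suc k)
  have g: "Ck_on k g S" using Suc.prems Ck_on_SucD by auto
  have d: "f differentiable (at (g x))" "g differentiable (at x)" if "x \<in> S" for x
    using Suc.prems that assms(3) by auto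
  show ?case
  proof (rule Ck_on_SucI[OF assms(1)])
    show "((\<lambda>x. f (g x)) has_derivative (\<lambda>v. \<Sum>b\<in>Basis. (fd g x v \<bullet> b) *\<^sub>R fd f (g x) b)) (at x)"
      if "x \<in> S" for x
    proof -
      have "((\<lambda>x. f (g x)) has_derivative (\<lambda>v. fd f (g x) (fd g x v))) (at x)"
        using has_derivative_compose[OF has_derivative_fd[OF d(2)] has_derivative_fd[OF d(1)]] that by auto
      moreover have "fd f (g x) (fd g x v) = (\<Sum>b\<in>Basis. (fd g x v \<bullet> b) *\<^sub>R fd f (g x) b)" for v
        using linear_eq_sum_Basis[OF linear_fd[OF d(1)[OF that]]] .
      ultimately show ?thesis by simp
    qed
    show "Ck_on k (\<lambda>x. \<Sum>b\<in>Basis. (fd g x v \<bullet> b) *\<^sub>R fd f (g x) b) S" for v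
    proof (intro Ck_on_sum assms(1) Ck_on_bilinear[OF bounded_bilinear_scaleR])
      show "Ck_on k (\<lambda>x. fd g x v \<bullet> b) S" for b
        using Suc.prems by (intro Ck_on_linear[OF bounded_linear_inner_left assms(1)]) auto
      show "Ck_on k (\<lambda>x. fd f (g x) b) S" for b
        by (rule Suc.IH) (use Suc.prems g in auto)
    qed
  qed
qed

lemma Ck_on_Pair:
  assumes "open S" "Ck_on k f S" "Ck_on k g S"
  shows "Ck_on k (\<lambda>x. (f x, g x)) S"
proof -
  have "bounded_linear (\<lambda>a::'b. (a, 0::'c))" "bounded_linear (\<lambda>a::'c. (0::'b, a))"
    by (auto intro!: bounded_linear_Pair bounded_linear_ident bounded_linear_zero)
  then have "Ck_on k (\<lambda>x. (f x, 0) + (0, g x)) S"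
    using assms by (intro Ck_on_add Ck_on_linear[where L = "\<lambda>a. (a, 0::'c)"] Ck_on_linear[where L = "\<lambda>a. (0, a)"])
  then show ?thesis by simp
qed

lemma Ck_on_vec:
  fixes f :: "'i::finite \<Rightarrow> 'a::euclidean_space \<Rightarrow> real"
  assumes "open S" "\<And>i. Ck_on k (f i) S"
  shows "Ck_on k (\<lambda>x. \<chi> i. f i x) S"
proof -
  have eq: "(\<chi> i. f i x) = (\<Sum>i\<in>UNIV. f i x *\<^sub>R axis i 1)" for x
    by (vector axis_def) (auto simp: if_distrib cong: if_cong)
  have "Ck_on k (\<lambda>x. f i x *\<^sub>R axis i (1::real)) S" for i
    by (rule Ck_on_linear[OF bounded_linear_scaleR_left assms(1) assms(2)])
  then show ?thesis unfolding eq by (intro Ck_on_sum assms(1))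
qed

lemma Ck_on_inverse_real: "Ck_on k (inverse :: real \<Rightarrow> real) (- {0})"
proof (induction k)
  case 0
  show ?case by (auto intro!: continuous_intros)
next
  case (Suc k)
  show ?case
  proof (rule Ck_on_SucI)
    show "(inverse has_derivative (\<lambda>v. - (inverse x * v * inverse x))) (at x)" if "x \<in> - {0}" for x :: real
      using has_derivative_inverse'[of x UNIV] that by auto
    show "Ck_on k (\<lambda>x::real. - (inverse x * v * inverse x)) (- {0})" for v
      using Suc by (intro Ck_on_linear[OF bounded_linear_minus[OF bounded_linear_ident]]
          Ck_on_bilinear[OF bounded_bilinear_mult] Ck_on_const) auto
  qed auto
qed

lemma Ck_on_inverse:
  fixes f :: "'a::euclidean_space \<Rightarrow> real"
  assumes "open S" "Ck_on k f S" "\<And>x. x \<in> S \<Longrightarrow> f x \<noteq> 0"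
  shows "Ck_on k (\<lambda>x. inverse (f x)) S"
  by (rule Ck_on_compose[of S "- {0}"]) (use assms Ck_on_inverse_real in auto)

lemma Ck_on_sqrt_real: "Ck_on k sqrt {0<..}"
proof (induction k)
  case 0
  show ?case by (auto intro!: continuous_intros)
next
  case (Suc k)
  show ?case
  proof (rule Ck_on_SucI)
    show "(sqrt has_derivative (\<lambda>v. v * (inverse (sqrt x) / 2))) (at x)" if "x \<in> {0<..}" for x :: real
      using has_derivative_eq_rhs[OF DERIV_real_sqrt[unfolded has_field_derivative_def]] that
      by (auto simp: fun_eq_iff)
    have "Ck_on k (\<lambda>x. inverse (sqrt x)) {0<..}"
      by (rule Ck_on_inverse) (use Suc in auto)
    then show "Ck_on k (\<lambda>x. v * (inverse (sqrt x) / 2)) {0<..}" for v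
      by (intro Ck_on_bilinear[OF bounded_bilinear_mult] Ck_on_const
          Ck_on_linear[of "\<lambda>x. x / 2"] bounded_linear_divide) auto
  qed auto
qed

lemma Ck_on_sin_cos: "Ck_on k (sin :: real \<Rightarrow> real) S \<and> Ck_on k (cos :: real \<Rightarrow> real) S"
proof -
  have "Ck_on k (sin :: real \<Rightarrow> real) UNIV \<and> Ck_on k (cos :: real \<Rightarrow> real) UNIV"
  proof (induction k)
    case 0
    show ?case by (auto intro!: continuous_intros)
  next
    case (Suc k)
    have "(sin has_derivative (\<lambda>v. cos x * v)) (at x)" "(cos has_derivative (\<lambda>v. - sin x * v)) (at x)" for x :: real
      using DERIV_sin[of x] DERIV_cos[of x] unfolding has_field_derivative_def by blast+
    then show ?case
      using Suc by (intro conjI Ck_on_SucI[where f' = "\<lambda>x v. cos x * v"] Ck_on_SucI[where f' = "\<lambda>x v. - sin x * v"]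
         Ck_on_linear[OF bounded_linear_mult_left] Ck_on_linear[OF bounded_linear_minus[OF bounded_linear_ident]]) auto
  qed
  then show ?thesis using Ck_on_subset by blast
qed

section \<open>Closure properties of smooth maps and symmetry of second derivatives\<close>

named_theorems smooth_intros

lemma smooth_on_Ck: "smooth_on f S \<Longrightarrow> Ck_on k f S"
  by (simp add: smooth_on_def)

lemma smooth_on_cong: "open S \<Longrightarrow> (\<And>x. x \<in> S \<Longrightarrow> f x = g x) \<Longrightarrow> smooth_on f S \<longleftrightarrow> smooth_on g S"
  unfolding smooth_on_def using Ck_on_cong by metis

lemma smooth_on_subset: "smooth_on f T \<Longrightarrow> S \<subseteq> T \<Longrightarrow> smooth_on f S"
  unfolding smooth_on_def using Ck_on_subset by metis

lemma smooth_on_imp_differentiable: "smooth_on f S \<Longrightarrow> x \<in> S \<Longrightarrow> f differentiable (at x)"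
  using smooth_on_Ck[of f S "Suc 0"] by simp

lemma smooth_on_has_derivative: "smooth_on f S \<Longrightarrow> x \<in> S \<Longrightarrow> (f has_derivative fd f x) (at x)"
  using smooth_on_imp_differentiable has_derivative_fd by blast

lemma smooth_on_imp_continuous: "smooth_on f S \<Longrightarrow> continuous_on S f"
  using smooth_on_Ck[of f S 0] by simp

lemma smooth_on_fd: "smooth_on f S \<Longrightarrow> smooth_on (\<lambda>x. fd f x v) S"
  unfolding smooth_on_def using Ck_on.simps(2) by metis

lemma smooth_on_const [smooth_intros]: "smooth_on (\<lambda>x. c) S"
  by (simp add: smooth_on_def Ck_on_const)

lemma smooth_on_ident [smooth_intros]: "smooth_on (\<lambda>x. x) S"
  by (simp add: smooth_on_def Ck_on_ident)

lemma smooth_on_linear: "bounded_linear L \<Longrightarrow> open S \<Longrightarrow> smooth_on g S \<Longrightarrow> smooth_on (\<lambda>x. L (g x)) S"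
  by (simp add: smooth_on_def Ck_on_linear)

lemma smooth_on_add [smooth_intros]:
  "open S \<Longrightarrow> smooth_on f S \<Longrightarrow> smooth_on g S \<Longrightarrow> smooth_on (\<lambda>x. f x + g x) S"
  by (simp add: smooth_on_def Ck_on_add)

lemma smooth_on_bilinear:
  "bounded_bilinear pr \<Longrightarrow> open S \<Longrightarrow> smooth_on f S \<Longrightarrow> smooth_on g S \<Longrightarrow> smooth_on (\<lambda>x. pr (f x) (g x)) S"
  by (simp add: smooth_on_def Ck_on_bilinear)

lemmas smooth_on_mult [smooth_intros] = smooth_on_bilinear[OF bounded_bilinear_mult]
lemmas smooth_on_scaleR [smooth_intros] = smooth_on_bilinear[OF bounded_bilinear_scaleR]
lemmas smooth_on_inner [smooth_intros] = smooth_on_bilinear[OF bounded_bilinear_inner]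
lemmas smooth_on_minus [smooth_intros] = smooth_on_linear[OF bounded_linear_minus[OF bounded_linear_ident]]
lemmas smooth_on_nth [smooth_intros] = smooth_on_linear[OF bounded_linear_vec_nth]
lemmas smooth_on_fst [smooth_intros] = smooth_on_linear[OF bounded_linear_fst]
lemmas smooth_on_snd [smooth_intros] = smooth_on_linear[OF bounded_linear_snd]

lemma smooth_on_diff [smooth_intros]:
  "open S \<Longrightarrow> smooth_on f S \<Longrightarrow> smooth_on g S \<Longrightarrow> smooth_on (\<lambda>x. f x - g x) S"
  using smooth_on_add[of S f "\<lambda>x. - g x"] smooth_on_minus[of S g] by simp

lemma smooth_on_sum [smooth_intros]:
  "open S \<Longrightarrow> (\<And>i. i \<in> A \<Longrightarrow> smooth_on (f i) S) \<Longrightarrow> smooth_on (\<lambda>x. \<Sum>i\<in>A. f i x) S"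
  by (simp add: smooth_on_def Ck_on_sum)

lemma smooth_on_compose:
  "open S \<Longrightarrow> open T \<Longrightarrow> g ` S \<subseteq> T \<Longrightarrow> smooth_on f T \<Longrightarrow> smooth_on g S \<Longrightarrow> smooth_on (\<lambda>x. f (g x)) S"
  by (simp add: smooth_on_def Ck_on_compose)

lemma smooth_on_Pair [smooth_intros]:
  "open S \<Longrightarrow> smooth_on f S \<Longrightarrow> smooth_on g S \<Longrightarrow> smooth_on (\<lambda>x. (f x, g x)) S"
  by (simp add: smooth_on_def Ck_on_Pair)

lemma smooth_on_vec [smooth_intros]:
  fixes f :: "'i::finite \<Rightarrow> 'a::euclidean_space \<Rightarrow> real"
  shows "open S \<Longrightarrow> (\<And>i. smooth_on (f i) S) \<Longrightarrow> smooth_on (\<lambda>x. \<chi> i. f i x) S"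
  by (simp add: smooth_on_def Ck_on_vec)

lemma smooth_on_inverse [smooth_intros]:
  fixes f :: "'a::euclidean_space \<Rightarrow> real"
  shows "open S \<Longrightarrow> smooth_on f S \<Longrightarrow> (\<And>x. x \<in> S \<Longrightarrow> f x \<noteq> 0) \<Longrightarrow> smooth_on (\<lambda>x. inverse (f x)) S"
  by (simp add: smooth_on_def Ck_on_inverse)

lemma smooth_on_divide [smooth_intros]:
  fixes f g :: "'a::euclidean_space \<Rightarrow> real"
  shows "open S \<Longrightarrow> smooth_on f S \<Longrightarrow> smooth_on g S \<Longrightarrow> (\<And>x. x \<in> S \<Longrightarrow> g x \<noteq> 0) \<Longrightarrow> smooth_on (\<lambda>x. f x / g x) S"
  by (simp add: divide_inverse smooth_on_mult smooth_on_inverse)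

lemma smooth_on_sqrt [smooth_intros]:
  assumes "open S" "smooth_on f S" "\<And>x. x \<in> S \<Longrightarrow> f x > 0"
  shows "smooth_on (\<lambda>x. sqrt (f x)) S"
proof -
  have "smooth_on sqrt {0<..}" using Ck_on_sqrt_real by (simp add: smooth_on_def)
  moreover have "f ` S \<subseteq> {0<..}" using assms(3) by auto
  ultimately show ?thesis using smooth_on_compose[of S "{0<..}" f sqrt] assms(1,2) by simp
qed

lemma smooth_on_norm [smooth_intros]:
  fixes f :: "'a::euclidean_space \<Rightarrow> 'b::real_inner"
  assumes "open S" "smooth_on f S" "\<And>x. x \<in> S \<Longrightarrow> f x \<noteq> 0"
  shows "smooth_on (\<lambda>x. norm (f x)) S"
  unfolding norm_eq_sqrt_inner by (intro smooth_on_sqrt smooth_on_inner assms(1,2)) (simp add: assms(3))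

lemma smooth_on_sin [smooth_intros]: "open S \<Longrightarrow> smooth_on f S \<Longrightarrow> smooth_on (\<lambda>x. sin (f x)) S"
  for f :: "'a::euclidean_space \<Rightarrow> real"
  using smooth_on_compose[of S UNIV f sin] Ck_on_sin_cos by (auto simp: smooth_on_def)

lemma smooth_on_cos [smooth_intros]: "open S \<Longrightarrow> smooth_on f S \<Longrightarrow> smooth_on (\<lambda>x. cos (f x)) S"
  for f :: "'a::euclidean_space \<Rightarrow> real"
  using smooth_on_compose[of S UNIV f cos] Ck_on_sin_cos by (auto simp: smooth_on_def)

text \<open>Again the direction \<open>h x\<close> moves with the point, so it is expanded in
  \<open>Basis\<close>. The lemma is used for the right-hand side of the linearised differential
  equation.\<close>

lemma Ck_on_fd_compose:
  fixes f :: "'a::euclidean_space \<Rightarrow> 'b::real_normed_vector" and g h :: "'c::euclidean_space \<Rightarrow> 'a"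
  assumes "open S" "open T" "g ` S \<subseteq> T" "Ck_on (Suc k) f T" "Ck_on k g S" "Ck_on k h S"
  shows "Ck_on k (\<lambda>x. fd f (g x) (h x)) S"
proof -
  have 1: "Ck_on k (\<lambda>x. fd f (g x) b) S" for b
    by (rule Ck_on_compose[OF assms(1-3) _ assms(5)]) (use assms(4) in auto)
  have 2: "Ck_on k (\<lambda>x. h x \<bullet> b) S" for b
    by (rule Ck_on_linear[OF bounded_linear_inner_left assms(1,6)])
  have "Ck_on k (\<lambda>x. \<Sum>b\<in>Basis. (h x \<bullet> b) *\<^sub>R fd f (g x) b) S"
    by (rule Ck_on_sum[OF assms(1)]) (rule Ck_on_bilinear[OF bounded_bilinear_scaleR assms(1) 2 1])
  then show ?thesis
  proof (rule iffD1[OF Ck_on_cong[OF assms(1)], rotated])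
    fix x assume x: "x \<in> S"
    have "f differentiable (at (g x))" using assms(3,4) x by auto
    then show "(\<Sum>b\<in>Basis. (h x \<bullet> b) *\<^sub>R fd f (g x) b) = fd f (g x) (h x)"
      using linear_eq_sum_Basis[OF linear_fd] by metis
  qed
qed

text \<open>Equality of the mixed derivatives, through two mean value expressions of the same second difference.\<close>

lemma fd_fd_real_aux:
  fixes f :: "'a::euclidean_space \<Rightarrow> real"
  assumes S: "open S" "smooth_on f S" "x \<in> S" and e: "e > 0"
  shows "\<exists>d>0. \<forall>h. 0 < h \<and> h < d \<longrightarrow>
    \<bar>(f (x + h *\<^sub>R v + h *\<^sub>R w) - f (x + h *\<^sub>R v) - f (x + h *\<^sub>R w) + f x) / h^2 - fd (\<lambda>y. fd f y v) x w\<bar> < e"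
proof -
  define F where "F = (\<lambda>y. fd (\<lambda>y. fd f y v) y w)"
  have "continuous_on S F" unfolding F_def
    by (intro smooth_on_imp_continuous smooth_on_fd S)
  then have "isCont F x" using S continuous_on_eq_continuous_at by blast
  then obtain d1 where d1: "d1 > 0" "\<And>y. dist y x < d1 \<Longrightarrow> dist (F y) (F x) < e"
    using e unfolding continuous_at_eps_delta by blast
  obtain d2 where d2: "d2 > 0" "ball x d2 \<subseteq> S" using S openE by blast
  define d where "d = min d1 d2 / (norm v + norm w + 1)"
  have nn: "norm v + norm w + 1 > 0" by (smt (verit) norm_ge_zero)
  have "d > 0" unfolding d_def using d1 d2 nn by simp
  moreover have "\<bar>(f (x + h *\<^sub>R v + h *\<^sub>R w) - f (x + h *\<^sub>R v) - f (x + h *\<^sub>R w) + f x) / h^2 - F x\<bar> < e"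
    if h: "0 < h" "h < d" for h
  proof -
    have near: "dist (x + s *\<^sub>R v + t *\<^sub>R w) x < min d1 d2" if "0 \<le> s" "s \<le> h" "0 \<le> t" "t \<le> h" for s t
    proof -
      have "dist (x + s *\<^sub>R v + t *\<^sub>R w) x = norm (s *\<^sub>R v + t *\<^sub>R w)" by (simp add: dist_norm add.assoc)
      also have "\<dots> \<le> s * norm v + t * norm w" using that by (metis abs_of_nonneg norm_scaleR norm_triangle_ineq)
      also have "\<dots> \<le> h * norm v + h * norm w" using that by (intro add_mono mult_right_mono) auto
      also have "\<dots> \<le> h * (norm v + norm w + 1)" using h by (simp add: algebra_simps)
      also have "\<dots> < d * (norm v + norm w + 1)" using h nn by (intro mult_strict_right_mono) auto
      also have "\<dots> = min d1 d2" unfolding d_def using nn by simp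
      finally show ?thesis .
    qed
    have inS: "x + s *\<^sub>R v + t *\<^sub>R w \<in> S" if "0 \<le> s" "s \<le> h" "0 \<le> t" "t \<le> h" for s t
      using near[OF that] d2(2) by (auto simp: dist_commute subset_iff)
    have dv: "((\<lambda>s. f (x + s *\<^sub>R v + t *\<^sub>R w)) has_real_derivative fd f (x + s *\<^sub>R v + t *\<^sub>R w) v) (at s)"
      if "0 \<le> s" "s \<le> h" "0 \<le> t" "t \<le> h" for s t
    proof -
      have D: "((\<lambda>s. x + s *\<^sub>R v + t *\<^sub>R w) has_derivative (\<lambda>k. k *\<^sub>R v)) (at s)"
        by (auto intro!: derivative_eq_intros)
      have "((\<lambda>s. f (x + s *\<^sub>R v + t *\<^sub>R w)) has_derivative (\<lambda>k. fd f (x + s *\<^sub>R v + t *\<^sub>R w) (k *\<^sub>R v))) (at s)"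
        using has_derivative_compose[OF D smooth_on_has_derivative[OF S(2) inS[OF that]]] .
      then show ?thesis
        using linear_scale[OF linear_fd[OF smooth_on_imp_differentiable[OF S(2) inS[OF that]]]]
        by (simp add: has_field_derivative_def mult_commute_abs)
    qed
    have dw: "((\<lambda>t. fd f (x + s *\<^sub>R v + t *\<^sub>R w) v) has_real_derivative F (x + s *\<^sub>R v + t *\<^sub>R w)) (at t)"
      if "0 \<le> s" "s \<le> h" "0 \<le> t" "t \<le> h" for s t
    proof -
      have D: "((\<lambda>t. x + s *\<^sub>R v + t *\<^sub>R w) has_derivative (\<lambda>k. k *\<^sub>R w)) (at t)"
        by (auto intro!: derivative_eq_intros)
      have sm: "smooth_on (\<lambda>y. fd f y v) S" by (rule smooth_on_fd[OF S(2)])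
      have "((\<lambda>t. fd f (x + s *\<^sub>R v + t *\<^sub>R w) v) has_derivative (\<lambda>k. fd (\<lambda>y. fd f y v) (x + s *\<^sub>R v + t *\<^sub>R w) (k *\<^sub>R w))) (at t)"
        using has_derivative_compose[OF D smooth_on_has_derivative[OF sm inS[OF that]]] .
      then show ?thesis
        using linear_scale[OF linear_fd[OF smooth_on_imp_differentiable[OF sm inS[OF that]]]]
        unfolding F_def by (simp add: has_field_derivative_def mult_commute_abs)
    qed
    have "\<exists>z>0. z < h \<and> (f (x + h *\<^sub>R v + h *\<^sub>R w) - f (x + h *\<^sub>R v + 0 *\<^sub>R w)) - (f (x + 0 *\<^sub>R v + h *\<^sub>R w) - f (x + 0 *\<^sub>R v + 0 *\<^sub>R w))
        = (h - 0) * (fd f (x + z *\<^sub>R v + h *\<^sub>R w) v - fd f (x + z *\<^sub>R v + 0 *\<^sub>R w) v)"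
      by (rule MVT2) (use h in \<open>auto intro!: DERIV_diff dv[of _ 0, simplified] dv\<close>)
    then obtain z where z: "z > 0" "z < h" and eq1: "f (x + h *\<^sub>R v + h *\<^sub>R w) - f (x + h *\<^sub>R v) - f (x + h *\<^sub>R w) + f x
        = h * (fd f (x + z *\<^sub>R v + h *\<^sub>R w) v - fd f (x + z *\<^sub>R v + 0 *\<^sub>R w) v)" by auto
    have "\<exists>y>0. y < h \<and> fd f (x + z *\<^sub>R v + h *\<^sub>R w) v - fd f (x + z *\<^sub>R v + 0 *\<^sub>R w) v = (h - 0) * F (x + z *\<^sub>R v + y *\<^sub>R w)"
      by (rule MVT2) (use h z in \<open>auto intro!: dw\<close>)
    then obtain y where y: "y > 0" "y < h" and eq2: "fd f (x + z *\<^sub>R v + h *\<^sub>R w) v - fd f (x + z *\<^sub>R v + 0 *\<^sub>R w) v = h * F (x + z *\<^sub>R v + y *\<^sub>R w)"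
      by auto
    have "(f (x + h *\<^sub>R v + h *\<^sub>R w) - f (x + h *\<^sub>R v) - f (x + h *\<^sub>R w) + f x) / h^2 = F (x + z *\<^sub>R v + y *\<^sub>R w)"
      unfolding eq1 eq2 using h by (simp add: power2_eq_square)
    moreover have "dist (F (x + z *\<^sub>R v + y *\<^sub>R w)) (F x) < e" using near[of z y] z y d1(2) by auto
    ultimately show ?thesis by (simp add: dist_real_def)
  qed
  ultimately show ?thesis unfolding F_def by blast
qed

lemma fd_fd_real_commute:
  fixes f :: "'a::euclidean_space \<Rightarrow> real"
  assumes S: "open S" "smooth_on f S" "x \<in> S"
  shows "fd (\<lambda>y. fd f y v) x w = fd (\<lambda>y. fd f y w) x v"
proof (rule ccontr)
  define A where "A = fd (\<lambda>y. fd f y v) x w"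
  define B where "B = fd (\<lambda>y. fd f y w) x v"
  assume "fd (\<lambda>y. fd f y v) x w \<noteq> fd (\<lambda>y. fd f y w) x v"
  then have e: "\<bar>A - B\<bar> / 2 > 0" by (simp add: A_def B_def)
  obtain d1 where d1: "d1 > 0" "\<And>h. 0 < h \<Longrightarrow> h < d1 \<Longrightarrow>
    \<bar>(f (x + h *\<^sub>R v + h *\<^sub>R w) - f (x + h *\<^sub>R v) - f (x + h *\<^sub>R w) + f x) / h^2 - A\<bar> < \<bar>A - B\<bar> / 2"
    using fd_fd_real_aux[OF S e, of v w] unfolding A_def by blast
  obtain d2 where d2: "d2 > 0" "\<And>h. 0 < h \<Longrightarrow> h < d2 \<Longrightarrow>
    \<bar>(f (x + h *\<^sub>R w + h *\<^sub>R v) - f (x + h *\<^sub>R w) - f (x + h *\<^sub>R v) + f x) / h^2 - B\<bar> < \<bar>A - B\<bar> / 2"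
    using fd_fd_real_aux[OF S e, of w v] unfolding B_def by blast
  define h where "h = min d1 d2 / 2"
  have h: "0 < h" "h < d1" "h < d2" using d1(1) d2(1) by (auto simp: h_def)
  have eq: "f (x + h *\<^sub>R w + h *\<^sub>R v) - f (x + h *\<^sub>R w) - f (x + h *\<^sub>R v) + f x
      = f (x + h *\<^sub>R v + h *\<^sub>R w) - f (x + h *\<^sub>R v) - f (x + h *\<^sub>R w) + f x"
    by (simp add: algebra_simps)
  have "\<not> (\<bar>X - A\<bar> < \<bar>A - B\<bar> / 2 \<and> \<bar>X - B\<bar> < \<bar>A - B\<bar> / 2)" for X
    unfolding abs_if by auto
  then show False using d1(2)[OF h(1,2)] d2(2)[OF h(1,3)] unfolding eq by blast
qed

lemma fd_inner:
  assumes "f differentiable (at x)"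
  shows "fd (\<lambda>y. f y \<bullet> b) x v = fd f x v \<bullet> b"
  using fd_eq[OF has_derivative_inner_left[OF has_derivative_fd[OF assms]], of b] by simp

lemma fd_fd_commute:
  fixes f :: "'a::euclidean_space \<Rightarrow> 'b::euclidean_space"
  assumes S: "open S" "smooth_on f S" "x \<in> S"
  shows "fd (\<lambda>y. fd f y v) x w = fd (\<lambda>y. fd f y w) x v"
proof (rule euclidean_eqI)
  fix b :: 'b
  have d: "f differentiable (at y)" if "y \<in> S" for y using smooth_on_imp_differentiable[OF S(2) that] .
  have sm: "smooth_on (\<lambda>y. f y \<bullet> b) S" using S by (intro smooth_intros)
  have *: "fd (\<lambda>y. fd f y v) x w \<bullet> b = fd (\<lambda>y. fd (\<lambda>y. f y \<bullet> b) y v) x w" for v w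
  proof -
    have "fd (\<lambda>y. fd f y v) x w \<bullet> b = fd (\<lambda>y. fd f y v \<bullet> b) x w"
      by (rule fd_inner[symmetric]) (rule smooth_on_imp_differentiable[OF smooth_on_fd[OF S(2)] S(3)])
    also have "\<dots> = fd (\<lambda>y. fd (\<lambda>y. f y \<bullet> b) y v) x w"
      by (rule fun_cong[OF fd_cong_open[OF S(1,3)]]) (simp add: fd_inner d)
    finally show ?thesis .
  qed
  show "fd (\<lambda>y. fd f y v) x w \<bullet> b = fd (\<lambda>y. fd f y w) x v \<bullet> b"
    unfolding * by (rule fd_fd_real_commute[OF S(1) sm S(3)])
qed

section \<open>Smooth matrix inverses and local inverses\<close>

lemma matrix_inv_props:
  fixes A :: "real^'n^'n"
  assumes "invertible A"
  shows "A ** matrix_inv A = mat 1" "matrix_inv A ** A = mat 1"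
  using someI_ex[OF assms[unfolded invertible_def]] by (auto simp: matrix_inv_def)

lemma smooth_on_eqI: "smooth_on f S \<Longrightarrow> open S \<Longrightarrow> (\<And>x. x \<in> S \<Longrightarrow> f x = g x) \<Longrightarrow> smooth_on g S"
  using smooth_on_cong[of S f g] by blast

lemma smooth_on_det3 [smooth_intros]:
  fixes A :: "'a::euclidean_space \<Rightarrow> real^3^3"
  assumes "open S" "\<And>i j. smooth_on (\<lambda>x. A x $ i $ j) S"
  shows "smooth_on (\<lambda>x. det (A x)) S"
  unfolding det_3 by (intro smooth_on_add smooth_on_diff smooth_on_mult assms)

text \<open>Cramer's rule: column \<open>l\<close> of the inverse solves the linear system with
  right-hand side \<open>axis l 1\<close>, so each entry is a quotient of two determinants.\<close>

lemma smooth_on_matrix_inv: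
  fixes A :: "'a::euclidean_space \<Rightarrow> real^3^3"
  assumes S: "open S" and A: "\<And>i j. smooth_on (\<lambda>x. A x $ i $ j) S" and inv: "\<And>x. x \<in> S \<Longrightarrow> invertible (A x)"
  shows "smooth_on (\<lambda>x. matrix_inv (A x) $ k $ l) S"
proof -
  let ?C = "\<lambda>x. (\<chi> i j. if j = k then axis l 1 $ i else A x $ i $ j) :: real^3^3"
  have eq: "matrix_inv (A x) $ k $ l = det (?C x) / det (A x)" if "x \<in> S" for x
  proof -
    have "A x *v (matrix_inv (A x) *v axis l 1) = axis l 1"
      by (simp add: matrix_vector_mul_assoc matrix_inv_props[OF inv[OF that]])
    then have "matrix_inv (A x) *v axis l 1 = (\<chi> k. det (\<chi> i j. if j = k then axis l 1 $ i else A x $ i $ j) / det (A x))"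
      using cramer[of "A x"] inv[OF that] by (simp add: invertible_det_nz)
    then show ?thesis
      by (simp add: matrix_vector_mult_basis column_def vec_eq_iff)
  qed
  have "smooth_on (\<lambda>x. det (?C x) / det (A x)) S"
  proof (intro smooth_on_divide smooth_on_det3 S A)
    show "smooth_on (\<lambda>x. ?C x $ i $ j) S" for i j
      by (cases "j = k") (simp_all add: A smooth_on_const)
    show "det (A x) \<noteq> 0" if "x \<in> S" for x using inv[OF that] by (simp add: invertible_det_nz)
  qed
  then show ?thesis by (rule smooth_on_eqI[OF _ S]) (simp add: eq)
qed

text \<open>In finite dimension continuity in every fixed direction is continuity in operator norm,
  which is the form required by the inverse function theorem and by uniform estimates.\<close>

lemma Ck_on_Blinfun_fd:
  fixes f :: "'a::euclidean_space \<Rightarrow> 'b::real_normed_vector"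
  assumes "Ck_on (Suc 0) f U"
  shows "continuous_on U (\<lambda>x. Blinfun (fd f x))"
    and "\<And>x. x \<in> U \<Longrightarrow> blinfun_apply (Blinfun (fd f x)) = fd f x"
proof -
  have "bounded_linear (fd f x)" if "x \<in> U" for x
    using linear_fd[of f x] linear_conv_bounded_linear assms that by auto
  then show F: "blinfun_apply (Blinfun (fd f x)) = fd f x" if "x \<in> U" for x
    using that by (simp add: bounded_linear_Blinfun_apply)
  show "continuous_on U (\<lambda>x. Blinfun (fd f x))"
  proof (rule continuous_on_blinfun_componentwise)
    fix i :: 'a
    have "continuous_on U (\<lambda>x. fd f x i)" using assms by simp
    then show "continuous_on U (\<lambda>x. blinfun_apply (Blinfun (fd f x)) i)" by (rule continuous_on_eq) (simp add: F)
  qed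
qed

text \<open>Smoothness of \<open>g\<close> is a bootstrap: its derivative at \<open>y\<close> is the
  inverse matrix \<open>M (g y)\<close> with \<open>M\<close> smooth, so \<open>g\<close> of class k
  has a derivative of class k and is itself of class k + 1.\<close>

lemma smooth_local_inverse:
  fixes f :: "real^3 \<Rightarrow> real^3"
  assumes U: "open U" "x0 \<in> U" and f: "smooth_on f U" and inj: "inj (fd f x0)"
  obtains U' V g where "open U'" "U' \<subseteq> U" "x0 \<in> U'" "open V" "homeomorphism U' V f g"
    "smooth_on g V" "\<And>x. x \<in> U' \<Longrightarrow> bij (fd f x)" "\<And>y. y \<in> V \<Longrightarrow> fd g y = inv (fd f (g y))"
proof -
  define F where "F = (\<lambda>x. Blinfun (fd f x))"
  have d: "f differentiable (at x)" if "x \<in> U" for x using smooth_on_imp_differentiable[OF f that] .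
  note C1 = Ck_on_Blinfun_fd[OF smooth_on_Ck[OF f]]
  have F: "blinfun_apply (F x) = fd f x" if "x \<in> U" for x
    unfolding F_def using C1(2) that by simp
  have cont: "continuous_on U F" unfolding F_def by (rule C1(1))
  obtain h where h: "linear h" "h \<circ> fd f x0 = id"
    using linear_injective_left_inverse[OF linear_fd[OF d[OF U(2)]] inj] by blast
  have hb: "bounded_linear h" using h linear_conv_bounded_linear by blast
  have "Blinfun h o\<^sub>L F x0 = id_blinfun"
    by (rule blinfun_eqI) (use h(2) in \<open>simp add: F[OF U(2)] bounded_linear_Blinfun_apply[OF hb] fun_eq_iff\<close>)
  from inverse_function_theorem[OF U(1) _ cont U(2) this]
  obtain U1 V1 g g' where *: "open U1" "U1 \<subseteq> U" "x0 \<in> U1" "open V1" "f x0 \<in> V1" "homeomorphism U1 V1 f g"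
      and g': "\<And>y. y \<in> V1 \<Longrightarrow> (g has_derivative (g' y)) (at y)"
      and g'_eq: "\<And>y. y \<in> V1 \<Longrightarrow> g' y = inv (blinfun_apply (F (g y)))"
      and g'_bij: "\<And>y. y \<in> V1 \<Longrightarrow> bij (blinfun_apply (F (g y)))"
    using has_derivative_fd[OF d] F by (metis (no_types, lifting))
  have gU: "g y \<in> U1" "f (g y) = y" if "y \<in> V1" for y using *(6) that unfolding homeomorphism_def by auto
  have fU: "f x \<in> V1" "g (f x) = x" if "x \<in> U1" for x using *(6) that unfolding homeomorphism_def by auto
  have gd: "fd g y = inv (fd f (g y))" and gb: "bij (fd f (g y))" if "y \<in> V1" for y
  proof -
    have y: "g y \<in> U" using gU(1)[OF that] *(2) by blast
    show "fd g y = inv (fd f (g y))" using g'_eq[OF that] fd_eq[OF g'[OF that]] F[OF y] by simp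
    show "bij (fd f (g y))" using g'_bij[OF that] F[OF y] by simp
  qed
  have fb: "bij (fd f x)" if "x \<in> U1" for x using gb[OF fU(1)[OF that]] fU(2)[OF that] by simp
  define M where "M = (\<lambda>x. matrix_inv (matrix (fd f x)))"
  have matM: "invertible (matrix (fd f x))" "\<And>v. inv (fd f x) v = M x *v v" if "x \<in> U1" for x
  proof -
    have lin: "linear (fd f x)" using linear_fd[OF d] that *(2) by blast
    have eq: "matrix (fd f x) *v v = fd f x v" for v by (simp add: matrix_works lin)
    have "inj ((*v) (matrix (fd f x)))" using bij_is_inj[OF fb[OF that]] by (simp add: eq[abs_def])
    then show inv: "invertible (matrix (fd f x))"
      using invertible_left_inverse matrix_left_invertible_injective by blast
    show "inv (fd f x) v = M x *v v" for v
    proof (rule inv_f_eq)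
      show "inj (fd f x)" using fb[OF that] bij_is_inj by blast
      show "fd f x (M x *v v) = v"
      proof -
        have "matrix (fd f x) *v (M x *v v) = v"
          unfolding M_def by (simp add: matrix_vector_mul_assoc matrix_inv_props(1)[OF inv])
        then show ?thesis using eq by metis
      qed
    qed
  qed
  have smM: "smooth_on (\<lambda>x. M x *v v) U1" for v
  proof -
    have "smooth_on (\<lambda>x. M x $ k $ l) U1" for k l unfolding M_def
    proof (rule smooth_on_matrix_inv[OF *(1)])
      show "smooth_on (\<lambda>x. matrix (fd f x) $ i $ j) U1" for i j
        unfolding matrix_def using *(1,2)
        by (auto intro!: smooth_on_nth smooth_on_fd smooth_on_subset[OF f])
    qed (use matM in auto)
    then show ?thesis unfolding matrix_vector_mult_def
      by (intro smooth_on_vec smooth_on_sum smooth_on_mult smooth_on_const *(1))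
  qed
  have "Ck_on k g V1" for k
  proof (induction k)
    case 0
    show ?case using *(6) by (simp add: homeomorphism_def)
  next
    case (Suc k)
    show ?case
    proof (rule Ck_on_SucI[OF *(4)])
      show "(g has_derivative (\<lambda>v. M (g y) *v v)) (at y)" if "y \<in> V1" for y
        using g'[OF that] gd[OF that] fd_eq[OF g'[OF that]] matM(2)[OF gU(1)[OF that]]
        by (metis (no_types, lifting) ext)
      show "Ck_on k (\<lambda>x. M (g x) *v v) V1" for v
        by (rule Ck_on_compose[OF *(4,1) _ _ Suc]) (use gU smooth_on_Ck[OF smM] in auto)
    qed
  qed
  then have "smooth_on g V1" by (simp add: smooth_on_def)
  then show ?thesis using that[OF *(1-4,6)] fb gd by blast
qed

section \<open>Ordinary differential equations\<close>

text \<open>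
  All equations are considered on the fixed time interval \<open>]-2, 2[\<close> with right-hand sides of
  Lipschitz constant \<open>1/8\<close>; then the sup norm alone controls the solutions.
\<close>

lemma norm_le_of_vector_derivative:
  fixes z :: "real \<Rightarrow> 'y::real_normed_vector"
  assumes "\<And>t. t \<in> {-b..b} \<Longrightarrow> (z has_vector_derivative z' t) (at t within {-b..b})"
    and "\<And>t. t \<in> {-b..b} \<Longrightarrow> norm (z' t) \<le> B" and "s \<in> {-b..b}" "z 0 = 0"
  shows "norm (z s) \<le> \<bar>s\<bar> * B"
proof -
  have "0 \<in> {-b..b}" using assms(3) by auto
  have "norm (z s - z 0) \<le> B * norm (s - 0)"
  proof (rule differentiable_bound[of "{-b..b}"])
    show "(z has_derivative (\<lambda>h. h *\<^sub>R z' t)) (at t within {-b..b})" if "t \<in> {-b..b}" for t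
      using assms(1)[OF that] by (simp add: has_vector_derivative_def)
    show "onorm (\<lambda>h. h *\<^sub>R z' t) \<le> B" if "t \<in> {-b..b}" for t
      using assms(2)[OF that] by (intro onorm_le) (simp add: mult.commute[of B] mult_left_mono)
  qed (use assms \<open>0 \<in> {-b..b}\<close> in auto)
  then show ?thesis using assms(4) by (simp add: mult.commute)
qed

text \<open>A Gronwall estimate without exponentials. At a point where norm e attains its maximum X,
  the mean value inequality over a time of at most 2 gives X \<le> 2 (X / 8 + \<eta>), so X \<le>
  8/3 \<eta>; the factor 4 is a round upper bound. All later estimates for solutions are instances
  of this one.\<close>

lemma sup_estimate:
  fixes e :: "real \<Rightarrow> 'y::real_normed_vector"
  assumes b: "b \<le> 2" and "e 0 = 0"
    and d: "\<And>t. t \<in> {-b..b} \<Longrightarrow> (e has_vector_derivative e' t) (at t within {-b..b})"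
    and B: "\<And>t. t \<in> {-b..b} \<Longrightarrow> norm (e' t) \<le> norm (e t) / 8 + \<eta>" and s: "s \<in> {-b..b}"
  shows "norm (e s) \<le> 4 * \<eta>"
proof -
  have "continuous_on {-b..b} e"
    using d has_vector_derivative_continuous continuous_on_eq_continuous_within by blast
  then have "continuous_on {-b..b} (\<lambda>t. norm (e t))" by (intro continuous_intros)
  then obtain m where m: "m \<in> {-b..b}" "\<And>t. t \<in> {-b..b} \<Longrightarrow> norm (e t) \<le> norm (e m)"
    using continuous_attains_sup[of "{-b..b}" "\<lambda>t. norm (e t)"] s by auto
  have \<eta>: "norm (e m) / 8 + \<eta> \<ge> 0" using B[OF m(1)] norm_ge_zero order_trans by blast
  have "norm (e m) \<le> \<bar>m\<bar> * (norm (e m) / 8 + \<eta>)"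
    by (rule norm_le_of_vector_derivative[OF d]) (use B m assms(2) in \<open>force\<close>)+
  also have "\<dots> \<le> 2 * (norm (e m) / 8 + \<eta>)"
    using m(1) b \<eta> by (intro mult_right_mono) auto
  also have "\<dots> = norm (e m) / 4 + 2 * \<eta>" by simp
  finally have "norm (e m) \<le> 4 * \<eta>" using norm_ge_zero[of "e m"] by linarith
  then show ?thesis using m(2)[OF s] by linarith
qed

lemma ode_unique:
  fixes y z :: "real \<Rightarrow> 'y::real_normed_vector"
  assumes b: "b \<le> 2" and "y 0 = z 0"
    and "\<And>t. t \<in> {-b..b} \<Longrightarrow> (y has_vector_derivative G t (y t)) (at t within {-b..b})"
    and "\<And>t. t \<in> {-b..b} \<Longrightarrow> (z has_vector_derivative G t (z t)) (at t within {-b..b})"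
    and "\<And>t. t \<in> {-b..b} \<Longrightarrow> norm (G t (y t) - G t (z t)) \<le> norm (y t - z t) / 8"
    and "s \<in> {-b..b}"
  shows "y s = z s"
proof -
  have "norm (y s - z s) \<le> 4 * 0"
    by (rule sup_estimate[OF b, where e' = "\<lambda>t. G t (y t) - G t (z t)"])
       (use assms in \<open>auto intro!: has_vector_derivative_diff\<close>)
  then show ?thesis by simp
qed

text \<open>Picard iteration as a Banach fixed point: over a time of at most 2, integrating a
  right-hand side of Lipschitz constant 1/8 contracts the sup norm by the factor 1/4.\<close>

lemma ode_exists:
  fixes G :: "real \<Rightarrow> 'y::euclidean_space \<Rightarrow> 'y"
  assumes b: "0 < b" "b \<le> 2" and cont: "continuous_on ({-b..b} \<times> UNIV) (\<lambda>(t, y). G t y)"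
    and lip: "\<And>t y z. t \<in> {-b..b} \<Longrightarrow> norm (G t y - G t z) \<le> norm (y - z) / 8"
  shows "\<exists>z. z 0 = 0 \<and> (\<forall>t\<in>{-b..b}. (z has_vector_derivative G t (z t)) (at t within {-b..b}))"
proof -
  \<comment> \<open>Clamping the time to [-b, b] turns functions on the interval into bounded
    continuous functions on the whole line, which form a complete space.\<close>
  define c where "c = (\<lambda>t::real. max (-b) (min b t))"
  have c: "c t \<in> {-b..b}" "t \<in> {-b..b} \<Longrightarrow> c t = t" for t using b by (auto simp: c_def)
  have "\<exists>J. J 0 = 0 \<and> (\<forall>t\<in>{-b..b}. (J has_vector_derivative G t (apply_bcontfun z t)) (at t within {-b..b}))" for z
  proof -
    have "continuous_on {-b..b} ((\<lambda>(t, y). G t y) \<circ> (\<lambda>t. (t, apply_bcontfun z t)))"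
      by (rule continuous_on_compose) (auto intro!: continuous_intros continuous_on_subset[OF cont])
    then have "continuous_on {-b..b} (\<lambda>t. G t (apply_bcontfun z t))" by (simp add: o_def)
    then obtain g where g: "\<And>t. t \<in> {-b..b} \<Longrightarrow> (g has_vector_derivative G t (apply_bcontfun z t)) (at t within {-b..b})"
      using antiderivative_continuous by blast
    have "((\<lambda>t. g t - g 0) has_vector_derivative G t (apply_bcontfun z t)) (at t within {-b..b})" if "t \<in> {-b..b}" for t
      using has_vector_derivative_diff[OF g[OF that] has_vector_derivative_const, of "g 0"] by simp
    then show ?thesis by (intro exI[of _ "\<lambda>t. g t - g 0"]) auto
  qed
  then obtain J where J0: "\<And>z. J z 0 = 0"
    and J: "\<And>z t. t \<in> {-b..b} \<Longrightarrow> (J z has_vector_derivative G t (apply_bcontfun z t)) (at t within {-b..b})"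
    by metis
  have Jc: "(\<lambda>t. J z (c t)) \<in> bcontfun" for z
  proof -
    have J1: "continuous_on {-b..b} (J z)"
      using J has_vector_derivative_continuous continuous_on_eq_continuous_within by blast
    have "continuous_on UNIV (\<lambda>t. J z (c t))"
      by (rule continuous_on_compose2[OF J1]) (use c in \<open>auto simp: c_def intro!: continuous_intros\<close>)
    moreover have "bounded (J z ` {-b..b})"
      using compact_continuous_image[OF J1] compact_imp_bounded by blast
    then have "bounded (range (\<lambda>t. J z (c t)))"
      by (rule bounded_subset) (use c in auto)
    ultimately show ?thesis by (simp add: bcontfun_def)
  qed
  define T where "T = (\<lambda>z. Bcontfun (\<lambda>t. J z (c t)))"
  have T: "apply_bcontfun (T z) t = J z (c t)" for z t
    unfolding T_def using Bcontfun_inverse[OF Jc] by simp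
  have "dist (T y) (T z) \<le> 1 / 4 * dist y z" for y z
  proof (rule dist_bound)
    fix t
    have "norm (J y (c t) - J z (c t)) \<le> \<bar>c t\<bar> * (dist y z / 8)"
    proof (rule norm_le_of_vector_derivative[where z = "\<lambda>t. J y t - J z t"])
      show "((\<lambda>t. J y t - J z t) has_vector_derivative G t (apply_bcontfun y t) - G t (apply_bcontfun z t)) (at t within {-b..b})"
        if "t \<in> {-b..b}" for t using J that by (intro has_vector_derivative_diff)
      show "norm (G t (apply_bcontfun y t) - G t (apply_bcontfun z t)) \<le> dist y z / 8" if "t \<in> {-b..b}" for t
        using lip[OF that, of "apply_bcontfun y t" "apply_bcontfun z t"] dist_bounded[of y t z] by (simp add: dist_norm)
    qed (use c J0 in auto)
    also have "\<dots> \<le> 2 * (dist y z / 8)" using c(1)[of t] b by (intro mult_right_mono) auto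
    finally show "dist (apply_bcontfun (T y) t) (apply_bcontfun (T z) t) \<le> 1 / 4 * dist y z"
      by (simp add: T dist_norm)
  qed
  then obtain z where z: "T z = z" using banach_fix_type[of "1/4" T] by auto
  have eq: "apply_bcontfun z t = J z t" if "t \<in> {-b..b}" for t using T[of z t] c(2)[OF that] z by simp
  have "(apply_bcontfun z has_vector_derivative G t (apply_bcontfun z t)) (at t within {-b..b})" if "t \<in> {-b..b}" for t
    by (rule has_vector_derivative_transform[OF that _ J[OF that]]) (simp add: eq)
  moreover have "apply_bcontfun z 0 = 0" using eq[of 0] b J0 by auto
  ultimately show ?thesis by blast
qed

abbreviation I2 :: "real set" where "I2 \<equiv> {-2<..<2}"

text \<open>Solutions on the closed intervals [-b, b] with b < 2 agree by uniqueness and are glued;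
  at time t the one on [-\<open>bt t\<close>, \<open>bt t\<close>] is taken, where
  \<open>bt t\<close> is the midpoint between \<bar>t\<bar> and 2.\<close>

lemma ode_exists_I2:
  fixes G :: "real \<Rightarrow> 'y::euclidean_space \<Rightarrow> 'y"
  assumes cont: "continuous_on (I2 \<times> UNIV) (\<lambda>(t, y). G t y)"
    and lip: "\<And>t y z. t \<in> I2 \<Longrightarrow> norm (G t y - G t z) \<le> norm (y - z) / 8"
  shows "\<exists>z. z 0 = 0 \<and> (\<forall>t\<in>I2. (z has_vector_derivative G t (z t)) (at t))"
proof -
  have "\<exists>z. z 0 = 0 \<and> (\<forall>t\<in>{-b..b}. (z has_vector_derivative G t (z t)) (at t within {-b..b}))" if "0 < b" "b < 2" for b
    by (rule ode_exists) (use that lip in \<open>auto intro!: continuous_on_subset[OF cont]\<close>)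
  then obtain Z where Z0: "\<And>b. 0 < b \<Longrightarrow> b < 2 \<Longrightarrow> Z b 0 = 0"
    and Z: "\<And>b t. 0 < b \<Longrightarrow> b < 2 \<Longrightarrow> t \<in> {-b..b} \<Longrightarrow> (Z b has_vector_derivative G t (Z b t)) (at t within {-b..b})"
    by metis
  have agree: "Z b s = Z d s" if "0 < b" "b \<le> d" "d < 2" "s \<in> {-b..b}" for b d s
  proof (rule ode_unique[of b "Z b" "Z d" G])
    show "(Z d has_vector_derivative G t (Z d t)) (at t within {-b..b})" if "t \<in> {-b..b}" for t
      by (rule has_vector_derivative_within_subset[OF Z]) (use that \<open>0 < b\<close> \<open>b \<le> d\<close> \<open>d < 2\<close> in auto)
  qed (use that Z0 Z lip in auto)
  define bt where "bt = (\<lambda>t::real. (\<bar>t\<bar> + 2) / 2)"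
  have bt: "0 < bt t" "bt t < 2" "\<bar>t\<bar> < bt t" if "t \<in> I2" for t using that by (auto simp: bt_def)
  define z where "z = (\<lambda>t. Z (bt t) t)"
  have "(z has_vector_derivative G t (z t)) (at t)" if t: "t \<in> I2" for t
  proof -
    have eq: "z s = Z (bt t) s" if "\<bar>s\<bar> < bt t" for s
    proof -
      have s: "s \<in> I2" using that bt(2)[OF t] unfolding abs_less_iff by auto
      have mem: "s \<in> {-bt s..bt s}" "s \<in> {-bt t..bt t}"
        using bt(3)[OF s] that unfolding abs_less_iff by auto
      show ?thesis
      proof (cases "bt s \<le> bt t")
        case True
        then show ?thesis unfolding z_def by (rule agree[OF bt(1)[OF s] _ bt(2)[OF t] mem(1)])
      next
        case False
        then have "bt t \<le> bt s" by simp
        then show ?thesis unfolding z_def by (rule agree[OF bt(1)[OF t] _ bt(2)[OF s] mem(2), symmetric])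
      qed
    qed
    have "(Z (bt t) has_vector_derivative G t (Z (bt t) t)) (at t within {-bt t..bt t})"
      by (rule Z) (use bt[OF t] in auto)
    moreover have "at t within {-bt t..bt t} = at t"
      by (rule at_within_interior) (use bt(3)[OF t] in \<open>auto simp: abs_less_iff\<close>)
    ultimately have "(Z (bt t) has_vector_derivative G t (z t)) (at t)" by (simp add: z_def)
    then show ?thesis
      by (rule has_vector_derivative_transform_within_open[where S = "{-bt t<..<bt t}"])
         (use bt(3)[OF t] eq in \<open>auto simp: abs_less_iff\<close>)
  qed
  moreover have "z 0 = 0" using Z0[of "bt 0"] bt[of 0] by (simp add: z_def)
  ultimately show ?thesis by blast
qed

text \<open>The derivative is uniformly continuous on a closed neighbourhood \<open>K'\<close> of
  \<open>K\<close>, so the mean value inequality yields one remainder bound for all base points in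
  \<open>K\<close>. The compact set will be the trajectory of a solution.\<close>

lemma uniform_differentiability:
  fixes F :: "'a::euclidean_space \<Rightarrow> 'b::real_normed_vector"
  assumes "open \<Omega>" "compact K" "K \<subseteq> \<Omega>" "Ck_on (Suc 0) F \<Omega>"
  shows "e > 0 \<Longrightarrow> \<exists>d>0. \<forall>q\<in>K. \<forall>k. norm k < d \<longrightarrow> norm (F (q + k) - F q - fd F q k) \<le> e * norm k"
    and "\<exists>M>0. \<forall>q\<in>K. \<forall>k. norm (fd F q k) \<le> M * norm k"
proof -
  define DF where "DF = (\<lambda>x. Blinfun (fd F x))"
  have cont: "continuous_on \<Omega> DF" and DF: "\<And>x. x \<in> \<Omega> \<Longrightarrow> blinfun_apply (DF x) = fd F x"
    unfolding DF_def using Ck_on_Blinfun_fd[OF assms(4)] by auto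
  have "bounded (DF ` K)"
    using compact_continuous_image[OF continuous_on_subset[OF cont assms(3)] assms(2)] compact_imp_bounded by blast
  then obtain M where M: "M > 0" "\<And>q. q \<in> K \<Longrightarrow> norm (DF q) \<le> M" unfolding bounded_pos by auto
  have "norm (fd F q k) \<le> M * norm k" if "q \<in> K" for q k
  proof -
    have "norm (fd F q k) \<le> norm (DF q) * norm k" using norm_blinfun[of "DF q" k] DF assms(3) that by auto
    also have "\<dots> \<le> M * norm k" using M(2)[OF that] by (intro mult_right_mono) auto
    finally show ?thesis .
  qed
  then show "\<exists>M>0. \<forall>q\<in>K. \<forall>k. norm (fd F q k) \<le> M * norm k" using M(1) by blast
  assume e: "e > 0"
  obtain r where r: "r > 0" "(\<Union>x\<in>K. cball x r) \<subseteq> \<Omega>"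
    using compact_subset_open_imp_cball_epsilon_subset[OF assms(2,1,3)] by blast
  define K' where "K' = (\<Union>x\<in>K. \<Union>y\<in>cball 0 r. {x + y})"
  have "compact K'" unfolding K'_def using compact_sums'[OF assms(2) compact_cball] by simp
  moreover have K': "K' \<subseteq> \<Omega>" using r(2) unfolding K'_def by (force simp: dist_norm)
  ultimately have "uniformly_continuous_on K' DF"
    using compact_uniformly_continuous continuous_on_subset[OF cont] by blast
  then obtain d where d: "d > 0" "\<And>x y. x \<in> K' \<Longrightarrow> y \<in> K' \<Longrightarrow> dist y x < d \<Longrightarrow> dist (DF y) (DF x) < e"
    using e unfolding uniformly_continuous_on_def by metis
  have "norm (F (q + k) - F q - fd F q k) \<le> e * norm k" if q: "q \<in> K" and k: "norm k < min r d" for q k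
  proof -
    have sub: "cball q (norm k) \<subseteq> K'"
    proof
      fix x assume "x \<in> cball q (norm k)"
      then have "x - q \<in> cball 0 r" using k by (simp add: dist_norm norm_minus_commute)
      then show "x \<in> K'" unfolding K'_def using q by (intro UN_I[of q] UN_I[of "x - q"]) auto
    qed
    have "norm (F (q + k) - F q - fd F q (q + k - q)) \<le> norm (q + k - q) * e"
    proof (rule differentiable_bound_linearization[where S = "cball q (norm k)"])
      show "q + t *\<^sub>R (q + k - q) \<in> cball q (norm k)" if "t \<in> {0..1}" for t
        using that by (simp add: dist_norm mult_left_le_one_le)
      show "(F has_derivative fd F x) (at x within cball q (norm k))" if "x \<in> cball q (norm k)" for x
      proof (rule has_derivative_at_withinI[OF has_derivative_fd])
        have "x \<in> \<Omega>" using that sub K' by blast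
        then show "F differentiable (at x)" using assms(4) by auto
      qed
      show "onorm (fd F x - fd F q) \<le> e" if x: "x \<in> cball q (norm k)" for x
      proof -
        have "x \<in> K'" "q \<in> K'" using x sub by auto
        moreover have "dist x q < d" using x k by (simp add: dist_commute)
        ultimately have "dist (DF x) (DF q) < e" using d(2) by blast
        moreover have "blinfun_apply (DF x - DF q) = fd F x - fd F q"
          using DF[OF subsetD[OF K' \<open>x \<in> K'\<close>]] DF[OF subsetD[OF K' \<open>q \<in> K'\<close>]]
          by (simp add: blinfun.diff_left fun_eq_iff)
        ultimately show ?thesis by (metis dist_norm less_eq_real_def norm_blinfun.rep_eq)
      qed
    qed auto
    then show ?thesis by (simp add: mult.commute)
  qed
  then show "\<exists>d>0. \<forall>q\<in>K. \<forall>k. norm k < d \<longrightarrow> norm (F (q + k) - F q - fd F q k) \<le> e * norm k"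
    using r(1) d(1) by (intro exI[of _ "min r d"]) auto
qed

text \<open>The difference of two solutions with nearby parameters satisfies
  \<open>sup_estimate\<close>, where \<eta> bounds the change of \<open>F\<close> in the parameter
  along one fixed solution. Uniform continuity on a compact time interval makes that \<eta>
  small.\<close>

lemma ode_continuous:
  fixes F :: "real \<times> 'p::euclidean_space \<times> 'y::euclidean_space \<Rightarrow> 'y" and Y :: "real \<times> 'p \<Rightarrow> 'y"
  assumes V: "open V" and F: "continuous_on (I2 \<times> V \<times> W) F"
    and lip: "\<And>t p y z. t \<in> I2 \<Longrightarrow> p \<in> V \<Longrightarrow> y \<in> W \<Longrightarrow> z \<in> W \<Longrightarrow> norm (F (t, p, y) - F (t, p, z)) \<le> norm (y - z) / 8"
    and Y0: "\<And>p. p \<in> V \<Longrightarrow> Y (0, p) = 0"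
    and YW: "\<And>p t. p \<in> V \<Longrightarrow> t \<in> I2 \<Longrightarrow> Y (t, p) \<in> W"
    and Y: "\<And>p t. p \<in> V \<Longrightarrow> t \<in> I2 \<Longrightarrow> ((\<lambda>t. Y (t, p)) has_vector_derivative F (t, p, Y (t, p))) (at t)"
  shows "continuous_on (I2 \<times> V) Y"
proof (rule continuous_at_imp_continuous_on, safe)
  fix t0 p0 assume t0: "t0 \<in> I2" and p0: "p0 \<in> V"
  define b where "b = (\<bar>t0\<bar> + 2) / 2"
  have b: "b < 2" "\<bar>t0\<bar> < b" "0 < b" using t0 by (auto simp: b_def)
  have bI: "{-b..b} \<subseteq> I2" using b by auto
  obtain r where r: "r > 0" "cball p0 r \<subseteq> V" using V p0 open_contains_cball by blast
  have Yc: "continuous_on {-b..b} (\<lambda>t. Y (t, p0))"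
    using Y[OF p0] bI has_vector_derivative_continuous by (fast intro: continuous_at_imp_continuous_on)
  show "isCont Y (t0, p0)"
    unfolding continuous_at_eps_delta
  proof (intro allI impI)
    fix e :: real assume e: "e > 0"
    have "continuous_on ({-b..b} \<times> cball p0 r) (F \<circ> (\<lambda>x. (fst x, snd x, Y (fst x, p0))))"
    proof (rule continuous_on_compose)
      show "continuous_on ({-b..b} \<times> cball p0 r) (\<lambda>x. (fst x, snd x, Y (fst x, p0)))"
        by (intro continuous_intros continuous_on_compose2[OF Yc]) auto
      show "continuous_on ((\<lambda>x. (fst x, snd x, Y (fst x, p0))) ` ({-b..b} \<times> cball p0 r)) F"
        by (rule continuous_on_subset[OF F]) (use bI r YW[OF p0] in auto)
    qed
    then have "uniformly_continuous_on ({-b..b} \<times> cball p0 r) (F \<circ> (\<lambda>x. (fst x, snd x, Y (fst x, p0))))"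
      by (intro compact_uniformly_continuous compact_Times) auto
    then obtain d1 where d1: "d1 > 0" "\<And>x y. x \<in> {-b..b} \<times> cball p0 r \<Longrightarrow> y \<in> {-b..b} \<times> cball p0 r \<Longrightarrow> dist y x < d1
        \<Longrightarrow> dist (F (fst y, snd y, Y (fst y, p0))) (F (fst x, snd x, Y (fst x, p0))) < e / 8"
      using e unfolding uniformly_continuous_on_def o_def by (metis zero_less_divide_iff zero_less_numeral)
    have "isCont (\<lambda>t. Y (t, p0)) t0" using has_vector_derivative_continuous[OF Y[OF p0 t0]] .
    then obtain d2 where d2: "d2 > 0" "\<And>t. dist t t0 < d2 \<Longrightarrow> dist (Y (t, p0)) (Y (t0, p0)) < e / 2"
      using e unfolding continuous_at_eps_delta by (metis half_gt_zero)
    define d where "d = Min {d1, d2, r, b - \<bar>t0\<bar>}"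
    have d: "d > 0" using d1 d2 r b by (simp add: d_def)
    have "dist (Y x) (Y (t0, p0)) < e" if x: "dist x (t0, p0) < d" for x
    proof -
      obtain t p where tp: "x = (t, p)" by (cases x)
      have dt: "dist t t0 < d" "dist p p0 < d" using x tp dist_fst_le[of x "(t0, p0)"] dist_snd_le[of x "(t0, p0)"] by auto
      have t: "t \<in> {-b..b}" using dt(1) b by (auto simp: d_def dist_real_def)
      have p: "p \<in> cball p0 r" using dt(2) by (simp add: d_def dist_commute)
      then have pV: "p \<in> V" using r by blast
      have "norm (Y (t, p) - Y (t, p0)) \<le> 4 * (e / 8)"
      proof (rule sup_estimate[where b = b and e = "\<lambda>s. Y (s, p) - Y (s, p0)"])
        fix s assume s: "s \<in> {-b..b}"
        then have sI: "s \<in> I2" using bI by blast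
        show "((\<lambda>s. Y (s, p) - Y (s, p0)) has_vector_derivative F (s, p, Y (s, p)) - F (s, p0, Y (s, p0))) (at s within {-b..b})"
          by (intro has_vector_derivative_diff has_vector_derivative_at_within[OF Y] pV p0 sI)
        have "dist (s, p) (s, p0) < d1" using dt(2) by (simp add: dist_Pair_Pair d_def)
        then have "dist (F (s, p, Y (s, p0))) (F (s, p0, Y (s, p0))) < e / 8"
          using d1(2)[of "(s, p0)" "(s, p)"] s p r by auto
        moreover have "norm (F (s, p, Y (s, p)) - F (s, p, Y (s, p0))) \<le> norm (Y (s, p) - Y (s, p0)) / 8"
          by (rule lip) (use sI pV p0 YW in auto)
        ultimately show "norm (F (s, p, Y (s, p)) - F (s, p0, Y (s, p0))) \<le> norm (Y (s, p) - Y (s, p0)) / 8 + e / 8"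
          using norm_triangle_ineq[of "F (s, p, Y (s, p)) - F (s, p, Y (s, p0))" "F (s, p, Y (s, p0)) - F (s, p0, Y (s, p0))"]
          by (simp add: dist_norm)
      qed (use b t Y0 pV p0 in auto)
      then have "dist (Y (t, p)) (Y (t, p0)) \<le> e / 2" by (simp add: dist_norm)
      moreover have "dist (Y (t, p0)) (Y (t0, p0)) < e / 2" using d2(2) dt(1) by (simp add: d_def)
      ultimately show ?thesis using dist_triangle[of "Y (t, p)" "Y (t0, p0)" "Y (t, p0)"] tp by simp
    qed
    then show "\<exists>d>0. \<forall>x. dist x (t0, p0) < d \<longrightarrow> dist (Y x) (Y (t0, p0)) < e" using d by blast
  qed
qed

lemma norm_fd_le_of_lipschitz:
  fixes f :: "'a::real_normed_vector \<Rightarrow> 'b::real_normed_vector"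
  assumes f: "f differentiable (at y)" and W: "open W" "y \<in> W" and C: "C \<ge> 0"
    and lip: "\<And>z. z \<in> W \<Longrightarrow> norm (f z - f y) \<le> C * norm (z - y)"
  shows "norm (fd f y w) \<le> C * norm w"
proof (rule field_le_epsilon)
  fix e :: real assume e: "e > 0"
  have lin: "linear (fd f y)" using linear_fd[OF f] .
  define e' where "e' = e / (norm w + 1)"
  have nw: "norm w + 1 > 0" by (smt (verit) norm_ge_zero)
  have e': "e' > 0" using e nw by (simp add: e'_def)
  obtain d where d: "d > 0" "\<And>z. norm (z - y) < d \<Longrightarrow> norm (f z - f y - fd f y (z - y)) \<le> e' * norm (z - y)"
    using has_derivative_fd[OF f] e' unfolding has_derivative_at_alt by blast
  obtain r where r: "r > 0" "ball y r \<subseteq> W" using W openE by blast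
  define N where "N = norm w + 1"
  define s where "s = min d r / (2 * N)"
  have s: "s > 0" using d(1) r(1) nw by (simp add: s_def N_def)
  have "s * norm w \<le> s * N" using s by (simp add: N_def)
  also have "\<dots> = min d r / 2" unfolding s_def using nw by (simp add: N_def[symmetric])
  finally have sw: "s * norm w < min d r" using d(1) r(1) by linarith
  define z where "z = y + s *\<^sub>R w"
  have nz: "norm (z - y) = s * norm w" using s by (simp add: z_def)
  have "z \<in> W" using r(2) sw nz by (auto simp: dist_norm norm_minus_commute)
  have "norm (fd f y (z - y)) \<le> norm (f z - f y) + norm (f z - f y - fd f y (z - y))"
    using norm_triangle_ineq4[of "f z - f y" "f z - f y - fd f y (z - y)"] by simp
  also have "\<dots> \<le> C * norm (z - y) + e' * norm (z - y)"
    by (intro add_mono lip d(2)) (use \<open>z \<in> W\<close> sw nz in auto)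
  also have "\<dots> = s * ((C + e') * norm w)" by (simp add: nz algebra_simps)
  also have "norm (fd f y (z - y)) = s * norm (fd f y w)"
    using s by (simp add: z_def linear_scale[OF lin])
  finally have "norm (fd f y w) \<le> (C + e') * norm w" using s by simp
  also have "\<dots> = C * norm w + e' * norm w" by (simp add: algebra_simps)
  also have "e' * norm w \<le> e" using e nw by (simp add: e'_def field_simps)
  finally show "norm (fd f y w) \<le> C * norm w + e" by simp
qed

text \<open>The linearised equation inherits the Lipschitz constant 1/8, so existence, uniqueness
  and \<open>sup_estimate\<close> apply to it without change.\<close>

lemma norm_fd_third_le:
  fixes F :: "'a::euclidean_space \<times> 'p::euclidean_space \<times> 'y::euclidean_space \<Rightarrow> 'z::real_normed_vector"
  assumes F: "F differentiable (at (t, p, y0))" and W: "open W" "y0 \<in> W"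
    and lip: "\<And>y. y \<in> W \<Longrightarrow> norm (F (t, p, y) - F (t, p, y0)) \<le> norm (y - y0) / 8"
  shows "norm (fd F (t, p, y0) (0, 0, w)) \<le> norm w / 8"
proof -
  have D0: "((\<lambda>y. (t, p, y)) has_derivative (\<lambda>w. (0, 0, w))) (at y0)"
    by (auto intro!: derivative_eq_intros has_derivative_Pair)
  have D: "((\<lambda>y. F (t, p, y)) has_derivative (\<lambda>w. fd F (t, p, y0) (0, 0, w))) (at y0)"
    by (rule has_derivative_compose[OF D0 has_derivative_fd[OF F]])
  have "norm (fd (\<lambda>y. F (t, p, y)) y0 w) \<le> 1 / 8 * norm w"
    by (rule norm_fd_le_of_lipschitz[OF _ W]) (use D lip in \<open>auto simp: differentiable_def\<close>)
  then show ?thesis using fd_eq[OF D] by simp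
qed

text \<open>\<open>Z h\<close> solves the equation of first variation and is the candidate for the
  derivative in the direction \<open>h\<close>. Linearising \<open>F\<close> along the trajectory
  shows that Y(t, p + h) - Y(t, p) - Z h (t, p) satisfies \<open>sup_estimate\<close> with a defect
  o(norm h).\<close>

lemma ode_differentiable:
  fixes F :: "real \<times> 'p::euclidean_space \<times> 'y::euclidean_space \<Rightarrow> 'y" and Y :: "real \<times> 'p \<Rightarrow> 'y"
  assumes V: "open V" and W: "open W" and F: "Ck_on (Suc 0) F (I2 \<times> V \<times> W)"
    and lip: "\<And>t p y z. t \<in> I2 \<Longrightarrow> p \<in> V \<Longrightarrow> y \<in> W \<Longrightarrow> z \<in> W \<Longrightarrow> norm (F (t, p, y) - F (t, p, z)) \<le> norm (y - z) / 8"
    and Y0: "\<And>p. p \<in> V \<Longrightarrow> Y (0, p) = 0"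
    and YW: "\<And>p t. p \<in> V \<Longrightarrow> t \<in> I2 \<Longrightarrow> Y (t, p) \<in> W"
    and Y: "\<And>p t. p \<in> V \<Longrightarrow> t \<in> I2 \<Longrightarrow> ((\<lambda>t. Y (t, p)) has_vector_derivative F (t, p, Y (t, p))) (at t)"
  shows "\<exists>Z. (\<forall>h. \<forall>p\<in>V. Z h (0, p) = 0) \<and>
    (\<forall>h. \<forall>p\<in>V. \<forall>t\<in>I2. ((\<lambda>t. Z h (t, p)) has_vector_derivative fd F (t, p, Y (t, p)) (0, h, Z h (t, p))) (at t)) \<and>
    (\<forall>p\<in>V. \<forall>t\<in>I2. (Y has_derivative (\<lambda>(\<tau>, h). \<tau> *\<^sub>R F (t, p, Y (t, p)) + Z h (t, p))) (at (t, p)))"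
proof -
  let ?q = "\<lambda>t p. (t, p, Y (t, p))"
  let ?\<Omega> = "I2 \<times> V \<times> W"
  have \<Omega>: "open ?\<Omega>" using V W by (intro open_Times) auto
  have Fd: "F differentiable (at x)" if "x \<in> ?\<Omega>" for x using F that by auto
  have q\<Omega>: "?q t p \<in> ?\<Omega>" if "t \<in> I2" "p \<in> V" for t p using that YW by auto
  have lin: "linear (fd F (?q t p))" if "t \<in> I2" "p \<in> V" for t p
    using linear_fd[OF Fd[OF q\<Omega>[OF that]]] .
  have Fc: "continuous_on ?\<Omega> F" using Ck_on_SucD[OF F] by simp
  have Yc: "continuous_on (I2 \<times> V) Y" by (rule ode_continuous[OF V Fc lip Y0 YW Y])
  have bnd: "norm (fd F (?q t p) (0, 0, w)) \<le> norm w / 8" if t: "t \<in> I2" and p: "p \<in> V" for t p w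
    by (rule norm_fd_third_le[OF Fd[OF q\<Omega>[OF t p]] W YW[OF p t]]) (rule lip[OF t p _ YW[OF p t]])
  have dfl: "norm (fd F (?q t p) (0, h, y) - fd F (?q t p) (0, h, z)) \<le> norm (y - z) / 8" if t: "t \<in> I2" and p: "p \<in> V" for t p h y z
    using bnd[OF t p, of "y - z"] linear_diff[OF lin[OF t p], of "(0, h, y)" "(0, h, z)"] by simp
  have "\<exists>z. z 0 = 0 \<and> (\<forall>t\<in>I2. (z has_vector_derivative fd F (?q t p) (0, h, z t)) (at t))" if p: "p \<in> V" for h p
  proof (rule ode_exists_I2[where G = "\<lambda>t y. fd F (?q t p) (0, h, y)"])
    have "Ck_on 0 (\<lambda>x. fd F ((\<lambda>(t, y). ?q t p) x) ((\<lambda>(t, y). (0, h, y)) x)) (I2 \<times> UNIV)"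
    proof (rule Ck_on_fd_compose[OF _ \<Omega> _ F])
      have "continuous_on (I2 \<times> UNIV) (\<lambda>x. ?q (fst x) p)"
        by (intro continuous_intros continuous_on_compose2[OF Yc]) (use p in auto)
      then show "Ck_on 0 (\<lambda>(t, y). ?q t p) (I2 \<times> UNIV)" by (simp add: case_prod_beta')
    qed (use q\<Omega> p in \<open>auto simp: case_prod_beta' open_Times intro!: continuous_intros\<close>)
    then show "continuous_on (I2 \<times> UNIV) (\<lambda>(t, y). fd F (?q t p) (0, h, y))"
      by (simp add: case_prod_beta')
  qed (rule dfl[OF _ p])
  note ex = this
  define Z' where "Z' = (\<lambda>h p. SOME z. z 0 = 0 \<and> (\<forall>t\<in>I2. (z has_vector_derivative fd F (?q t p) (0, h, z t)) (at t)))"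
  have "Z' h p 0 = 0 \<and> (\<forall>t\<in>I2. (Z' h p has_vector_derivative fd F (?q t p) (0, h, Z' h p t)) (at t))" if "p \<in> V" for h p
    unfolding Z'_def by (rule someI_ex[OF ex[OF that]])
  then have Z'0: "\<And>h p. p \<in> V \<Longrightarrow> Z' h p 0 = 0"
    and Z': "\<And>h p t. p \<in> V \<Longrightarrow> t \<in> I2 \<Longrightarrow> (Z' h p has_vector_derivative fd F (?q t p) (0, h, Z' h p t)) (at t)"
    by blast+
  \<comment> \<open>Linearity in \<open>h\<close> is uniqueness for the equation of first variation:
    both sides solve it with the parameter increment \<open>h + k\<close>.\<close>
  have Zadd: "Z' (h + k) p t = Z' h p t + Z' k p t" if t: "t \<in> I2" and p: "p \<in> V" for h k p t
  proof (rule ode_unique[where b = "\<bar>t\<bar>" and G = "\<lambda>t y. fd F (?q t p) (0, h + k, y)"])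
    fix s assume s: "s \<in> {-\<bar>t\<bar>..\<bar>t\<bar>}"
    then have sI: "s \<in> I2" using t by auto
    show "(Z' (h + k) p has_vector_derivative fd F (?q s p) (0, h + k, Z' (h + k) p s)) (at s within {-\<bar>t\<bar>..\<bar>t\<bar>})"
      by (rule has_vector_derivative_at_within[OF Z'[OF p sI]])
    have "fd F (?q s p) (0, h, Z' h p s) + fd F (?q s p) (0, k, Z' k p s) = fd F (?q s p) (0, h + k, Z' h p s + Z' k p s)"
      using linear_add[OF lin[OF sI p], of "(0, h, Z' h p s)" "(0, k, Z' k p s)"] by simp
    then show "((\<lambda>t. Z' h p t + Z' k p t) has_vector_derivative fd F (?q s p) (0, h + k, Z' h p s + Z' k p s)) (at s within {-\<bar>t\<bar>..\<bar>t\<bar>})"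
      using has_vector_derivative_at_within[OF has_vector_derivative_add[OF Z'[OF p sI] Z'[OF p sI], of h k]] by metis
    show "norm (fd F (?q s p) (0, h + k, Z' (h + k) p s) - fd F (?q s p) (0, h + k, Z' h p s + Z' k p s))
        \<le> norm (Z' (h + k) p s - (Z' h p s + Z' k p s)) / 8" by (rule dfl[OF sI p])
  qed (use t p Z'0 in auto)
  have Zscale: "Z' (c *\<^sub>R h) p t = c *\<^sub>R Z' h p t" if t: "t \<in> I2" and p: "p \<in> V" for h c p t
  proof (rule ode_unique[where b = "\<bar>t\<bar>" and G = "\<lambda>t y. fd F (?q t p) (0, c *\<^sub>R h, y)"])
    fix s assume s: "s \<in> {-\<bar>t\<bar>..\<bar>t\<bar>}"
    then have sI: "s \<in> I2" using t by auto
    show "(Z' (c *\<^sub>R h) p has_vector_derivative fd F (?q s p) (0, c *\<^sub>R h, Z' (c *\<^sub>R h) p s)) (at s within {-\<bar>t\<bar>..\<bar>t\<bar>})"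
      by (rule has_vector_derivative_at_within[OF Z'[OF p sI]])
    have "c *\<^sub>R fd F (?q s p) (0, h, Z' h p s) = fd F (?q s p) (0, c *\<^sub>R h, c *\<^sub>R Z' h p s)"
      using linear_scale[OF lin[OF sI p], of c "(0, h, Z' h p s)"] by simp
    then show "((\<lambda>t. c *\<^sub>R Z' h p t) has_vector_derivative fd F (?q s p) (0, c *\<^sub>R h, c *\<^sub>R Z' h p s)) (at s within {-\<bar>t\<bar>..\<bar>t\<bar>})"
      using has_vector_derivative_at_within[OF bounded_linear.has_vector_derivative[OF bounded_linear_scaleR_right[of c] Z'[OF p sI, of h]]] by metis
    show "norm (fd F (?q s p) (0, c *\<^sub>R h, Z' (c *\<^sub>R h) p s) - fd F (?q s p) (0, c *\<^sub>R h, c *\<^sub>R Z' h p s))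
        \<le> norm (Z' (c *\<^sub>R h) p s - c *\<^sub>R Z' h p s) / 8" by (rule dfl[OF sI p])
  qed (use t p Z'0 in auto)
  have Dp: "((\<lambda>p. Y (t, p)) has_derivative (\<lambda>h. Z' h p t)) (at p)" if t: "t \<in> I2" and p: "p \<in> V" for t p
    unfolding has_derivative_at_alt
  proof (intro conjI allI impI)
    have "linear (\<lambda>h. Z' h p t)" by (rule linearI) (auto simp: Zadd[OF t p] Zscale[OF t p])
    then show "bounded_linear (\<lambda>h. Z' h p t)" using linear_conv_bounded_linear by blast
    fix e :: real assume e: "e > 0"
    define b where "b = \<bar>t\<bar>"
    have b: "b < 2" "t \<in> {-b..b}" using t by (auto simp: b_def)
    have bI: "{-b..b} \<subseteq> I2" using b by auto
    define K where "K = (\<lambda>s. ?q s p) ` {-b..b}"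
    have "continuous_on {-b..b} (\<lambda>s. ?q s p)"
      by (intro continuous_intros continuous_on_compose2[OF Yc]) (use p bI in auto)
    then have K: "compact K" unfolding K_def by (intro compact_continuous_image) auto
    have K\<Omega>: "K \<subseteq> ?\<Omega>" unfolding K_def using q\<Omega> p bI by blast
    have qK: "?q s p \<in> K" if "s \<in> {-b..b}" for s unfolding K_def using that by blast
    note ud = uniform_differentiability[OF \<Omega> K K\<Omega> F]
    obtain M where M: "M > 0" "\<And>q k. q \<in> K \<Longrightarrow> norm (fd F q k) \<le> M * norm k" using ud(2) by blast
    \<comment> \<open>By the estimate for \<open>Y (s, p') - Y (s, p)\<close> below,
      \<open>C\<close> bounds the full increment of the argument of \<open>F\<close> relative to
      norm h. In \<open>e'\<close> the factor 4 undoes the loss in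
      \<open>sup_estimate\<close>.\<close>
    define C where "C = 1 + 4 * (1 + M)"
    have C: "C > 0" using M by (simp add: C_def)
    define e' where "e' = e / (4 * C)"
    have e': "e' > 0" using e C by (simp add: e'_def)
    obtain d1 where d1: "d1 > 0" "\<And>q k. q \<in> K \<Longrightarrow> norm k < d1 \<Longrightarrow> norm (F (q + k) - F q - fd F q k) \<le> 1 * norm k"
      using ud(1)[OF zero_less_one] by blast
    obtain d2 where d2: "d2 > 0" "\<And>q k. q \<in> K \<Longrightarrow> norm k < d2 \<Longrightarrow> norm (F (q + k) - F q - fd F q k) \<le> e' * norm k"
      using ud(1)[OF e'] by blast
    obtain r where r: "r > 0" "ball p r \<subseteq> V" using V p openE by blast
    define d where "d = Min {d1, d2 / C, r}"
    have d: "d > 0" using d1 d2 r C by (simp add: d_def)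
    have "norm (Y (t, p') - Y (t, p) - Z' (p' - p) p t) \<le> e * norm (p' - p)" if "norm (p' - p) < d" for p'
    proof -
      define h where "h = p' - p"
      have h: "norm h < d1" "norm h < d2 / C" "norm h < r" and p'h: "p' = p + h" using that by (auto simp: d_def h_def)
      have p': "p' \<in> V" using r(2) h(3) by (auto simp: p'h dist_norm)
      have Yd: "((\<lambda>t. Y (t, x)) has_vector_derivative F (?q s x)) (at s within {-b..b})" if "x \<in> V" "s \<in> {-b..b}" for x s
        using has_vector_derivative_at_within[OF Y] that bI by blast
      have \<Delta>: "norm (Y (s, p') - Y (s, p)) \<le> 4 * ((1 + M) * norm h)" if s: "s \<in> {-b..b}" for s
      proof (rule sup_estimate[where b = b and e = "\<lambda>s. Y (s, p') - Y (s, p)"])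
        fix s assume s: "s \<in> {-b..b}"
        then have sI: "s \<in> I2" using bI by blast
        show "((\<lambda>s. Y (s, p') - Y (s, p)) has_vector_derivative F (?q s p') - F (?q s p)) (at s within {-b..b})"
          by (intro has_vector_derivative_diff Yd p p' s)
        have "norm (F (?q s p + (0, h, 0)) - F (?q s p) - fd F (?q s p) (0, h, 0)) \<le> norm h"
          using d1(2)[OF qK[OF s], of "(0, h, 0)"] h(1) by (simp add: norm_Pair)
        moreover have "norm (fd F (?q s p) (0, h, 0)) \<le> M * norm h"
          using M(2)[OF qK[OF s], of "(0, h, 0)"] by (simp add: norm_Pair)
        ultimately have 1: "norm (F (s, p', Y (s, p)) - F (?q s p)) \<le> (1 + M) * norm h"
          using norm_triangle_ineq[of "F (s, p', Y (s, p)) - F (?q s p) - fd F (?q s p) (0, h, 0)" "fd F (?q s p) (0, h, 0)"]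
          by (simp add: p'h algebra_simps)
        have 2: "norm (F (?q s p') - F (s, p', Y (s, p))) \<le> norm (Y (s, p') - Y (s, p)) / 8"
          by (rule lip) (use sI p p' YW in auto)
        show "norm (F (?q s p') - F (?q s p)) \<le> norm (Y (s, p') - Y (s, p)) / 8 + (1 + M) * norm h"
          using norm_triangle_ineq[of "F (?q s p') - F (s, p', Y (s, p))" "F (s, p', Y (s, p)) - F (?q s p)"] 1 2 by simp
      qed (use b s Y0 p p' in auto)
      have "norm (Y (t, p') - Y (t, p) - Z' h p t) \<le> 4 * (e' * (C * norm h))"
      proof (rule sup_estimate[where b = b and e = "\<lambda>s. Y (s, p') - Y (s, p) - Z' h p s"])
        fix s assume s: "s \<in> {-b..b}"
        then have sI: "s \<in> I2" using bI by blast
        show "((\<lambda>s. Y (s, p') - Y (s, p) - Z' h p s) has_vector_derivative F (?q s p') - F (?q s p) - fd F (?q s p) (0, h, Z' h p s)) (at s within {-b..b})"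
          by (intro has_vector_derivative_diff Yd p p' s has_vector_derivative_at_within[OF Z'] sI)
        let ?k = "(0 :: real, h, Y (s, p') - Y (s, p))"
        have "norm ?k \<le> norm h + norm (Y (s, p') - Y (s, p))"
          using norm_Pair_le[of 0 "(h, Y (s, p') - Y (s, p))"] norm_Pair_le[of h "Y (s, p') - Y (s, p)"] by simp
        also have "\<dots> \<le> C * norm h" using \<Delta>[OF s] by (simp add: C_def algebra_simps)
        finally have k: "norm ?k \<le> C * norm h" .
        moreover have "C * norm h < d2" using h(2) C by (simp add: field_simps)
        ultimately have "norm (F (?q s p + ?k) - F (?q s p) - fd F (?q s p) ?k) \<le> e' * norm ?k"
          by (intro d2(2) qK s) simp
        also have "\<dots> \<le> e' * (C * norm h)" using k e' by (intro mult_left_mono) auto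
        finally have 1: "norm (F (?q s p') - F (?q s p) - fd F (?q s p) ?k) \<le> e' * (C * norm h)" by (simp add: p'h)
        have 2: "norm (fd F (?q s p) ?k - fd F (?q s p) (0, h, Z' h p s)) \<le> norm (Y (s, p') - Y (s, p) - Z' h p s) / 8"
          by (rule dfl[OF sI p])
        show "norm (F (?q s p') - F (?q s p) - fd F (?q s p) (0, h, Z' h p s))
            \<le> norm (Y (s, p') - Y (s, p) - Z' h p s) / 8 + e' * (C * norm h)"
          using norm_triangle_ineq[of "F (?q s p') - F (?q s p) - fd F (?q s p) ?k" "fd F (?q s p) ?k - fd F (?q s p) (0, h, Z' h p s)"] 1 2
          by simp
      qed (use b Y0 p p' Z'0 in auto)
      also have "\<dots> = e * norm h" using C by (simp add: e'_def)
      finally show ?thesis by (simp add: h_def)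
    qed
    then show "\<exists>d>0. \<forall>p'. norm (p' - p) < d \<longrightarrow> norm (Y (t, p') - Y (t, p) - Z' (p' - p) p t) \<le> e * norm (p' - p)"
      using d by blast
  qed
  have D: "(Y has_derivative (\<lambda>(\<tau>, h). \<tau> *\<^sub>R F (?q t p) + Z' h p t)) (at (t, p))" if t: "t \<in> I2" and p: "p \<in> V" for t p
  proof -
    \<comment> \<open>Joint differentiability needs one partial derivative to be continuous. At this
      stage only the one in time is, being \<open>F\<close> along \<open>Y\<close>, and the rule
      wants it in second place; hence the swapped arguments.\<close>
    have "((\<lambda>(p, t). Y (t, p)) has_derivative (\<lambda>(h, \<tau>). Z' h p t + blinfun_apply (blinfun_scaleR_left (F (?q t p))) \<tau>)) (at (p, t) within V \<times> I2)"
    proof (rule has_derivative_partialsI[where f = "\<lambda>p t. Y (t, p)" and fy = "\<lambda>p t. blinfun_scaleR_left (F (?q t p))"])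
      show "((\<lambda>x. Y (t, x)) has_derivative (\<lambda>h. Z' h p t)) (at p within V)"
        by (rule has_derivative_at_withinI[OF Dp[OF t p]])
      show "((\<lambda>t. Y (t, x)) has_derivative blinfun_apply (blinfun_scaleR_left (F (?q y x)))) (at y within I2)"
        if "x \<in> V" "y \<in> I2" for x y
        using has_vector_derivative_at_within[OF Y[OF that], of I2] unfolding has_vector_derivative_def by simp
      have "continuous_on (V \<times> I2) (\<lambda>x. F (?q (snd x) (fst x)))"
        by (rule continuous_on_compose2[OF Fc]) (use q\<Omega> in \<open>auto intro!: continuous_intros continuous_on_compose2[OF Yc]\<close>)
      then have "continuous_on (V \<times> I2) (\<lambda>x. blinfun_scaleR_left (F (?q (snd x) (fst x))))"
        by (rule bounded_linear.continuous_on[OF bounded_linear_blinfun_scaleR_left])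
      then show "continuous (at (p, t) within V \<times> I2) (\<lambda>(p, t). blinfun_scaleR_left (F (?q t p)))"
        using t p by (simp add: continuous_on_eq_continuous_within case_prod_beta')
    qed (use t in auto)
    moreover have "at (p, t) within V \<times> I2 = at (p, t)"
      by (rule at_within_open) (use t p V in \<open>auto intro!: open_Times\<close>)
    ultimately have 1: "((\<lambda>(p, t). Y (t, p)) has_derivative (\<lambda>(h, \<tau>). Z' h p t + \<tau> *\<^sub>R F (?q t p))) (at (p, t))" by simp
    have sw: "((\<lambda>x. (snd x, fst x)) has_derivative (\<lambda>x. (snd x, fst x))) (at (t, p))"
      by (intro bounded_linear_imp_has_derivative bounded_linear_Pair bounded_linear_fst bounded_linear_snd)
    have "((\<lambda>x. (\<lambda>(p, t). Y (t, p)) (snd x, fst x)) has_derivative (\<lambda>x. (\<lambda>(h, \<tau>). Z' h p t + \<tau> *\<^sub>R F (?q t p)) (snd x, fst x))) (at (t, p))"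
      by (rule has_derivative_compose[OF sw]) (use 1 in simp)
    then show ?thesis by (simp add: case_prod_beta' add.commute)
  qed
  show ?thesis
    by (rule exI[of _ "\<lambda>h x. Z' h (snd x) (fst x)"]) (use Z'0 Z' D in simp)
qed

text \<open>The derivative of \<open>Y\<close> consists of \<open>F\<close> along \<open>Y\<close>
  and of \<open>Z\<close>. The latter solves an equation of the same shape, whose right-hand side
  involves \<open>fd F\<close> and \<open>Y\<close> and is of class k, with all vectors allowed as
  values. So the induction runs over all \<open>F\<close>, \<open>W\<close> and \<open>Y\<close> at
  once.\<close>

proposition ode_Ck:
  fixes F :: "real \<times> 'p::euclidean_space \<times> 'y::euclidean_space \<Rightarrow> 'y" and Y :: "real \<times> 'p \<Rightarrow> 'y"
  assumes V: "open V" and W: "open W" and F: "Ck_on k F (I2 \<times> V \<times> W)"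
    and lip: "\<And>t p y z. t \<in> I2 \<Longrightarrow> p \<in> V \<Longrightarrow> y \<in> W \<Longrightarrow> z \<in> W \<Longrightarrow> norm (F (t, p, y) - F (t, p, z)) \<le> norm (y - z) / 8"
    and Y0: "\<And>p. p \<in> V \<Longrightarrow> Y (0, p) = 0"
    and YW: "\<And>p t. p \<in> V \<Longrightarrow> t \<in> I2 \<Longrightarrow> Y (t, p) \<in> W"
    and Y: "\<And>p t. p \<in> V \<Longrightarrow> t \<in> I2 \<Longrightarrow> ((\<lambda>t. Y (t, p)) has_vector_derivative F (t, p, Y (t, p))) (at t)"
  shows "Ck_on k Y (I2 \<times> V)"
  using W F lip Y0 YW Y
proof (induction k arbitrary: F W Y)
  case 0
  then show ?case using ode_continuous[OF V, of W F Y] by simp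
next
  case (Suc k)
  note W = Suc.prems(1) and F = Suc.prems(2) and lip = Suc.prems(3) and Y0 = Suc.prems(4) and YW = Suc.prems(5) and Y = Suc.prems(6)
  have o: "open (I2 \<times> V)" "open (I2 \<times> V \<times> W)" "open (I2 \<times> V \<times> (UNIV :: 'y set))" using V W by (auto intro!: open_Times)
  have Yk: "Ck_on k Y (I2 \<times> V)" by (rule Suc.IH[OF W Ck_on_SucD[OF F] lip Y0 YW Y])
  have Fk: "Ck_on k (\<lambda>x. F (fst x, snd x, Y x)) (I2 \<times> V)"
  proof (rule Ck_on_compose[OF o(1,2) _ Ck_on_SucD[OF F]])
    show "Ck_on k (\<lambda>x. (fst x, snd x, Y x)) (I2 \<times> V)"
      by (intro Ck_on_Pair o Yk Ck_on_bounded_linear bounded_linear_fst bounded_linear_snd)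
  qed (use YW in auto)
  obtain Z where Z0: "\<And>h p. p \<in> V \<Longrightarrow> Z h (0, p) = 0"
    and Z: "\<And>h p t. p \<in> V \<Longrightarrow> t \<in> I2 \<Longrightarrow> ((\<lambda>t. Z h (t, p)) has_vector_derivative fd F (t, p, Y (t, p)) (0, h, Z h (t, p))) (at t)"
    and D: "\<And>p t. p \<in> V \<Longrightarrow> t \<in> I2 \<Longrightarrow> (Y has_derivative (\<lambda>(\<tau>, h). \<tau> *\<^sub>R F (t, p, Y (t, p)) + Z h (t, p))) (at (t, p))"
    using ode_differentiable[OF V W Ck_on_le[OF F] lip Y0 YW Y] by blast
  have Zk: "Ck_on k (Z h) (I2 \<times> V)" for h
  proof (rule Suc.IH[where W = UNIV and F = "\<lambda>(t, p, z). fd F (t, p, Y (t, p)) (0, h, z)"])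
    have "Ck_on k (\<lambda>x. fd F (fst x, fst (snd x), Y (fst x, fst (snd x))) (0, h, snd (snd x))) (I2 \<times> V \<times> UNIV)"
    proof (rule Ck_on_fd_compose[OF o(3,2) _ F])
      have bl: "bounded_linear (\<lambda>x::real \<times> 'p \<times> 'y. fst (snd x))" "bounded_linear (\<lambda>x::real \<times> 'p \<times> 'y. snd (snd x))"
        by (auto intro: bounded_linear_compose[OF bounded_linear_fst bounded_linear_snd] bounded_linear_compose[OF bounded_linear_snd bounded_linear_snd])
      have "Ck_on k (\<lambda>x. Y (fst x, fst (snd x))) (I2 \<times> V \<times> (UNIV :: 'y set))"
        by (rule Ck_on_compose[OF o(3,1) _ Yk]) (auto intro!: Ck_on_bounded_linear bounded_linear_Pair bl bounded_linear_fst)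
      then show "Ck_on k (\<lambda>x. (fst x, fst (snd x), Y (fst x, fst (snd x)))) (I2 \<times> V \<times> (UNIV :: 'y set))"
        by (intro Ck_on_Pair[OF o(3)]) (auto intro: Ck_on_bounded_linear bl bounded_linear_fst)
      show "Ck_on k (\<lambda>x. (0, h, snd (snd x))) (I2 \<times> V \<times> (UNIV :: 'y set))"
        by (intro Ck_on_Pair Ck_on_const Ck_on_bounded_linear bl o)
    qed (use YW in auto)
    then show "Ck_on k (\<lambda>(t, p, z). fd F (t, p, Y (t, p)) (0, h, z)) (I2 \<times> V \<times> UNIV)"
      by (simp add: case_prod_beta')
    fix t p and y z :: 'y assume t: "t \<in> I2" and p: "p \<in> V"
    have q: "F differentiable (at (t, p, Y (t, p)))" using F t p YW by auto
    have "norm (fd F (t, p, Y (t, p)) (0, 0, y - z)) \<le> norm (y - z) / 8"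
      by (rule norm_fd_third_le[OF q W YW[OF p t]]) (rule lip[OF t p _ YW[OF p t]])
    then show "norm ((case (t, p, y) of (t, p, z) \<Rightarrow> fd F (t, p, Y (t, p)) (0, h, z))
        - (case (t, p, z) of (t, p, z) \<Rightarrow> fd F (t, p, Y (t, p)) (0, h, z))) \<le> norm (y - z) / 8"
      using linear_diff[OF linear_fd[OF q], of "(0, h, y)" "(0, h, z)"] by simp
  qed (use Z0 Z in auto)
  show ?case
  proof (rule Ck_on_SucI[OF o(1)])
    fix x assume "x \<in> I2 \<times> V"
    then show "(Y has_derivative (\<lambda>v. fst v *\<^sub>R F (fst x, snd x, Y x) + Z (snd v) x)) (at x)"
      using D[of "snd x" "fst x"] by (cases x) (simp add: case_prod_beta')
  next
    fix v :: "real \<times> 'p"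
    show "Ck_on k (\<lambda>x. fst v *\<^sub>R F (fst x, snd x, Y x) + Z (snd v) x) (I2 \<times> V)"
      by (intro Ck_on_add o Zk Ck_on_linear[OF bounded_linear_scaleR_right o(1) Fk])
  qed
qed

section \<open>Local flows and the exponential map of a spray\<close>

lemma C1_lipschitz_on_compact_convex:
  fixes f :: "'a::euclidean_space \<Rightarrow> 'b::real_normed_vector"
  assumes "open \<Omega>" "Ck_on (Suc 0) f \<Omega>" "compact K" "convex K" "K \<subseteq> \<Omega>"
  shows "\<exists>M>0. \<forall>x\<in>K. \<forall>y\<in>K. norm (f x - f y) \<le> M * norm (x - y)"
proof -
  obtain M where M: "M > 0" "\<And>q k. q \<in> K \<Longrightarrow> norm (fd f q k) \<le> M * norm k"
    using uniform_differentiability(2)[OF assms(1,3,5,2)] by blast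
  have "norm (f x - f y) \<le> M * norm (x - y)" if "x \<in> K" "y \<in> K" for x y
  proof (rule differentiable_bound[OF assms(4) _ _ that])
    have "\<forall>x\<in>\<Omega>. f differentiable (at x)" using assms(2) by simp
    then show "(f has_derivative fd f x) (at x within K)" if "x \<in> K" for x
      using assms(5) that by (blast intro: has_derivative_at_withinI has_derivative_fd)
    show "onorm (fd f x) \<le> M" if "x \<in> K" for x
      using M(2)[OF that] by (rule onorm_le)
  qed
  then show ?thesis using M(1) by blast
qed

text \<open>Slowing time by the factor \<open>a\<close> brings the Lipschitz constant down to 1/8
  and the speed down to r/4. Up to time 2 a solution then moves by at most r/2 and stays in the
  ball.\<close>

lemma local_flow:
  fixes f :: "'p::euclidean_space \<times> 'y::euclidean_space \<Rightarrow> 'y"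
  assumes f: "smooth_on f \<Omega>" and \<Omega>: "open \<Omega>" and sub: "cball 0 1 \<times> cball 0 r \<subseteq> \<Omega>" and r: "r > 0"
  shows "\<exists>a>0. \<exists>Y. smooth_on Y (I2 \<times> ball 0 1) \<and> (\<forall>p\<in>ball 0 1. Y (0, p) = 0 \<and>
    (\<forall>t\<in>I2. Y (t, p) \<in> ball 0 r \<and> ((\<lambda>t. Y (t, p)) has_vector_derivative a *\<^sub>R f (p, Y (t, p))) (at t))) \<and>
    (\<forall>p\<in>ball 0 1. \<forall>y\<in>ball 0 r. \<forall>z\<in>ball 0 r. norm (a *\<^sub>R f (p, y) - a *\<^sub>R f (p, z)) \<le> norm (y - z) / 8)"
proof -
  let ?K = "cball (0::'p) 1 \<times> cball (0::'y) r"
  have K: "compact ?K" "convex ?K" by (auto intro!: compact_Times convex_Times)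
  have fc: "continuous_on \<Omega> f" by (rule smooth_on_imp_continuous[OF f])
  obtain M where M: "M > 0" "\<And>x y. x \<in> ?K \<Longrightarrow> y \<in> ?K \<Longrightarrow> norm (f x - f y) \<le> M * norm (x - y)"
    using C1_lipschitz_on_compact_convex[OF \<Omega> smooth_on_Ck[OF f] K sub] by blast
  have "bounded (f ` ?K)"
    by (intro compact_imp_bounded compact_continuous_image continuous_on_subset[OF fc sub] K)
  then obtain B where B: "B > 0" "\<And>x. x \<in> ?K \<Longrightarrow> norm (f x) \<le> B" unfolding bounded_pos by auto
  define a where "a = min (1 / (8 * M)) (r / (4 * B))"
  have a: "a > 0" using M B r by (simp add: a_def)
  have aM: "a * M \<le> 1 / 8"
  proof -
    have "a * M \<le> 1 / (8 * M) * M" using M by (intro mult_right_mono) (auto simp: a_def)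
    then show ?thesis using M by simp
  qed
  have aB: "a * B \<le> r / 4"
  proof -
    have "a * B \<le> r / (4 * B) * B" using B by (intro mult_right_mono) (auto simp: a_def)
    then show ?thesis using B by simp
  qed
  \<comment> \<open>The nearest-point projection extends the right-hand side to all vectors with the
    same Lipschitz constant. Since the solutions stay inside the ball, the projection disappears
    from the equation afterwards.\<close>
  define cp where "cp = closest_point (cball (0::'y) r)"
  have cp: "cp y \<in> cball 0 r" "y \<in> cball 0 r \<Longrightarrow> cp y = y" for y
    unfolding cp_def using closest_point_in_set[of "cball (0::'y) r" y] closest_point_self[of y] r by auto
  have cpl: "norm (cp y - cp z) \<le> norm (y - z)" for y z
    using closest_point_lipschitz[of "cball (0::'y) r" y z] r by (simp add: cp_def dist_norm)
  have cpc: "continuous_on UNIV cp"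
    unfolding cp_def using r by (intro continuous_on_closest_point) auto
  have lip: "norm (a *\<^sub>R f (p, y) - a *\<^sub>R f (p, z)) \<le> norm (y - z) / 8" if "p \<in> cball 0 1" "y \<in> cball 0 r" "z \<in> cball 0 r" for p y z
  proof -
    have "norm (a *\<^sub>R f (p, y) - a *\<^sub>R f (p, z)) = a * norm (f (p, y) - f (p, z))"
      using a by (simp flip: scaleR_right_diff_distrib)
    also have "\<dots> \<le> a * (M * norm ((p, y) - (p, z)))"
      using a that by (intro mult_left_mono M(2)) auto
    also have "\<dots> = (a * M) * norm (y - z)" by (simp add: norm_Pair)
    also have "\<dots> \<le> 1 / 8 * norm (y - z)" by (intro mult_right_mono aM) auto
    finally show ?thesis by simp
  qed
  define S where "S = (\<lambda>p z. z 0 = 0 \<and> (\<forall>t\<in>I2. (z has_vector_derivative a *\<^sub>R f (p, cp (z t))) (at t)))"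
  have ex: "\<exists>z. S p z" if p: "p \<in> ball 0 1" for p
    unfolding S_def
  proof (rule ode_exists_I2[where G = "\<lambda>t y. a *\<^sub>R f (p, cp y)"])
    have "continuous_on (I2 \<times> UNIV) (\<lambda>x. a *\<^sub>R f (p, cp (snd x)))"
    proof (intro continuous_on_scaleR continuous_on_const continuous_on_compose2[OF fc])
      show "continuous_on (I2 \<times> UNIV) (\<lambda>x. (p, cp (snd x)))"
        by (intro continuous_intros continuous_on_compose2[OF cpc]) auto
      show "(\<lambda>x. (p, cp (snd x))) ` (I2 \<times> UNIV) \<subseteq> \<Omega>"
      proof safe
        fix t y have "(p, cp y) \<in> ?K" using p cp(1) by auto
        then show "(p, cp (snd (t, y))) \<in> \<Omega>" using sub by auto
      qed
    qed
    then show "continuous_on (I2 \<times> UNIV) (\<lambda>(t, y). a *\<^sub>R f (p, cp y))" by (simp add: case_prod_beta')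
    show "norm (a *\<^sub>R f (p, cp y) - a *\<^sub>R f (p, cp z)) \<le> norm (y - z) / 8" for y z
      using lip[of p "cp y" "cp z"] cp(1) cpl[of y z] p by fastforce
  qed
  define Y where "Y = (\<lambda>x. (SOME z. S (snd x) z) (fst x))"
  have Yp: "(\<lambda>t. Y (t, p)) = (SOME z. S p z)" for p by (simp add: Y_def)
  have S: "S p (\<lambda>t. Y (t, p))" if "p \<in> ball 0 1" for p
    unfolding Yp by (rule someI_ex[OF ex[OF that]])
  have Y0: "Y (0, p) = 0" if "p \<in> ball 0 1" for p using S[OF that] by (simp add: S_def)
  have Yd: "((\<lambda>t. Y (t, p)) has_vector_derivative a *\<^sub>R f (p, cp (Y (t, p)))) (at t)" if "p \<in> ball 0 1" "t \<in> I2" for p t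
    using S[OF that(1)] that(2) unfolding S_def by blast
  have Yr: "Y (t, p) \<in> ball 0 r" if p: "p \<in> ball 0 1" and t: "t \<in> I2" for p t
  proof -
    have "norm (Y (t, p)) \<le> \<bar>t\<bar> * (a * B)"
    proof (rule norm_le_of_vector_derivative[where b = "\<bar>t\<bar>" and z = "\<lambda>t. Y (t, p)"])
      show "((\<lambda>t. Y (t, p)) has_vector_derivative a *\<^sub>R f (p, cp (Y (s, p)))) (at s within {- \<bar>t\<bar>..\<bar>t\<bar>})"
        if "s \<in> {- \<bar>t\<bar>..\<bar>t\<bar>}" for s
        by (rule has_vector_derivative_at_within[OF Yd[OF p]]) (use that t in auto)
      have "(p, cp (Y (s, p))) \<in> ?K" for s using p cp(1) by auto
      then show "norm (a *\<^sub>R f (p, cp (Y (s, p)))) \<le> a * B" for s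
        using a B(2) by (simp add: mult_left_mono)
    qed (use Y0[OF p] in auto)
    also have "\<dots> \<le> 2 * (r / 4)" using t a B aB by (intro mult_mono) auto
    finally show ?thesis using r by simp
  qed
  have Yd': "((\<lambda>t. Y (t, p)) has_vector_derivative a *\<^sub>R f (p, Y (t, p))) (at t)" if "p \<in> ball 0 1" "t \<in> I2" for p t
    using Yd[OF that] cp(2)[of "Y (t, p)"] Yr[OF that] by simp
  have "Ck_on k Y (I2 \<times> ball 0 1)" for k
  proof (rule ode_Ck[where F = "\<lambda>(t, p, y). a *\<^sub>R f (p, y)" and W = "ball 0 r"])
    have "Ck_on k (\<lambda>x. a *\<^sub>R f (snd x)) (I2 \<times> ball 0 1 \<times> ball 0 r)"
      by (intro Ck_on_linear[OF bounded_linear_scaleR_right] Ck_on_compose[OF _ \<Omega> _ smooth_on_Ck[OF f]]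
          Ck_on_bounded_linear bounded_linear_snd open_Times open_ball open_greaterThanLessThan)
         (use sub in force)
    then show "Ck_on k (\<lambda>(t, p, y). a *\<^sub>R f (p, y)) (I2 \<times> ball 0 1 \<times> ball 0 r)"
      by (simp add: case_prod_beta')
  qed (use lip Y0 Yr Yd' in auto)
  then have "smooth_on Y (I2 \<times> ball 0 1)" by (simp add: smooth_on_def)
  then show ?thesis
    using a Y0 Yr Yd' lip
    by (intro exI[of _ a] conjI exI[of _ Y] ballI) auto
qed

text \<open>
  The exponential map of a spray, i.e. of the equation \<open>x'' = Q(x, x')\<close> with \<open>Q\<close> homogeneous of
  degree two in the velocity.
\<close>

proposition exponential_map:
  fixes Q :: "'a::euclidean_space \<times> 'a \<Rightarrow> 'a" and L :: "'a \<Rightarrow> 'a"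
  assumes U: "open U" "x0 \<in> U" and Q: "smooth_on Q (U \<times> UNIV)"
    and hom: "\<And>x u c. x \<in> U \<Longrightarrow> Q (x, c *\<^sub>R u) = c\<^sup>2 *\<^sub>R Q (x, u)" and L: "linear L"
  obtains E a where "a > 0" "smooth_on E (ball 0 a)" "E ` ball 0 a \<subseteq> U" "E 0 = x0" "fd E 0 = L"
    "\<And>s v. s *\<^sub>R v \<in> ball 0 a \<Longrightarrow> fd (\<lambda>y. fd E y v) (s *\<^sub>R v) v = Q (E (s *\<^sub>R v), fd E (s *\<^sub>R v) v)"
proof -
  obtain r where r: "r > 0" "cball x0 r \<subseteq> U" using U open_contains_cball by blast
  have Lb: "bounded_linear L" using L linear_conv_bounded_linear by blast
  define \<Omega> where "\<Omega> = (UNIV :: 'a set) \<times> (ball (0::'a) r \<times> (UNIV :: 'a set))"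
  \<comment> \<open>The second-order equation as a first-order system with zero initial value: the
    position is \<open>x0 + fst y\<close>, the velocity \<open>L p + snd y\<close>, and the initial
    velocity \<open>L p\<close> has become a parameter.\<close>
  define f where "f = (\<lambda>(p, y). (L p + snd y, Q (x0 + fst y, L p + snd y)))"
  have \<Omega>: "open \<Omega>" unfolding \<Omega>_def by (intro open_Times) auto
  have bl: "bounded_linear (\<lambda>x::'a \<times> 'a \<times> 'a. L (fst x))" "bounded_linear (\<lambda>x::'a \<times> 'a \<times> 'a. snd (snd x))"
    "bounded_linear (\<lambda>x::'a \<times> 'a \<times> 'a. fst (snd x))"
    using bounded_linear_compose[OF Lb bounded_linear_fst] bounded_linear_compose[OF bounded_linear_snd bounded_linear_snd]
      bounded_linear_compose[OF bounded_linear_fst bounded_linear_snd] by (auto simp: o_def)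
  have sl: "smooth_on l \<Omega>" if "bounded_linear l" for l :: "'a \<times> 'a \<times> 'a \<Rightarrow> 'a"
    using Ck_on_bounded_linear[OF that] by (simp add: smooth_on_def)
  have "smooth_on (\<lambda>x. (L (fst x) + snd (snd x), Q (x0 + fst (snd x), L (fst x) + snd (snd x)))) \<Omega>"
    by (intro smooth_on_Pair smooth_on_add smooth_on_const sl bl \<Omega>
        smooth_on_compose[OF \<Omega> open_Times[OF U(1) open_UNIV] _ Q])
       (use r in \<open>auto simp: \<Omega>_def dist_norm\<close>)
  then have fs: "smooth_on f \<Omega>" by (simp add: f_def case_prod_beta')
  have "cball 0 1 \<times> cball 0 (r/2) \<subseteq> \<Omega>"
  proof
    fix x :: "'a \<times> 'a \<times> 'a" assume "x \<in> cball 0 1 \<times> cball 0 (r/2)"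
    then have "norm (fst (snd x)) \<le> r / 2" using norm_fst_le[of "fst (snd x)" "snd (snd x)"] by auto
    then show "x \<in> \<Omega>" using r by (auto simp: \<Omega>_def mem_Times_iff)
  qed
  moreover have "r / 2 > 0" using r(1) by simp
  ultimately obtain a Y where a: "a > 0" and Ys: "smooth_on Y (I2 \<times> ball 0 1)"
    and Y0: "\<And>p. p \<in> ball 0 1 \<Longrightarrow> Y (0, p) = 0"
    and Yr: "\<And>p t. p \<in> ball 0 1 \<Longrightarrow> t \<in> I2 \<Longrightarrow> Y (t, p) \<in> ball 0 (r/2)"
    and Yd: "\<And>p t. p \<in> ball 0 1 \<Longrightarrow> t \<in> I2 \<Longrightarrow> ((\<lambda>t. Y (t, p)) has_vector_derivative a *\<^sub>R f (p, Y (t, p))) (at t)"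
    and lip: "\<And>p y z. p \<in> ball 0 1 \<Longrightarrow> y \<in> ball 0 (r/2) \<Longrightarrow> z \<in> ball 0 (r/2) \<Longrightarrow> norm (a *\<^sub>R f (p, y) - a *\<^sub>R f (p, z)) \<le> norm (y - z) / 8"
    using local_flow[OF fs \<Omega>, of "r/2"] by blast
  have xU: "x0 + fst y \<in> U" if "y \<in> ball 0 (r/2)" for y :: "'a \<times> 'a"
    using that norm_fst_le[of "fst y" "snd y"] r by (auto simp: dist_norm intro!: subsetD[OF r(2)])
  define x where "x = (\<lambda>t p. x0 + fst (Y (t, p)))"
  define w where "w = (\<lambda>t p. L p + snd (Y (t, p)))"
  have xU': "x t p \<in> U" if "p \<in> ball 0 1" "t \<in> I2" for t p
    unfolding x_def by (rule xU[OF Yr[OF that]])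
  have xd: "((\<lambda>t. x t p) has_vector_derivative a *\<^sub>R w t p) (at t)"
    and wd: "((\<lambda>t. w t p) has_vector_derivative a *\<^sub>R Q (x t p, w t p)) (at t)" if "p \<in> ball 0 1" "t \<in> I2" for t p
  proof -
    note D = Yd[OF that]
    have "((\<lambda>t. fst (Y (t, p))) has_vector_derivative fst (a *\<^sub>R f (p, Y (t, p)))) (at t)"
         "((\<lambda>t. snd (Y (t, p))) has_vector_derivative snd (a *\<^sub>R f (p, Y (t, p)))) (at t)"
      using bounded_linear.has_vector_derivative[OF bounded_linear_fst D] bounded_linear.has_vector_derivative[OF bounded_linear_snd D] by auto
    then show "((\<lambda>t. x t p) has_vector_derivative a *\<^sub>R w t p) (at t)"
      "((\<lambda>t. w t p) has_vector_derivative a *\<^sub>R Q (x t p, w t p)) (at t)"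
      unfolding x_def w_def f_def
      by (auto simp: case_prod_beta' intro!: derivative_eq_intros)
  qed
  \<comment> \<open>Homogeneity of degree two: running the solution with parameter \<open>p\<close>
    at the speed \<open>s\<close> gives a solution with parameter \<open>s p\<close>, and uniqueness
    identifies the two. This makes \<open>E\<close> map rays to solutions.\<close>
  have scale: "Y (t, s *\<^sub>R p) = (fst (Y (s * t, p)), s *\<^sub>R snd (Y (s * t, p)))"
    if p: "p \<in> ball 0 1" and s: "\<bar>s\<bar> \<le> 1" and t: "t \<in> I2" for s p t
  proof -
    have sp: "s *\<^sub>R p \<in> ball 0 1"
    proof -
      have "norm (s *\<^sub>R p) \<le> norm p" using s by (simp add: mult_left_le_one_le)
      then show ?thesis using p by simp
    qed
    have st: "s * u \<in> I2" if "u \<in> I2" for u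
    proof -
      have "\<bar>s * u\<bar> \<le> 1 * \<bar>u\<bar>" using s unfolding abs_mult by (intro mult_right_mono) auto
      then show ?thesis using that by auto
    qed
    let ?z = "\<lambda>t. (fst (Y (s * t, p)), s *\<^sub>R snd (Y (s * t, p)))"
    have zr: "?z u \<in> ball 0 (r/2)" if "u \<in> I2" for u
    proof -
      have "norm (?z u) \<le> norm (Y (s * u, p))"
      proof -
        have "norm (s *\<^sub>R snd (Y (s * u, p))) \<le> 1 * norm (snd (Y (s * u, p)))"
          using s unfolding norm_scaleR by (intro mult_right_mono) auto
        then have "norm (?z u) \<le> norm (fst (Y (s * u, p)), snd (Y (s * u, p)))"
          unfolding norm_Pair by (intro real_sqrt_le_mono add_left_mono power_mono) auto
        then show ?thesis by simp
      qed
      then show ?thesis using Yr[OF p st[OF that]] by simp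
    qed
    show ?thesis
    proof (rule ode_unique[where b = "\<bar>t\<bar>" and G = "\<lambda>t y. a *\<^sub>R f (s *\<^sub>R p, y)" and z = ?z])
      fix u assume "u \<in> {- \<bar>t\<bar>..\<bar>t\<bar>}"
      then have u: "u \<in> I2" using t by auto
      show "((\<lambda>t. Y (t, s *\<^sub>R p)) has_vector_derivative a *\<^sub>R f (s *\<^sub>R p, Y (u, s *\<^sub>R p))) (at u within {- \<bar>t\<bar>..\<bar>t\<bar>})"
        by (rule has_vector_derivative_at_within[OF Yd[OF sp u]])
      have m: "((\<lambda>u. s * u) has_vector_derivative s) (at u)"
        by (auto intro!: derivative_eq_intros)
      have "((\<lambda>u. Y (s * u, p)) has_vector_derivative s *\<^sub>R (a *\<^sub>R f (p, Y (s * u, p)))) (at u)"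
        using vector_diff_chain_at[OF m Yd[OF p st[OF u]]] by (simp add: o_def)
      then have "((\<lambda>u. fst (Y (s * u, p))) has_vector_derivative fst (s *\<^sub>R (a *\<^sub>R f (p, Y (s * u, p))))) (at u)"
        "((\<lambda>u. s *\<^sub>R snd (Y (s * u, p))) has_vector_derivative s *\<^sub>R snd (s *\<^sub>R (a *\<^sub>R f (p, Y (s * u, p))))) (at u)"
        by (auto intro!: bounded_linear.has_vector_derivative[OF bounded_linear_fst]
            bounded_linear.has_vector_derivative[OF bounded_linear_scaleR_right]
            bounded_linear.has_vector_derivative[OF bounded_linear_snd] simp del: fst_scaleR snd_scaleR)
      then have "(?z has_vector_derivative (fst (s *\<^sub>R (a *\<^sub>R f (p, Y (s * u, p)))), s *\<^sub>R snd (s *\<^sub>R (a *\<^sub>R f (p, Y (s * u, p)))))) (at u)"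
        by (rule has_vector_derivative_Pair)
      moreover have "(fst (s *\<^sub>R (a *\<^sub>R f (p, Y (s * u, p)))), s *\<^sub>R snd (s *\<^sub>R (a *\<^sub>R f (p, Y (s * u, p))))) = a *\<^sub>R f (s *\<^sub>R p, ?z u)"
      proof -
        define X where "X = x0 + fst (Y (s * u, p))"
        define N where "N = L p + snd (Y (s * u, p))"
        have N: "L (s *\<^sub>R p) + s *\<^sub>R snd (Y (s * u, p)) = s *\<^sub>R N"
          by (simp add: N_def linear_scale[OF L] scaleR_add_right)
        have "X \<in> U" unfolding X_def by (rule xU[OF Yr[OF p st[OF u]]])
        then have "Q (X, s *\<^sub>R N) = s\<^sup>2 *\<^sub>R Q (X, N)" by (rule hom)
        then have "f (s *\<^sub>R p, ?z u) = (s *\<^sub>R N, s\<^sup>2 *\<^sub>R Q (X, N))"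
          unfolding f_def prod.case fst_conv snd_conv N X_def[symmetric] by simp
        moreover have "f (p, Y (s * u, p)) = (N, Q (X, N))" by (simp add: f_def N_def X_def)
        ultimately show ?thesis by (simp add: power2_eq_square mult.commute)
      qed
      ultimately have "(?z has_vector_derivative a *\<^sub>R f (s *\<^sub>R p, ?z u)) (at u)" by (simp only:)
      then show "(?z has_vector_derivative a *\<^sub>R f (s *\<^sub>R p, ?z u)) (at u within {- \<bar>t\<bar>..\<bar>t\<bar>})"
        by (rule has_vector_derivative_at_within)
      show "norm (a *\<^sub>R f (s *\<^sub>R p, Y (u, s *\<^sub>R p)) - a *\<^sub>R f (s *\<^sub>R p, ?z u)) \<le> norm (Y (u, s *\<^sub>R p) - ?z u) / 8"
        by (rule lip[OF sp Yr[OF sp u] zr[OF u]])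
    qed (use t Y0[OF p] Y0[OF sp] in \<open>auto simp: zero_prod_def\<close>)
  qed
  \<comment> \<open>Time 1 of the slowed flow. Dividing \<open>v\<close> by \<open>a\<close>
    compensates for the slowing, so that the true initial velocity is \<open>L v\<close>.\<close>
  define E where "E = (\<lambda>v. x 1 (v /\<^sub>R a))"
  have va: "v /\<^sub>R a \<in> ball 0 1" if "v \<in> ball 0 a" for v :: 'a using that a by (simp add: field_simps)
  have sE: "smooth_on E (ball 0 a)"
  proof -
    have "smooth_on (\<lambda>v. x0 + fst (Y (1, v /\<^sub>R a))) (ball 0 a)"
      by (intro smooth_on_add smooth_on_const smooth_on_fst smooth_on_compose[OF _ _ _ Ys] smooth_on_Pair
          smooth_on_scaleR smooth_on_ident open_Times open_ball open_greaterThanLessThan) (use va in auto)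
    then show ?thesis by (simp add: E_def x_def)
  qed
  have Ex: "E (s *\<^sub>R v) = x s (v /\<^sub>R a)" if v: "v \<in> ball 0 a" and s: "\<bar>s\<bar> \<le> 1" for s v
    using scale[OF va[OF v] s, of 1] by (simp add: E_def x_def mult.commute)
  have line: "((\<lambda>s. s *\<^sub>R v) has_derivative (\<lambda>h. h *\<^sub>R v)) (at s)" for s and v :: 'a
    by (auto intro!: derivative_eq_intros)
  have bs: "s *\<^sub>R v \<in> ball 0 a" if "v \<in> ball 0 a" "\<bar>s\<bar> < 1" for s and v :: 'a
  proof -
    have "norm (s *\<^sub>R v) \<le> norm v" using that(2) by (simp add: mult_left_le_one_le)
    then show ?thesis using that(1) by simp
  qed
  have D1: "fd E (s *\<^sub>R v) v = a *\<^sub>R w s (v /\<^sub>R a)" if v: "v \<in> ball 0 a" and s: "\<bar>s\<bar> < 1" for s v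
  proof -
    have d: "E differentiable (at (s *\<^sub>R v))" by (rule smooth_on_imp_differentiable[OF sE bs[OF that]])
    have "((\<lambda>s. E (s *\<^sub>R v)) has_derivative (\<lambda>h. fd E (s *\<^sub>R v) (h *\<^sub>R v))) (at s)"
      by (rule has_derivative_compose[OF line has_derivative_fd[OF d]])
    then have 1: "((\<lambda>s. E (s *\<^sub>R v)) has_vector_derivative fd E (s *\<^sub>R v) v) (at s)"
      by (simp add: has_vector_derivative_def linear_scale[OF linear_fd[OF d]])
    have "((\<lambda>s. x s (v /\<^sub>R a)) has_vector_derivative a *\<^sub>R w s (v /\<^sub>R a)) (at s)"
      by (rule xd[OF va[OF v]]) (use s in auto)
    then have "((\<lambda>s. E (s *\<^sub>R v)) has_vector_derivative a *\<^sub>R w s (v /\<^sub>R a)) (at s)"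
      by (rule has_vector_derivative_transform_within_open[where S = "{-1<..<1}"]) (use s Ex[OF v] in auto)
    then show ?thesis using 1 vector_derivative_unique_at by blast
  qed
  have D2: "fd (\<lambda>y. fd E y v) (s *\<^sub>R v) v = Q (E (s *\<^sub>R v), fd E (s *\<^sub>R v) v)" if v: "v \<in> ball 0 a" and s: "\<bar>s\<bar> < 1" for s v
  proof -
    have d: "(\<lambda>y. fd E y v) differentiable (at (s *\<^sub>R v))"
      by (rule smooth_on_imp_differentiable[OF smooth_on_fd[OF sE] bs[OF that]])
    have "((\<lambda>s. fd E (s *\<^sub>R v) v) has_derivative (\<lambda>h. fd (\<lambda>y. fd E y v) (s *\<^sub>R v) (h *\<^sub>R v))) (at s)"
      by (rule has_derivative_compose[OF line has_derivative_fd[OF d]])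
    then have 1: "((\<lambda>s. fd E (s *\<^sub>R v) v) has_vector_derivative fd (\<lambda>y. fd E y v) (s *\<^sub>R v) v) (at s)"
      by (simp add: has_vector_derivative_def linear_scale[OF linear_fd[OF d]])
    have sI: "s \<in> I2" using s by auto
    have "((\<lambda>s. a *\<^sub>R w s (v /\<^sub>R a)) has_vector_derivative a *\<^sub>R a *\<^sub>R Q (x s (v /\<^sub>R a), w s (v /\<^sub>R a))) (at s)"
      by (rule bounded_linear.has_vector_derivative[OF bounded_linear_scaleR_right wd[OF va[OF v] sI]])
    then have "((\<lambda>s. fd E (s *\<^sub>R v) v) has_vector_derivative a *\<^sub>R a *\<^sub>R Q (x s (v /\<^sub>R a), w s (v /\<^sub>R a))) (at s)"
      by (rule has_vector_derivative_transform_within_open[where S = "{-1<..<1}"]) (use s D1[OF v] in auto)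
    then have "fd (\<lambda>y. fd E y v) (s *\<^sub>R v) v = a\<^sup>2 *\<^sub>R Q (x s (v /\<^sub>R a), w s (v /\<^sub>R a))"
      using 1 vector_derivative_unique_at by (auto simp: power2_eq_square)
    also have "\<dots> = Q (x s (v /\<^sub>R a), a *\<^sub>R w s (v /\<^sub>R a))"
      by (rule hom[OF xU'[OF va[OF v] sI], symmetric])
    finally show ?thesis using Ex[OF v, of s] D1[OF v s] s by simp
  qed
  show ?thesis
  proof (rule that[OF a sE])
    show "E ` ball 0 a \<subseteq> U" unfolding E_def using xU'[OF va, of _ 1] by auto
    show "E 0 = x0" using Y0[of 0] scale[of 0 0 1] by (simp add: E_def x_def)
    show "fd E 0 = L"
    proof
      fix v :: 'a
      obtain c where c: "c > 0" "c *\<^sub>R v \<in> ball 0 a"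
      proof
        have "norm v + 1 > 0" by (smt (verit) norm_ge_zero)
        then show "a / (norm v + 1) > 0" "(a / (norm v + 1)) *\<^sub>R v \<in> ball 0 a"
          using a by (auto simp: field_simps)
      qed
      have 0: "E differentiable (at 0)" by (rule smooth_on_imp_differentiable[OF sE]) (use a in auto)
      have "fd E 0 (c *\<^sub>R v) = a *\<^sub>R w 0 ((c *\<^sub>R v) /\<^sub>R a)" using D1[OF c(2), of 0] by simp
      also have "\<dots> = c *\<^sub>R L v" unfolding w_def using Y0[OF va[OF c(2)]] a by (simp add: linear_scale[OF L])
      finally show "fd E 0 v = L v" using c(1) by (simp add: linear_scale[OF linear_fd[OF 0]])
    qed
    fix s :: real and v :: 'a assume sv: "s *\<^sub>R v \<in> ball 0 a"
    \<comment> \<open>Only \<open>s v\<close> is known to lie in the ball, not \<open>v\<close>.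
      Rescaling to \<open>c v\<close>, which does, puts the point at the time s / c of modulus below
      1, where \<open>D2\<close> applies; both sides scale by the square of
      \<open>c\<close>.\<close>
    obtain c where c: "c > \<bar>s\<bar>" "c *\<^sub>R v \<in> ball 0 a"
    proof (cases "v = 0")
      case True then show ?thesis using that[of "\<bar>s\<bar> + 1"] a by simp
    next
      case False
      then have "\<bar>s\<bar> < a / norm v" using sv by (simp add: field_simps)
      then obtain c where "\<bar>s\<bar> < c" "c < a / norm v" using dense by blast
      then show ?thesis using that[of c] False by (simp add: field_simps)
    qed
    have c0: "c > 0" using c(1) by linarith
    have dE: "E differentiable (at (s *\<^sub>R v))" by (rule smooth_on_imp_differentiable[OF sE sv])
    have cs: "(s / c) *\<^sub>R (c *\<^sub>R v) = s *\<^sub>R v" using c0 by simp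
    have "\<bar>s / c\<bar> < 1" using c(1) c0 by simp
    from D2[OF c(2) this]
    have eq: "fd (\<lambda>y. fd E y (c *\<^sub>R v)) (s *\<^sub>R v) (c *\<^sub>R v) = Q (E (s *\<^sub>R v), fd E (s *\<^sub>R v) (c *\<^sub>R v))" unfolding cs .
    have d2: "(\<lambda>y. fd E y v) differentiable (at (s *\<^sub>R v))"
      by (rule smooth_on_imp_differentiable[OF smooth_on_fd[OF sE] sv])
    have "fd (\<lambda>y. fd E y (c *\<^sub>R v)) (s *\<^sub>R v) = fd (\<lambda>y. c *\<^sub>R fd E y v) (s *\<^sub>R v)"
      by (rule fd_cong_open[OF open_ball sv]) (simp add: linear_scale[OF linear_fd[OF smooth_on_imp_differentiable[OF sE]]])
    also have "\<dots> = (\<lambda>h. c *\<^sub>R fd (\<lambda>y. fd E y v) (s *\<^sub>R v) h)"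
      by (rule fd_eq[OF has_derivative_scaleR_right[OF has_derivative_fd[OF d2]]])
    finally have "fd (\<lambda>y. fd E y (c *\<^sub>R v)) (s *\<^sub>R v) (c *\<^sub>R v) = c\<^sup>2 *\<^sub>R fd (\<lambda>y. fd E y v) (s *\<^sub>R v) v"
      by (simp add: linear_scale[OF linear_fd[OF d2]] power2_eq_square)
    moreover have "E (s *\<^sub>R v) \<in> U" unfolding E_def using xU'[OF va[OF sv], of 1] by auto
    then have "Q (E (s *\<^sub>R v), fd E (s *\<^sub>R v) (c *\<^sub>R v)) = c\<^sup>2 *\<^sub>R Q (E (s *\<^sub>R v), fd E (s *\<^sub>R v) v)"
      using hom by (simp add: linear_scale[OF linear_fd[OF dE]])
    ultimately show "fd (\<lambda>y. fd E y v) (s *\<^sub>R v) v = Q (E (s *\<^sub>R v), fd E (s *\<^sub>R v) v)"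
      using eq c0 by simp
  qed
qed

section \<open>Riemannian metrics in a coordinate patch\<close>

definition ip :: "(3 \<Rightarrow> 3 \<Rightarrow> real^3 \<Rightarrow> real) \<Rightarrow> real^3 \<Rightarrow> real^3 \<Rightarrow> real^3 \<Rightarrow> real" where
  "ip g x \<xi> \<eta> = (\<Sum>i\<in>UNIV. \<Sum>j\<in>UNIV. g i j x * \<xi> $ i * \<eta> $ j)"

definition chr :: "(3 \<Rightarrow> 3 \<Rightarrow> real^3 \<Rightarrow> real) \<Rightarrow> 3 \<Rightarrow> 3 \<Rightarrow> 3 \<Rightarrow> real^3 \<Rightarrow> real" where
  "chr g k i j x = (1/2) * (\<Sum>l\<in>UNIV. matrix_inv (\<chi> k l. g k l x) $ k $ l *
        (partial i (g j l) x + partial j (g i l) x - partial l (g i j) x))"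

definition Gam :: "(3 \<Rightarrow> 3 \<Rightarrow> real^3 \<Rightarrow> real) \<Rightarrow> real^3 \<Rightarrow> real^3 \<Rightarrow> real^3 \<Rightarrow> real^3" where
  "Gam g x \<xi> \<eta> = (\<chi> k. \<Sum>i\<in>UNIV. \<Sum>j\<in>UNIV. chr g k i j x * \<xi> $ i * \<eta> $ j)"

text \<open>Constant fields commute, so no bracket term occurs. Expanding the two second covariant
  derivatives of a constant field leaves a derivative of \<open>Gam\<close> and a product for each
  order.\<close>

definition Riem :: "(3 \<Rightarrow> 3 \<Rightarrow> real^3 \<Rightarrow> real) \<Rightarrow> real^3 \<Rightarrow> real^3 \<Rightarrow> real^3 \<Rightarrow> real^3 \<Rightarrow> real^3" where
  "Riem g x \<xi> \<eta> \<zeta> = fd (\<lambda>y. Gam g y \<eta> \<zeta>) x \<xi> - fd (\<lambda>y. Gam g y \<xi> \<zeta>) x \<eta>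
     + Gam g x \<xi> (Gam g x \<eta> \<zeta>) - Gam g x \<eta> (Gam g x \<xi> \<zeta>)"

text \<open>The Riemannian volume form for the standard orientation of the coordinate space.\<close>

definition vol :: "(3 \<Rightarrow> 3 \<Rightarrow> real^3 \<Rightarrow> real) \<Rightarrow> real^3 \<Rightarrow> real^3 \<Rightarrow> real^3 \<Rightarrow> real^3 \<Rightarrow> real" where
  "vol g x a b c = sqrt (det (\<chi> i j. g i j x)) * (a \<bullet> cross3 b c)"

lemma ip_bilin [simp]:
  "ip g x (a + b) c = ip g x a c + ip g x b c" "ip g x c (a + b) = ip g x c a + ip g x c b"
  "ip g x (r *\<^sub>R a) c = r * ip g x a c" "ip g x c (r *\<^sub>R a) = r * ip g x c a"
  "ip g x (- a) c = - ip g x a c" "ip g x c (- a) = - ip g x c a"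
  "ip g x (a - b) c = ip g x a c - ip g x b c" "ip g x c (a - b) = ip g x c a - ip g x c b"
  "ip g x 0 c = 0" "ip g x c 0 = 0"
  by (simp_all add: ip_def sum_3 algebra_simps)

lemma Gam_bilin [simp]:
  "Gam g x (a + b) c = Gam g x a c + Gam g x b c" "Gam g x c (a + b) = Gam g x c a + Gam g x c b"
  "Gam g x (r *\<^sub>R a) c = r *\<^sub>R Gam g x a c" "Gam g x c (r *\<^sub>R a) = r *\<^sub>R Gam g x c a"
  "Gam g x (- a) c = - Gam g x a c" "Gam g x c (- a) = - Gam g x c a"
  "Gam g x (a - b) c = Gam g x a c - Gam g x b c" "Gam g x c (a - b) = Gam g x c a - Gam g x c b"
  "Gam g x 0 c = 0" "Gam g x c 0 = 0"
  by (simp_all add: Gam_def sum_3 vec_eq_iff algebra_simps)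

lemma vol_trilin [simp]:
  "vol g x (a + b) c d = vol g x a c d + vol g x b c d" "vol g x c (a + b) d = vol g x c a d + vol g x c b d"
  "vol g x c d (a + b) = vol g x c d a + vol g x c d b"
  "vol g x (r *\<^sub>R a) c d = r * vol g x a c d" "vol g x c (r *\<^sub>R a) d = r * vol g x c a d" "vol g x c d (r *\<^sub>R a) = r * vol g x c d a"
  "vol g x (- a) c d = - vol g x a c d" "vol g x c (- a) d = - vol g x c a d" "vol g x c d (- a) = - vol g x c d a"
  "vol g x (a - b) c d = vol g x a c d - vol g x b c d" "vol g x c (a - b) d = vol g x c a d - vol g x c b d"
  "vol g x c d (a - b) = vol g x c d a - vol g x c d b"
  "vol g x 0 c d = 0" "vol g x c 0 d = 0" "vol g x c d 0 = 0"
  "vol g x a a c = 0" "vol g x a c a = 0" "vol g x c a a = 0"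
  by (simp_all add: vol_def cross3_def inner_vec_def sum_3 algebra_simps)

lemma vol_swap: "vol g x b a c = - vol g x a b c" "vol g x a c b = - vol g x a b c"
  by (simp_all add: vol_def cross3_def inner_vec_def sum_3 algebra_simps)

lemma Riem_skew: "Riem g x b a c = - Riem g x a b c"
  by (simp add: Riem_def)

lemma ip_matrix: "ip g x a b = a \<bullet> ((\<chi> i j. g i j x) *v b)"
  by (simp add: ip_def inner_vec_def matrix_vector_mult_def sum_3 algebra_simps)

lemma ip_axis:
  "ip g x a (axis j 1) = (\<Sum>k\<in>UNIV. a $ k * g k j x)" "ip g x (axis i 1) a = (\<Sum>k\<in>UNIV. g i k x * a $ k)"
  unfolding ip_matrix matrix_vector_mult_basis
  by (simp add: column_def inner_vec_def, simp add: inner_axis' matrix_vector_mult_def)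

lemma ip_axis_axis: "ip g x (axis i 1) (axis j 1) = g i j x"
  unfolding ip_matrix matrix_vector_mult_basis by (simp add: column_def inner_axis')

text \<open>Gram-Schmidt on the coordinate axes; the orthonormal vectors become the columns of
  \<open>L\<close>.\<close>

lemma orthonormal_basis_exists:
  fixes B :: "real^3 \<Rightarrow> real^3 \<Rightarrow> real"
  assumes bil: "bilinear B" and sym: "\<And>a b. B a b = B b a" and pos: "\<And>a. a \<noteq> 0 \<Longrightarrow> B a a > 0"
  shows "\<exists>L :: real^3^3. \<forall>a b. B (L *v a) (L *v b) = a \<bullet> b"
proof -
  note b [simp] = bilinear_ladd[OF bil] bilinear_radd[OF bil] bilinear_lmul[OF bil] bilinear_rmul[OF bil]
    bilinear_lsub[OF bil] bilinear_rsub[OF bil]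
  define nm where "nm = (\<lambda>a. (1 / sqrt (B a a)) *\<^sub>R a)"
  have nm: "B (nm a) (nm a) = 1" if "a \<noteq> 0" for a
    using pos[OF that] by (simp add: nm_def flip: power2_eq_square)
  define e1 where "e1 = nm (axis 1 1)"
  define u2 where "u2 = axis 2 1 - B (axis 2 1) e1 *\<^sub>R e1"
  define e2 where "e2 = nm u2"
  define u3 where "u3 = axis 3 1 - B (axis 3 1) e1 *\<^sub>R e1 - B (axis 3 1) e2 *\<^sub>R e2"
  define e3 where "e3 = nm u3"
  have z: "axis 1 1 \<noteq> (0 :: real^3)" by (simp add: axis_eq_0_iff)
  \<comment> \<open>The vectors subtracted have no component in the new coordinate, so that
    component stays 1 and the vector to be normalised is nonzero.\<close>
  have "u2 $ 2 = 1" by (simp add: u2_def e1_def nm_def axis_def)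
  then have u2: "u2 \<noteq> 0" by (metis zero_index zero_neq_one)
  have "u3 $ 3 = 1" by (simp add: u3_def e1_def e2_def nm_def u2_def axis_def)
  then have u3: "u3 \<noteq> 0" by (metis zero_index zero_neq_one)
  have o11: "B e1 e1 = 1" unfolding e1_def by (rule nm[OF z])
  have o22: "B e2 e2 = 1" unfolding e2_def by (rule nm[OF u2])
  have o33: "B e3 e3 = 1" unfolding e3_def by (rule nm[OF u3])
  have "B u2 e1 = 0" by (simp add: u2_def o11)
  then have o21: "B e2 e1 = 0" by (simp add: e2_def nm_def)
  then have o12: "B e1 e2 = 0" using sym by metis
  have "B u3 e1 = 0" "B u3 e2 = 0" by (simp_all add: u3_def o11 o21 o12 o22)
  then have o3: "B e3 e1 = 0" "B e3 e2 = 0" by (simp_all add: e3_def nm_def)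
  then have o3': "B e1 e3 = 0" "B e2 e3 = 0" using sym by metis+
  define L :: "real^3^3" where "L = (\<chi> i j. if j = 1 then e1 $ i else if j = 2 then e2 $ i else e3 $ i)"
  have L: "L *v a = a $ 1 *\<^sub>R e1 + a $ 2 *\<^sub>R e2 + a $ 3 *\<^sub>R e3" for a
    by (simp add: L_def matrix_vector_mult_def sum_3 vec_eq_iff algebra_simps)
  have "B (L *v a) (L *v b) = a \<bullet> b" for a b
    unfolding L by (simp add: o11 o22 o33 o21 o12 o3 o3' inner_vec_def sum_3 algebra_simps)
  then show ?thesis by blast
qed

locale patch =
  fixes U :: "(real^3) set" and g :: "3 \<Rightarrow> 3 \<Rightarrow> real^3 \<Rightarrow> real"
  assumes open_U: "open U"
    and smooth_g: "\<And>i j. smooth_on (g i j) U"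
    and sym_g: "\<And>i j x. x \<in> U \<Longrightarrow> g i j x = g j i x"
    and pos_g: "\<And>x \<xi>. x \<in> U \<Longrightarrow> \<xi> \<noteq> 0 \<Longrightarrow> ip g x \<xi> \<xi> > 0"
begin

lemma ip_commute: "x \<in> U \<Longrightarrow> ip g x a b = ip g x b a"
  using sym_g[of x] by (simp add: ip_def sum_3 algebra_simps)

lemma ip_eq_0: "x \<in> U \<Longrightarrow> ip g x a a = 0 \<longleftrightarrow> a = 0"
  using pos_g[of x a] by force

lemma ip_ext: "x \<in> U \<Longrightarrow> (\<And>c. ip g x a c = ip g x b c) \<Longrightarrow> a = b"
  using ip_eq_0[of x "a - b"] by simp

lemma frame_exists:
  assumes "x \<in> U" obtains L :: "real^3^3" where "\<And>a b. ip g x (L *v a) (L *v b) = a \<bullet> b"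
proof -
  have "bilinear (ip g x)"
    unfolding bilinear_def by (intro conjI allI linearI) auto
  then show ?thesis
    using orthonormal_basis_exists[of "ip g x"] ip_commute[OF assms] pos_g[OF assms] that by metis
qed

text \<open>Orthonormality of the columns says that the transpose of L times g times L is the
  identity. Taking determinants, sqrt (det g) * det L squares to 1; this number is the sign
  \<open>s\<close> by which \<open>vol\<close> differs from the Euclidean triple product.\<close>

lemma frame_props:
  assumes x: "x \<in> U" and L: "\<And>a b. ip g x (L *v a) (L *v b) = a \<bullet> b"
  shows "invertible L" and "surj ((*v) L)" and "det (\<chi> i j. g i j x) > 0"
    and "\<exists>s\<in>{1, -1}. \<forall>a b c. vol g x (L *v a) (L *v b) (L *v c) = s * (a \<bullet> cross3 b c)"
proof -
  let ?G = "(\<chi> i j. g i j x) :: real^3^3"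
  have tl: "a \<bullet> (transpose L *v w) = (L *v a) \<bullet> w" for a w
    by (metis dot_lmul_matrix inner_commute transpose_matrix_vector)
  have "a \<bullet> ((transpose L ** ?G ** L) *v b) = a \<bullet> (mat 1 *v b)" for a b
  proof -
    have "a \<bullet> ((transpose L ** ?G ** L) *v b) = (L *v a) \<bullet> (?G *v (L *v b))"
      unfolding tl[symmetric] by (simp only: matrix_vector_mul_assoc matrix_mul_assoc)
    then show ?thesis using L[of a b] by (simp add: ip_matrix)
  qed
  then have "transpose L ** ?G ** L = mat 1"
    unfolding matrix_eq by (metis vector_eq_ldot)
  then have "det (transpose L ** ?G ** L) = 1" by simp
  then have d: "det L * det ?G * det L = 1" by (simp add: det_mul det_transpose)
  then have dL: "det L \<noteq> 0" by auto
  then show "invertible L" by (simp add: invertible_det_nz)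
  then show "surj ((*v) L)" using invertible_right_inverse matrix_right_invertible_surjective by blast
  have d2: "det ?G * (det L)\<^sup>2 = 1" using d by (simp add: power2_eq_square mult.commute mult.left_commute)
  then show dG: "det ?G > 0" by (metis dL mult_less_0_iff not_less_iff_gr_or_eq zero_less_one zero_less_power2 zero_less_mult_pos2)
  define s where "s = sqrt (det ?G) * det L"
  have "s\<^sup>2 = 1" unfolding s_def power_mult_distrib using d2 dG by simp
  then have s: "s \<in> {1, -1}" by (simp add: power2_eq_1_iff)
  have "(L *v a) \<bullet> cross3 (L *v b) (L *v c) = det L * (a \<bullet> cross3 b c)" for a b c
  proof -
    show ?thesis unfolding tl[symmetric] cross_matrix_mult by simp
  qed
  then show "\<exists>s\<in>{1, -1}. \<forall>a b c. vol g x (L *v a) (L *v b) (L *v c) = s * (a \<bullet> cross3 b c)"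
    using s by (intro bexI[of _ s]) (simp_all add: vol_def s_def)
qed

lemma det_g_pos: "x \<in> U \<Longrightarrow> det (\<chi> i j. g i j x) > 0"
  using frame_exists frame_props(3) by metis

lemma invertible_g: "x \<in> U \<Longrightarrow> invertible (\<chi> i j. g i j x)"
  using det_g_pos by (fastforce simp: invertible_det_nz)

lemma Gam_commute:
  assumes x: "x \<in> U" shows "Gam g x a b = Gam g x b a"
proof -
  have p: "partial l (g i j) x = partial l (g j i) x" for l i j
    unfolding partial_def by (rule fun_cong[OF fd_cong_open[OF open_U x]]) (rule sym_g)
  have c: "chr g k i j x = chr g k j i x" for k i j
    unfolding chr_def by (simp add: p[of _ i j] add.commute)
  show ?thesis by (simp add: Gam_def vec_eq_iff sum_3 c[of _ 1 2] c[of _ 1 3] c[of _ 2 3] algebra_simps)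
qed

lemma smooth_chr: "smooth_on (chr g k i j) U"
proof -
  have "smooth_on (\<lambda>x. matrix_inv (\<chi> k l. g k l x) $ k $ l) U" for k l
    by (rule smooth_on_matrix_inv[OF open_U]) (use invertible_g smooth_g in auto)
  moreover have "smooth_on (\<lambda>x. partial i (g j l) x) U" for i j l
    unfolding partial_def by (rule smooth_on_fd[OF smooth_g])
  ultimately have "smooth_on (\<lambda>x. chr g k i j x) U"
    unfolding chr_def
    by (intro smooth_on_mult smooth_on_const smooth_on_sum smooth_on_add smooth_on_diff open_U)
  then show ?thesis by simp
qed

lemma smooth_on_Gam:
  assumes S: "open S" and f: "smooth_on f S" "f ` S \<subseteq> U" and a: "smooth_on a S" and b: "smooth_on b S"
  shows "smooth_on (\<lambda>z. Gam g (f z) (a z) (b z)) S"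
proof -
  have "smooth_on (\<lambda>z. chr g k i j (f z)) S" for k i j
    by (rule smooth_on_compose[OF S open_U f(2) smooth_chr f(1)])
  then show ?thesis unfolding Gam_def
    by (intro smooth_on_vec smooth_on_sum smooth_on_mult smooth_on_nth S a b)
qed

lemma smooth_on_ip:
  assumes S: "open S" and f: "smooth_on f S" "f ` S \<subseteq> U" and a: "smooth_on a S" and b: "smooth_on b S"
  shows "smooth_on (\<lambda>z. ip g (f z) (a z) (b z)) S"
proof -
  have "smooth_on (\<lambda>z. g i j (f z)) S" for i j
    by (rule smooth_on_compose[OF S open_U f(2) smooth_g f(1)])
  then show ?thesis unfolding ip_def
    by (intro smooth_on_sum smooth_on_mult smooth_on_nth S a b)
qed

lemma smooth_on_sqrt_det: "smooth_on (\<lambda>x. sqrt (det (\<chi> i j. g i j x))) U"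
  by (intro smooth_on_sqrt smooth_on_det3 open_U) (use smooth_g det_g_pos in auto)

lemma smooth_on_vol:
  assumes S: "open S" and f: "smooth_on f S" "f ` S \<subseteq> U" and a: "smooth_on a S" and b: "smooth_on b S" and c: "smooth_on c S"
  shows "smooth_on (\<lambda>z. vol g (f z) (a z) (b z) (c z)) S"
proof -
  have n: "smooth_on (\<lambda>z. a z $ i) S" "smooth_on (\<lambda>z. b z $ i) S" "smooth_on (\<lambda>z. c z $ i) S" for i
    using a b c by (auto intro: smooth_on_nth[OF S])
  have "smooth_on (\<lambda>z. sqrt (det (\<chi> i j. g i j (f z)))) S"
    by (rule smooth_on_compose[OF S open_U f(2) smooth_on_sqrt_det f(1)])
  moreover have "smooth_on (\<lambda>z. a z \<bullet> cross3 (b z) (c z)) S"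
    unfolding inner_vec_def sum_3 cross_components inner_real_def
    by (intro smooth_on_add smooth_on_diff smooth_on_mult n S)
  ultimately show ?thesis unfolding vol_def by (rule smooth_on_mult[OF S])
qed

lemma chr_lower:
  assumes x: "x \<in> U"
  shows "(\<Sum>k\<in>UNIV. g m k x * chr g k i j x) = (partial i (g j m) x + partial j (g i m) x - partial m (g i j) x) / 2"
proof -
  let ?G = "(\<chi> i j. g i j x) :: real^3^3"
  let ?p = "\<lambda>l. partial i (g j l) x + partial j (g i l) x - partial l (g i j) x"
  have *: "(\<Sum>k\<in>UNIV. g m k x * matrix_inv ?G $ k $ l) = (if m = l then 1 else 0)" for l
    using matrix_inv_props(1)[OF invertible_g[OF x]] by (auto simp: matrix_matrix_mult_def mat_def vec_eq_iff)
  have aux: "(\<Sum>k\<in>UNIV. a k * ((1/2) * (\<Sum>l\<in>UNIV. H k l * p l))) = (\<Sum>l\<in>UNIV. (\<Sum>k\<in>UNIV. a k * H k l) * p l) / 2"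
    for a p :: "3 \<Rightarrow> real" and H
    unfolding sum_3 by (simp add: algebra_simps add_divide_distrib)
  have aux2: "(\<Sum>l\<in>UNIV. (if m = l then 1 else 0) * p l) / 2 = p m / 2" for p :: "3 \<Rightarrow> real"
  proof -
    have "(\<Sum>l\<in>UNIV. (if m = l then 1 else 0) * p l) = (\<Sum>l\<in>UNIV. if m = l then p l else 0)"
      by (rule sum.cong) auto
    then show ?thesis by simp
  qed
  have "(\<Sum>k\<in>UNIV. g m k x * chr g k i j x) = (\<Sum>l\<in>UNIV. (\<Sum>k\<in>UNIV. g m k x * matrix_inv ?G $ k $ l) * ?p l) / 2"
    unfolding chr_def by (rule aux)
  also have "\<dots> = ?p m / 2" unfolding * by (rule aux2)
  finally show ?thesis .
qed

text \<open>Compatibility of the Levi-Civita connection with the metric: after lowering the index,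
  the last two terms of the two Christoffel symbols cancel by symmetry of g.\<close>

lemma ip_Gam:
  assumes x: "x \<in> U"
  shows "ip g x (Gam g x \<zeta> \<xi>) \<eta> + ip g x \<xi> (Gam g x \<zeta> \<eta>) =
    (\<Sum>j\<in>UNIV. \<Sum>m\<in>UNIV. fd (g j m) x \<zeta> * \<xi> $ j * \<eta> $ m)"
proof -
  have p: "partial l (g i j) x = partial l (g j i) x" for l i j
    unfolding partial_def by (rule fun_cong[OF fd_cong_open[OF open_U x]]) (rule sym_g)
  have f: "fd (g j m) x \<zeta> = (\<Sum>i\<in>UNIV. \<zeta> $ i * partial i (g j m) x)" for j m
  proof -
    have "linear (fd (g j m) x)" by (rule linear_fd[OF smooth_on_imp_differentiable[OF smooth_g x]])
    moreover have "\<zeta> = (\<Sum>i\<in>UNIV. \<zeta> $ i *\<^sub>R axis i 1)"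
      using basis_expansion[of \<zeta>] by (simp add: scalar_mult_eq_scaleR)
    ultimately have "fd (g j m) x \<zeta> = (\<Sum>i\<in>UNIV. \<zeta> $ i *\<^sub>R fd (g j m) x (axis i 1))"
      using linear_sum[of "fd (g j m) x" "\<lambda>i. \<zeta> $ i *\<^sub>R axis i 1" UNIV] linear_scale[of "fd (g j m) x"] by simp
    then show ?thesis by (simp add: partial_def)
  qed
  have l: "ip g x (Gam g x \<zeta> \<xi>) \<eta> = (\<Sum>m\<in>UNIV. \<Sum>i\<in>UNIV. \<Sum>j\<in>UNIV. ((partial i (g j m) x + partial j (g i m) x - partial m (g i j) x) / 2) * (\<zeta> $ i * \<xi> $ j * \<eta> $ m))" for \<xi> \<eta>
  proof -
    have "ip g x (Gam g x \<zeta> \<xi>) \<eta> = ip g x \<eta> (Gam g x \<zeta> \<xi>)" by (rule ip_commute[OF x])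
    also have "\<dots> = (\<Sum>m\<in>UNIV. \<Sum>i\<in>UNIV. \<Sum>j\<in>UNIV. (\<Sum>k\<in>UNIV. g m k x * chr g k i j x) * (\<zeta> $ i * \<xi> $ j * \<eta> $ m))"
      unfolding ip_def Gam_def sum_3 by (simp add: algebra_simps)
    finally show ?thesis unfolding chr_lower[OF x] .
  qed
  show ?thesis
    unfolding ip_commute[OF x, of \<xi>] l f sum_3
    using p[of _ 1 2] p[of _ 1 3] p[of _ 2 3] by (simp add: field_simps)
qed

text \<open>Compatibility absorbs the derivative of the metric into covariant derivatives of the two
  arguments. The domain of \<open>X\<close> is left general, so the rule serves for curves as well
  as for fields.\<close>

lemma ip_has_derivative:
  assumes X: "(X has_derivative X') (at z within S)" "X z \<in> U"
    and A: "(A has_derivative A') (at z within S)" and B: "(B has_derivative B') (at z within S)"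
  shows "((\<lambda>s. ip g (X s) (A s) (B s)) has_derivative
    (\<lambda>h. ip g (X z) (A' h + Gam g (X z) (X' h) (A z)) (B z) + ip g (X z) (A z) (B' h + Gam g (X z) (X' h) (B z)))) (at z within S)"
proof -
  have gd: "((\<lambda>s. g i j (X s)) has_derivative (\<lambda>h. fd (g i j) (X z) (X' h))) (at z within S)" for i j
    by (rule has_derivative_compose[OF X(1) smooth_on_has_derivative[OF smooth_g X(2)]])
  note n = bounded_linear.has_derivative[OF bounded_linear_vec_nth]
  have "((\<lambda>s. ip g (X s) (A s) (B s)) has_derivative
     (\<lambda>h. \<Sum>i\<in>UNIV. \<Sum>j\<in>UNIV. g i j (X z) * A z $ i * B' h $ j + (g i j (X z) * A' h $ i + fd (g i j) (X z) (X' h) * A z $ i) * B z $ j)) (at z within S)"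
    unfolding ip_def by (intro has_derivative_sum has_derivative_mult gd n A B)
  moreover have "(\<Sum>i\<in>UNIV. \<Sum>j\<in>UNIV. g i j (X z) * A z $ i * B' h $ j + (g i j (X z) * A' h $ i + fd (g i j) (X z) (X' h) * A z $ i) * B z $ j)
      = ip g (X z) (A' h + Gam g (X z) (X' h) (A z)) (B z) + ip g (X z) (A z) (B' h + Gam g (X z) (X' h) (B z))" for h
    using ip_Gam[OF X(2), of "X' h" "A z" "B z"] unfolding ip_bilin
    by (simp add: ip_def[of g _ "A' h"] ip_def[of g _ _ "B' h"] sum.distrib algebra_simps)
  ultimately show ?thesis by simp
qed

text \<open>The volume form is parallel. With \<open>tr\<close> the trace of the endomorphism Gam
  (X' h), the determinant of g has derivative 2 * tr * det, so its root contributes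
  \<open>tr\<close>; and a trace acts on a triple product as a derivation in the three
  vectors.\<close>

lemma vol_has_derivative:
  assumes X: "(X has_derivative X') (at z within S)" "X z \<in> U"
    and A: "(A has_derivative A') (at z within S)" and B: "(B has_derivative B') (at z within S)"
    and C: "(C has_derivative C') (at z within S)"
  shows "((\<lambda>s. vol g (X s) (A s) (B s) (C s)) has_derivative
    (\<lambda>h. vol g (X z) (A' h + Gam g (X z) (X' h) (A z)) (B z) (C z) + vol g (X z) (A z) (B' h + Gam g (X z) (X' h) (B z)) (C z)
      + vol g (X z) (A z) (B z) (C' h + Gam g (X z) (X' h) (C z)))) (at z within S)"
proof -
  define G where "G = (\<lambda>h. (\<chi> k j. Gam g (X z) (X' h) (axis j 1) $ k) :: real^3^3)"
  have G: "Gam g (X z) (X' h) a = G h *v a" for h a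
    unfolding G_def Gam_def matrix_vector_mult_def by (simp add: vec_eq_iff sum_3 axis_def algebra_simps)
  have gd: "((\<lambda>s. g i j (X s)) has_derivative (\<lambda>h. \<Sum>k\<in>UNIV. G h $ k $ i * g k j (X z) + g i k (X z) * G h $ k $ j)) (at z within S)" for i j
  proof -
    note eq = ip_axis_axis
    have "((\<lambda>s. ip g (X s) (axis i 1) (axis j 1)) has_derivative (\<lambda>h. ip g (X z) (0 + Gam g (X z) (X' h) (axis i 1)) (axis j 1) + ip g (X z) (axis i 1) (0 + Gam g (X z) (X' h) (axis j 1)))) (at z within S)"
      by (rule ip_has_derivative[OF X]) auto
    moreover have "ip g (X z) (0 + Gam g (X z) (X' h) (axis i 1)) (axis j 1) + ip g (X z) (axis i 1) (0 + Gam g (X z) (X' h) (axis j 1))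
        = (\<Sum>k\<in>UNIV. G h $ k $ i * g k j (X z) + g i k (X z) * G h $ k $ j)" for h
      by (simp add: ip_axis G_def sum.distrib)
    ultimately show ?thesis unfolding eq by simp
  qed
  define tr where "tr = (\<lambda>h. G h $ 1 $ 1 + G h $ 2 $ 2 + G h $ 3 $ 3)"
  let ?d = "det (\<chi> i j. g i j (X z)) :: real"
  have s: "g 2 1 (X z) = g 1 2 (X z)" "g 3 1 (X z) = g 1 3 (X z)" "g 3 2 (X z) = g 2 3 (X z)"
    using sym_g[OF X(2)] by auto
  have "((\<lambda>s. det (\<chi> i j. g i j (X s))) has_derivative (\<lambda>h. 2 * tr h * ?d)) (at z within S)"
    unfolding det_3 vec_lambda_beta
    apply (rule has_derivative_eq_rhs)
     apply (rule has_derivative_add has_derivative_diff has_derivative_mult gd)+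
    apply (rule ext)
    unfolding tr_def sum_3 s by algebra
  then have sd: "((\<lambda>s. sqrt (det (\<chi> i j. g i j (X s)))) has_derivative (\<lambda>h. tr h * sqrt ?d)) (at z within S)"
    by (rule has_derivative_eq_rhs[OF has_derivative_real_sqrt[where g = "\<lambda>s. det (\<chi> i j. g i j (X s))", OF det_g_pos[OF X(2)]]])
       (use det_g_pos[OF X(2)] in \<open>simp add: fun_eq_iff real_sqrt_divide real_div_sqrt field_simps\<close>)
  have cd: "((\<lambda>s. A s \<bullet> cross3 (B s) (C s)) has_derivative
     (\<lambda>h. A z \<bullet> (cross3 (B z) (C' h) + cross3 (B' h) (C z)) + A' h \<bullet> cross3 (B z) (C z))) (at z within S)"
    by (intro has_derivative_inner A bounded_bilinear.FDERIV[OF bilinear_conv_bounded_bilinear[THEN iffD1, OF bilinear_cross]] B C)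
  have "((\<lambda>s. vol g (X s) (A s) (B s) (C s)) has_derivative
     (\<lambda>h. sqrt ?d * (A z \<bullet> (cross3 (B z) (C' h) + cross3 (B' h) (C z)) + A' h \<bullet> cross3 (B z) (C z)) + tr h * sqrt ?d * (A z \<bullet> cross3 (B z) (C z)))) (at z within S)"
    unfolding vol_def by (rule has_derivative_mult[OF sd cd])
  moreover have "sqrt ?d * (A z \<bullet> (cross3 (B z) (C' h) + cross3 (B' h) (C z)) + A' h \<bullet> cross3 (B z) (C z)) + tr h * sqrt ?d * (A z \<bullet> cross3 (B z) (C z))
    = vol g (X z) (A' h + Gam g (X z) (X' h) (A z)) (B z) (C z) + vol g (X z) (A z) (B' h + Gam g (X z) (X' h) (B z)) (C z)
      + vol g (X z) (A z) (B z) (C' h + Gam g (X z) (X' h) (C z))" for h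
  proof -
    have "tr h * (a \<bullet> cross3 b c) = (G h *v a) \<bullet> cross3 b c + a \<bullet> cross3 (G h *v b) c + a \<bullet> cross3 b (G h *v c)" for a b c
      unfolding tr_def by (simp add: cross3_def inner_vec_def sum_3 matrix_vector_mult_def algebra_simps)
    then have "tr h * sqrt ?d * (A z \<bullet> cross3 (B z) (C z)) =
        sqrt ?d * ((G h *v A z) \<bullet> cross3 (B z) (C z) + A z \<bullet> cross3 (G h *v B z) (C z) + A z \<bullet> cross3 (B z) (G h *v C z))"
      by (simp only: mult.commute[of "tr h"] mult.assoc)
    then show ?thesis
      unfolding vol_trilin G
      unfolding vol_def by (simp add: inner_add_right distrib_left)
  qed
  ultimately show ?thesis by simp
qed

end

section \<open>Curvature\<close>

lemma linear_axis_expand: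
  fixes f :: "real^3 \<Rightarrow> 'b::real_vector"
  assumes "linear f" shows "f a = (\<Sum>i\<in>UNIV. a $ i *\<^sub>R f (axis i 1))"
proof -
  have "f a = f (\<Sum>i\<in>UNIV. a $ i *\<^sub>R axis i 1)"
    using basis_expansion[of a] by (simp add: scalar_mult_eq_scaleR)
  then show ?thesis by (simp add: linear_sum[OF assms] linear_scale[OF assms])
qed

lemma linear_ext_axis:
  fixes f h :: "real^3 \<Rightarrow> 'b::real_vector"
  assumes "linear f" "linear h" "\<And>i. f (axis i 1) = h (axis i 1)"
  shows "f = h"
  using linear_axis_expand[OF assms(1), unfolded assms(3)] linear_axis_expand[OF assms(2)] by (intro ext) (rule trans[OF _ sym])

lemma has_derivative_vec_lambda:
  fixes f :: "'i::finite \<Rightarrow> 'a::real_normed_vector \<Rightarrow> real"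
  assumes "\<And>i. (f i has_derivative f' i) (at x within S)"
  shows "((\<lambda>x. \<chi> i. f i x) has_derivative (\<lambda>h. \<chi> i. f' i h)) (at x within S)"
  unfolding has_derivative_componentwise_within[of "\<lambda>x. \<chi> i. f i x"]
  using assms by (auto simp: Basis_vec_def inner_axis)

text \<open>In dimension three every component of the curvature form is, up to symmetries, either a
  sectional value or of the shape R(e_i, e_j, e_j, e_l) with three distinct indices. The hypothesis
  \<open>orth\<close> kills the second kind and makes the sectional values equal.\<close>

lemma curvature_form_constant:
  fixes R :: "real^3 \<Rightarrow> real^3 \<Rightarrow> real^3 \<Rightarrow> real^3 \<Rightarrow> real"
  assumes lin: "\<And>b c d. linear (\<lambda>a. R a b c d)" "\<And>a c d. linear (\<lambda>b. R a b c d)"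
      "\<And>a b d. linear (\<lambda>c. R a b c d)" "\<And>a b c. linear (\<lambda>d. R a b c d)"
    and sk: "\<And>a b c d. R b a c d = - R a b c d" "\<And>a b c d. R a b d c = - R a b c d"
    and pair: "\<And>a b c d. R c d a b = R a b c d"
    and orth: "\<And>x e f. x \<bullet> e = 0 \<Longrightarrow> x \<bullet> f = 0 \<Longrightarrow> e \<bullet> f = 0 \<Longrightarrow> norm e = norm f \<Longrightarrow> R e x x f = 0"
  shows "\<exists>k. \<forall>a b c d. R a b c d = k * ((b \<bullet> c) * (a \<bullet> d) - (a \<bullet> c) * (b \<bullet> d))"
proof -
  let ?e = "\<lambda>i. axis i 1 :: real^3"
  define k where "k = R (?e 1) (?e 2) (?e 2) (?e 1)"
  have ax: "?e i \<bullet> ?e j = (if i = j then 1 else 0)" for i j by (simp add: inner_axis_axis)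
  have nz: "R a a c d = 0" "R a b c c = 0" for a b c d using sk(1)[of a a c d] sk(2)[of a b c c] by auto
  have o: "R (?e i) (?e j) (?e j) (?e l) = 0" if "i \<noteq> j" "j \<noteq> l" "i \<noteq> l" for i j l
    using that by (intro orth) (auto simp: ax norm_eq_sqrt_inner)
  \<comment> \<open>The hypothesis is applied to the sum and the difference of two axes, which are
    orthogonal and of equal length; their cross terms vanish by \<open>o\<close>.\<close>
  have eq: "R (?e i) (?e j) (?e j) (?e i) = R (?e l) (?e j) (?e j) (?e l)" if "i \<noteq> j" "j \<noteq> l" "i \<noteq> l" for i j l
  proof -
    have "R (?e i + ?e l) (?e j) (?e j) (?e i - ?e l) = 0"
      using that by (intro orth) (auto simp: ax inner_add_left inner_add_right inner_diff_left inner_diff_right norm_eq_sqrt_inner)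
    then show ?thesis using o[of i j l] o[of l j i] that
      by (simp add: linear_add[OF lin(1)] linear_diff[OF lin(4)])
  qed
  have s: "R (?e 2) (?e 1) c d = - R (?e 1) (?e 2) c d" "R (?e 3) (?e 1) c d = - R (?e 1) (?e 3) c d" "R (?e 3) (?e 2) c d = - R (?e 2) (?e 3) c d"
    "R c d (?e 2) (?e 1) = - R c d (?e 1) (?e 2)" "R c d (?e 3) (?e 1) = - R c d (?e 1) (?e 3)" "R c d (?e 3) (?e 2) = - R c d (?e 2) (?e 3)" for c d
    by (rule sk)+
  have d: "R (?e 1) (?e 2) (?e 1) (?e 2) = - k" by (simp add: k_def s)
  have d3: "R (?e 2) (?e 3) (?e 2) (?e 3) = - k" using eq[of 1 2 3] by (simp add: k_def s)
  have d2: "R (?e 1) (?e 3) (?e 1) (?e 3) = - k" using eq[of 2 3 1] d3 by (simp add: s)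
  have f: "R (?e 1) (?e 2) (?e 1) (?e 3) = 0" "R (?e 1) (?e 2) (?e 2) (?e 3) = 0" "R (?e 1) (?e 3) (?e 2) (?e 3) = 0"
    using o[of 2 1 3] o[of 1 2 3] o[of 1 3 2] by (simp_all add: s)
  have f': "R (?e 1) (?e 3) (?e 1) (?e 2) = 0" "R (?e 2) (?e 3) (?e 1) (?e 2) = 0" "R (?e 2) (?e 3) (?e 1) (?e 3) = 0"
    using f pair by metis+
  have base: "\<forall>i j l m. R (?e i) (?e j) (?e l) (?e m) = k * ((?e j \<bullet> ?e l) * (?e i \<bullet> ?e m) - (?e i \<bullet> ?e l) * (?e j \<bullet> ?e m))"
    unfolding forall_3 by (simp add: ax s d d2 d3 f f' nz)
  define T where "T = (\<lambda>a b c d :: real^3. k * ((b \<bullet> c) * (a \<bullet> d) - (a \<bullet> c) * (b \<bullet> d)))"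
  have T: "linear (\<lambda>a. T a b c d)" "linear (\<lambda>b. T a b c d)" "linear (\<lambda>c. T a b c d)" "linear (\<lambda>d. T a b c d)" for a b c d :: "real^3"
    unfolding T_def by (auto intro!: linearI simp: inner_add_left inner_add_right algebra_simps)
  have 1: "R (?e i) (?e j) (?e l) = T (?e i) (?e j) (?e l)" for i j l
    by (rule linear_ext_axis) (use lin T base in \<open>auto simp: T_def\<close>)
  have 2: "R (?e i) (?e j) c d = T (?e i) (?e j) c d" for i j c d
    by (rule fun_cong[OF linear_ext_axis[of "\<lambda>c. R (?e i) (?e j) c d" "\<lambda>c. T (?e i) (?e j) c d"]]) (simp_all only: lin T 1)
  have 3: "R (?e i) b c d = T (?e i) b c d" for i b c d
    by (rule fun_cong[OF linear_ext_axis[of "\<lambda>b. R (?e i) b c d" "\<lambda>b. T (?e i) b c d"]]) (simp_all only: lin T 2)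
  have "R a b c d = T a b c d" for a b c d
    by (rule fun_cong[OF linear_ext_axis[of "\<lambda>a. R a b c d" "\<lambda>a. T a b c d"]]) (simp_all only: lin T 3)
  then show ?thesis unfolding T_def by blast
qed

abbreviation dGam :: "(3 \<Rightarrow> 3 \<Rightarrow> real^3 \<Rightarrow> real) \<Rightarrow> real^3 \<Rightarrow> real^3 \<Rightarrow> real^3 \<Rightarrow> real^3 \<Rightarrow> real^3" where
  "dGam g x h a b \<equiv> fd (\<lambda>y. Gam g y a b) x h"

context patch
begin

lemma Gam_has_derivative:
  assumes X: "(X has_derivative X') (at z within S)" "X z \<in> U"
    and A: "(A has_derivative A') (at z within S)" and B: "(B has_derivative B') (at z within S)"
  shows "((\<lambda>s. Gam g (X s) (A s) (B s)) has_derivative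
    (\<lambda>h. dGam g (X z) (X' h) (A z) (B z) + Gam g (X z) (A' h) (B z) + Gam g (X z) (A z) (B' h))) (at z within S)"
proof -
  note n = bounded_linear.has_derivative[OF bounded_linear_vec_nth]
  have cd: "((\<lambda>s. chr g k i j (Y s)) has_derivative (\<lambda>h. fd (chr g k i j) (Y w) (Y' h))) (at w within T)"
    if "(Y has_derivative Y') (at w within T)" "Y w \<in> U" for k i j and Y :: "'w::real_normed_vector \<Rightarrow> real^3" and Y' w T
    by (rule has_derivative_compose[OF that(1) smooth_on_has_derivative[OF smooth_chr that(2)]])
  have dG: "dGam g (X z) h a b = (\<chi> k. \<Sum>i\<in>UNIV. \<Sum>j\<in>UNIV. fd (chr g k i j) (X z) h * a $ i * b $ j)" for h a b
  proof -
    have "((\<lambda>y. Gam g y a b) has_derivative (\<lambda>h. \<chi> k. \<Sum>i\<in>UNIV. \<Sum>j\<in>UNIV. fd (chr g k i j) (X z) h * a $ i * b $ j)) (at (X z))"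
      unfolding Gam_def
      by (intro has_derivative_vec_lambda has_derivative_sum has_derivative_mult_left cd[OF has_derivative_ident X(2)])
    then show ?thesis by (simp add: fd_eq)
  qed
  have "((\<lambda>s. Gam g (X s) (A s) (B s)) has_derivative
     (\<lambda>h. \<chi> k. \<Sum>i\<in>UNIV. \<Sum>j\<in>UNIV. chr g k i j (X z) * A z $ i * B' h $ j + (chr g k i j (X z) * A' h $ i + fd (chr g k i j) (X z) (X' h) * A z $ i) * B z $ j)) (at z within S)"
    unfolding Gam_def by (intro has_derivative_vec_lambda has_derivative_sum has_derivative_mult cd[OF X] n A B)
  then show ?thesis
    by (rule has_derivative_eq_rhs) (unfold dG, simp add: fun_eq_iff vec_eq_iff Gam_def sum.distrib algebra_simps)
qed

lemma dGam_linear: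
  assumes "x \<in> U" shows "dGam g x (h + k) a b = dGam g x h a b + dGam g x k a b" "dGam g x (r *\<^sub>R h) a b = r *\<^sub>R dGam g x h a b"
proof -
  have "((\<lambda>y. Gam g y a b) has_derivative (\<lambda>h. dGam g x h a b + Gam g x 0 b + Gam g x a 0)) (at x)"
    by (rule Gam_has_derivative[OF has_derivative_ident assms has_derivative_const has_derivative_const])
  then have "linear (\<lambda>h. dGam g x h a b)" using has_derivative_linear by fastforce
  then show "dGam g x (h + k) a b = dGam g x h a b + dGam g x k a b" "dGam g x (r *\<^sub>R h) a b = r *\<^sub>R dGam g x h a b"
    by (simp_all add: linear_add linear_scale)
qed

lemma dGam_bilinear:
  assumes x: "x \<in> U"
  shows "dGam g x h (a + b) c = dGam g x h a c + dGam g x h b c" "dGam g x h c (a + b) = dGam g x h c a + dGam g x h c b"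
    "dGam g x h (r *\<^sub>R a) c = r *\<^sub>R dGam g x h a c" "dGam g x h c (r *\<^sub>R a) = r *\<^sub>R dGam g x h c a"
    "dGam g x h b a = dGam g x h a b"
proof -
  have d: "(\<lambda>y. Gam g y a b) differentiable (at x)" for a b
    by (rule smooth_on_imp_differentiable[OF _ x]) (auto intro!: smooth_on_Gam smooth_on_ident smooth_on_const open_U)
  show "dGam g x h (a + b) c = dGam g x h a c + dGam g x h b c" "dGam g x h c (a + b) = dGam g x h c a + dGam g x h c b"
    using has_derivative_add[OF has_derivative_fd[OF d] has_derivative_fd[OF d], of a c b c]
      has_derivative_add[OF has_derivative_fd[OF d] has_derivative_fd[OF d], of c a c b] by (simp_all add: fd_eq)
  show "dGam g x h (r *\<^sub>R a) c = r *\<^sub>R dGam g x h a c" "dGam g x h c (r *\<^sub>R a) = r *\<^sub>R dGam g x h c a"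
    using has_derivative_scaleR_right[OF has_derivative_fd[OF d], of r a c] has_derivative_scaleR_right[OF has_derivative_fd[OF d], of r c a]
    by (simp_all add: fd_eq)
  show "dGam g x h b a = dGam g x h a b"
    by (rule fun_cong[OF fd_cong_open[OF open_U x]]) (rule Gam_commute)
qed

lemma Riem_linear:
  assumes x: "x \<in> U"
  shows "linear (\<lambda>a. Riem g x a b c)" "linear (\<lambda>b. Riem g x a b c)" "linear (\<lambda>c. Riem g x a b c)"
proof -
  have d: "linear (\<lambda>h. dGam g x h a b)" "linear (\<lambda>a. dGam g x h a b)" "linear (\<lambda>b. dGam g x h a b)" for a b h
    by (rule linearI[OF dGam_linear[OF x]] linearI[OF dGam_bilinear(1)[OF x] dGam_bilinear(3)[OF x]]
        linearI[OF dGam_bilinear(2)[OF x] dGam_bilinear(4)[OF x]])+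
  have G: "linear (\<lambda>a. Gam g x a b)" "linear (\<lambda>a. Gam g x b (Gam g x a c))" "linear (\<lambda>a. Gam g x b (Gam g x c a))" for b c
    by (rule linearI; simp)+
  show "linear (\<lambda>a. Riem g x a b c)" "linear (\<lambda>b. Riem g x a b c)" "linear (\<lambda>c. Riem g x a b c)"
    unfolding Riem_def by (intro linear_compose_sub linear_compose_add d G)+
qed

lemma Riem_bianchi: "x \<in> U \<Longrightarrow> Riem g x a b c + Riem g x b c a + Riem g x c a b = 0"
  using dGam_bilinear(5)[of x] Gam_commute[of x] by (simp add: Riem_def)

text \<open>Symmetry of the second derivatives of the function y -> ip g y c d: applying metric
  compatibility twice, the difference of the two orders is the sum of the two curvature
  terms.\<close>

lemma Riem_skew_ip:
  assumes x: "x \<in> U"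
  shows "ip g x (Riem g x a b c) d = - ip g x c (Riem g x a b d)"
proof -
  define f where "f = (\<lambda>y. ip g y c d)"
  have sf: "smooth_on f U" unfolding f_def by (auto intro!: smooth_on_ip smooth_on_ident smooth_on_const open_U)
  have *: "fd (\<lambda>y. fd f y b) x a = ip g x (dGam g x a b c + Gam g x a (Gam g x b c)) d + ip g x (Gam g x b c) (Gam g x a d)
      + (ip g x (Gam g x a c) (Gam g x b d) + ip g x c (dGam g x a b d + Gam g x a (Gam g x b d)))" for a b
  proof -
    have f1: "fd f y b = ip g y (Gam g y b c) d + ip g y c (Gam g y b d)" if "y \<in> U" for y
      using ip_has_derivative[where S = UNIV and A = "\<lambda>_. c" and B = "\<lambda>_. d", OF has_derivative_ident that has_derivative_const has_derivative_const]
      unfolding f_def by (simp add: fd_eq)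
    have "fd (\<lambda>y. fd f y b) x = fd (\<lambda>y. ip g y (Gam g y b c) d + ip g y c (Gam g y b d)) x"
      by (rule fd_cong_open[OF open_U x]) (rule f1)
    moreover have G: "((\<lambda>y. Gam g y b c) has_derivative (\<lambda>h. dGam g x h b c)) (at x)" for c
      using Gam_has_derivative[where S = UNIV and A = "\<lambda>_. b" and B = "\<lambda>_. c", OF has_derivative_ident x has_derivative_const has_derivative_const] by simp
    note D = has_derivative_add[OF ip_has_derivative[where B = "\<lambda>_. d", OF has_derivative_ident x G[of c] has_derivative_const]
        ip_has_derivative[where A = "\<lambda>_. c", OF has_derivative_ident x has_derivative_const G[of d]]]
    ultimately show ?thesis using fd_eq[OF D] by simp
  qed
  have "fd (\<lambda>y. fd f y b) x a = fd (\<lambda>y. fd f y a) x b" by (rule fd_fd_commute[OF open_U sf x])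
  then have "ip g x (Riem g x a b c) d + ip g x c (Riem g x a b d) = 0"
    unfolding * Riem_def by (simp add: algebra_simps)
  then show ?thesis by simp
qed

text \<open>The classical combination of four cyclic identities with the two skew
  symmetries.\<close>

lemma Riem_pair:
  assumes x: "x \<in> U"
  shows "ip g x (Riem g x c d a) b = ip g x (Riem g x a b c) d"
proof -
  let ?R = "\<lambda>a b c d. ip g x (Riem g x a b c) d"
  have B: "?R a b c d + ?R b c a d + ?R c a b d = 0" for a b c d
    using Riem_bianchi[OF x, of a b c] by (metis ip_bilin(1) ip_bilin(9))
  have s1: "?R b a c d = - ?R a b c d" for a b c d by (simp add: Riem_skew[of g x b a])
  have s2: "?R a b d c = - ?R a b c d" for a b c d
    using Riem_skew_ip[OF x, of a b d c] ip_commute[OF x] by metis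
  show ?thesis
    using B[of a b c d] B[of b c d a] B[of c d a b] B[of d a b c]
      s1[of a c b d] s2[of c a b d] s2[of b c d a] s1[of b d c a] s2[of c d a b] s2[of b d c a] s2[of a b c d] s1[of a c d b] s2[of d a b c] s1[of b d a c]
      s2[of a c b d] s2[of b d a c] s2[of b c a d] s1[of d a b c]
    by (smt (verit) s1 s2)
qed

lemma Riem_constant_at:
  assumes x: "x \<in> U"
    and orth: "\<And>u e f. ip g x u e = 0 \<Longrightarrow> ip g x u f = 0 \<Longrightarrow> ip g x e f = 0 \<Longrightarrow> ip g x e e = ip g x f f \<Longrightarrow>
      ip g x (Riem g x e u u) f = 0"
  shows "\<exists>k. \<forall>a b c. Riem g x a b c = k *\<^sub>R (ip g x b c *\<^sub>R a - ip g x a c *\<^sub>R b)"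
proof -
  obtain L :: "real^3^3" where L: "\<And>a b. ip g x (L *v a) (L *v b) = a \<bullet> b" using frame_exists[OF x] by blast
  note sur = frame_props(2)[OF x L]
  have lL: "linear ((*v) L)" by simp
  have linR: "linear (\<lambda>b. ip g x (Riem g x a b c) d)" "linear (\<lambda>a. ip g x (Riem g x a b c) d)"
     "linear (\<lambda>c. ip g x (Riem g x a b c) d)" "linear (\<lambda>d. ip g x (Riem g x a b c) d)" for a b c d
  proof -
    have l: "linear (\<lambda>a. ip g x a d)" for d by (rule linearI) simp_all
    show "linear (\<lambda>b. ip g x (Riem g x a b c) d)" "linear (\<lambda>a. ip g x (Riem g x a b c) d)" "linear (\<lambda>c. ip g x (Riem g x a b c) d)"
      using linear_compose[OF Riem_linear(2)[OF x] l] linear_compose[OF Riem_linear(1)[OF x] l] linear_compose[OF Riem_linear(3)[OF x] l]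
      by (simp_all add: o_def)
    show "linear (\<lambda>d. ip g x (Riem g x a b c) d)" by (rule linearI) simp_all
  qed
  have "\<exists>k. \<forall>a b c d. ip g x (Riem g x (L *v a) (L *v b) (L *v c)) (L *v d) = k * ((b \<bullet> c) * (a \<bullet> d) - (a \<bullet> c) * (b \<bullet> d))"
  proof (rule curvature_form_constant)
    fix a b c d
    show "linear (\<lambda>a. ip g x (Riem g x (L *v a) (L *v b) (L *v c)) (L *v d))" "linear (\<lambda>b. ip g x (Riem g x (L *v a) (L *v b) (L *v c)) (L *v d))"
      "linear (\<lambda>c. ip g x (Riem g x (L *v a) (L *v b) (L *v c)) (L *v d))" "linear (\<lambda>d. ip g x (Riem g x (L *v a) (L *v b) (L *v c)) (L *v d))"
      using linear_compose[OF lL linR(2)] linear_compose[OF lL linR(1)] linear_compose[OF lL linR(3)] linear_compose[OF lL linR(4)]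
      by (simp_all add: o_def)
    show "ip g x (Riem g x (L *v b) (L *v a) (L *v c)) (L *v d) = - ip g x (Riem g x (L *v a) (L *v b) (L *v c)) (L *v d)"
      by (simp add: Riem_skew[of g x "L *v b"])
    show "ip g x (Riem g x (L *v a) (L *v b) (L *v d)) (L *v c) = - ip g x (Riem g x (L *v a) (L *v b) (L *v c)) (L *v d)"
      using Riem_skew_ip[OF x] ip_commute[OF x] by metis
    show "ip g x (Riem g x (L *v c) (L *v d) (L *v a)) (L *v b) = ip g x (Riem g x (L *v a) (L *v b) (L *v c)) (L *v d)"
      by (rule Riem_pair[OF x])
  next
    fix u e f :: "real^3"
    assume "u \<bullet> e = 0" "u \<bullet> f = 0" "e \<bullet> f = 0" "norm e = norm f"
    then show "ip g x (Riem g x (L *v e) (L *v u) (L *v u)) (L *v f) = 0"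
      by (intro orth) (simp_all add: L norm_eq)
  qed
  then obtain k where k: "\<And>a b c d. ip g x (Riem g x (L *v a) (L *v b) (L *v c)) (L *v d) = k * ((b \<bullet> c) * (a \<bullet> d) - (a \<bullet> c) * (b \<bullet> d))" by blast
  have "Riem g x a b c = k *\<^sub>R (ip g x b c *\<^sub>R a - ip g x a c *\<^sub>R b)" for a b c
  proof (rule ip_ext[OF x])
    fix d
    obtain a' b' c' d' where "a = L *v a'" "b = L *v b'" "c = L *v c'" "d = L *v d'" using sur by (metis surjD)
    then show "ip g x (Riem g x a b c) d = ip g x (k *\<^sub>R (ip g x b c *\<^sub>R a - ip g x a c *\<^sub>R b)) d"
      by (simp add: k L)
  qed
  then show ?thesis by blast
qed

text \<open>Polarisation: the hypothesis at \<open>e + f\<close>, minus those at \<open>e\<close>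
  and \<open>f\<close>, leaves twice the mixed term, since the pair symmetry makes the two mixed
  terms equal.\<close>

lemma Riem_constant_at_of_sectional:
  assumes x: "x \<in> U"
    and K: "\<And>u v. ip g x (Riem g x u v v) u = K * (ip g x u u * ip g x v v - (ip g x u v)\<^sup>2)"
  shows "Riem g x a b c = K *\<^sub>R (ip g x b c *\<^sub>R a - ip g x a c *\<^sub>R b)"
proof -
  have "\<exists>k. \<forall>a b c. Riem g x a b c = k *\<^sub>R (ip g x b c *\<^sub>R a - ip g x a c *\<^sub>R b)"
  proof (rule Riem_constant_at[OF x])
    fix u e f assume o: "ip g x u e = 0" "ip g x u f = 0" "ip g x e f = 0"
    note c = ip_commute[OF x]
    have "ip g x (Riem g x f u u) e = ip g x (Riem g x e u u) f"
      using Riem_pair[OF x, of e u u f] Riem_skew[of g x f u u] Riem_skew_ip[OF x, of u f e u] c Riem_skew[of g x u f]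
      by (metis Riem_pair[OF x] Riem_skew Riem_skew_ip[OF x] ip_bilin(5) minus_minus)
    moreover have "ip g x (Riem g x (e + f) u u) (e + f) = ip g x (Riem g x e u u) e + ip g x (Riem g x f u u) f
       + ip g x (Riem g x e u u) f + ip g x (Riem g x f u u) e"
      using linear_add[OF Riem_linear(1)[OF x]] by simp
    ultimately show "ip g x (Riem g x e u u) f = 0"
      using K[of "e + f" u] K[of e u] K[of f u] o c[of e u] c[of f u] c[of f e] by (simp add: algebra_simps)
  qed
  then obtain k where k: "\<And>a b c. Riem g x a b c = k *\<^sub>R (ip g x b c *\<^sub>R a - ip g x a c *\<^sub>R b)" by blast
  obtain L :: "real^3^3" where L: "\<And>a b. ip g x (L *v a) (L *v b) = a \<bullet> b" using frame_exists[OF x] by blast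
  have "k = K" using K[of "L *v axis 1 1" "L *v axis 2 1"] unfolding k by (simp add: L inner_axis_axis)
  then show ?thesis using k by simp
qed

end

section \<open>Second Bianchi identity and Schur's lemma\<close>

context patch
begin

lemma smooth_dGam: "smooth_on (\<lambda>y. dGam g y a b c) U"
  by (intro smooth_on_fd smooth_on_Gam smooth_on_ident smooth_on_const open_U) simp

lemma smooth_Riem: "smooth_on (\<lambda>y. Riem g y a b c) U"
  unfolding Riem_def
  by (intro smooth_on_diff smooth_on_add smooth_dGam smooth_on_Gam smooth_on_ident smooth_on_const open_U) simp_all

lemma Riem_expand:
  assumes x: "x \<in> U"
  shows "Riem g x u v w = (\<Sum>i\<in>UNIV. \<Sum>j\<in>UNIV. \<Sum>k\<in>UNIV. (u $ i * v $ j * w $ k) *\<^sub>R Riem g x (axis i 1) (axis j 1) (axis k 1))"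
proof -
  have "Riem g x u v w = (\<Sum>i\<in>UNIV. u $ i *\<^sub>R (\<Sum>j\<in>UNIV. v $ j *\<^sub>R (\<Sum>k\<in>UNIV. w $ k *\<^sub>R Riem g x (axis i 1) (axis j 1) (axis k 1))))"
    by (rule trans[OF linear_axis_expand[OF Riem_linear(1)[OF x]]], rule sum.cong[OF refl], rule arg_cong[where f = "(*\<^sub>R) _"],
        rule trans[OF linear_axis_expand[OF Riem_linear(2)[OF x]]], rule sum.cong[OF refl], rule arg_cong[where f = "(*\<^sub>R) _"],
        rule linear_axis_expand[OF Riem_linear(3)[OF x]])
  then show ?thesis by (simp add: scaleR_sum_right mult.assoc)
qed

lemma smooth_on_Riem_compose:
  assumes S: "open S" and f: "smooth_on f S" "f ` S \<subseteq> U" and a: "smooth_on a S" and b: "smooth_on b S" and c: "smooth_on c S"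
  shows "smooth_on (\<lambda>z. Riem g (f z) (a z) (b z) (c z)) S"
proof -
  have "smooth_on (\<lambda>z. \<Sum>i\<in>UNIV. \<Sum>j\<in>UNIV. \<Sum>k\<in>UNIV. (a z $ i * b z $ j * c z $ k) *\<^sub>R Riem g (f z) (axis i 1) (axis j 1) (axis k 1)) S"
    by (intro smooth_on_sum smooth_on_scaleR smooth_on_mult smooth_on_nth a b c S smooth_on_compose[OF S open_U f(2) smooth_Riem f(1)])
  then show ?thesis by (rule smooth_on_eqI[OF _ S]) (rule Riem_expand[symmetric], use f(2) in blast)
qed

text \<open>\<open>N\<close> is the covariant derivative of the curvature without the two terms in
  which the connection acts on \<open>a\<close> and \<open>b\<close>. In the cyclic sum these
  cancel, because \<open>Gam\<close> is symmetric and the curvature skew. What remains is symmetry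
  of second derivatives.\<close>

lemma Riem_bianchi2:
  assumes x: "x \<in> U"
  defines "N \<equiv> \<lambda>h a b c. fd (\<lambda>y. Riem g y a b c) x h + Gam g x h (Riem g x a b c) - Riem g x a b (Gam g x h c)"
  shows "N h a b c + N a b h c + N b h a c = 0"
proof -
  define T where "T = (\<lambda>h a b c. fd (\<lambda>y. dGam g y a b c) x h)"
  have sm: "smooth_on (\<lambda>y. Gam g y b c) U" for b c
    by (intro smooth_on_Gam smooth_on_ident smooth_on_const open_U) simp
  have T: "T h a b c = T a h b c" for h a b c
    unfolding T_def by (rule fd_fd_commute[OF open_U sm x])
  have D: "fd (\<lambda>y. Riem g y a b c) x h = T h a b c - T h b a c + (dGam g x h a (Gam g x b c) + Gam g x a (dGam g x h b c))
      - (dGam g x h b (Gam g x a c) + Gam g x b (dGam g x h a c))" for h a b c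
  proof -
    have G: "((\<lambda>y. Gam g y a (Gam g y b c)) has_derivative (\<lambda>h. dGam g x h a (Gam g x b c) + Gam g x 0 (Gam g x b c) + Gam g x a (dGam g x h b c))) (at x)" for a b c
      by (rule Gam_has_derivative[OF has_derivative_ident x has_derivative_const has_derivative_fd[OF smooth_on_imp_differentiable[OF sm x]]])
    have dG: "((\<lambda>y. dGam g y a b c) has_derivative (\<lambda>h. T h a b c)) (at x)" for a b c
      unfolding T_def by (rule has_derivative_fd[OF smooth_on_imp_differentiable[OF smooth_dGam x]])
    show ?thesis
      unfolding Riem_def
      using fd_eq[OF has_derivative_diff[OF has_derivative_add[OF has_derivative_diff[OF dG[where a=a and b=b and c=c] dG[where a=b and b=a and c=c]] G[of a b c]] G[of b a c]]]
      by simp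
  qed
  show ?thesis
    unfolding N_def D
    unfolding Riem_def using T[of h a b c] T[of h b a c] T[of a b h c]
    by (simp add: algebra_simps)
qed

text \<open>\<open>K\<close> comes without any regularity, so it is recovered near \<open>x\<close>
  as the quotient of a curvature value and a Gram determinant of two fixed vectors, which is smooth.
  The second Bianchi identity then becomes the cyclic relation \<open>cyc\<close> for its
  derivative.\<close>

theorem schur:
  assumes K: "\<And>x a b c. x \<in> U \<Longrightarrow> Riem g x a b c = K x *\<^sub>R (ip g x b c *\<^sub>R a - ip g x a c *\<^sub>R b)" and x: "x \<in> U"
  shows "(K has_derivative (\<lambda>h. 0)) (at x)"
proof -
  obtain L :: "real^3^3" where L: "\<And>a b. ip g x (L *v a) (L *v b) = a \<bullet> b" using frame_exists[OF x] by blast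
  let ?e = "\<lambda>i. L *v axis i 1"
  have e: "ip g x (?e i) (?e j) = (if i = j then 1 else 0)" for i j by (simp add: L inner_axis_axis)
  let ?D = "\<lambda>y. ip g y (?e 1) (?e 1) * ip g y (?e 2) (?e 2) - (ip g y (?e 1) (?e 2)) * (ip g y (?e 1) (?e 2))"
  let ?N = "\<lambda>y. ip g y (Riem g y (?e 1) (?e 2) (?e 2)) (?e 1)"
  have sD: "smooth_on ?D U" and sN: "smooth_on ?N U"
    by (intro smooth_on_diff smooth_on_mult smooth_on_ip smooth_on_ident smooth_on_const smooth_Riem open_U; simp)+
  have "?D x = 1" by (simp add: e)
  moreover have "isCont ?D x" using smooth_on_imp_continuous[OF sD] open_U x continuous_on_eq_continuous_at by blast
  ultimately obtain r where r: "r > 0" "\<And>y. dist y x < r \<Longrightarrow> ?D y \<noteq> 0"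
    using continuous_at_avoid[of x ?D 0] by (auto simp: dist_commute)
  have "ball x r \<inter> U \<subseteq> U" by blast
  have sq: "smooth_on (\<lambda>y. ?N y / ?D y) (ball x r \<inter> U)"
    by (intro smooth_on_divide open_Int open_ball open_U smooth_on_subset[OF sN] smooth_on_subset[OF sD]) (use r(2) in \<open>auto simp: dist_commute\<close>)
  have eq: "?N y / ?D y = K y" if "y \<in> ball x r \<inter> U" for y
  proof -
    have y: "y \<in> U" "?D y \<noteq> 0" using that r(2)[of y] by (auto simp: dist_commute)
    have "?N y = K y * ?D y" unfolding K[OF y(1)] by (simp add: ip_commute[OF y(1), of "?e 2" "?e 1"] algebra_simps)
    then show ?thesis using y(2) by simp
  qed
  have "smooth_on K (ball x r \<inter> U)" by (rule smooth_on_eqI[OF sq _ eq]) (auto intro: open_U)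
  then have dK: "K differentiable (at x)" by (rule smooth_on_imp_differentiable) (use x r in auto)
  define K' where "K' = fd K x"
  have hK: "(K has_derivative K') (at x)" unfolding K'_def by (rule has_derivative_fd[OF dK])
  have lK: "linear K'" by (rule has_derivative_linear[OF hK])
  have DR: "fd (\<lambda>y. Riem g y a b c) x h = K' h *\<^sub>R (ip g x b c *\<^sub>R a - ip g x a c *\<^sub>R b)
     + K x *\<^sub>R ((ip g x (Gam g x h b) c + ip g x b (Gam g x h c)) *\<^sub>R a - (ip g x (Gam g x h a) c + ip g x a (Gam g x h c)) *\<^sub>R b)" for a b c h
  proof -
    have I: "((\<lambda>y. ip g y b c) has_derivative (\<lambda>h. ip g x (0 + Gam g x h b) c + ip g x b (0 + Gam g x h c))) (at x)" for b c
      by (rule ip_has_derivative[OF has_derivative_ident x has_derivative_const has_derivative_const])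
    have "fd (\<lambda>y. Riem g y a b c) x = fd (\<lambda>y. K y *\<^sub>R (ip g y b c *\<^sub>R a - ip g y a c *\<^sub>R b)) x"
      by (rule fd_cong_open[OF open_U x]) (rule K)
    then show ?thesis
      using fd_eq[OF has_derivative_scaleR[OF hK has_derivative_diff[OF has_derivative_scaleR_left[OF I[of b c], of a] has_derivative_scaleR_left[OF I[of a c], of b]]]]
      by simp
  qed
  have cyc: "K' h *\<^sub>R (ip g x b c *\<^sub>R a - ip g x a c *\<^sub>R b) + K' a *\<^sub>R (ip g x h c *\<^sub>R b - ip g x b c *\<^sub>R h)
      + K' b *\<^sub>R (ip g x a c *\<^sub>R h - ip g x h c *\<^sub>R a) = 0" for h a b c
    using Riem_bianchi2[OF x, where h = h and a = a and b = b and c = c] Gam_commute[OF x, of a h] Gam_commute[OF x, of b h] Gam_commute[OF x, of b a]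
    unfolding DR K[OF x] by (simp add: algebra_simps)
  have z: "K' (?e i) = 0" if "i \<noteq> j" "j \<noteq> l" "i \<noteq> l" for i j l
  proof -
    \<comment> \<open>Three orthonormal directions with the fourth argument equal to the third of
      them; this is where the dimension must be at least three.\<close>
    have "K' (?e i) *\<^sub>R ?e j - K' (?e j) *\<^sub>R ?e i = 0"
      using cyc[where h = "?e i" and a = "?e j" and b = "?e l" and c = "?e l"] that by (simp add: e)
    then have "ip g x (K' (?e i) *\<^sub>R ?e j - K' (?e j) *\<^sub>R ?e i) (?e j) = 0" by simp
    then show ?thesis using that by (simp add: e)
  qed
  have z1: "K' (?e 1) = 0" by (rule z[of 1 2 3]) auto
  have z2: "K' (?e 2) = 0" by (rule z[of 2 3 1]) auto
  have z3: "K' (?e 3) = 0" by (rule z[of 3 1 2]) auto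
  have "(\<lambda>a. K' (L *v a)) = (\<lambda>a. 0)"
  proof (rule linear_ext_axis)
    show "linear (\<lambda>a. K' (L *v a))" using linear_compose[OF _ lK, of "(*v) L"] by (simp add: o_def)
    show "K' (?e i) = 0" for i using exhaust_3[of i] z1 z2 z3 by auto
  qed (auto intro!: linearI)
  then have "K' = (\<lambda>h. 0)" using frame_props(2)[OF x L] by (metis surjD)
  then show ?thesis using hK by simp
qed

end

section \<open>Isometries between patches\<close>

locale patch_isometry = p1: patch U1 g1 + p2: patch U2 g2 for U1 g1 U2 g2 +
  fixes \<phi> :: "real^3 \<Rightarrow> real^3"
  assumes smooth_phi: "smooth_on \<phi> U1" and phi_U: "\<phi> ` U1 \<subseteq> U2"
    and iso: "\<And>x a b. x \<in> U1 \<Longrightarrow> ip g2 (\<phi> x) (fd \<phi> x a) (fd \<phi> x b) = ip g1 x a b"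
begin

lemma phi_in: "x \<in> U1 \<Longrightarrow> \<phi> x \<in> U2" using phi_U by blast

lemma phi_derivative: "x \<in> U1 \<Longrightarrow> (\<phi> has_derivative fd \<phi> x) (at x)"
  by (rule smooth_on_has_derivative[OF smooth_phi])

lemma linear_fd_phi: "x \<in> U1 \<Longrightarrow> linear (fd \<phi> x)"
  by (rule has_derivative_linear[OF phi_derivative])

lemma bij_fd_phi: assumes x: "x \<in> U1" shows "bij (fd \<phi> x)"
proof -
  have "a = 0" if "fd \<phi> x a = 0" for a using iso[OF x, of a a] that p1.ip_eq_0[OF x] by simp
  then have "inj (fd \<phi> x)" using linear_injective_0[OF linear_fd_phi[OF x]] by blast
  then show ?thesis using linear_injective_imp_surjective[OF linear_fd_phi[OF x]] by (simp add: bij_def)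
qed

abbreviation "d2 x a b \<equiv> fd (\<lambda>y. fd \<phi> y b) x a"

lemma d2_commute: "x \<in> U1 \<Longrightarrow> d2 x a b = d2 x b a"
  by (rule fd_fd_commute[OF p1.open_U smooth_phi])

lemma fd_phi_apply_derivative:
  assumes X: "(X has_derivative X') (at z within S)" "X z \<in> U1" and V: "(V has_derivative V') (at z within S)" and z: "z \<in> S"
  shows "((\<lambda>s. fd \<phi> (X s) (V s)) has_derivative (\<lambda>h. d2 (X z) (X' h) (V z) + fd \<phi> (X z) (V' h))) (at z within S)"
proof -
  have d: "((\<lambda>s. fd \<phi> (X s) b) has_derivative (\<lambda>h. d2 (X z) (X' h) b)) (at z within S)" for b
    by (rule has_derivative_compose[OF X(1) smooth_on_has_derivative[OF smooth_on_fd[OF smooth_phi] X(2)]])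
  have l2: "linear (\<lambda>b. d2 (X z) a b)" for a
  proof -
    have "(\<lambda>b. d2 (X z) a b) = fd (\<lambda>y. fd \<phi> y a) (X z)" by (rule ext) (rule d2_commute[OF X(2)])
    then show ?thesis using linear_fd[OF smooth_on_imp_differentiable[OF smooth_on_fd[OF smooth_phi] X(2)]] by simp
  qed
  have "((\<lambda>s. \<Sum>b\<in>Basis. (V s \<bullet> b) *\<^sub>R fd \<phi> (X s) b) has_derivative
      (\<lambda>h. \<Sum>b\<in>Basis. (V z \<bullet> b) *\<^sub>R d2 (X z) (X' h) b + (V' h \<bullet> b) *\<^sub>R fd \<phi> (X z) b)) (at z within S)"
    by (intro has_derivative_sum has_derivative_scaleR has_derivative_inner_left V d)
  moreover have "(\<lambda>h. \<Sum>b\<in>Basis. (V z \<bullet> b) *\<^sub>R d2 (X z) (X' h) b + (V' h \<bullet> b) *\<^sub>R fd \<phi> (X z) b)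
      = (\<lambda>h. d2 (X z) (X' h) (V z) + fd \<phi> (X z) (V' h))"
    unfolding sum.distrib linear_eq_sum_Basis[OF linear_fd_phi[OF X(2)], symmetric] linear_eq_sum_Basis[OF l2, symmetric] ..
  ultimately have D: "((\<lambda>s. \<Sum>b\<in>Basis. (V s \<bullet> b) *\<^sub>R fd \<phi> (X s) b) has_derivative (\<lambda>h. d2 (X z) (X' h) (V z) + fd \<phi> (X z) (V' h))) (at z within S)"
    by simp
  have "continuous (at z within S) X" using X(1) has_derivative_continuous by blast
  then have ev: "eventually (\<lambda>s. X s \<in> U1) (at z within S)"
    using X(2) p1.open_U by (auto simp: continuous_within intro: topological_tendstoD)
  show ?thesis
  proof (rule has_derivative_transform_eventually[OF D])
    show "\<forall>\<^sub>F s in at z within S. (\<Sum>b\<in>Basis. (V s \<bullet> b) *\<^sub>R fd \<phi> (X s) b) = fd \<phi> (X s) (V s)"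
      using ev by eventually_elim (rule linear_eq_sum_Basis[OF linear_fd_phi, symmetric])
    show "(\<Sum>b\<in>Basis. (V z \<bullet> b) *\<^sub>R fd \<phi> (X z) b) = fd \<phi> (X z) (V z)"
      by (rule linear_eq_sum_Basis[OF linear_fd_phi[OF X(2)], symmetric])
  qed (rule z)
qed

text \<open>The uniqueness argument for the Levi-Civita connection. The deviation from the
  transformation law, paired with the metric, is symmetric in its first two arguments and, because
  both connections are metric, skew in the last two; such a form vanishes.\<close>

theorem Gam_transform:
  assumes x: "x \<in> U1"
  shows "fd \<phi> x (Gam g1 x a b) = d2 x a b + Gam g2 (\<phi> x) (fd \<phi> x a) (fd \<phi> x b)"
proof -
  define C where "C = (\<lambda>a b. d2 x a b + Gam g2 (\<phi> x) (fd \<phi> x a) (fd \<phi> x b) - fd \<phi> x (Gam g1 x a b))"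
  define c where "c = (\<lambda>z a b. ip g2 (\<phi> x) (C z a) (fd \<phi> x b))"
  have sym: "c z a b = c a z b" for z a b
    unfolding c_def C_def d2_commute[OF x, of z] p1.Gam_commute[OF x, of z] p2.Gam_commute[OF phi_in[OF x], of "fd \<phi> x z"] ..
  have skew: "c z a b = - c z b a" for z a b
  proof -
    have A: "((\<lambda>y. fd \<phi> y a) has_derivative (\<lambda>h. d2 x h a)) (at x)" for a
      by (rule smooth_on_has_derivative[OF smooth_on_fd[OF smooth_phi] x])
    have 1: "((\<lambda>y. ip g1 y a b) has_derivative (\<lambda>h. ip g1 x (0 + Gam g1 x h a) b + ip g1 x a (0 + Gam g1 x h b))) (at x)"
      by (rule p1.ip_has_derivative[OF has_derivative_ident x has_derivative_const has_derivative_const])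
    have 2: "((\<lambda>y. ip g2 (\<phi> y) (fd \<phi> y a) (fd \<phi> y b)) has_derivative
       (\<lambda>h. ip g2 (\<phi> x) (d2 x h a + Gam g2 (\<phi> x) (fd \<phi> x h) (fd \<phi> x a)) (fd \<phi> x b)
         + ip g2 (\<phi> x) (fd \<phi> x a) (d2 x h b + Gam g2 (\<phi> x) (fd \<phi> x h) (fd \<phi> x b)))) (at x)"
      by (rule p2.ip_has_derivative[OF phi_derivative[OF x] phi_in[OF x] A A])
    have "fd (\<lambda>y. ip g1 y a b) x z = fd (\<lambda>y. ip g2 (\<phi> y) (fd \<phi> y a) (fd \<phi> y b)) x z"
      by (rule fun_cong[OF fd_cong_open[OF p1.open_U x]]) (rule iso[symmetric])
    then have "ip g1 x (Gam g1 x z a) b + ip g1 x a (Gam g1 x z b) = ip g2 (\<phi> x) (d2 x z a + Gam g2 (\<phi> x) (fd \<phi> x z) (fd \<phi> x a)) (fd \<phi> x b)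
         + ip g2 (\<phi> x) (fd \<phi> x a) (d2 x z b + Gam g2 (\<phi> x) (fd \<phi> x z) (fd \<phi> x b))"
      unfolding fd_eq[OF 1] fd_eq[OF 2] by simp
    then show ?thesis
      unfolding c_def C_def using p2.ip_commute[OF phi_in[OF x], of _ "fd \<phi> x a"] iso[OF x, symmetric]
      by (simp add: algebra_simps)
  qed
  have c0: "c z a b = 0" for z a b
    using skew[of z a b] sym[of z b a] skew[of b z a] sym[of b a z] skew[of a b z] sym[of a z b] by linarith
  have "C a b = 0"
  proof -
    obtain v where v: "fd \<phi> x v = C a b" using bij_fd_phi[OF x] by (metis bij_is_surj surjD)
    show ?thesis using c0[of a b v] p2.ip_eq_0[OF phi_in[OF x], of "C a b"] unfolding c_def v by simp
  qed
  then show ?thesis by (simp add: C_def)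
qed

text \<open>Differentiate \<open>Gam_transform\<close> and skew-symmetrise: the third derivatives of
  \<phi> drop out, and the second ones are replaced by means of \<open>Gam_transform\<close>
  itself.\<close>

theorem Riem_transform:
  assumes x: "x \<in> U1"
  shows "fd \<phi> x (Riem g1 x a b c) = Riem g2 (\<phi> x) (fd \<phi> x a) (fd \<phi> x b) (fd \<phi> x c)"
proof -
  have key: "d2 x a (Gam g1 x b c) + fd \<phi> x (dGam g1 x a b c) = fd (\<lambda>y. d2 y b c) x a
     + (dGam g2 (\<phi> x) (fd \<phi> x a) (fd \<phi> x b) (fd \<phi> x c) + Gam g2 (\<phi> x) (d2 x a b) (fd \<phi> x c) + Gam g2 (\<phi> x) (fd \<phi> x b) (d2 x a c))" for a b c
  proof -
    have A: "((\<lambda>y. fd \<phi> y a) has_derivative (\<lambda>h. d2 x h a)) (at x)" for a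
      by (rule smooth_on_has_derivative[OF smooth_on_fd[OF smooth_phi] x])
    have G: "((\<lambda>y. Gam g1 y b c) has_derivative (\<lambda>h. dGam g1 x h b c)) (at x)"
      using p1.Gam_has_derivative[where S = UNIV and A = "\<lambda>_. b" and B = "\<lambda>_. c", OF has_derivative_ident x has_derivative_const has_derivative_const] by simp
    have D3: "((\<lambda>y. d2 y b c) has_derivative (\<lambda>h. fd (\<lambda>y. d2 y b c) x h)) (at x)"
      by (rule smooth_on_has_derivative[OF smooth_on_fd[OF smooth_on_fd[OF smooth_phi]] x])
    have "fd (\<lambda>y. fd \<phi> y (Gam g1 y b c)) x a = fd (\<lambda>y. d2 y b c + Gam g2 (\<phi> y) (fd \<phi> y b) (fd \<phi> y c)) x a"
      by (rule fun_cong[OF fd_cong_open[OF p1.open_U x]]) (rule Gam_transform)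
    then show ?thesis
      unfolding fd_eq[OF fd_phi_apply_derivative[OF has_derivative_ident x G UNIV_I]]
        fd_eq[OF has_derivative_add[OF D3 p2.Gam_has_derivative[OF phi_derivative[OF x] phi_in[OF x] A A]]] .
  qed
  have D3: "fd (\<lambda>y. d2 y b c) x a = fd (\<lambda>y. d2 y a c) x b"
    by (rule fd_fd_commute[OF p1.open_U smooth_on_fd[OF smooth_phi] x])
  note l = linear_add[OF linear_fd_phi[OF x]] linear_diff[OF linear_fd_phi[OF x]]
  have t: "d2 x a c = fd \<phi> x (Gam g1 x a c) - Gam g2 (\<phi> x) (fd \<phi> x a) (fd \<phi> x c)" for a c
    using Gam_transform[OF x] by simp
  have "d2 x a (Gam g1 x b c) + fd \<phi> x (dGam g1 x a b c) - (d2 x b (Gam g1 x a c) + fd \<phi> x (dGam g1 x b a c)) =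
     (dGam g2 (\<phi> x) (fd \<phi> x a) (fd \<phi> x b) (fd \<phi> x c) + Gam g2 (\<phi> x) (d2 x a b) (fd \<phi> x c) + Gam g2 (\<phi> x) (fd \<phi> x b) (d2 x a c))
     - (dGam g2 (\<phi> x) (fd \<phi> x b) (fd \<phi> x a) (fd \<phi> x c) + Gam g2 (\<phi> x) (d2 x b a) (fd \<phi> x c) + Gam g2 (\<phi> x) (fd \<phi> x a) (d2 x b c))"
    unfolding key D3 by simp
  then show ?thesis
    using d2_commute[OF x, of b a]
    unfolding Riem_def l t by (simp add: algebra_simps)
qed

text \<open>Covariant differentiation along a curve commutes with the differential of \<phi>. The
  second claim is solved for the plain derivative of the image field, so it also proves that this
  field is differentiable.\<close>

lemma cov_transform:
  assumes X: "(X has_vector_derivative X') (at t within S)" "X t \<in> U1" and V: "(V has_vector_derivative V') (at t within S)" and t: "t \<in> S"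
  shows "((\<lambda>s. \<phi> (X s)) has_vector_derivative fd \<phi> (X t) X') (at t within S)"
    and "((\<lambda>s. fd \<phi> (X s) (V s)) has_vector_derivative
      (fd \<phi> (X t) (V' + Gam g1 (X t) X' (V t)) - Gam g2 (\<phi> (X t)) (fd \<phi> (X t) X') (fd \<phi> (X t) (V t)))) (at t within S)"
proof -
  note l = linear_fd_phi[OF X(2)]
  have "((\<lambda>s. \<phi> (X s)) has_derivative (\<lambda>h. fd \<phi> (X t) (h *\<^sub>R X'))) (at t within S)"
    by (rule has_derivative_compose[OF X(1)[unfolded has_vector_derivative_def] phi_derivative[OF X(2)]])
  then show "((\<lambda>s. \<phi> (X s)) has_vector_derivative fd \<phi> (X t) X') (at t within S)"
    by (simp add: has_vector_derivative_def linear_scale[OF l])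
  have l2: "linear (\<lambda>a. d2 (X t) a (V t))"
    by (rule linear_fd[OF smooth_on_imp_differentiable[OF smooth_on_fd[OF smooth_phi] X(2)]])
  have "((\<lambda>s. fd \<phi> (X s) (V s)) has_derivative (\<lambda>h. d2 (X t) (h *\<^sub>R X') (V t) + fd \<phi> (X t) (h *\<^sub>R V'))) (at t within S)"
    by (rule fd_phi_apply_derivative[OF X(1)[unfolded has_vector_derivative_def] X(2) V[unfolded has_vector_derivative_def] t])
  then show "((\<lambda>s. fd \<phi> (X s) (V s)) has_vector_derivative
      (fd \<phi> (X t) (V' + Gam g1 (X t) X' (V t)) - Gam g2 (\<phi> (X t)) (fd \<phi> (X t) X') (fd \<phi> (X t) (V t)))) (at t within S)"
    unfolding has_vector_derivative_def
    by (rule has_derivative_eq_rhs) (simp add: fun_eq_iff linear_scale[OF l] linear_scale[OF l2] linear_add[OF l] Gam_transform[OF X(2)] algebra_simps)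
qed

end

section \<open>Normal coordinates\<close>

text \<open>Normal coordinates described by the coefficients alone: the last condition is the
  geodesic equation for the straight rays from the origin.\<close>

locale normal_patch = patch "ball 0 \<rho>" g for \<rho> g +
  assumes rho_pos: "\<rho> > 0"
    and ip_origin: "ip g 0 a b = a \<bullet> b"
    and Gam_radial: "v \<in> ball 0 \<rho> \<Longrightarrow> Gam g v v v = 0"

text \<open>\<open>E\<close> is the exponential map composed with an orthonormal frame
  \<open>L\<close> at \<open>x0\<close>, restricted to a ball on which it is invertible;
  \<open>gh\<close> is the metric pulled back by it. By \<open>Gam_transform\<close> the
  second-order equation for \<open>E\<close> along rays says that the symbols of \<open>gh\<close>
  vanish radially.\<close>

lemma (in patch) normal_coordinates_exist:
  assumes x0: "x0 \<in> U"
  obtains \<rho> E Ei V gh where "normal_patch \<rho> gh" "patch_isometry (ball 0 \<rho>) gh U g E"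
    "patch V g" "V \<subseteq> U" "patch_isometry V g (ball 0 \<rho>) gh Ei" "homeomorphism (ball 0 \<rho>) V E Ei" "E 0 = x0"
proof -
  obtain L :: "real^3^3" where L: "\<And>a b. ip g x0 (L *v a) (L *v b) = a \<bullet> b" using frame_exists[OF x0] by blast
  have fU: "fst ` (U \<times> (UNIV :: (real^3) set)) \<subseteq> U" by auto
  have oU: "open (U \<times> (UNIV :: (real^3) set))" by (intro open_Times open_U open_UNIV)
  have sQ: "smooth_on (\<lambda>z. - Gam g (fst z) (snd z) (snd z)) (U \<times> UNIV)"
    by (intro smooth_on_minus smooth_on_Gam smooth_on_fst smooth_on_snd smooth_on_ident oU fU)
  obtain E a where a: "a > 0" and sE: "smooth_on E (ball 0 a)" and EU: "E ` ball 0 a \<subseteq> U" and E0: "E 0 = x0"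
    and fE0: "fd E 0 = (*v) L"
    and geo: "\<And>s v. s *\<^sub>R v \<in> ball 0 a \<Longrightarrow> fd (\<lambda>y. fd E y v) (s *\<^sub>R v) v = - Gam g (E (s *\<^sub>R v)) (fd E (s *\<^sub>R v) v) (fd E (s *\<^sub>R v) v)"
  proof (rule exponential_map[OF open_U x0 sQ])
    show "linear ((*v) L)" by simp
  qed (auto simp: power2_eq_square)
  have "inj (fd E 0)" using frame_props(1)[OF x0 L] unfolding fE0
    by (simp add: invertible_left_inverse matrix_left_invertible_injective)
  then obtain U' V' Ei where U': "open U'" "U' \<subseteq> ball 0 a" "0 \<in> U'" and V': "open V'" and hom: "homeomorphism U' V' E Ei"
    and sEi: "smooth_on Ei V'" and bij: "\<And>x. x \<in> U' \<Longrightarrow> bij (fd E x)" and fEi: "\<And>y. y \<in> V' \<Longrightarrow> fd Ei y = inv (fd E (Ei y))"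
    using smooth_local_inverse[OF open_ball _ sE] a by (metis centre_in_ball)
  obtain \<rho> where \<rho>: "\<rho> > 0" "ball 0 \<rho> \<subseteq> U'" using U'(1,3) openE by blast
  let ?B = "ball (0 :: real^3) \<rho>"
  have Ba: "?B \<subseteq> ball 0 a" using \<rho> U'(2) by blast
  define V where "V = E ` ?B"
  have V: "V = V' \<inter> Ei -` ?B"
  proof
    show "V \<subseteq> V' \<inter> Ei -` ?B" using hom \<rho>(2) unfolding V_def homeomorphism_def by auto
    show "V' \<inter> Ei -` ?B \<subseteq> V"
    proof
      fix y assume "y \<in> V' \<inter> Ei -` ?B"
      then have "y = E (Ei y)" "Ei y \<in> ?B" using hom unfolding homeomorphism_def by auto
      then show "y \<in> V" unfolding V_def by blast
    qed
  qed
  have oV: "open V" unfolding V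
    by (rule continuous_open_preimage[OF smooth_on_imp_continuous[OF sEi] V' open_ball])
  have VU: "V \<subseteq> U" unfolding V_def using EU Ba by blast
  have homB: "homeomorphism ?B V E Ei"
    by (rule homeomorphism_of_subsets[OF hom \<rho>(2)]) (use V hom V_def in \<open>auto simp: homeomorphism_def\<close>)
  have sEB: "smooth_on E ?B" by (rule smooth_on_subset[OF sE Ba])
  have EB: "E ` ?B \<subseteq> U" using EU Ba by blast
  have lE: "linear (fd E v)" if "v \<in> ?B" for v by (rule linear_fd[OF smooth_on_imp_differentiable[OF sEB that]])
  define gh where "gh = (\<lambda>i j v. ip g (E v) (fd E v (axis i 1)) (fd E v (axis j 1)))"
  have ipgh: "ip gh v a b = ip g (E v) (fd E v a) (fd E v b)" if v: "v \<in> ?B" for v a b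
  proof -
    have l: "linear (\<lambda>a. ip g (E v) (fd E v a) c)" "linear (\<lambda>a. ip g (E v) c (fd E v a))" for c
      by (rule linearI; simp add: linear_add[OF lE[OF v]] linear_scale[OF lE[OF v]])+
    have "ip g (E v) (fd E v a) (fd E v b) = (\<Sum>i\<in>UNIV. a $ i *\<^sub>R (\<Sum>j\<in>UNIV. b $ j *\<^sub>R gh i j v))"
      unfolding gh_def
      by (rule trans[OF linear_axis_expand[OF l(1)]], rule sum.cong[OF refl], rule arg_cong[where f = "(*\<^sub>R) _"],
          rule linear_axis_expand[OF l(2)])
    then show ?thesis by (simp add: ip_def sum_3 algebra_simps)
  qed
  interpret pgh: patch ?B gh
  proof
    have sa: "smooth_on (\<lambda>v. fd E v (axis i 1)) ?B" for i by (rule smooth_on_fd[OF sEB])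
    have "smooth_on (\<lambda>v. gh i j v) ?B" for i j
      unfolding gh_def by (rule smooth_on_ip[OF open_ball sEB EB sa sa])
    then show "smooth_on (gh i j) ?B" for i j by simp
    show "gh i j x = gh j i x" if "x \<in> ?B" for i j x
      unfolding gh_def by (rule ip_commute) (use that EB in blast)
    show "ip gh x \<xi> \<xi> > 0" if "x \<in> ?B" "\<xi> \<noteq> 0" for x \<xi>
    proof -
      have "fd E x \<xi> \<noteq> 0"
        using bij[of x] that \<rho>(2) linear_injective_0[OF lE[OF that(1)]] bij_is_inj by blast
      then show ?thesis unfolding ipgh[OF that(1)] by (intro pos_g) (use that EB in auto)
    qed
  qed simp
  interpret pV: patch V g
    by standard (use oV VU smooth_on_subset[OF smooth_g VU] sym_g pos_g in auto)
  interpret iE: patch_isometry ?B gh U g E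
    by standard (use sEB EB ipgh in auto)
  have EiE: "E (Ei y) = y" "Ei y \<in> ?B" if "y \<in> V" for y using homB that unfolding homeomorphism_def by auto
  interpret iEi: patch_isometry V g ?B gh Ei
  proof
    show "smooth_on Ei V" by (rule smooth_on_subset[OF sEi]) (use V in blast)
    show "Ei ` V \<subseteq> ?B" using EiE by blast
    show "ip gh (Ei y) (fd Ei y a) (fd Ei y b) = ip g y a b" if y: "y \<in> V" for y a b
    proof -
      have "surj (fd E (Ei y))" by (rule bij_is_surj[OF bij]) (use EiE(2)[OF y] \<rho>(2) in blast)
      moreover have "y \<in> V'" using y V by blast
      ultimately show ?thesis unfolding ipgh[OF EiE(2)[OF y]] EiE(1)[OF y] fEi[OF \<open>y \<in> V'\<close>] by (simp add: surj_f_inv_f)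
    qed
  qed
  have "normal_patch \<rho> gh"
  proof
    show "\<rho> > 0" by (rule \<rho>)
    show "ip gh 0 a b = a \<bullet> b" for a b using ipgh[of 0 a b] \<rho>(1) by (simp add: E0 fE0 L)
    fix v assume v: "v \<in> ?B"
    have "fd E v (Gam gh v v v) = 0"
      unfolding iE.Gam_transform[OF v] using geo[of 1 v] v Ba by auto
    then show "Gam gh v v v = 0"
      using bij[of v] v \<rho>(2) linear_injective_0[OF lE[OF v]] bij_is_inj by blast
  qed
  then show ?thesis
    by (rule that[OF _ iE.patch_isometry_axioms pV.patch_axioms VU iEi.patch_isometry_axioms homB E0])
qed

context normal_patch
begin

abbreviation "B \<equiv> ball (0::real^3) \<rho>"

lemma scale_in: "v \<in> B \<Longrightarrow> \<bar>r\<bar> \<le> 1 \<Longrightarrow> r *\<^sub>R v \<in> B"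
  using mult_left_le_one_le[of "norm v" "\<bar>r\<bar>"] by auto

lemma Gam_radial_scaled:
  assumes "r *\<^sub>R v \<in> B" "r \<noteq> 0" shows "Gam g (r *\<^sub>R v) v v = 0"
  using Gam_radial[OF assms(1)] assms(2) by simp

text \<open>Gam (r v) v v vanishes for small r > 0, hence by continuity at the origin; polarisation
  with the symmetry of \<open>Gam\<close> does the rest.\<close>

lemma Gam_origin: "Gam g 0 a b = 0"
proof -
  have z: "(0 :: real^3) \<in> B" using rho_pos by simp
  have 1: "Gam g 0 v v = 0" for v
  proof (rule ccontr)
    assume nz: "Gam g 0 v v \<noteq> 0"
    have "smooth_on (\<lambda>x. Gam g x v v) B"
      by (intro smooth_on_Gam smooth_on_ident smooth_on_const open_U) simp
    then have "isCont (\<lambda>x. Gam g x v v) 0"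
      using smooth_on_imp_continuous continuous_on_eq_continuous_at[OF open_ball] z by blast
    then obtain e where e: "e > 0" "\<And>y. dist 0 y < e \<Longrightarrow> Gam g y v v \<noteq> 0"
      using continuous_at_avoid[of 0 "\<lambda>x. Gam g x v v" 0] nz by blast
    define r where "r = min e \<rho> / (2 * (norm v + 1))"
    have n: "norm v + 1 > 0" by (smt (verit) norm_ge_zero)
    have r: "r > 0" unfolding r_def using e(1) rho_pos n by simp
    have "r * norm v < r * (norm v + 1) * 2" using r by (simp add: algebra_simps add_pos_pos add_nonneg_pos)
    also have "\<dots> = min e \<rho>" unfolding r_def using n by (simp add: divide_simps)
    finally have "norm (r *\<^sub>R v) < min e \<rho>" using r by simp
    then show False using e(2)[of "r *\<^sub>R v"] Gam_radial_scaled[of r v] r by simp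
  qed
  have "Gam g 0 (a + b) (a + b) = 0" by (rule 1)
  then have "2 *\<^sub>R Gam g 0 a b = 0" using 1[of a] 1[of b] Gam_commute[OF z, of b a] by (simp add: scaleR_2)
  then show ?thesis by simp
qed

lemma Gam_ray: "r *\<^sub>R v \<in> B \<Longrightarrow> Gam g (r *\<^sub>R v) v v = 0"
  using Gam_radial_scaled[of r v] Gam_origin by (cases "r = 0") auto

text \<open>Differentiate the identity Gam y y y = 0 at y = r v and cancel one factor r. Keeping the
  other factor makes the formula valid at r = 0 too. It removes the derivative of \<open>Gam\<close>
  across the ray from the Jacobi equation.\<close>

lemma dGam_ray:
  assumes "r *\<^sub>R v \<in> B" shows "r *\<^sub>R dGam g (r *\<^sub>R v) w v v = - 2 *\<^sub>R Gam g (r *\<^sub>R v) w v"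
proof (cases "r = 0")
  case True then show ?thesis by (simp add: Gam_origin)
next
  case False
  let ?y = "r *\<^sub>R v"
  have D: "((\<lambda>y. Gam g y y y) has_derivative (\<lambda>h. dGam g ?y h ?y ?y + Gam g ?y h ?y + Gam g ?y ?y h)) (at ?y)"
    by (rule Gam_has_derivative[OF has_derivative_ident assms has_derivative_ident has_derivative_ident])
  have "fd (\<lambda>y. Gam g y y y) ?y = fd (\<lambda>y. 0) ?y"
    by (rule fd_cong_open[OF open_ball assms]) (rule Gam_radial)
  from fun_cong[OF this, of w] have "dGam g ?y w ?y ?y + Gam g ?y w ?y + Gam g ?y ?y w = 0"
    unfolding fd_eq[OF D] by simp
  then have "r *\<^sub>R r *\<^sub>R dGam g ?y w v v + r *\<^sub>R Gam g ?y w v + r *\<^sub>R Gam g ?y w v = 0"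
    unfolding Gam_commute[OF assms, of ?y w] dGam_bilinear(3,4)[OF assms]
    unfolding Gam_bilin .
  then have "r *\<^sub>R (r *\<^sub>R dGam g ?y w v v + 2 *\<^sub>R Gam g ?y w v) = 0"
    by (simp only: scaleR_add_right scaleR_2 add.assoc)
  then show ?thesis using False by (simp add: eq_neg_iff_add_eq_0)
qed

lemma ray_derivative: "((\<lambda>s. s *\<^sub>R v) has_derivative (\<lambda>h. h *\<^sub>R v)) (at r within S)"
  by (auto intro!: derivative_eq_intros)

lemma const_of_zero_derivative:
  fixes f :: "real \<Rightarrow> real"
  assumes "\<And>r. 0 \<le> r \<Longrightarrow> r \<le> 1 \<Longrightarrow> (f has_derivative (\<lambda>h. 0)) (at r)"
  shows "f 1 = f 0"
proof (rule DERIV_isconst_end[of 0 1 f])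
  have D: "(f has_real_derivative 0) (at r)" if "0 \<le> r" "r \<le> 1" for r
    using assms[OF that] by (simp add: has_field_derivative_def lambda_zero)
  show "continuous_on {0..1} f"
  proof (rule continuous_at_imp_continuous_on, rule ballI)
    show "isCont f x" if "x \<in> {0..1}" for x using DERIV_isCont[OF D, of x] that by simp
  qed
  show "(f has_real_derivative 0) (at r)" if "0 < r" "r < 1" for r using D that by simp
qed simp

text \<open>The constant field \<open>v\<close> is parallel along its own ray, so its length keeps
  the value it has at the origin.\<close>

lemma ip_radial_square: assumes v: "v \<in> B" shows "ip g v v v = v \<bullet> v"
proof -
  have "((\<lambda>s. ip g (s *\<^sub>R v) v v) has_derivative (\<lambda>h. 0)) (at r)" if r: "0 \<le> r" "r \<le> 1" for r
  proof -
    have rv: "r *\<^sub>R v \<in> B" by (rule scale_in[OF v]) (use r in auto)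
    show ?thesis
      using ip_has_derivative[where A = "\<lambda>_. v" and B = "\<lambda>_. v" and X = "\<lambda>s. s *\<^sub>R v" and z = r, OF ray_derivative rv has_derivative_const has_derivative_const]
      by (simp add: Gam_ray[OF rv])
  qed
  then have "ip g (1 *\<^sub>R v) v v = ip g (0 *\<^sub>R v) v v" by (rule const_of_zero_derivative)
  then show ?thesis by (simp add: ip_origin)
qed

text \<open>Along the ray the pairing of \<open>v\<close> with the Jacobi field s w has derivative
  ip v (w + s Gam v w). Differentiating \<open>ip_radial_square\<close> across the ray shows that
  this is the constant v \<bullet> w; both sides agree at s = 0.\<close>

theorem gauss_lemma: assumes v: "v \<in> B" shows "ip g v v w = v \<bullet> w"
proof -
  have 1: "ip g y y (w + Gam g y w y) = y \<bullet> w" if y: "y \<in> B" for y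
  proof -
    have D1: "((\<lambda>y. ip g y y y) has_derivative (\<lambda>h. ip g y (h + Gam g y h y) y + ip g y y (h + Gam g y h y))) (at y)"
      by (rule ip_has_derivative[OF has_derivative_ident y has_derivative_ident has_derivative_ident])
    have D2: "((\<lambda>y. y \<bullet> y) has_derivative (\<lambda>h. y \<bullet> h + h \<bullet> y)) (at y)"
      by (rule has_derivative_inner[OF has_derivative_ident has_derivative_ident])
    have "fd (\<lambda>y. ip g y y y) y = fd (\<lambda>y. y \<bullet> y) y"
      by (rule fd_cong_open[OF open_ball y]) (rule ip_radial_square)
    from fun_cong[OF this, of w]
    have "ip g y (w + Gam g y w y) y + ip g y y (w + Gam g y w y) = y \<bullet> w + w \<bullet> y"
      unfolding fd_eq[OF D1] fd_eq[OF D2] .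
    then show ?thesis using ip_commute[OF y, of "w + Gam g y w y" y] by (simp add: inner_commute)
  qed
  have "((\<lambda>s. ip g (s *\<^sub>R v) v (s *\<^sub>R w) - s * (v \<bullet> w)) has_derivative (\<lambda>h. 0)) (at r)" if r: "0 \<le> r" "r \<le> 1" for r
  proof -
    have rv: "r *\<^sub>R v \<in> B" by (rule scale_in[OF v]) (use r in auto)
    have "ip g (r *\<^sub>R v) v (w + r *\<^sub>R Gam g (r *\<^sub>R v) v w) = v \<bullet> w"
    proof (cases "r = 0")
      case True then show ?thesis by (simp add: ip_origin)
    next
      case False
      then show ?thesis using 1[OF rv] by (simp add: Gam_commute[OF rv, of w v] distrib_left[symmetric])
    qed
    then have eq: "ip g (r *\<^sub>R v) v w + ip g (r *\<^sub>R v) v (r *\<^sub>R Gam g (r *\<^sub>R v) v w) = v \<bullet> w" by simp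
    have D: "((\<lambda>s. ip g (s *\<^sub>R v) v (s *\<^sub>R w)) has_derivative (\<lambda>h. ip g (r *\<^sub>R v) (0 + Gam g (r *\<^sub>R v) (h *\<^sub>R v) v) (r *\<^sub>R w)
        + ip g (r *\<^sub>R v) v (h *\<^sub>R w + Gam g (r *\<^sub>R v) (h *\<^sub>R v) (r *\<^sub>R w)))) (at r)"
      by (rule ip_has_derivative[OF ray_derivative rv has_derivative_const ray_derivative])
    have m: "((\<lambda>s. s * (v \<bullet> w)) has_derivative (\<lambda>h. h * (v \<bullet> w))) (at r)" by (auto intro!: derivative_eq_intros)
    show ?thesis
    proof (rule has_derivative_eq_rhs[OF has_derivative_diff[OF D m]])
      have "h * ip g (r *\<^sub>R v) v w + h * ip g (r *\<^sub>R v) v (r *\<^sub>R Gam g (r *\<^sub>R v) v w) = h * (v \<bullet> w)" for h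
        unfolding distrib_left[symmetric] eq ..
      then show "(\<lambda>h. ip g (r *\<^sub>R v) (0 + Gam g (r *\<^sub>R v) (h *\<^sub>R v) v) (r *\<^sub>R w)
        + ip g (r *\<^sub>R v) v (h *\<^sub>R w + Gam g (r *\<^sub>R v) (h *\<^sub>R v) (r *\<^sub>R w)) - h * (v \<bullet> w)) = (\<lambda>h. 0)"
        by (simp add: Gam_ray[OF rv] fun_eq_iff mult.assoc mult.left_commute[of r])
    qed
  qed
  then have "ip g (1 *\<^sub>R v) v (1 *\<^sub>R w) - 1 * (v \<bullet> w) = ip g (0 *\<^sub>R v) v (0 *\<^sub>R w) - 0 * (v \<bullet> w)"
    by (rule const_of_zero_derivative)
  then show ?thesis by simp
qed

text \<open>
  Along the ray \<open>r \<mapsto> r v\<close> the field \<open>J = r w\<close> is a Jacobi field, with covariant derivative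
  \<open>J' = w + r \<Gamma>(w, v)\<close>; the Jacobi equation gives the derivative of the volume of \<open>v, J, J'\<close>.
\<close>

lemma vol_jacobi_derivative:
  assumes rv: "r *\<^sub>R v \<in> B"
  shows "((\<lambda>s. vol g (s *\<^sub>R v) v (s *\<^sub>R w) (w + s *\<^sub>R Gam g (s *\<^sub>R v) w v)) has_real_derivative
     - r\<^sup>2 * vol g (r *\<^sub>R v) v w (Riem g (r *\<^sub>R v) w v v)) (at r within S)"
proof -
  let ?x = "r *\<^sub>R v"
  define J' where "J' = w + r *\<^sub>R Gam g ?x w v"
  have G: "((\<lambda>s. Gam g (s *\<^sub>R v) w v) has_derivative (\<lambda>h. dGam g ?x (h *\<^sub>R v) w v + Gam g ?x 0 v + Gam g ?x w 0)) (at r within S)"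
    by (rule Gam_has_derivative[OF ray_derivative rv has_derivative_const has_derivative_const])
  have C: "((\<lambda>s. w + s *\<^sub>R Gam g (s *\<^sub>R v) w v) has_derivative (\<lambda>h. h *\<^sub>R (r *\<^sub>R dGam g ?x v w v + Gam g ?x w v))) (at r within S)"
    by (rule has_derivative_eq_rhs[OF has_derivative_add[OF has_derivative_const has_derivative_scaleR[OF has_derivative_ident G]]])
       (simp add: fun_eq_iff dGam_linear[OF rv] algebra_simps)
  have JJ: "r *\<^sub>R dGam g ?x v w v + Gam g ?x w v + Gam g ?x v J' = - r *\<^sub>R Riem g ?x w v v"
  proof -
    have "- r *\<^sub>R Riem g ?x w v v = - (r *\<^sub>R dGam g ?x w v v) + r *\<^sub>R dGam g ?x v w v + r *\<^sub>R Gam g ?x v (Gam g ?x w v)"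
      unfolding Riem_def using Gam_ray[OF rv] by (simp add: algebra_simps)
    then show ?thesis
      unfolding dGam_ray[OF rv] J'_def using Gam_commute[OF rv, of v w] by (simp add: algebra_simps scaleR_2)
  qed
  have D: "((\<lambda>s. vol g (s *\<^sub>R v) v (s *\<^sub>R w) (w + s *\<^sub>R Gam g (s *\<^sub>R v) w v)) has_derivative
    (\<lambda>h. vol g ?x (0 + Gam g ?x (h *\<^sub>R v) v) (r *\<^sub>R w) J' + vol g ?x v (h *\<^sub>R w + Gam g ?x (h *\<^sub>R v) (r *\<^sub>R w)) J'
      + vol g ?x v (r *\<^sub>R w) (h *\<^sub>R (r *\<^sub>R dGam g ?x v w v + Gam g ?x w v) + Gam g ?x (h *\<^sub>R v) J'))) (at r within S)"
    using vol_has_derivative[OF ray_derivative rv has_derivative_const ray_derivative C, of v w] by (simp only: J'_def)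
  have eq: "vol g ?x (0 + Gam g ?x (h *\<^sub>R v) v) (r *\<^sub>R w) J' + vol g ?x v (h *\<^sub>R w + Gam g ?x (h *\<^sub>R v) (r *\<^sub>R w)) J'
      + vol g ?x v (r *\<^sub>R w) (h *\<^sub>R (r *\<^sub>R dGam g ?x v w v + Gam g ?x w v) + Gam g ?x (h *\<^sub>R v) J')
      = - r\<^sup>2 * vol g ?x v w (Riem g ?x w v v) * h" for h
  proof -
    have 1: "h *\<^sub>R (r *\<^sub>R dGam g ?x v w v + Gam g ?x w v) + Gam g ?x (h *\<^sub>R v) J' = h *\<^sub>R (- r *\<^sub>R Riem g ?x w v v)"
      unfolding JJ[symmetric] by (simp add: scaleR_add_right)
    have 2: "h *\<^sub>R w + Gam g ?x (h *\<^sub>R v) (r *\<^sub>R w) = h *\<^sub>R J'"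
      unfolding J'_def using Gam_commute[OF rv, of v w] by (simp add: scaleR_add_right)
    show ?thesis unfolding 1 2 by (simp add: Gam_ray[OF rv] power2_eq_square)
  qed
  show ?thesis
    unfolding has_field_derivative_def by (rule has_derivative_eq_rhs[OF D]) (rule ext, rule eq)
qed

text \<open>In constant curvature R(w, v)v lies in the span of \<open>v\<close> and
  \<open>w\<close>, so the volume of v, J, J' is constant along the ray. It vanishes at the origin,
  and at time 1 the summand \<open>w\<close> of J' = w + Gam w v drops out.\<close>

lemma vol_Gam_zero:
  assumes K: "\<And>x a b c. x \<in> B \<Longrightarrow> Riem g x a b c = K x *\<^sub>R (ip g x b c *\<^sub>R a - ip g x a c *\<^sub>R b)" and v: "v \<in> B"
  shows "vol g v v w (Gam g v w v) = 0"
proof -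
  let ?f = "\<lambda>s. vol g (s *\<^sub>R v) v (s *\<^sub>R w) (w + s *\<^sub>R Gam g (s *\<^sub>R v) w v)"
  have "(?f has_derivative (\<lambda>h. 0)) (at r)" if r: "0 \<le> r" "r \<le> 1" for r
  proof -
    have rv: "r *\<^sub>R v \<in> B" by (rule scale_in[OF v]) (use r in auto)
    have "vol g (r *\<^sub>R v) v w (Riem g (r *\<^sub>R v) w v v) = 0" unfolding K[OF rv] by simp
    then show ?thesis
      using vol_jacobi_derivative[OF rv, of w UNIV] by (simp add: has_field_derivative_def lambda_zero)
  qed
  then have "?f 1 = ?f 0" by (rule const_of_zero_derivative)
  then show ?thesis by simp
qed

text \<open>Up to the factor 1 / R the quadratic form is the second fundamental form of the sphere
  through \<open>v\<close>. At \<open>v = 0\<close> it is the Euclidean square, so compactness of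
  the unit sphere keeps it positive for small \<open>v\<close>, and homogeneity covers all
  \<open>w\<close>. This is the strict convexity of small spheres.\<close>

lemma shape_positive:
  obtains r where "0 < r" "r \<le> \<rho>" "\<And>v w. v \<in> ball 0 r \<Longrightarrow> w \<noteq> 0 \<Longrightarrow> ip g v w (w + Gam g v w v) > 0"
proof -
  let ?h = "\<lambda>z. ip g (fst z) (snd z) (snd z + Gam g (fst z) (snd z) (fst z))"
  let ?K = "cball (0::real^3) (\<rho>/2) \<times> sphere (0::real^3) 1"
  have oB: "open (B \<times> (UNIV :: (real^3) set))" by (intro open_Times open_ball open_UNIV)
  have fB: "fst ` (B \<times> (UNIV :: (real^3) set)) \<subseteq> B" by auto
  have sh: "smooth_on ?h (B \<times> UNIV)"
  proof -
    have f: "smooth_on fst (B \<times> (UNIV :: (real^3) set))" and s: "smooth_on snd (B \<times> (UNIV :: (real^3) set))"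
      by (rule smooth_on_fst[OF oB smooth_on_ident] smooth_on_snd[OF oB smooth_on_ident])+
    show ?thesis by (rule smooth_on_ip[OF oB f fB s smooth_on_add[OF oB s smooth_on_Gam[OF oB f fB s f]]])
  qed
  have "continuous_on ?K ?h"
    by (rule continuous_on_subset[OF smooth_on_imp_continuous[OF sh]]) (use rho_pos in auto)
  then have "uniformly_continuous_on ?K ?h"
    by (rule compact_uniformly_continuous) (intro compact_Times compact_cball compact_sphere)
  then obtain d where d: "d > 0" "\<And>z z'. z \<in> ?K \<Longrightarrow> z' \<in> ?K \<Longrightarrow> dist z' z < d \<Longrightarrow> dist (?h z') (?h z) < 1"
    unfolding uniformly_continuous_on_def using zero_less_one by blast
  define r where "r = min d (\<rho>/2)"
  have r: "0 < r" "r \<le> \<rho>" "r \<le> \<rho>/2" "r \<le> d" using d(1) rho_pos by (auto simp: r_def)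
  have "ip g v w (w + Gam g v w v) > 0" if v: "v \<in> ball 0 r" and w: "w \<noteq> 0" for v w
  proof -
    define u where "u = w /\<^sub>R norm w"
    have u: "norm u = 1" "w = norm w *\<^sub>R u" using w by (auto simp: u_def)
    have "(v, u) \<in> ?K" "(0, u) \<in> ?K" using v r u(1) rho_pos by auto
    moreover have "dist (v, u) (0, u) < d" using v r(4) by (simp add: dist_Pair_Pair)
    ultimately have "dist (?h (v, u)) (?h (0, u)) < 1" using d(2) by blast
    moreover have "?h (0, u) = 1" using u(1) by (simp add: ip_origin Gam_origin dot_square_norm)
    ultimately have "?h (v, u) > 0" by (simp add: dist_real_def)
    then have p: "ip g v u u + ip g v u (Gam g v u v) > 0" by simp
    have "ip g v (c *\<^sub>R u) (c *\<^sub>R u + Gam g v (c *\<^sub>R u) v) = c\<^sup>2 * (ip g v u u + ip g v u (Gam g v u v))" for c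
      by (simp add: power2_eq_square algebra_simps)
    from this[of "norm w"] have "ip g v w (w + Gam g v w v) = (norm w)\<^sup>2 * (ip g v u u + ip g v u (Gam g v u v))"
      unfolding u(2)[symmetric] .
    then show ?thesis using p w by simp
  qed
  then show ?thesis using that r(1,2) by blast
qed

end

section \<open>Total torsion\<close>

lemma orthonormal_triple:
  fixes a b c v :: "real^3"
  assumes "a \<bullet> a = 1" "b \<bullet> b = 1" "c \<bullet> c = 1" "a \<bullet> b = 0" "a \<bullet> c = 0" "b \<bullet> c = 0"
  shows "v = (v \<bullet> a) *\<^sub>R a + (v \<bullet> b) *\<^sub>R b + (v \<bullet> c) *\<^sub>R c" and "(a \<bullet> cross3 b c)\<^sup>2 = 1"
proof -
  define M :: "real^3^3" where "M = vector [a, b, c]"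
  have rows: "M $ 1 = a" "M $ 2 = b" "M $ 3 = c" by (simp_all add: M_def)
  have "M ** transpose M = mat 1"
    using assms by (simp add: vec_eq_iff forall_3 matrix_matrix_mult_def transpose_def mat_def rows inner_vec_def sum_3 mult.commute)
  then have M: "transpose M ** M = mat 1" "M ** transpose M = mat 1" using matrix_left_right_inverse by auto
  have "v = transpose M *v (M *v v)" by (simp add: matrix_vector_mul_assoc M)
  also have "\<dots> = (v \<bullet> a) *\<^sub>R a + (v \<bullet> b) *\<^sub>R b + (v \<bullet> c) *\<^sub>R c"
    by (simp add: vec_eq_iff matrix_vector_mult_def transpose_def sum_3 forall_3 rows inner_vec_def algebra_simps)
  finally show "v = (v \<bullet> a) *\<^sub>R a + (v \<bullet> b) *\<^sub>R b + (v \<bullet> c) *\<^sub>R c" .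
  have "det M * det (transpose M) = 1" using M(2) by (metis det_I det_mul)
  then show "(a \<bullet> cross3 b c)\<^sup>2 = 1" by (simp add: dot_cross_det M_def[symmetric] det_transpose power2_eq_square)
qed

lemma has_vector_derivative_unique_interval:
  fixes a b :: real
  assumes "a < b" "s \<in> {a..b}" "(f has_vector_derivative f1) (at s within {a..b})" "(f has_vector_derivative f2) (at s within {a..b})"
  shows "f1 = f2"
  using vector_derivative_unique_within_closed_interval[of a b s f f1 f2] assms by simp

definition onb :: "(3 \<Rightarrow> 3 \<Rightarrow> real^3 \<Rightarrow> real) \<Rightarrow> real^3 \<Rightarrow> real^3 \<Rightarrow> real^3 \<Rightarrow> real^3 \<Rightarrow> bool" where
  "onb g x t n b \<longleftrightarrow> ip g x t t = 1 \<and> ip g x n n = 1 \<and> ip g x b b = 1 \<and> ip g x t n = 0 \<and> ip g x t b = 0 \<and> ip g x n b = 0"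

text \<open>Covariant derivative along a curve from the data at one time: point, velocity, value of
  the field and derivative of its components.\<close>

definition covd :: "(3 \<Rightarrow> 3 \<Rightarrow> real^3 \<Rightarrow> real) \<Rightarrow> real^3 \<Rightarrow> real^3 \<Rightarrow> real^3 \<Rightarrow> real^3 \<Rightarrow> real^3" where
  "covd g x x' v v' = v' + Gam g x x' v"

context patch
begin

lemma onb_expand:
  assumes x: "x \<in> U" and o: "onb g x t n b"
  shows "v = ip g x v t *\<^sub>R t + ip g x v n *\<^sub>R n + ip g x v b *\<^sub>R b" and "(vol g x t n b)\<^sup>2 = 1"
proof -
  obtain L :: "real^3^3" where L: "\<And>a b. ip g x (L *v a) (L *v b) = a \<bullet> b" using frame_exists[OF x] by blast
  obtain t' n' b' v' where e: "t = L *v t'" "n = L *v n'" "b = L *v b'" "v = L *v v'"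
    using frame_props(2)[OF x L] by (metis surjD)
  have o': "t' \<bullet> t' = 1" "n' \<bullet> n' = 1" "b' \<bullet> b' = 1" "t' \<bullet> n' = 0" "t' \<bullet> b' = 0" "n' \<bullet> b' = 0"
    using o unfolding onb_def e L by auto
  have "L *v v' = L *v ((v' \<bullet> t') *\<^sub>R t' + (v' \<bullet> n') *\<^sub>R n' + (v' \<bullet> b') *\<^sub>R b')"
    using orthonormal_triple(1)[OF o', of v'] by simp
  then show "v = ip g x v t *\<^sub>R t + ip g x v n *\<^sub>R n + ip g x v b *\<^sub>R b"
    unfolding e L by (simp add: matrix_vector_right_distrib matrix_vector_mult_scaleR)
  obtain s where "s \<in> {1, -1}" "\<And>a b c. vol g x (L *v a) (L *v b) (L *v c) = s * (a \<bullet> cross3 b c)"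
    using frame_props(4)[OF x L] by blast
  then show "(vol g x t n b)\<^sup>2 = 1"
    unfolding e using orthonormal_triple(2)[OF o'] by (auto simp: power_mult_distrib)
qed

lemma ip_curve:
  assumes "(X has_vector_derivative X') (at t within S)" "X t \<in> U" "(A has_vector_derivative A') (at t within S)" "(C has_vector_derivative C') (at t within S)"
  shows "((\<lambda>s. ip g (X s) (A s) (C s)) has_real_derivative
    ip g (X t) (covd g (X t) X' (A t) A') (C t) + ip g (X t) (A t) (covd g (X t) X' (C t) C')) (at t within S)"
  unfolding has_field_derivative_def covd_def
  by (rule has_derivative_eq_rhs[OF ip_has_derivative[OF assms(1)[unfolded has_vector_derivative_def] assms(2)
        assms(3)[unfolded has_vector_derivative_def] assms(4)[unfolded has_vector_derivative_def]]])
     (simp add: fun_eq_iff algebra_simps)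

lemma vol_curve:
  assumes "(X has_vector_derivative X') (at t within S)" "X t \<in> U" "(A has_vector_derivative A') (at t within S)"
    "(C has_vector_derivative C') (at t within S)" "(E has_vector_derivative E') (at t within S)"
  shows "((\<lambda>s. vol g (X s) (A s) (C s) (E s)) has_real_derivative
    vol g (X t) (covd g (X t) X' (A t) A') (C t) (E t) + vol g (X t) (A t) (covd g (X t) X' (C t) C') (E t)
      + vol g (X t) (A t) (C t) (covd g (X t) X' (E t) E')) (at t within S)"
  unfolding has_field_derivative_def covd_def
  by (rule has_derivative_eq_rhs[OF vol_has_derivative[OF assms(1)[unfolded has_vector_derivative_def] assms(2)
        assms(3)[unfolded has_vector_derivative_def] assms(4)[unfolded has_vector_derivative_def] assms(5)[unfolded has_vector_derivative_def]]])
     (simp add: fun_eq_iff algebra_simps)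

text \<open>
  A unit normal field \<open>N\<close> along a closed curve makes the angle \<open>\<theta>\<close> with the principal normal; as long as
  \<open>N\<close> is never orthogonal to it, \<open>\<theta> = arctan (\<langle>N, b\<rangle> / \<langle>N, n\<rangle>)\<close> is a closed function, and \<open>\<theta>'\<close> is
  the difference between the torsion and the rotation of \<open>N\<close>.
\<close>

theorem total_torsion_of_field:
  fixes a0 b0 :: real
  assumes ab: "a0 < b0"
    and X: "\<And>s. s \<in> {a0..b0} \<Longrightarrow> (X has_vector_derivative T s) (at s within {a0..b0})" and XU: "\<And>s. s \<in> {a0..b0} \<Longrightarrow> X s \<in> U"
    and T: "\<And>s. s \<in> {a0..b0} \<Longrightarrow> (T has_vector_derivative T' s) (at s within {a0..b0})"
    and n: "\<And>s. s \<in> {a0..b0} \<Longrightarrow> (n has_vector_derivative n' s) (at s within {a0..b0})"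
    and b: "\<And>s. s \<in> {a0..b0} \<Longrightarrow> (b has_vector_derivative b' s) (at s within {a0..b0})"
    and N: "\<And>s. s \<in> {a0..b0} \<Longrightarrow> (N has_vector_derivative N' s) (at s within {a0..b0})"
    and o: "\<And>s. s \<in> {a0..b0} \<Longrightarrow> onb g (X s) (T s) (n s) (b s)"
    and DT: "\<And>s. s \<in> {a0..b0} \<Longrightarrow> covd g (X s) (T s) (T s) (T' s) = \<kappa> s *\<^sub>R n s"
    and Dn: "\<And>s. s \<in> {a0..b0} \<Longrightarrow> covd g (X s) (T s) (n s) (n' s) = - \<kappa> s *\<^sub>R T s + \<tau> s *\<^sub>R b s"
    and Db: "\<And>s. s \<in> {a0..b0} \<Longrightarrow> covd g (X s) (T s) (b s) (b' s) = - \<tau> s *\<^sub>R n s"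
    and N1: "\<And>s. s \<in> {a0..b0} \<Longrightarrow> ip g (X s) (N s) (N s) = 1" and NT: "\<And>s. s \<in> {a0..b0} \<Longrightarrow> ip g (X s) (N s) (T s) = 0"
    and Nn: "\<And>s. s \<in> {a0..b0} \<Longrightarrow> ip g (X s) (N s) (n s) \<noteq> 0"
    and cl: "X a0 = X b0" "T a0 = T b0" "n a0 = n b0" "N a0 = N b0"
  shows "\<exists>\<sigma>. \<sigma>\<^sup>2 = 1 \<and> ((\<lambda>s. \<tau> s + \<sigma> * vol g (X s) (N s) (T s) (covd g (X s) (T s) (N s) (N' s))) has_integral 0) {a0..b0}"
proof -
  let ?I = "{a0..b0}"
  let ?DN = "\<lambda>s. covd g (X s) (T s) (N s) (N' s)"
  have in0: "a0 \<in> ?I" "b0 \<in> ?I" using ab by auto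
  define vl where "vl = (\<lambda>s. vol g (X s) (T s) (n s) (b s))"
  define \<sigma> where "\<sigma> = vl a0"
  have s1: "(vl s)\<^sup>2 = 1" if "s \<in> ?I" for s unfolding vl_def by (rule onb_expand(2)[OF XU[OF that] o[OF that]])
  have "(vl has_real_derivative 0) (at s within ?I)" if s: "s \<in> ?I" for s
    unfolding vl_def using vol_curve[OF X[OF s] XU[OF s] T[OF s] n[OF s] b[OF s]] by (simp add: DT[OF s] Dn[OF s] Db[OF s])
  then have "\<exists>c. \<forall>s\<in>?I. vl s = c"
    by (intro has_field_derivative_zero_constant) auto
  then have vl: "vl s = \<sigma>" if "s \<in> ?I" for s using that in0 unfolding \<sigma>_def by metis
  have sig: "\<sigma>\<^sup>2 = 1" unfolding \<sigma>_def by (rule s1[OF in0(1)])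
  \<comment> \<open>The binormal is not assumed to close up. Both end values complete the same
    tangent and normal, so they agree up to sign, and the constancy of \<open>vl\<close> excludes
    the minus sign.\<close>
  have cb: "b a0 = b b0"
  proof -
    have e: "b b0 = ip g (X a0) (b b0) (b a0) *\<^sub>R b a0"
      using onb_expand(1)[OF XU[OF in0(1)] o[OF in0(1)], of "b b0"] o[OF in0(2)] ip_commute[OF XU[OF in0(1)]]
      unfolding onb_def cl by simp
    have "vol g (X a0) (T a0) (n a0) (b b0) = vol g (X a0) (T a0) (n a0) (b a0)"
      using vl[OF in0(1)] vl[OF in0(2)] unfolding vl_def cl by simp
    then have "ip g (X a0) (b b0) (b a0) * vl a0 = vl a0" by (subst (asm) e) (simp add: vl_def)
    then have "ip g (X a0) (b b0) (b a0) = 1" using s1[OF in0(1)] by auto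
    then show ?thesis using e by simp
  qed
  define u where "u = (\<lambda>s. ip g (X s) (N s) (n s))"
  define w where "w = (\<lambda>s. ip g (X s) (N s) (b s))"
  define p where "p = (\<lambda>s. ip g (X s) (?DN s) (n s))"
  define q where "q = (\<lambda>s. ip g (X s) (?DN s) (b s))"
  have Nexp: "N s = u s *\<^sub>R n s + w s *\<^sub>R b s" if "s \<in> ?I" for s
    using onb_expand(1)[OF XU[OF that] o[OF that], of "N s"] NT[OF that] by (simp add: u_def w_def)
  have uw: "u s * u s + w s * w s = 1" if "s \<in> ?I" for s
  proof -
    have "ip g (X s) (u s *\<^sub>R n s + w s *\<^sub>R b s) (u s *\<^sub>R n s + w s *\<^sub>R b s) = 1" using N1[OF that] Nexp[OF that] by simp
    then show ?thesis using o[OF that] ip_commute[OF XU[OF that], of "b s" "n s"] by (simp add: onb_def)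
  qed
  \<comment> \<open>Since N = u n + w b, only the components \<open>p\<close>, \<open>q\<close> of
    the derivative of \<open>N\<close> normal to the curve survive in the volume.\<close>
  have vv: "vol g (X s) (N s) (T s) (?DN s) = \<sigma> * (w s * p s - u s * q s)" if s: "s \<in> ?I" for s
  proof -
    have "?DN s = ip g (X s) (?DN s) (T s) *\<^sub>R T s + p s *\<^sub>R n s + q s *\<^sub>R b s"
      unfolding p_def q_def by (rule onb_expand(1)[OF XU[OF s] o[OF s]])
    then obtain l where l: "?DN s = l *\<^sub>R T s + p s *\<^sub>R n s + q s *\<^sub>R b s" by blast
    show ?thesis
      unfolding vl[OF s, symmetric] vl_def
      apply (subst l, subst Nexp[OF s])
      using vol_swap[of g "X s" "n s" "T s" "b s"] vol_swap(1)[of g "X s" "b s" "T s" "n s"] vol_swap(2)[of g "X s" "T s" "b s" "n s"]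
      by (simp add: algebra_simps)
  qed
  define th where "th = (\<lambda>s. arctan (w s / u s))"
  \<comment> \<open>The relation u^2 + w^2 = 1 clears the denominators in the derivative of the
    arctangent, giving q u - p w - \<tau>. The torsion enters with a minus sign, hence the passage
    to - th.\<close>
  have dth: "((\<lambda>s. - th s) has_vector_derivative \<tau> s + \<sigma> * vol g (X s) (N s) (T s) (?DN s)) (at s within ?I)" if s: "s \<in> ?I" for s
  proof -
    have u0: "u s \<noteq> 0" unfolding u_def by (rule Nn[OF s])
    have c: "ip g (X s) (N s) (T s) = 0" by (rule NT[OF s])
    have du: "(u has_real_derivative p s + \<tau> s * w s) (at s within ?I)"
      unfolding u_def using ip_curve[OF X[OF s] XU[OF s] N[OF s] n[OF s]] by (simp add: Dn[OF s] c p_def w_def)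
    have dw: "(w has_real_derivative q s - \<tau> s * u s) (at s within ?I)"
      unfolding w_def using ip_curve[OF X[OF s] XU[OF s] N[OF s] b[OF s]] by (simp add: Db[OF s] q_def u_def)
    have "(th has_real_derivative inverse (1 + (w s / u s)\<^sup>2) * (((q s - \<tau> s * u s) * u s - w s * (p s + \<tau> s * w s)) / (u s * u s))) (at s within ?I)"
      unfolding th_def by (rule DERIV_chain2[OF DERIV_arctan DERIV_divide[OF dw du u0]])
    moreover have "inverse (1 + (w s / u s)\<^sup>2) = u s * u s"
      using uw[OF s] u0 by (simp add: field_simps power2_eq_square)
    moreover have "(q s - \<tau> s * u s) * u s - w s * (p s + \<tau> s * w s) = q s * u s - w s * p s - \<tau> s * (u s * u s + w s * w s)"
      by (simp add: algebra_simps)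
    ultimately have "(th has_real_derivative q s * u s - w s * p s - \<tau> s) (at s within ?I)"
      using u0 uw[OF s] by simp
    from DERIV_minus[OF this] have "((\<lambda>s. - th s) has_real_derivative \<tau> s + (w s * p s - u s * q s)) (at s within ?I)"
      by (simp add: algebra_simps)
    moreover have "\<sigma> * (\<sigma> * (w s * p s - u s * q s)) = w s * p s - u s * q s"
      using sig by (simp add: power2_eq_square flip: mult.assoc)
    ultimately show ?thesis unfolding vv[OF s] has_real_derivative_iff_has_vector_derivative by (simp only:)
  qed
  have "((\<lambda>s. \<tau> s + \<sigma> * vol g (X s) (N s) (T s) (?DN s)) has_integral (- th b0 - - th a0)) ?I"
    by (rule fundamental_theorem_of_calculus) (use ab dth in auto)
  moreover have "th a0 = th b0" unfolding th_def u_def w_def cl cb ..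
  ultimately show ?thesis using sig by auto
qed

end

context normal_patch
begin

text \<open>On a small sphere around the origin the radial field \<open>N = x / R\<close> is such a field.\<close>

theorem total_torsion_on_sphere:
  fixes a0 b0 :: real
  assumes r: "r \<le> \<rho>" "\<And>v w. v \<in> ball 0 r \<Longrightarrow> w \<noteq> 0 \<Longrightarrow> ip g v w (w + Gam g v w v) > 0"
    and ab: "a0 < b0" and R: "0 < R" "R < r" and sph: "\<And>s. s \<in> {a0..b0} \<Longrightarrow> norm (X s) = R"
    and X: "\<And>s. s \<in> {a0..b0} \<Longrightarrow> (X has_vector_derivative T s) (at s within {a0..b0})"
    and T: "\<And>s. s \<in> {a0..b0} \<Longrightarrow> (T has_vector_derivative T' s) (at s within {a0..b0})"
    and n: "\<And>s. s \<in> {a0..b0} \<Longrightarrow> (n has_vector_derivative n' s) (at s within {a0..b0})"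
    and b: "\<And>s. s \<in> {a0..b0} \<Longrightarrow> (b has_vector_derivative b' s) (at s within {a0..b0})"
    and o: "\<And>s. s \<in> {a0..b0} \<Longrightarrow> onb g (X s) (T s) (n s) (b s)"
    and DT: "\<And>s. s \<in> {a0..b0} \<Longrightarrow> covd g (X s) (T s) (T s) (T' s) = \<kappa> s *\<^sub>R n s"
    and Dn: "\<And>s. s \<in> {a0..b0} \<Longrightarrow> covd g (X s) (T s) (n s) (n' s) = - \<kappa> s *\<^sub>R T s + \<tau> s *\<^sub>R b s"
    and Db: "\<And>s. s \<in> {a0..b0} \<Longrightarrow> covd g (X s) (T s) (b s) (b' s) = - \<tau> s *\<^sub>R n s"
    and cl: "X a0 = X b0" "T a0 = T b0" "n a0 = n b0"
  shows "\<exists>\<sigma>. \<sigma>\<^sup>2 = 1 \<and> ((\<lambda>s. \<tau> s + \<sigma> * (vol g (X s) (X s) (T s) (Gam g (X s) (T s) (X s)) / R\<^sup>2)) has_integral 0) {a0..b0}"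
proof -
  let ?N = "\<lambda>s. X s /\<^sub>R R"
  let ?N' = "\<lambda>s. T s /\<^sub>R R"
  have XB: "X s \<in> B" "X s \<in> ball 0 r" if "s \<in> {a0..b0}" for s using sph[OF that] R r(1) by auto
  have xT: "X s \<bullet> T s = 0" if s: "s \<in> {a0..b0}" for s
  proof -
    have D: "((\<lambda>s. X s \<bullet> X s) has_vector_derivative X s \<bullet> T s + T s \<bullet> X s) (at s within {a0..b0})"
      using has_derivative_inner[OF X[OF s, unfolded has_vector_derivative_def] X[OF s, unfolded has_vector_derivative_def]]
      by (simp add: has_vector_derivative_def distrib_left)
    have C: "((\<lambda>s. X s \<bullet> X s) has_vector_derivative 0) (at s within {a0..b0})"
      by (rule has_vector_derivative_transform[OF s _ has_vector_derivative_const[of "R\<^sup>2"]]) (simp add: dot_square_norm sph)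
    have "X s \<bullet> T s + T s \<bullet> X s = 0"
      by (rule has_vector_derivative_unique_interval[OF ab s D C])
    then show ?thesis by (simp add: inner_commute)
  qed
  have Nd: "(?N has_vector_derivative ?N' s) (at s within {a0..b0})" if "s \<in> {a0..b0}" for s
    using bounded_linear.has_vector_derivative[OF bounded_linear_scaleR_right X[OF that]] .
  have DN: "covd g (X s) (T s) (?N s) (?N' s) = (T s + Gam g (X s) (T s) (X s)) /\<^sub>R R" for s
    by (simp add: covd_def scaleR_add_right)
  have NT: "ip g (X s) (?N s) (T s) = 0" if "s \<in> {a0..b0}" for s using gauss_lemma[OF XB(1)[OF that]] xT[OF that] by simp
  have "\<exists>\<sigma>. \<sigma>\<^sup>2 = 1 \<and> ((\<lambda>s. \<tau> s + \<sigma> * vol g (X s) (?N s) (T s) (covd g (X s) (T s) (?N s) (?N' s))) has_integral 0) {a0..b0}"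
  proof (rule total_torsion_of_field[OF ab X XB(1) T n b Nd o DT Dn Db _ NT _ cl])
    fix s assume s: "s \<in> {a0..b0}"
    show "ip g (X s) (?N s) (?N s) = 1"
      using gauss_lemma[OF XB(1)[OF s], of "X s"] R(1) sph[OF s] by (simp add: dot_square_norm field_simps power2_eq_square)
    have T1: "ip g (X s) (T s) (T s) = 1" using o[OF s] by (simp add: onb_def)
    then have Tn: "T s \<noteq> 0" by auto
    \<comment> \<open>Differentiate the orthogonality of \<open>N\<close> and \<open>T\<close>: the
      part in which \<open>N\<close> is differentiated is positive by convexity, so the other part,
      \<kappa> times the pairing of \<open>N\<close> with \<open>n\<close>, cannot vanish.\<close>
    have "((\<lambda>s. ip g (X s) (?N s) (T s)) has_real_derivative ip g (X s) ((T s + Gam g (X s) (T s) (X s)) /\<^sub>R R) (T s) + ip g (X s) (?N s) (\<kappa> s *\<^sub>R n s)) (at s within {a0..b0})"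
      using ip_curve[OF X[OF s] XB(1)[OF s] Nd[OF s] T[OF s]] unfolding DN DT[OF s] .
    moreover have "((\<lambda>s. ip g (X s) (?N s) (T s)) has_real_derivative 0) (at s within {a0..b0})"
      unfolding has_real_derivative_iff_has_vector_derivative
      by (rule has_vector_derivative_transform[OF s _ has_vector_derivative_const[of 0]]) (rule NT)
    ultimately have "ip g (X s) ((T s + Gam g (X s) (T s) (X s)) /\<^sub>R R) (T s) + ip g (X s) (?N s) (\<kappa> s *\<^sub>R n s) = 0"
      unfolding has_real_derivative_iff_has_vector_derivative
      by (rule has_vector_derivative_unique_interval[OF ab s])
    moreover have "ip g (X s) ((T s + Gam g (X s) (T s) (X s)) /\<^sub>R R) (T s) > 0"
      using r(2)[OF XB(2)[OF s] Tn] R(1) ip_commute[OF XB(1)[OF s], of "T s" "T s + Gam g (X s) (T s) (X s)"] by (simp del: ip_bilin(1,2))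
    ultimately show "ip g (X s) (?N s) (n s) \<noteq> 0" by auto
  qed (use cl in auto)
  moreover have "vol g (X s) (?N s) (T s) (covd g (X s) (T s) (?N s) (?N' s)) = vol g (X s) (X s) (T s) (Gam g (X s) (T s) (X s)) / R\<^sup>2" for s
    unfolding DN by (simp add: power2_eq_square field_simps)
  ultimately show ?thesis by simp
qed

end

section \<open>Smooth curves\<close>

lemma smooth_on_real_derivative:
  fixes X :: "real \<Rightarrow> 'a::real_normed_vector"
  assumes "open J" "smooth_on X J"
  shows "\<And>s. s \<in> J \<Longrightarrow> (X has_vector_derivative vector_derivative X (at s)) (at s)"
    and "smooth_on (\<lambda>s. vector_derivative X (at s)) J"
proof -
  show *: "(X has_vector_derivative vector_derivative X (at s)) (at s)" if "s \<in> J" for s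
    using smooth_on_imp_differentiable[OF assms(2) that] by (simp add: vector_derivative_works)
  have "fd X s 1 = vector_derivative X (at s)" if "s \<in> J" for s
    using fd_eq[OF *[OF that, unfolded has_vector_derivative_def]] by simp
  then show "smooth_on (\<lambda>s. vector_derivative X (at s)) J"
    by (rule smooth_on_eqI[OF smooth_on_fd[OF assms(2)] assms(1)])
qed

text \<open>\<open>h\<close> is the inverse of the arc length \<open>S\<close>; periodicity of the
  speed turns the shift by \<open>p\<close> into the shift by the length \<open>l\<close> of a
  period. Smoothness is again a bootstrap, from h' = 1 / \<sigma>(h).\<close>

lemma arc_length_reparametrisation:
  fixes \<sigma> :: "real \<Rightarrow> real"
  assumes \<sigma>: "smooth_on \<sigma> UNIV" "\<And>t. \<sigma> t > 0" and p: "p > 0" "\<And>t. \<sigma> (t + p) = \<sigma> t"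
  obtains h l where "l > 0" "smooth_on h UNIV" "h 0 = 0" "h l = p" "\<And>s. h (s + l) = h s + p"
    "\<And>s. (h has_real_derivative 1 / \<sigma> (h s)) (at s)"
proof -
  have \<sigma>c: "continuous_on A \<sigma>" for A using smooth_on_imp_continuous[OF \<sigma>(1)] continuous_on_subset by blast
  define S where "S = (\<lambda>t::real. LBINT y=0..t. \<sigma> y)"
  have S': "(S has_real_derivative \<sigma> t) (at t)" for t
  proof -
    have "((\<lambda>u. LBINT y=0..u. \<sigma> y) has_vector_derivative \<sigma> t) (at t within {-\<bar>t\<bar>-1..\<bar>t\<bar>+1})"
      using interval_integral_FTC2[of "-\<bar>t\<bar>-1" 0 "\<bar>t\<bar>+1" \<sigma> t] \<sigma>c by (simp add: zero_ereal_def)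
    moreover have "at t within {-\<bar>t\<bar>-1..\<bar>t\<bar>+1} = at t" by (rule at_within_interior) auto
    ultimately show ?thesis unfolding S_def has_real_derivative_iff_has_vector_derivative by simp
  qed
  have S0: "S 0 = 0" by (simp add: S_def zero_ereal_def)
  have Sc: "isCont S t" for t using DERIV_isCont S' by blast
  have mono: "S a < S b" if "a < b" for a b
    by (rule DERIV_pos_imp_increasing[OF that]) (use S' \<sigma>(2) in blast)
  define l where "l = S p"
  have l: "l > 0" unfolding l_def using mono[OF p(1)] S0 by simp
  have Sp: "S (t + p) = S t + l" for t
  proof -
    have "((\<lambda>t. S (t + p) - S t) has_real_derivative 0) (at t)" for t
    proof -
      have "((\<lambda>x. S (x + p)) has_real_derivative \<sigma> (t + p)) (at t)" using S'[of "t + p"] by (simp add: DERIV_shift)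
      from DERIV_diff[OF this S'[of t]] show ?thesis by (simp add: p(2))
    qed
    then have "S (t + p) - S t = S (0 + p) - S 0" by (rule DERIV_isconst_all[rule_format])
    then show ?thesis by (simp add: l_def S0)
  qed
  \<comment> \<open>Values at the integer multiples of the period show that \<open>S\<close> is
    unbounded in both directions, as surjectivity requires.\<close>
  have Spn: "S (of_nat k * p) = of_nat k * l" for k
    by (induction k) (use Sp[of "of_nat _ * p"] in \<open>auto simp: S0 algebra_simps\<close>)
  have Smn: "S (- (of_nat k * p)) = - (of_nat k * l)" for k
    by (induction k) (use Sp[of "- (of_nat (Suc _) * p)"] in \<open>auto simp: S0 algebra_simps\<close>)
  have "\<exists>t. S t = s" for s
  proof -
    obtain k where "\<bar>s\<bar> / l < of_nat k" using reals_Archimedean2 by blast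
    then have k: "\<bar>s\<bar> < of_nat k * l" using l by (simp add: field_simps)
    have "\<exists>t\<ge>- (of_nat k * p). t \<le> of_nat k * p \<and> S t = s"
      using k p(1) Sc by (intro IVT) (auto simp: Spn Smn)
    then show ?thesis by blast
  qed
  then obtain h where Sh: "\<And>s. S (h s) = s" by metis
  have inj: "a = b" if "S a = S b" for a b using mono[of a b] mono[of b a] that by (cases a b rule: linorder_cases) auto
  have hS: "h (S t) = t" for t by (rule inj) (rule Sh)
  have h0: "h 0 = 0" using hS[of 0] S0 by simp
  have hl: "h l = p" using hS[of p] by (simp add: l_def)
  have hp: "h (s + l) = h s + p" for s by (rule inj) (simp add: Sp Sh)
  have hc: "isCont h s" for s
    using isCont_inverse_function[of 1 "h s" h S] hS Sc Sh by simp
  have hd: "(h has_real_derivative 1 / \<sigma> (h s)) (at s)" for s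
    using DERIV_inverse_function[of S "\<sigma> (h s)" h s "s - 1" "s + 1", OF S' _ _ _ _ hc] \<sigma>(2)[of "h s"] Sh
    by (simp add: divide_inverse)
  have "Ck_on k h UNIV" for k
  proof (induction k)
    case 0
    show ?case using hc by (simp add: continuous_at_imp_continuous_on)
  next
    case (Suc k)
    show ?case
    proof (rule Ck_on_SucI)
      show "(h has_derivative (\<lambda>v. inverse (\<sigma> (h s)) * v)) (at s)" for s
        using hd[of s] by (simp add: has_field_derivative_def divide_inverse)
      have "Ck_on k (\<lambda>s. \<sigma> (h s)) UNIV" by (rule Ck_on_compose[OF _ _ _ smooth_on_Ck[OF \<sigma>(1)] Suc]) auto
      then have "Ck_on k (\<lambda>s. inverse (\<sigma> (h s))) UNIV"
        by (rule Ck_on_inverse[OF open_UNIV]) (use \<sigma>(2) in \<open>metis less_irrefl\<close>)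
      then show "Ck_on k (\<lambda>s. inverse (\<sigma> (h s)) * v) UNIV" for v
        by (rule Ck_on_linear[OF bounded_linear_mult_left open_UNIV])
    qed simp
  qed
  then have "smooth_on h UNIV" by (simp add: smooth_on_def)
  then show ?thesis using that l h0 hl hp hd by blast
qed

context patch
begin

text \<open>The cross product of the metric: \<open>b z\<close> represents the linear form v -> vol
  (a, c, v), and the explicit solution with the inverse metric keeps it smooth.\<close>

lemma smooth_metric_cross:
  assumes S: "open S" and f: "smooth_on f S" "f ` S \<subseteq> U" and a: "smooth_on a S" and c: "smooth_on c S"
  obtains b where "smooth_on b S" "\<And>z v. z \<in> S \<Longrightarrow> ip g (f z) (b z) v = vol g (f z) (a z) (c z) v"
proof -
  let ?G = "\<lambda>x. (\<chi> i j. g i j x) :: real^3^3"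
  define b where "b = (\<lambda>z. sqrt (det (?G (f z))) *\<^sub>R (matrix_inv (?G (f z)) *v cross3 (a z) (c z)))"
  have n: "smooth_on (\<lambda>z. a z $ i) S" "smooth_on (\<lambda>z. c z $ i) S" for i
    using a c by (auto intro: smooth_on_nth[OF S])
  have cr: "smooth_on (\<lambda>z. cross3 (a z) (c z) $ j) S" for j
    using exhaust_3[of j] by (auto simp: cross_components intro!: smooth_on_diff smooth_on_mult n S)
  have mi: "smooth_on (\<lambda>x. matrix_inv (?G x) $ i $ j) U" for i j
    by (rule smooth_on_matrix_inv[OF open_U]) (use smooth_g invertible_g in auto)
  have "smooth_on (\<lambda>z. matrix_inv (?G (f z)) *v cross3 (a z) (c z)) S"
    unfolding matrix_vector_mult_def
    by (intro smooth_on_vec smooth_on_sum smooth_on_mult cr S smooth_on_compose[OF S open_U f(2) mi f(1)])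
  then have "smooth_on b S" unfolding b_def
    by (intro smooth_on_scaleR S smooth_on_compose[OF S open_U f(2) smooth_on_sqrt_det f(1)])
  moreover have "ip g (f z) (b z) v = vol g (f z) (a z) (c z) v" if z: "z \<in> S" for z v
  proof -
    have x: "f z \<in> U" using f(2) z by blast
    have "ip g (f z) (b z) v = v \<bullet> (?G (f z) *v b z)" by (metis ip_commute[OF x] ip_matrix)
    also have "?G (f z) *v b z = sqrt (det (?G (f z))) *\<^sub>R cross3 (a z) (c z)"
      unfolding b_def by (simp add: matrix_vector_mult_scaleR matrix_vector_mul_assoc matrix_inv_props(1)[OF invertible_g[OF x]])
    finally have "ip g (f z) (b z) v = vol g (f z) v (a z) (c z)" by (simp add: vol_def)
    then show ?thesis by (metis vol_swap minus_minus)
  qed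
  ultimately show ?thesis using that by blast
qed

lemma onb_of_cross:
  assumes x: "x \<in> U" and t: "ip g x t t = 1" "ip g x n n = 1" "ip g x t n = 0"
    and b: "\<And>v. ip g x b v = vol g x t n v"
  shows "onb g x t n b"
proof -
  obtain L :: "real^3^3" where L: "\<And>a b. ip g x (L *v a) (L *v b) = a \<bullet> b" using frame_exists[OF x] by blast
  obtain t' n' where e: "t = L *v t'" "n = L *v n'" using frame_props(2)[OF x L] by (metis surjD)
  obtain s where s: "s \<in> {1, -1}" "\<And>a b c. vol g x (L *v a) (L *v b) (L *v c) = s * (a \<bullet> cross3 b c)"
    using frame_props(4)[OF x L] by blast
  have b': "b = L *v (s *\<^sub>R cross3 t' n')"
  proof (rule ip_ext[OF x])
    fix c obtain c' where c: "c = L *v c'" using frame_props(2)[OF x L] by (metis surjD)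
    have "t' \<bullet> cross3 n' c' = cross3 t' n' \<bullet> c'"
      by (simp add: cross3_def inner_vec_def sum_3 algebra_simps)
    then show "ip g x b c = ip g x (L *v (s *\<^sub>R cross3 t' n')) c" unfolding b e c s(2) L by simp
  qed
  have d: "t' \<bullet> t' = 1" "n' \<bullet> n' = 1" "t' \<bullet> n' = 0" using t unfolding e L by auto
  then have "norm t' = 1" "norm n' = 1" by (simp_all add: norm_eq_sqrt_inner)
  then have "(norm (cross3 t' n'))\<^sup>2 = 1" using norm_cross_dot[of t' n'] d(3) by simp
  then have "cross3 t' n' \<bullet> cross3 t' n' = 1" by (simp add: dot_square_norm)
  moreover have "s * s = 1" using s(1) by auto
  ultimately have "ip g x b b = 1" unfolding b' L by (simp flip: mult.assoc)
  then show ?thesis unfolding onb_def using t b[of t] b[of n] ip_commute[OF x] by simp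
qed

text \<open>The normal is the normalised acceleration and the binormal the metric cross product of
  \<open>T\<close> and \<open>n\<close>, so both are smooth by formula. The Frenet equations follow
  by differentiating the constant inner products of the frame and expanding in it.\<close>

theorem frenet_frame_exists:
  assumes X: "smooth_on X UNIV" "range X \<subseteq> U"
  defines "T \<equiv> \<lambda>s. vector_derivative X (at s)"
  defines "DT \<equiv> \<lambda>s. covd g (X s) (T s) (T s) (vector_derivative T (at s))"
  assumes T1: "\<And>s. ip g (X s) (T s) (T s) = 1" and DT0: "\<And>s. DT s \<noteq> 0"
  shows "\<exists>n b \<tau>. smooth_on n UNIV \<and> smooth_on b UNIV \<and> (\<forall>s. let \<kappa> = sqrt (ip g (X s) (DT s) (DT s)) in
    \<kappa> > 0 \<and> onb g (X s) (T s) (n s) (b s) \<and> DT s = \<kappa> *\<^sub>R n s \<and>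
    covd g (X s) (T s) (n s) (vector_derivative n (at s)) = - \<kappa> *\<^sub>R T s + \<tau> s *\<^sub>R b s \<and>
    covd g (X s) (T s) (b s) (vector_derivative b (at s)) = - \<tau> s *\<^sub>R n s)"
proof -
  have XU: "X s \<in> U" for s using X(2) by blast
  note sr = smooth_on_real_derivative[OF open_UNIV]
  have sT: "smooth_on T UNIV" unfolding T_def by (rule sr(2)[OF X(1)])
  have sDT: "smooth_on DT UNIV" unfolding DT_def covd_def
    by (intro smooth_on_add smooth_on_Gam sr(2) sT X open_UNIV)
  define \<kappa> where "\<kappa> = (\<lambda>s. sqrt (ip g (X s) (DT s) (DT s)))"
  have k2: "ip g (X s) (DT s) (DT s) > 0" for s by (rule pos_g[OF XU DT0])
  then have k: "\<kappa> s > 0" "\<kappa> s * \<kappa> s = ip g (X s) (DT s) (DT s)" for s by (simp_all add: \<kappa>_def less_imp_le)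
  have sk: "smooth_on \<kappa> UNIV" unfolding \<kappa>_def
    by (intro smooth_on_sqrt smooth_on_ip sDT X open_UNIV k2)
  define n where "n = (\<lambda>s. inverse (\<kappa> s) *\<^sub>R DT s)"
  have sn: "smooth_on n UNIV" unfolding n_def
    by (intro smooth_on_scaleR smooth_on_inverse sk sDT open_UNIV) (use k(1) in \<open>simp add: less_imp_neq[symmetric]\<close>)
  have DTn: "DT s = \<kappa> s *\<^sub>R n s" for s using k(1)[of s] by (simp add: n_def)
  obtain b where sb: "smooth_on b UNIV" and bv: "\<And>s v. ip g (X s) (b s) v = vol g (X s) (T s) (n s) v"
    using smooth_metric_cross[OF open_UNIV X sT sn] by (metis UNIV_I)
  have Xd: "(X has_vector_derivative T s) (at s)" for s unfolding T_def by (rule sr(1)[OF X(1) UNIV_I])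
  have Td: "(T has_vector_derivative vector_derivative T (at s)) (at s)" for s by (rule sr(1)[OF sT UNIV_I])
  have nd: "(n has_vector_derivative vector_derivative n (at s)) (at s)" for s by (rule sr(1)[OF sn UNIV_I])
  have bd: "(b has_vector_derivative vector_derivative b (at s)) (at s)" for s by (rule sr(1)[OF sb UNIV_I])
  define Dn where "Dn = (\<lambda>s. covd g (X s) (T s) (n s) (vector_derivative n (at s)))"
  define Db where "Db = (\<lambda>s. covd g (X s) (T s) (b s) (vector_derivative b (at s)))"
  have DTe: "covd g (X s) (T s) (T s) (vector_derivative T (at s)) = \<kappa> s *\<^sub>R n s" for s using DTn by (simp add: DT_def)
  have Dne: "covd g (X s) (T s) (n s) (vector_derivative n (at s)) = Dn s" for s by (simp add: Dn_def)
  have Dbe: "covd g (X s) (T s) (b s) (vector_derivative b (at s)) = Db s" for s by (simp add: Db_def)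
  have z: "D = 0" if "((\<lambda>s. c) has_real_derivative D) (at s)" for c D s
    using DERIV_unique[OF that DERIV_const] .
  have TDT: "ip g (X s) (T s) (DT s) = 0" for s
    using z[of 1, OF ip_curve[OF Xd XU Td Td, of s, unfolded T1]] ip_commute[OF XU, of s "T s"] unfolding DT_def by simp
  have nn: "ip g (X s) (n s) (n s) = 1" for s
    using k(1)[of s] by (simp add: n_def k(2)[symmetric] field_simps)
  have Tn: "ip g (X s) (T s) (n s) = 0" for s using TDT[of s] by (simp add: n_def)
  have o: "onb g (X s) (T s) (n s) (b s)" for s by (rule onb_of_cross[OF XU T1 nn Tn bv])
  note o' = o[unfolded onb_def]
  have bb: "ip g (X s) (b s) (b s) = 1" "ip g (X s) (T s) (b s) = 0" "ip g (X s) (n s) (b s) = 0" for s using o'[of s] by auto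
  define \<tau> where "\<tau> = (\<lambda>s. ip g (X s) (Dn s) (b s))"
  have c: "ip g (X s) v w = ip g (X s) w v" for s v w by (rule ip_commute[OF XU])
  have n1: "ip g (X s) (Dn s) (n s) = 0" for s
    using z[of 1, OF ip_curve[OF Xd XU nd nd, of s, unfolded nn]] c[of s "n s"] unfolding Dn_def by simp
  have n2: "ip g (X s) (Dn s) (T s) = - \<kappa> s" for s
    using z[of 0, OF ip_curve[OF Xd XU Td nd, of s, unfolded Tn]] c[of s "T s"] nn[of s]
    unfolding Dne DTe by simp
  have b1: "ip g (X s) (Db s) (b s) = 0" for s
    using z[of 1, OF ip_curve[OF Xd XU bd bd, of s, unfolded bb]] c[of s "b s"] unfolding Db_def by simp
  have b2: "ip g (X s) (Db s) (T s) = 0" for s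
    using z[of 0, OF ip_curve[OF Xd XU Td bd, of s, unfolded bb]] c[of s "T s"] bb[of s]
    unfolding Dbe DTe by simp
  have b3: "ip g (X s) (Db s) (n s) = - \<tau> s" for s
    using z[of 0, OF ip_curve[OF Xd XU nd bd, of s, unfolded bb]] c[of s "n s"]
    unfolding Dbe Dne \<tau>_def by simp
  have "Dn s = - \<kappa> s *\<^sub>R T s + \<tau> s *\<^sub>R b s" for s
    using onb_expand(1)[OF XU o, of "Dn s" s] n1 n2 by (simp add: \<tau>_def)
  moreover have "Db s = - \<tau> s *\<^sub>R n s" for s
    using onb_expand(1)[OF XU o, of "Db s" s] b1 b2 b3 by simp
  ultimately have "\<kappa> s > 0 \<and> onb g (X s) (T s) (n s) (b s) \<and> DT s = \<kappa> s *\<^sub>R n s \<and>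
    covd g (X s) (T s) (n s) (vector_derivative n (at s)) = - \<kappa> s *\<^sub>R T s + \<tau> s *\<^sub>R b s \<and>
    covd g (X s) (T s) (b s) (vector_derivative b (at s)) = - \<tau> s *\<^sub>R n s" for s
    using k(1) o DTn unfolding Dn_def Db_def by blast
  then show ?thesis using sn sb unfolding \<kappa>_def Let_def by blast
qed

end

section \<open>The test curves\<close>

lemma vector_derivative_periodic:
  fixes f :: "real \<Rightarrow> 'a::real_normed_vector"
  assumes per: "\<And>s. f (s + l) = f s"
  shows "vector_derivative f (at (s + l)) = vector_derivative f (at s)"
proof -
  have sh: "((\<lambda>s. s + a) has_vector_derivative 1) (at s)" for a s :: real by (auto intro!: derivative_eq_intros)
  have "(f has_vector_derivative D) (at s)" if "(f has_vector_derivative D) (at (s + l))" for D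
    using vector_diff_chain_at[OF sh[of l s] that] by (simp add: o_def per)
  moreover have "(f has_vector_derivative D) (at (s + l))" if "(f has_vector_derivative D) (at s)" for D
    using vector_diff_chain_at[OF sh[of "-l" "s + l"], of f D] that per[of "_ - l"] by (simp add: o_def)
  ultimately have "(f has_vector_derivative D) (at (s + l)) \<longleftrightarrow> (f has_vector_derivative D) (at s)" for D by blast
  then show ?thesis unfolding vector_derivative_def by simp
qed

context normal_patch
begin

text \<open>The torsion hypothesis as seen in normal coordinates, restricted to smooth periodic unit
  speed curves on the whole line. With it the converse can be proved entirely inside R^3.\<close>

definition torsion_free_spheres :: "real \<Rightarrow> bool" where
  "torsion_free_spheres R0 \<longleftrightarrow> (\<forall>R l X T n b \<kappa> \<tau>. 0 < R \<and> R < R0 \<and> 0 < l \<and>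
     smooth_on X UNIV \<and> smooth_on n UNIV \<and> smooth_on b UNIV \<and> (\<forall>s. norm (X s) = R) \<and> (\<forall>s. X (s + l) = X s) \<and>
     T = (\<lambda>s. vector_derivative X (at s)) \<and> (\<forall>s. \<kappa> s > 0 \<and> onb g (X s) (T s) (n s) (b s) \<and>
       covd g (X s) (T s) (T s) (vector_derivative T (at s)) = \<kappa> s *\<^sub>R n s \<and>
       covd g (X s) (T s) (n s) (vector_derivative n (at s)) = - \<kappa> s *\<^sub>R T s + \<tau> s *\<^sub>R b s \<and>
       covd g (X s) (T s) (b s) (vector_derivative b (at s)) = - \<tau> s *\<^sub>R n s)
     \<longrightarrow> (\<tau> has_integral 0) {0..l})"

text \<open>The numerator is quadratic in the velocity. Passing from arc length to the given
  parameter divides it by the squared speed and multiplies by the speed, hence the single root in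
  the denominator.\<close>

lemma torsion_free_periodic_integral:
  assumes r: "r \<le> \<rho>" "\<And>v w. v \<in> ball 0 r \<Longrightarrow> w \<noteq> 0 \<Longrightarrow> ip g v w (w + Gam g v w v) > 0"
    and H: "torsion_free_spheres R0" and R: "0 < R" "R < r" "R < R0" and p: "p > 0"
    and \<beta>: "smooth_on \<beta> UNIV" "\<And>t. norm (\<beta> t) = R" "\<And>t. \<beta> (t + p) = \<beta> t"
    and \<beta>': "\<And>t. (\<beta> has_vector_derivative \<beta>' t) (at t)" "\<And>t. \<beta>' t \<noteq> 0"
  shows "((\<lambda>t. vol g (\<beta> t) (\<beta> t) (\<beta>' t) (Gam g (\<beta> t) (\<beta>' t) (\<beta> t)) / sqrt (ip g (\<beta> t) (\<beta>' t) (\<beta>' t))) has_integral 0) {0..p}"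
proof -
  have be: "\<beta>' = (\<lambda>t. vector_derivative \<beta> (at t))"
    using vector_derivative_at[OF \<beta>'(1)] by (simp add: fun_eq_iff)
  have \<beta>B: "\<beta> t \<in> B" "\<beta> t \<in> ball 0 r" for t using \<beta>(2)[of t] R r(1) by auto
  have \<beta>r: "range \<beta> \<subseteq> B" using \<beta>B by blast
  have s\<beta>': "smooth_on \<beta>' UNIV" unfolding be by (rule smooth_on_real_derivative(2)[OF open_UNIV \<beta>(1)])
  define \<sigma> where "\<sigma> = (\<lambda>t. sqrt (ip g (\<beta> t) (\<beta>' t) (\<beta>' t)))"
  have ipp: "ip g (\<beta> t) (\<beta>' t) (\<beta>' t) > 0" for t by (rule pos_g[OF \<beta>B(1) \<beta>'(2)])
  have s\<sigma>: "smooth_on \<sigma> UNIV" unfolding \<sigma>_def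
    by (rule smooth_on_sqrt[OF open_UNIV smooth_on_ip[OF open_UNIV \<beta>(1) \<beta>r s\<beta>' s\<beta>'] ipp])
  have \<sigma>0: "\<sigma> t > 0" "\<sigma> t * \<sigma> t = ip g (\<beta> t) (\<beta>' t) (\<beta>' t)" for t using ipp[of t] by (auto simp: \<sigma>_def)
  have "\<sigma> (t + p) = \<sigma> t" for t
    unfolding \<sigma>_def \<beta>(3) be vector_derivative_periodic[where f = \<beta> and l = p, OF \<beta>(3)] ..
  then obtain h l where l: "l > 0" and sh: "smooth_on h UNIV" and h0: "h 0 = 0" and hl: "h l = p" and hp: "\<And>s. h (s + l) = h s + p"
    and h': "\<And>s. (h has_real_derivative 1 / \<sigma> (h s)) (at s)"
    using arc_length_reparametrisation[OF s\<sigma> \<sigma>0(1) p] by metis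
  define X where "X = (\<lambda>s. \<beta> (h s))"
  define T where "T = (\<lambda>s. vector_derivative X (at s))"
  have sX: "smooth_on X UNIV" unfolding X_def by (rule smooth_on_compose[OF open_UNIV open_UNIV _ \<beta>(1) sh]) auto
  have XB: "X s \<in> B" "X s \<in> ball 0 r" for s using \<beta>B by (auto simp: X_def)
  have nX: "norm (X s) = R" for s by (simp add: X_def \<beta>(2))
  have Xp: "X (s + l) = X s" for s by (simp add: X_def hp \<beta>(3))
  have TX: "T s = (1 / \<sigma> (h s)) *\<^sub>R \<beta>' (h s)" for s
    using vector_diff_chain_at[OF h'[unfolded has_real_derivative_iff_has_vector_derivative] \<beta>'(1), of s]
    unfolding T_def X_def by (simp add: o_def vector_derivative_at)
  have T1: "ip g (X s) (T s) (T s) = 1" for s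
    using \<sigma>0[of "h s"] by (simp add: TX X_def flip: \<sigma>0(2))
  note sr = smooth_on_real_derivative[OF open_UNIV]
  have sT: "smooth_on T UNIV" unfolding T_def by (rule sr(2)[OF sX])
  have Xd: "(X has_vector_derivative T s) (at s)" for s unfolding T_def by (rule sr(1)[OF sX UNIV_I])
  have Td: "(T has_vector_derivative vector_derivative T (at s)) (at s)" for s by (rule sr(1)[OF sT UNIV_I])
  define DT where "DT = (\<lambda>s. covd g (X s) (T s) (T s) (vector_derivative T (at s)))"
  \<comment> \<open>Convexity again: if the acceleration vanished, differentiating the orthogonality
    of position and tangent would annihilate the positive form of \<open>shape_positive\<close>. So
    the Frenet frame exists everywhere.\<close>
  have DT0: "DT s \<noteq> 0" for s
  proof
    assume z: "DT s = 0"
    have xT: "X s \<bullet> T s = 0" for s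
    proof -
      have "((\<lambda>s. X s \<bullet> X s) has_vector_derivative X s \<bullet> T s + T s \<bullet> X s) (at s)"
        using has_derivative_inner[OF Xd[of s, unfolded has_vector_derivative_def] Xd[of s, unfolded has_vector_derivative_def]]
        by (simp add: has_vector_derivative_def distrib_left)
      moreover have "(\<lambda>s. X s \<bullet> X s) = (\<lambda>s. R\<^sup>2)" by (simp add: dot_square_norm nX)
      ultimately have "X s \<bullet> T s + T s \<bullet> X s = 0" using vector_derivative_unique_at has_vector_derivative_const by metis
      then show ?thesis by (simp add: inner_commute)
    qed
    have XT: "ip g (X s) (X s) (T s) = 0" for s using gauss_lemma[OF XB(1)] xT by simp
    have D: "((\<lambda>s. ip g (X s) (X s) (T s)) has_real_derivative ip g (X s) (covd g (X s) (T s) (X s) (T s)) (T s) + ip g (X s) (X s) (DT s)) (at s)"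
      unfolding DT_def by (rule ip_curve[OF Xd XB(1) Xd Td])
    have "ip g (X s) (T s + Gam g (X s) (T s) (X s)) (T s) = 0"
      using DERIV_unique[OF D[unfolded XT] DERIV_const] unfolding z covd_def by simp
    moreover have "T s \<noteq> 0" using T1[of s] by auto
    then have "ip g (X s) (T s) (T s + Gam g (X s) (T s) (X s)) > 0" by (rule r(2)[OF XB(2)])
    ultimately show False unfolding ip_commute[OF XB(1), of s "T s"] by simp
  qed
  obtain n b \<tau> where sn: "smooth_on n UNIV" and sb: "smooth_on b UNIV" and fr: "\<And>s. sqrt (ip g (X s) (DT s) (DT s)) > 0 \<and> onb g (X s) (T s) (n s) (b s) \<and>
      DT s = sqrt (ip g (X s) (DT s) (DT s)) *\<^sub>R n s \<and>
      covd g (X s) (T s) (n s) (vector_derivative n (at s)) = - sqrt (ip g (X s) (DT s) (DT s)) *\<^sub>R T s + \<tau> s *\<^sub>R b s \<and>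
      covd g (X s) (T s) (b s) (vector_derivative b (at s)) = - \<tau> s *\<^sub>R n s"
  proof -
    have "range X \<subseteq> B" using XB(1) by blast
    from frenet_frame_exists[OF sX this T1[unfolded T_def] DT0[unfolded DT_def T_def]]
    show ?thesis using that unfolding Let_def DT_def T_def by blast
  qed
  define \<kappa> where "\<kappa> = (\<lambda>s. sqrt (ip g (X s) (DT s) (DT s)))"
  note fr = fr[folded \<kappa>_def, simplified]
  have fr': "\<kappa> s > 0" "onb g (X s) (T s) (n s) (b s)" "DT s = \<kappa> s *\<^sub>R n s"
    "covd g (X s) (T s) (n s) (vector_derivative n (at s)) = - \<kappa> s *\<^sub>R T s + \<tau> s *\<^sub>R b s"
    "covd g (X s) (T s) (b s) (vector_derivative b (at s)) = - \<tau> s *\<^sub>R n s" for s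
    using fr[of s] by (auto simp: \<kappa>_def)
  have "(\<tau> has_integral 0) {0..l}"
    by (rule H[unfolded torsion_free_spheres_def, rule_format, of R l X n b T \<kappa> \<tau>])
       (intro conjI allI R(1) R(3) l sX sn sb nX Xp T_def fr'(1) fr'(2) fr'(3)[unfolded DT_def] fr'(4) fr'(5))
  moreover have "\<exists>s0. s0\<^sup>2 = 1 \<and> ((\<lambda>s. \<tau> s + s0 * (vol g (X s) (X s) (T s) (Gam g (X s) (T s) (X s)) / R\<^sup>2)) has_integral 0) {0..l}"
  proof (rule total_torsion_on_sphere[where T' = "\<lambda>s. vector_derivative T (at s)" and n' = "\<lambda>s. vector_derivative n (at s)"
        and b' = "\<lambda>s. vector_derivative b (at s)", OF r l R(1,2) nX has_vector_derivative_at_within[OF Xd]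
        has_vector_derivative_at_within[OF Td] has_vector_derivative_at_within[OF sr(1)[OF sn UNIV_I]]
        has_vector_derivative_at_within[OF sr(1)[OF sb UNIV_I]] fr'(2) fr'(3)[unfolded DT_def] fr'(4) fr'(5)])
    have Tp: "T (s + l) = T s" for s unfolding T_def by (rule vector_derivative_periodic[where f = X and l = l, OF Xp])
    have DTp: "DT (s + l) = DT s" for s unfolding DT_def Xp Tp vector_derivative_periodic[where f = T and l = l, OF Tp] ..
    show "X 0 = X l" "T 0 = T l" using Xp[of 0] Tp[of 0] by simp_all
    have "\<kappa> l = \<kappa> 0" "DT l = DT 0" using DTp[of 0] Xp[of 0] by (simp_all add: \<kappa>_def)
    then have "\<kappa> 0 *\<^sub>R n l = \<kappa> 0 *\<^sub>R n 0" using fr'(3)[of l] fr'(3)[of 0] by simp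
    then show "n 0 = n l" using fr'(1)[of 0] by simp
  qed
  then obtain s0 where s0: "s0\<^sup>2 = 1" and i0: "((\<lambda>s. \<tau> s + s0 * (vol g (X s) (X s) (T s) (Gam g (X s) (T s) (X s)) / R\<^sup>2)) has_integral 0) {0..l}" by blast
  \<comment> \<open>Subtracting the vanishing total torsion leaves the integral of the volume term
    alone; its factor s0 / R^2 is nonzero.\<close>
  ultimately have d: "((\<lambda>s. (\<tau> s + s0 * (vol g (X s) (X s) (T s) (Gam g (X s) (T s) (X s)) / R\<^sup>2)) - \<tau> s) has_integral 0 - 0) {0..l}"
    using has_integral_diff by blast
  have int: "((\<lambda>s. vol g (X s) (X s) (T s) (Gam g (X s) (T s) (X s))) has_integral 0) {0..l}"
  proof -
    have "s0 * R\<^sup>2 * ((a + s0 * (v / R\<^sup>2)) - a) = v" for a v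
    proof -
      have "s0 * R\<^sup>2 * ((a + s0 * (v / R\<^sup>2)) - a) = s0\<^sup>2 * v" using R(1) by (simp add: power2_eq_square)
      then show ?thesis using s0 by simp
    qed
    then show ?thesis using has_integral_mult_right[OF d, of "s0 * R\<^sup>2"] by simp
  qed
  \<comment> \<open>Substitution t = h s, carried out through an antiderivative of
    \<open>V\<close>.\<close>
  define V where "V = (\<lambda>t. vol g (\<beta> t) (\<beta> t) (\<beta>' t) (Gam g (\<beta> t) (\<beta>' t) (\<beta> t)) / \<sigma> t)"
  have sV: "smooth_on V UNIV" unfolding V_def
    by (intro smooth_on_divide open_UNIV s\<sigma> smooth_on_vol smooth_on_Gam \<beta>(1) \<beta>r s\<beta>') (use \<sigma>0(1) in \<open>simp add: less_imp_neq[symmetric]\<close>)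
  have "continuous_on {0..p} V" by (rule continuous_on_subset[OF smooth_on_imp_continuous[OF sV]]) simp
  then obtain \<Phi> where \<Phi>: "\<And>t. t \<in> {0..p} \<Longrightarrow> (\<Phi> has_vector_derivative V t) (at t within {0..p})"
    using antiderivative_continuous by blast
  have hm: "h s \<in> {0..p}" if "s \<in> {0..l}" for s
  proof -
    have "h a \<le> h b" if "a \<le> b" for a b
    proof (rule DERIV_nonneg_imp_nondecreasing[OF that])
      fix x show "\<exists>y. (h has_real_derivative y) (at x) \<and> 0 \<le> y" using h'[of x] \<sigma>0(1)[of "h x"] by (intro exI[of _ "1 / \<sigma> (h x)"]) simp
    qed
    from this[of 0 s] this[of s l] show ?thesis using that h0 hl by auto
  qed
  have "((\<Phi> \<circ> h) has_vector_derivative vol g (X s) (X s) (T s) (Gam g (X s) (T s) (X s))) (at s within {0..l})" if s: "s \<in> {0..l}" for s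
  proof -
    have "((\<Phi> \<circ> h) has_vector_derivative (1 / \<sigma> (h s)) *\<^sub>R V (h s)) (at s within {0..l})"
      by (rule vector_diff_chain_within[OF has_vector_derivative_at_within[OF h'[unfolded has_real_derivative_iff_has_vector_derivative]]
            has_vector_derivative_within_subset[OF \<Phi>[OF hm[OF s]]]]) (use hm in auto)
    then show ?thesis by (simp add: V_def TX X_def)
  qed
  from fundamental_theorem_of_calculus[OF less_imp_le[OF l] this]
  have "((\<lambda>s. vol g (X s) (X s) (T s) (Gam g (X s) (T s) (X s))) has_integral (\<Phi> p - \<Phi> 0)) {0..l}" by (simp add: h0 hl)
  then have "\<Phi> p - \<Phi> 0 = 0" using int has_integral_unique by blast
  moreover have "(V has_integral (\<Phi> p - \<Phi> 0)) {0..p}" by (rule fundamental_theorem_of_calculus[OF less_imp_le[OF p] \<Phi>])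
  ultimately show ?thesis unfolding V_def \<sigma>_def by simp
qed

text \<open>
  The curves are the central projections of \<open>x + \<epsilon> y(t)\<close> to the sphere of radius \<open>\<epsilon>\<close>, where the plane curve \<open>y\<close>
  has velocity \<open>(1 + cos(2t) / 2) (cos t e + sin t f)\<close>; weighting the directions with \<open>1 + cos(2t) / 2\<close> keeps \<open>y\<close>
  closed and singles out one off-diagonal entry of the curvature as \<open>\<epsilon> \<rightarrow> 0\<close>.
\<close>

theorem curvature_origin_of_torsion_free:
  assumes H: "torsion_free_spheres R0" and R0: "R0 > 0"
    and x: "norm x = 1" and e: "norm e = 1" and xe: "x \<bullet> e = 0"
  shows "Riem g 0 e x x \<bullet> cross3 x e = 0"
proof -
  define f where "f = cross3 x e"
  have xf: "x \<bullet> f = 0" "e \<bullet> f = 0" unfolding f_def by (auto simp: dot_cross_self)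
  have "(norm f)\<^sup>2 = 1" unfolding f_def using norm_cross_dot[of x e] x e xe by simp
  then have nf: "f \<bullet> f = 1" by (simp add: dot_square_norm)
  have xx: "x \<bullet> x = 1" "e \<bullet> e = 1" using x e by (simp_all add: dot_square_norm)
  \<comment> \<open>Antiderivatives of w cos and w sin, from the two forms 3/2 - sin^2 and 1/2 +
    cos^2 of the weight w; as polynomials in sin and cos they have period 2 pi.\<close>
  define y where "y = (\<lambda>t::real. (3/2 * sin t - (sin t)^3 / 3) *\<^sub>R e + (- (cos t) / 2 - (cos t)^3 / 3) *\<^sub>R f)"
  define w where "w = (\<lambda>t::real. 1 + ((cos t)\<^sup>2 - (sin t)\<^sup>2) / 2)"
  define y' where "y' = (\<lambda>t. w t *\<^sub>R (cos t *\<^sub>R e + sin t *\<^sub>R f))"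
  have dy: "(y has_vector_derivative y' t) (at t)" for t
  proof -
    have "3 * cos t / 2 - cos t * (sin t)\<^sup>2 = w t * cos t" "sin t / 2 + sin t * (cos t)\<^sup>2 = w t * sin t"
      by (simp_all add: w_def cos_squared_eq field_simps)
    then have "((\<lambda>t. 3/2 * sin t - (sin t)^3 / 3) has_real_derivative w t * cos t) (at t)"
      "((\<lambda>t. - (cos t) / 2 - (cos t)^3 / 3) has_real_derivative w t * sin t) (at t)"
      by (auto intro!: derivative_eq_intros)
    note d = this[unfolded has_real_derivative_iff_has_vector_derivative]
    show ?thesis
      unfolding y_def y'_def scaleR_add_right scaleR_scaleR
      by (rule has_vector_derivative_add[OF bounded_linear.has_vector_derivative[OF bounded_linear_scaleR_left d(1)]
          bounded_linear.has_vector_derivative[OF bounded_linear_scaleR_left d(2)]])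
  qed
  have w0: "w t > 0" for t
  proof -
    have "(sin t)\<^sup>2 \<le> 1" by (metis abs_sin_le_one abs_square_le_1)
    then have "(sin t)\<^sup>2 / 2 \<le> 1/2" by simp
    moreover have "(cos t)\<^sup>2 \<ge> 0" by simp
    ultimately show ?thesis unfolding w_def diff_divide_distrib by linarith
  qed
  have y'y': "y' t \<bullet> y' t = (w t)\<^sup>2" for t
  proof -
    have "(cos t *\<^sub>R e + sin t *\<^sub>R f) \<bullet> (cos t *\<^sub>R e + sin t *\<^sub>R f) = cos t * cos t + sin t * sin t"
      using xf nf xx by (simp add: inner_add_left inner_add_right inner_commute[of f e])
    also have "\<dots> = 1" using sin_cos_squared_add[of t] by (simp add: power2_eq_square)
    finally show ?thesis by (simp add: y'_def power2_eq_square)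
  qed
  have xy: "x \<bullet> y t = 0" "x \<bullet> y' t = 0" for t using xe xf by (simp_all add: y_def y'_def inner_add_right)
  define P where "P = (\<lambda>\<epsilon> t. x + \<epsilon> *\<^sub>R y t)"
  have PP: "P \<epsilon> t \<bullet> P \<epsilon> t = 1 + \<epsilon>\<^sup>2 * (y t \<bullet> y t)" for \<epsilon> t
    using xy(1)[of t] xx by (simp add: P_def inner_add_left inner_add_right inner_commute[of "y t" x] power2_eq_square)
  have P0: "P \<epsilon> t \<noteq> 0" for \<epsilon> t
  proof
    assume z: "P \<epsilon> t = 0"
    have "0 \<le> \<epsilon>\<^sup>2 * (y t \<bullet> y t)" by (intro mult_nonneg_nonneg) auto
    moreover have "1 + \<epsilon>\<^sup>2 * (y t \<bullet> y t) = 0" using PP[of \<epsilon> t] unfolding z by simp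
    ultimately show False by linarith
  qed
  define m where "m = (\<lambda>\<epsilon> t. norm (P \<epsilon> t))"
  have m: "m \<epsilon> t > 0" "(m \<epsilon> t)\<^sup>2 = 1 + \<epsilon>\<^sup>2 * (y t \<bullet> y t)" for \<epsilon> t
    unfolding m_def using P0 PP[of \<epsilon> t] by (auto simp: dot_square_norm)
  define c where "c = (\<lambda>\<epsilon> t. inverse (m \<epsilon> t) *\<^sub>R P \<epsilon> t)"
  \<comment> \<open>The velocity of \<open>c\<close> with its factor \<epsilon> taken out. In this
    form it extends smoothly to \<epsilon> = 0, with the value y'.\<close>
  define u where "u = (\<lambda>\<epsilon> t. inverse (m \<epsilon> t) *\<^sub>R y' t - (\<epsilon> * (y t \<bullet> y' t) * inverse (m \<epsilon> t ^ 3)) *\<^sub>R P \<epsilon> t)"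
  have nc: "norm (c \<epsilon> t) = 1" for \<epsilon> t using m(1)[of \<epsilon> t] by (simp add: c_def m_def)
  have dc: "(c \<epsilon> has_vector_derivative \<epsilon> *\<^sub>R u \<epsilon> t) (at t)" for \<epsilon> t
  proof -
    have dP: "(P \<epsilon> has_vector_derivative \<epsilon> *\<^sub>R y' t) (at t)" unfolding P_def
      by (auto intro!: derivative_eq_intros dy)
    have "((\<lambda>t. P \<epsilon> t \<bullet> P \<epsilon> t) has_real_derivative 2 * \<epsilon>\<^sup>2 * (y t \<bullet> y' t)) (at t)"
      unfolding has_field_derivative_def
      by (rule has_derivative_eq_rhs[OF has_derivative_inner[OF dP[unfolded has_vector_derivative_def] dP[unfolded has_vector_derivative_def]]])
         (simp add: fun_eq_iff P_def inner_add_left inner_add_right xy(2) inner_commute[of "y' t"] power2_eq_square algebra_simps)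
    then have "((\<lambda>t. sqrt (P \<epsilon> t \<bullet> P \<epsilon> t)) has_real_derivative (inverse (sqrt (P \<epsilon> t \<bullet> P \<epsilon> t)) / 2) * (2 * \<epsilon>\<^sup>2 * (y t \<bullet> y' t))) (at t)"
      by (rule DERIV_chain2[OF DERIV_real_sqrt, rotated]) (use P0 in simp)
    then have dm: "(m \<epsilon> has_real_derivative \<epsilon>\<^sup>2 * (y t \<bullet> y' t) * inverse (m \<epsilon> t)) (at t)"
      by (simp add: m_def[abs_def] norm_eq_sqrt_inner mult.commute)
    have "((\<lambda>t. inverse (m \<epsilon> t)) has_real_derivative - (inverse (m \<epsilon> t ^ 3) * (\<epsilon>\<^sup>2 * (y t \<bullet> y' t)))) (at t)"
      by (rule DERIV_cong[OF DERIV_inverse_fun[OF dm]]) (use m(1)[of \<epsilon> t] in \<open>auto simp: field_simps power3_eq_cube power2_eq_square\<close>)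
    from has_vector_derivative_scaleR[OF this dP]
    show ?thesis unfolding c_def u_def
      by (elim has_vector_derivative_eq_rhs) (simp add: algebra_simps power2_eq_square)
  qed
  have u0: "u \<epsilon> t \<noteq> 0" for \<epsilon> t
  proof
    assume z: "u \<epsilon> t = 0"
    have "u \<epsilon> t \<bullet> x = - (\<epsilon> * (y t \<bullet> y' t) * inverse (m \<epsilon> t ^ 3))"
      using xy[of t] xx by (simp add: u_def P_def inner_diff_left inner_add_left inner_commute[of "y t" x] inner_commute[of "y' t" x])
    then have "\<epsilon> * (y t \<bullet> y' t) = 0" using z m(1)[of \<epsilon> t] by simp
    then have "inverse (m \<epsilon> t) *\<^sub>R y' t = 0" using z unfolding u_def by simp
    then have "y' t = 0" using m(1)[of \<epsilon> t] by simp
    then show False using y'y'[of t] w0[of t] by simp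
  qed
  obtain r where r: "0 < r" "r \<le> \<rho>" "\<And>v w. v \<in> ball 0 r \<Longrightarrow> w \<noteq> 0 \<Longrightarrow> ip g v w (w + Gam g v w v) > 0"
    using shape_positive by blast
  define E0 where "E0 = min r R0 / 2"
  have E0: "0 < E0" "E0 < r" "E0 < R0" "E0 < \<rho>" using r(1,2) R0 by (auto simp: E0_def)
  \<comment> \<open>The rescaled integrand with two separate radii: the curvature is taken at the
    radius \<xi> supplied by a mean value theorem, the speed at the radius \<epsilon> of the
    sphere.\<close>
  define F where "F = (\<lambda>\<xi> \<epsilon> t. vol g (\<xi> *\<^sub>R c \<epsilon> t) (c \<epsilon> t) (u \<epsilon> t) (Riem g (\<xi> *\<^sub>R c \<epsilon> t) (u \<epsilon> t) (c \<epsilon> t) (c \<epsilon> t)) / sqrt (ip g (\<epsilon> *\<^sub>R c \<epsilon> t) (u \<epsilon> t) (u \<epsilon> t)))"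
  have scB: "a *\<^sub>R c \<epsilon> t \<in> B" if "\<bar>a\<bar> < \<rho>" for a \<epsilon> t using that nc by simp
  have smP: "smooth_on (\<lambda>z. P (fst z) (snd z)) UNIV" and smy: "smooth_on (\<lambda>z::real\<times>real. y (snd z)) UNIV" and smy': "smooth_on (\<lambda>z::real\<times>real. y' (snd z)) UNIV"
    unfolding P_def y_def y'_def w_def power2_eq_square power3_eq_cube divide_inverse
    by (intro smooth_intros open_UNIV)+
  have smm: "smooth_on (\<lambda>z. inverse (m (fst z) (snd z))) UNIV"
    unfolding m_def by (intro smooth_on_inverse smooth_on_norm smP open_UNIV) (use P0 in auto)
  have smc: "smooth_on (\<lambda>z. c (fst z) (snd z)) UNIV"
    unfolding c_def by (intro smooth_on_scaleR smm smP open_UNIV)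
  have smu: "smooth_on (\<lambda>z. u (fst z) (snd z)) UNIV"
    unfolding u_def power3_eq_cube inverse_mult_distrib
    by (intro smooth_on_diff smooth_on_scaleR smooth_on_mult smooth_on_inner smm smP smy smy' smooth_on_fst smooth_on_ident open_UNIV)
  have cF: "continuous_on ({0..E0} \<times> {0..E0} \<times> {0..2*pi}) (\<lambda>z. F (fst z) (fst (snd z)) (snd (snd z)))"
  proof -
    define \<Omega> where "\<Omega> = ball (0::real) \<rho> \<times> ball (0::real) \<rho> \<times> (UNIV :: real set)"
    have \<Omega>: "open \<Omega>" unfolding \<Omega>_def by (intro open_Times open_ball open_UNIV)
    have pr: "smooth_on (\<lambda>z::real\<times>real\<times>real. fst z) \<Omega>" "smooth_on (\<lambda>z::real\<times>real\<times>real. snd z) \<Omega>" "smooth_on (\<lambda>z::real\<times>real\<times>real. fst (snd z)) \<Omega>"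
      by (intro smooth_on_fst smooth_on_snd smooth_on_ident \<Omega>)+
    have c1: "smooth_on (\<lambda>z. c (fst (snd z)) (snd (snd z))) \<Omega>"
      by (rule smooth_on_compose[OF \<Omega> open_UNIV _ smc pr(2)]) simp
    have u1: "smooth_on (\<lambda>z. u (fst (snd z)) (snd (snd z))) \<Omega>"
      by (rule smooth_on_compose[OF \<Omega> open_UNIV _ smu pr(2)]) simp
    have a: "smooth_on (\<lambda>z. fst z *\<^sub>R c (fst (snd z)) (snd (snd z))) \<Omega>" by (rule smooth_on_scaleR[OF \<Omega> pr(1) c1])
    have aB: "(\<lambda>z. fst z *\<^sub>R c (fst (snd z)) (snd (snd z))) ` \<Omega> \<subseteq> B" using scB unfolding \<Omega>_def by auto
    have d: "smooth_on (\<lambda>z. fst (snd z) *\<^sub>R c (fst (snd z)) (snd (snd z))) \<Omega>" by (rule smooth_on_scaleR[OF \<Omega> pr(3) c1])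
    have dB: "(\<lambda>z. fst (snd z) *\<^sub>R c (fst (snd z)) (snd (snd z))) ` \<Omega> \<subseteq> B" using scB unfolding \<Omega>_def by auto
    have pos: "ip g (fst (snd z) *\<^sub>R c (fst (snd z)) (snd (snd z))) (u (fst (snd z)) (snd (snd z))) (u (fst (snd z)) (snd (snd z))) > 0" if "z \<in> \<Omega>" for z
      by (rule pos_g[OF _ u0]) (use dB that in blast)
    have "smooth_on (\<lambda>z. F (fst z) (fst (snd z)) (snd (snd z))) \<Omega>"
      unfolding F_def
      by (rule smooth_on_divide[OF \<Omega> smooth_on_vol[OF \<Omega> a aB c1 u1 smooth_on_Riem_compose[OF \<Omega> a aB u1 c1 c1]] smooth_on_sqrt[OF \<Omega> smooth_on_ip[OF \<Omega> d dB u1 u1] pos]])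
         (use pos in force)+
    then show ?thesis
      by (rule continuous_on_subset[OF smooth_on_imp_continuous]) (use E0 in \<open>auto simp: \<Omega>_def\<close>)
  qed
  define \<psi> where "\<psi> = (\<lambda>\<epsilon> t. vol g (\<epsilon> *\<^sub>R c \<epsilon> t) (\<epsilon> *\<^sub>R c \<epsilon> t) (\<epsilon> *\<^sub>R \<epsilon> *\<^sub>R u \<epsilon> t) (Gam g (\<epsilon> *\<^sub>R c \<epsilon> t) (\<epsilon> *\<^sub>R \<epsilon> *\<^sub>R u \<epsilon> t) (\<epsilon> *\<^sub>R c \<epsilon> t))
      / sqrt (ip g (\<epsilon> *\<^sub>R c \<epsilon> t) (\<epsilon> *\<^sub>R \<epsilon> *\<^sub>R u \<epsilon> t) (\<epsilon> *\<^sub>R \<epsilon> *\<^sub>R u \<epsilon> t)))"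
  have int0: "(\<psi> \<epsilon> has_integral 0) {0..2*pi}" if \<epsilon>: "0 < \<epsilon>" "\<epsilon> \<le> E0" for \<epsilon>
    unfolding \<psi>_def
  proof (rule torsion_free_periodic_integral[OF r(2,3) H \<epsilon>(1)])
    have "smooth_on (\<lambda>t. (\<lambda>z. c (fst z) (snd z)) (\<epsilon>, t)) UNIV"
      by (rule smooth_on_compose[OF open_UNIV open_UNIV _ smc]) (auto intro!: smooth_on_Pair smooth_on_const smooth_on_ident)
    then show "smooth_on (\<lambda>t. \<epsilon> *\<^sub>R c \<epsilon> t) UNIV" by (intro smooth_on_scaleR smooth_on_const open_UNIV) simp
    show "((\<lambda>t. \<epsilon> *\<^sub>R c \<epsilon> t) has_vector_derivative \<epsilon> *\<^sub>R \<epsilon> *\<^sub>R u \<epsilon> t) (at t)" for t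
      by (rule bounded_linear.has_vector_derivative[OF bounded_linear_scaleR_right dc])
    show "\<epsilon> *\<^sub>R c \<epsilon> (t + 2 * pi) = \<epsilon> *\<^sub>R c \<epsilon> t" for t by (simp add: c_def m_def P_def y_def)
  qed (use \<epsilon> E0 nc u0 in auto)
  \<comment> \<open>Cauchy's mean value theorem compares the Jacobi volume \<open>d\<close>, of
    derivative - s^2 q(s), with s^3; so d(\<epsilon>) = - \<epsilon>^3 q(\<xi>) / 3. The remaining
    power \<epsilon>^2 is \<epsilon>^4 from rescaling the vectors, divided by \<epsilon>^2 from the
    speed. As \<xi> depends on t, the limit below is taken by uniform continuity of
    \<open>F\<close>.\<close>
  have val: "\<exists>\<xi>\<in>{0..\<epsilon>}. \<psi> \<epsilon> t = - (\<epsilon>^5 / 3) * F \<xi> \<epsilon> t" if \<epsilon>: "0 < \<epsilon>" "\<epsilon> \<le> E0" for \<epsilon> t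
  proof -
    let ?c = "c \<epsilon> t" and ?u = "u \<epsilon> t"
    define d where "d = (\<lambda>s. vol g (s *\<^sub>R ?c) ?c (s *\<^sub>R ?u) (?u + s *\<^sub>R Gam g (s *\<^sub>R ?c) ?u ?c))"
    define q where "q = (\<lambda>s. vol g (s *\<^sub>R ?c) ?c ?u (Riem g (s *\<^sub>R ?c) ?u ?c ?c))"
    have dd: "(d has_real_derivative - s\<^sup>2 * q s) (at s)" if "0 \<le> s" "s \<le> \<epsilon>" for s
      unfolding d_def q_def by (rule vol_jacobi_derivative[OF scB]) (use that \<epsilon> E0 in auto)
    have d3: "((\<lambda>s. s^3) has_real_derivative 3 * s\<^sup>2) (at s)" for s :: real
      by (auto intro!: derivative_eq_intros)
    have "\<exists>\<xi>>0. \<xi> < \<epsilon> \<and> (d \<epsilon> - d 0) * (3 * \<xi>\<^sup>2) = (\<epsilon>^3 - 0^3) * (- \<xi>\<^sup>2 * q \<xi>)"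
      by (rule GMVT'[OF \<epsilon>(1) DERIV_isCont[OF dd] DERIV_isCont[OF d3] d3 dd]) auto
    then obtain \<xi> where \<xi>: "\<xi> > 0" "\<xi> < \<epsilon>" "(d \<epsilon> - d 0) * (3 * \<xi>\<^sup>2) = (\<epsilon>^3 - 0^3) * (- \<xi>\<^sup>2 * q \<xi>)" by blast
    have "d 0 = 0" by (simp add: d_def)
    then have h: "\<xi>\<^sup>2 * (3 * d \<epsilon>) = \<xi>\<^sup>2 * (- (\<epsilon>^3) * q \<xi>)" using \<xi>(3) by (simp add: algebra_simps)
    have "\<xi>\<^sup>2 \<noteq> 0" using \<xi>(1) by simp
    from mult_left_cancel[OF this, THEN iffD1, OF h] have de: "d \<epsilon> = - (\<epsilon>^3) * q \<xi> / 3" by simp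
    define s where "s = sqrt (ip g (\<epsilon> *\<^sub>R ?c) ?u ?u)"
    have "sqrt (ip g (\<epsilon> *\<^sub>R ?c) (\<epsilon> *\<^sub>R \<epsilon> *\<^sub>R ?u) (\<epsilon> *\<^sub>R \<epsilon> *\<^sub>R ?u)) = \<epsilon>\<^sup>2 * s"
      unfolding s_def using \<epsilon>(1) by (simp add: real_sqrt_mult power2_eq_square real_sqrt_mult_self)
    moreover have "vol g (\<epsilon> *\<^sub>R ?c) (\<epsilon> *\<^sub>R ?c) (\<epsilon> *\<^sub>R \<epsilon> *\<^sub>R ?u) (Gam g (\<epsilon> *\<^sub>R ?c) (\<epsilon> *\<^sub>R \<epsilon> *\<^sub>R ?u) (\<epsilon> *\<^sub>R ?c)) = \<epsilon>^4 * d \<epsilon>"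
      unfolding d_def by (simp add: power4_eq_xxxx)
    ultimately have "\<psi> \<epsilon> t = \<epsilon>^4 * d \<epsilon> / (\<epsilon>\<^sup>2 * s)" by (simp only: \<psi>_def)
    also have "\<dots> = - (\<epsilon>^5 / 3) * (q \<xi> / s)"
      unfolding de using \<epsilon>(1) by (simp add: eval_nat_numeral)
    finally show ?thesis using \<xi> unfolding F_def q_def s_def by (intro bexI[of _ \<xi>]) auto
  qed
  define Z where "Z = (\<lambda>v. Riem g 0 v x x)"
  have zB: "(0::real^3) \<in> B" using rho_pos by simp
  have lZ: "linear Z" unfolding Z_def by (rule Riem_linear(1)[OF zB])
  \<comment> \<open>\<open>A1\<close> is the entry to be shown zero; \<open>A2\<close> collects the
    coefficient of cos t sin t, which integrates to zero against the weight.\<close>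
  define A1 where "A1 = Z e \<bullet> f"
  define A2 where "A2 = x \<bullet> cross3 e (Z f) + x \<bullet> cross3 f (Z e)"
  have vol0: "vol g 0 a b c = a \<bullet> cross3 b c" for a b c
  proof -
    have "(\<chi> i j. g i j 0) = (mat 1 :: real^3^3)"
      unfolding ip_axis_axis[of g 0, symmetric] ip_origin by (simp add: mat_def inner_axis_axis cong: if_cong)
    then show ?thesis by (simp add: vol_def)
  qed
  have F0: "F 0 0 t = w t * (A1 * ((cos t)\<^sup>2 - (sin t)\<^sup>2) + A2 * (cos t * sin t))" for t
  proof -
    let ?v = "cos t *\<^sub>R e + sin t *\<^sub>R f"
    have m1: "m 0 t = 1" using x by (simp add: m_def P_def)
    have cu: "c 0 t = x" "u 0 t = y' t" by (simp_all add: c_def u_def m1 P_def)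
    have "sqrt (y' t \<bullet> y' t) = w t" using w0[of t] by (simp add: y'y')
    then have "F 0 0 t = x \<bullet> cross3 (y' t) (Z (y' t)) / w t"
      unfolding F_def cu by (simp add: ip_origin vol0 Z_def)
    also have "\<dots> = w t * (x \<bullet> cross3 ?v (Z ?v))"
      unfolding y'_def using w0[of t] by (simp add: linear_scale[OF lZ] cross_mult_left cross_mult_right)
    also have "x \<bullet> cross3 ?v (Z ?v) = (cos t)\<^sup>2 * (x \<bullet> cross3 e (Z e)) + (cos t * sin t) * A2 + (sin t)\<^sup>2 * (x \<bullet> cross3 f (Z f))"
      unfolding A2_def by (simp add: linear_add[OF lZ] linear_scale[OF lZ] cross_add_left cross_add_right cross_mult_left cross_mult_right
          inner_add_right power2_eq_square algebra_simps)
    also have "x \<bullet> cross3 e (Z e) = A1" unfolding A1_def f_def by (simp add: cross3_def inner_vec_def sum_3 algebra_simps)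
    \<comment> \<open>Self-adjointness of \<open>Z\<close>, from the pair symmetry, together with
      cross3 x f = - e. Thus the form has trace zero and is A1 cos 2t plus a multiple of sin
      2t.\<close>
    also have "x \<bullet> cross3 f (Z f) = - A1"
    proof -
      have "x \<bullet> cross3 f (Z f) = cross3 x f \<bullet> Z f" by (simp add: cross3_def inner_vec_def sum_3 algebra_simps)
      also have "cross3 x f = - e"
      proof -
        have "cross3 x (cross3 x e) = (x \<bullet> e) *\<^sub>R x - (x \<bullet> x) *\<^sub>R e"
          by (simp add: cross3_def vec_eq_iff forall_3 inner_vec_def sum_3 algebra_simps)
        then show ?thesis using xe xx by (simp add: f_def)
      qed
      also have "- e \<bullet> Z f = - (Z e \<bullet> f)"
      proof -
        have "ip g 0 (Riem g 0 f x x) e = ip g 0 (Riem g 0 x e f) x" by (rule Riem_pair[OF zB])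
        also have "\<dots> = - ip g 0 f (Riem g 0 x e x)" by (rule Riem_skew_ip[OF zB])
        also have "\<dots> = ip g 0 f (Riem g 0 e x x)" by (simp add: Riem_skew[of g 0 x e])
        finally show ?thesis unfolding Z_def ip_origin by (simp add: inner_commute)
      qed
      finally show ?thesis by (simp add: A1_def)
    qed
    finally show ?thesis by (simp add: algebra_simps)
  qed
  have intF: "((\<lambda>t. F 0 0 t) has_integral A1 * pi / 2) {0..2*pi}"
  proof -
    define c2 where "c2 = (\<lambda>t::real. (cos t)\<^sup>2 - (sin t)\<^sup>2)"
    define s2 where "s2 = (\<lambda>t::real. 2 * (cos t * sin t))"
    have dc2: "(c2 has_real_derivative - 2 * s2 t) (at t within A)" for t A
      unfolding c2_def s2_def by (auto intro!: derivative_eq_intros)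
    have ds2: "(s2 has_real_derivative 2 * c2 t) (at t within A)" for t A
      unfolding c2_def s2_def by (auto intro!: derivative_eq_intros simp: power2_eq_square algebra_simps)
    have cs: "c2 t * c2 t + s2 t * s2 t = 1" for t
    proof -
      have "(a\<^sup>2 - b\<^sup>2) * (a\<^sup>2 - b\<^sup>2) + 2 * (a * b) * (2 * (a * b)) = (a\<^sup>2 + b\<^sup>2)\<^sup>2" for a b :: real
        by (simp add: power2_eq_square algebra_simps)
      from this[of "cos t" "sin t"] show ?thesis by (simp add: c2_def s2_def)
    qed
    \<comment> \<open>An explicit antiderivative in terms of c2 = cos 2t and s2 = sin 2t. Its only
      non-periodic term is A1 t / 4, which accounts for the value A1 pi / 2.\<close>
    define G where "G = (\<lambda>t. A1 * (1/2 * s2 t + 1/4 * t + 1/8 * (s2 t * c2 t)) - A2 / 2 * (1/2 * c2 t + 1/8 * (c2 t * c2 t)))"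
    have "(G has_vector_derivative F 0 0 t) (at t within {0..2*pi})" for t
    proof -
      have "(G has_real_derivative A1 * (2 * c2 t / 2 + 1 / 4 + (s2 t * (- 2 * s2 t) + 2 * c2 t * c2 t) / 8)
         - A2 / 2 * (- 2 * s2 t / 2 + (c2 t * (- 2 * s2 t) + - 2 * s2 t * c2 t) / 8)) (at t within {0..2*pi})"
        unfolding G_def by (auto intro!: derivative_eq_intros dc2 ds2 simp: field_simps)
      moreover have "A1 * (2 * c2 t / 2 + 1 / 4 + (s2 t * (- 2 * s2 t) + 2 * c2 t * c2 t) / 8)
         - A2 / 2 * (- 2 * s2 t / 2 + (c2 t * (- 2 * s2 t) + - 2 * s2 t * c2 t) / 8) = F 0 0 t"
      proof -
        have "cos t * sin t = s2 t / 2" by (simp add: s2_def)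
        then have "F 0 0 t = (1 + c2 t / 2) * (A1 * c2 t + A2 * (s2 t / 2))"
          unfolding F0 w_def c2_def by simp
        moreover have "s2 t * s2 t = 1 - c2 t * c2 t" using cs[of t] by simp
        then have "A1 * (s2 t * s2 t) = A1 - A1 * (c2 t * c2 t)" by (simp only: right_diff_distrib mult_1_right)
        ultimately show ?thesis by (simp add: algebra_simps add_divide_distrib diff_divide_distrib)
      qed
      ultimately show ?thesis unfolding has_real_derivative_iff_has_vector_derivative by simp
    qed
    then have "((\<lambda>t. F 0 0 t) has_integral G (2*pi) - G 0) {0..2*pi}"
      by (intro fundamental_theorem_of_calculus) auto
    moreover have "G (2*pi) - G 0 = A1 * pi / 2" by (simp add: G_def s2_def c2_def algebra_simps)
    ultimately show ?thesis by simp
  qed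
  have "\<bar>A1 * pi / 2\<bar> \<le> \<eta> * (2 * pi)" if \<eta>: "\<eta> > 0" for \<eta>
  proof -
    define K where "K = {0..E0} \<times> {0..E0} \<times> {0..2*pi}"
    have "uniformly_continuous_on K (\<lambda>z. F (fst z) (fst (snd z)) (snd (snd z)))"
      unfolding K_def by (rule compact_uniformly_continuous[OF cF]) (intro compact_Times compact_Icc)
    then obtain d where d: "d > 0" "\<And>z z'. z \<in> K \<Longrightarrow> z' \<in> K \<Longrightarrow> dist z' z < d
        \<Longrightarrow> dist (F (fst z') (fst (snd z')) (snd (snd z'))) (F (fst z) (fst (snd z)) (snd (snd z))) < \<eta>"
      unfolding uniformly_continuous_on_def using \<eta> by blast
    define \<epsilon> where "\<epsilon> = min E0 (d / 3)"
    have \<epsilon>: "0 < \<epsilon>" "\<epsilon> \<le> E0" "\<epsilon> + \<epsilon> < d" using E0 d(1) by (auto simp: \<epsilon>_def)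
    \<comment> \<open>This normalisation turns the integrand into
      \<open>F \<xi> \<epsilon> t\<close>, uniformly close to \<open>F 0 0 t\<close>, while its
      integral is still zero.\<close>
    have "((\<lambda>t. - 3 / \<epsilon>^5 * \<psi> \<epsilon> t) has_integral - 3 / \<epsilon>^5 * 0) {0..2*pi}"
      by (rule has_integral_mult_right[OF int0[OF \<epsilon>(1,2)]])
    from has_integral_diff[OF intF this]
    have hi: "((\<lambda>t. F 0 0 t - - 3 / \<epsilon>^5 * \<psi> \<epsilon> t) has_integral A1 * pi / 2) (cbox 0 (2*pi))" by simp
    have "norm (A1 * pi / 2) \<le> \<eta> * measure lborel (cbox 0 (2*pi))"
    proof (rule has_integral_bound[OF _ hi])
      fix t assume "t \<in> cbox 0 (2*pi)"
      then have t: "t \<in> {0..2*pi}" by simp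
      obtain \<xi> where \<xi>: "\<xi> \<in> {0..\<epsilon>}" "\<psi> \<epsilon> t = - (\<epsilon>^5 / 3) * F \<xi> \<epsilon> t" using val[OF \<epsilon>(1,2)] by blast
      have "- 3 / \<epsilon>^5 * \<psi> \<epsilon> t = F \<xi> \<epsilon> t" unfolding \<xi>(2) using \<epsilon>(1) by simp
      moreover have "dist (0, 0, t) (\<xi>, \<epsilon>, t) < d"
      proof -
        have "dist (0, 0, t) (\<xi>, \<epsilon>, t) \<le> dist 0 \<xi> + (dist 0 \<epsilon> + dist t t)"
          unfolding dist_norm by (simp add: norm_Pair_le[THEN order_trans] norm_Pair)
            (metis abs_ge_zero order_trans real_sqrt_abs sqrt_sum_squares_le_sum_abs power2_abs)
        then show ?thesis using \<xi>(1) \<epsilon> by simp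
      qed
      then have "dist (F 0 0 t) (F \<xi> \<epsilon> t) < \<eta>" using d(2)[of "(\<xi>, \<epsilon>, t)" "(0, 0, t)"] \<xi>(1) \<epsilon> E0 t by (auto simp: K_def)
      ultimately show "norm (F 0 0 t - - 3 / \<epsilon>^5 * \<psi> \<epsilon> t) \<le> \<eta>" by (simp add: dist_norm)
    qed (use \<eta> in simp)
    then show ?thesis by simp
  qed
  note bound = this
  have "\<bar>A1\<bar> \<le> 0 + \<eta>" if "\<eta> > 0" for \<eta>
  proof -
    have "\<bar>A1\<bar> * pi \<le> \<eta> * pi" using bound[of "\<eta> / 4"] that by (simp add: abs_mult)
    from mult_right_le_imp_le[OF this pi_gt_zero] show ?thesis by simp
  qed
  then have "\<bar>A1\<bar> \<le> 0" by (rule field_le_epsilon)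
  then have "A1 = 0" by simp
  then show ?thesis by (simp add: A1_def Z_def f_def)
qed

text \<open>After normalising \<open>u\<close> and \<open>e\<close>, dimension three forces
  \<open>f\<close> to be a multiple of their cross product, which is the case already settled;
  vanishing vectors are trivial.\<close>

lemma Riem_origin_constant:
  assumes H: "torsion_free_spheres R0" and R0: "R0 > 0"
  shows "\<exists>k. \<forall>a b c. Riem g 0 a b c = k *\<^sub>R (ip g 0 b c *\<^sub>R a - ip g 0 a c *\<^sub>R b)"
proof (rule Riem_constant_at)
  have zB: "(0::real^3) \<in> B" using rho_pos by simp
  then show "0 \<in> B" .
  fix u e f :: "real^3"
  assume "ip g 0 u e = 0" "ip g 0 u f = 0" "ip g 0 e f = 0"
  then have o: "u \<bullet> e = 0" "u \<bullet> f = 0" "e \<bullet> f = 0" by (simp_all add: ip_origin)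
  note l = linear_scale[OF Riem_linear(1)[OF zB]] linear_scale[OF Riem_linear(2)[OF zB]] linear_scale[OF Riem_linear(3)[OF zB]]
    linear_0[OF Riem_linear(1)[OF zB]] linear_0[OF Riem_linear(2)[OF zB]]
  show "ip g 0 (Riem g 0 e u u) f = 0"
  proof (cases "u = 0 \<or> e = 0")
    case True
    then show ?thesis by (auto simp: l)
  next
    case False
    define x where "x = u /\<^sub>R norm u"
    define v where "v = e /\<^sub>R norm e"
    have x: "norm x = 1" "norm v = 1" "x \<bullet> v = 0" "u = norm u *\<^sub>R x" "e = norm e *\<^sub>R v" "f \<bullet> x = 0" "f \<bullet> v = 0"
      using False o by (auto simp: x_def v_def inner_commute)
    define k where "k = cross3 x v"
    have "(norm k)\<^sup>2 = 1" unfolding k_def using norm_cross_dot[of x v] x by simp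
    then have o': "x \<bullet> x = 1" "v \<bullet> v = 1" "k \<bullet> k = 1" "x \<bullet> v = 0" "x \<bullet> k = 0" "v \<bullet> k = 0"
      using x by (auto simp: dot_square_norm k_def dot_cross_self)
    have f: "f = (f \<bullet> k) *\<^sub>R k" using orthonormal_triple(1)[OF o', of f] x by simp
    have "Riem g 0 v x x \<bullet> k = 0" unfolding k_def by (rule curvature_origin_of_torsion_free[OF H R0 x(1-3)])
    then have "Riem g 0 e u u \<bullet> k = 0" by (subst x(5), subst (1 2) x(4)) (simp add: l)
    then show ?thesis by (subst f) (simp add: ip_origin)
  qed
qed

end

section \<open>Coordinates on a Riemannian manifold\<close>

lemma (in patch) patch_subset: "open S \<Longrightarrow> S \<subseteq> U \<Longrightarrow> patch S g"
  using smooth_on_subset[OF smooth_g] sym_g pos_g by unfold_locales blast+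

locale riemannian3 =
  fixes M :: "('a, 'z) riem_scheme"
  assumes manifold: "riemannian_3_manifold M"
begin

lemma chart_props:
  assumes "c \<in> charts M"
  shows openin_dom: "openin (rtop M) (chart_dom c)" and open_cod: "open (chart_cod c)"
    and homeo_chart: "homeomorphic_map (subtopology (rtop M) (chart_dom c)) (top_of_set (chart_cod c)) (chart_map c)"
  using assms manifold by (auto simp: riemannian_3_manifold_def smooth_atlas_def is_chart_def)

lemma dom_topspace: "c \<in> charts M \<Longrightarrow> chart_dom c \<subseteq> topspace (rtop M)"
  using openin_subset[OF openin_dom] .

lemma charts_atD: "c \<in> charts_at M p \<Longrightarrow> c \<in> charts M" "c \<in> charts_at M p \<Longrightarrow> p \<in> chart_dom c"
  by (auto simp: charts_at_def)

lemma charts_at_exists: assumes "p \<in> topspace (rtop M)" obtains c where "c \<in> charts_at M p"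
proof -
  have "(\<Union>c\<in>charts M. chart_dom c) = topspace (rtop M)"
    using manifold by (simp add: riemannian_3_manifold_def smooth_atlas_def)
  then show thesis using that assms unfolding charts_at_def by blast
qed

lemma inj_chart: assumes c: "c \<in> charts M" shows "inj_on (chart_map c) (chart_dom c)"
  using homeomorphic_imp_injective_map[OF homeo_chart[OF c]] dom_topspace[OF c] by (simp add: inf.absorb2)

lemma chart_inv_map: "c \<in> charts M \<Longrightarrow> p \<in> chart_dom c \<Longrightarrow> chart_inv c (chart_map c p) = p"
  unfolding chart_inv_def by (rule inv_into_f_f[OF inj_chart])

lemma chart_map_cod: "p \<in> chart_dom c \<Longrightarrow> chart_map c p \<in> chart_cod c"
  by (simp add: chart_cod_def)

lemma chart_inv_dom: "x \<in> chart_cod c \<Longrightarrow> chart_inv c x \<in> chart_dom c"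
  unfolding chart_inv_def chart_cod_def by (rule inv_into_into)

lemma chart_map_inv: "x \<in> chart_cod c \<Longrightarrow> chart_map c (chart_inv c x) = x"
  unfolding chart_inv_def chart_cod_def by (rule f_inv_into_f)

lemma charts_at_inv: "c \<in> charts M \<Longrightarrow> x \<in> chart_cod c \<Longrightarrow> c \<in> charts_at M (chart_inv c x)"
  by (simp add: charts_at_def chart_inv_dom)

lemma open_chart_image:
  assumes c: "c \<in> charts M" and W: "openin (rtop M) W" shows "open (chart_map c ` (chart_dom c \<inter> W))"
proof -
  have "openin (subtopology (rtop M) (chart_dom c)) (chart_dom c \<inter> W)" using W by (rule openin_subtopology_Int2)
  then have "openin (top_of_set (chart_cod c)) (chart_map c ` (chart_dom c \<inter> W))"
    using homeomorphic_imp_open_map[OF homeo_chart[OF c]] unfolding open_map_def by blast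
  then show ?thesis using open_cod[OF c] openin_open_eq by blast
qed

lemma openin_chart_preimage:
  assumes c: "c \<in> charts M" and S: "open S" shows "openin (rtop M) {p \<in> chart_dom c. chart_map c p \<in> S}"
proof -
  have t: "topspace (subtopology (rtop M) (chart_dom c)) = chart_dom c" using dom_topspace[OF c] by (simp add: inf.absorb2)
  have "openin (subtopology (rtop M) (chart_dom c)) {p \<in> topspace (subtopology (rtop M) (chart_dom c)). chart_map c p \<in> chart_cod c \<inter> S}"
    by (rule openin_continuous_map_preimage[OF homeomorphic_imp_continuous_map[OF homeo_chart[OF c]] openin_open_Int[OF S]])
  then have "openin (rtop M) {p \<in> topspace (subtopology (rtop M) (chart_dom c)). chart_map c p \<in> chart_cod c \<inter> S}"
    using openin_trans_full openin_dom[OF c] by blast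
  moreover have "{p \<in> topspace (subtopology (rtop M) (chart_dom c)). chart_map c p \<in> chart_cod c \<inter> S} = {p \<in> chart_dom c. chart_map c p \<in> S}"
    unfolding t by (auto simp: chart_map_cod)
  ultimately show ?thesis by simp
qed

lemma continuous_map_chart_inv:
  assumes c: "c \<in> charts M" and X: "continuous_on I X" and cod: "X ` I \<subseteq> chart_cod c"
  shows "continuous_map (top_of_set I) (rtop M) (\<lambda>s. chart_inv c (X s))"
proof -
  have "openin (top_of_set I) {s \<in> I. chart_inv c (X s) \<in> W}" if W: "openin (rtop M) W" for W
  proof -
    have "{s \<in> I. chart_inv c (X s) \<in> W} = I \<inter> X -` (chart_map c ` (chart_dom c \<inter> W))" (is "?L = ?R")
    proof
      show "?L \<subseteq> ?R"
      proof
        fix s assume s: "s \<in> ?L"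
        then have "X s \<in> chart_cod c" using cod by blast
        then have "X s = chart_map c (chart_inv c (X s))" "chart_inv c (X s) \<in> chart_dom c" by (simp_all add: chart_map_inv chart_inv_dom)
        then show "s \<in> ?R" using s by blast
      qed
      show "?R \<subseteq> ?L" using chart_inv_map[OF c] by force
    qed
    then show ?thesis using continuous_openin_preimage_gen[OF X open_chart_image[OF c W]] by simp
  qed
  moreover have "chart_inv c (X s) \<in> topspace (rtop M)" if "s \<in> I" for s
    using that cod chart_inv_dom dom_topspace[OF c] by blast
  ultimately show ?thesis by (auto simp: continuous_map_def)
qed

lemma curve_in_chart:
  assumes \<alpha>: "continuous_map (top_of_set I) (rtop M) \<alpha>" and t: "t \<in> I" and c: "c \<in> charts_at M (\<alpha> t)"
  obtains e where "e > 0" "\<And>s. s \<in> I \<Longrightarrow> dist s t < e \<Longrightarrow> \<alpha> s \<in> chart_dom c"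
proof -
  have "openin (top_of_set I) {s \<in> topspace (top_of_set I). \<alpha> s \<in> chart_dom c}"
    by (rule openin_continuous_map_preimage[OF \<alpha> openin_dom[OF charts_atD(1)[OF c]]])
  then have "\<exists>e>0. \<forall>s\<in>I. dist s t < e \<longrightarrow> s \<in> {s \<in> I. \<alpha> s \<in> chart_dom c}"
    using t charts_atD(2)[OF c] unfolding openin_euclidean_subtopology_iff by simp
  then show thesis using that by blast
qed

section \<open>Transition maps and tangent vectors\<close>

abbreviation "overlap c d \<equiv> chart_map c ` (chart_dom c \<inter> chart_dom d)"

lemma overlap_props:
  assumes c: "c \<in> charts M" and d: "d \<in> charts M"
  shows open_overlap: "open (overlap c d)" and overlap_cod: "overlap c d \<subseteq> chart_cod c"
    and smooth_transition: "smooth_on (transition c d) (overlap c d)"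
    and transition_cod: "transition c d ` overlap c d \<subseteq> chart_cod d"
  subgoal by (rule open_chart_image[OF c openin_dom[OF d]])
  subgoal by (auto simp: chart_cod_def)
  subgoal using c d manifold by (auto simp: riemannian_3_manifold_def smooth_atlas_def)
  subgoal by (auto simp: chart_inv_map[OF c] transition_def chart_map_cod)
  done

lemma chart_map_overlap: "c \<in> charts_at M p \<Longrightarrow> d \<in> charts_at M p \<Longrightarrow> chart_map c p \<in> overlap c d"
  by (auto simp: charts_at_def)

lemma transition_derivative:
  "c \<in> charts_at M p \<Longrightarrow> d \<in> charts_at M p \<Longrightarrow>
    (transition c d has_derivative fd (transition c d) (chart_map c p)) (at (chart_map c p))"
  by (rule smooth_on_has_derivative[OF smooth_transition chart_map_overlap]) (simp_all add: charts_atD)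

lemma linear_fd_transition:
  "c \<in> charts_at M p \<Longrightarrow> d \<in> charts_at M p \<Longrightarrow> linear (fd (transition c d) (chart_map c p))"
  by (rule has_derivative_linear[OF transition_derivative])

lemma fd_transition_self: assumes c: "c \<in> charts_at M p" shows "fd (transition c c) (chart_map c p) \<xi> = \<xi>"
proof -
  have "fd (transition c c) (chart_map c p) = fd (\<lambda>x. x) (chart_map c p)"
    by (rule fd_cong_open[OF open_overlap[of c c] chart_map_overlap[OF c c]])
      (use charts_atD(1)[OF c] in \<open>auto simp: transition_def chart_inv_map\<close>)
  also have "\<dots> = (\<lambda>x. x)" by (rule fd_eq) (rule has_derivative_ident)
  finally show ?thesis by simp
qed

lemma fd_transition_trans:
  assumes c: "c \<in> charts_at M p" and d: "d \<in> charts_at M p" and e: "e \<in> charts_at M p"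
  shows "fd (transition d e) (chart_map d p) (fd (transition c d) (chart_map c p) \<xi>) = fd (transition c e) (chart_map c p) \<xi>"
proof -
  have cm: "c \<in> charts M" and dm: "d \<in> charts M" using c d by (auto simp: charts_at_def)
  have tp: "transition c d (chart_map c p) = chart_map d p" using c by (simp add: transition_def chart_inv_map charts_atD)
  have "((\<lambda>x. transition d e (transition c d x)) has_derivative
      (\<lambda>h. fd (transition d e) (chart_map d p) (fd (transition c d) (chart_map c p) h))) (at (chart_map c p))"
    by (rule has_derivative_compose[OF transition_derivative[OF c d]]) (simp add: tp transition_derivative[OF d e])
  then have "fd (\<lambda>x. transition d e (transition c d x)) (chart_map c p) =
      (\<lambda>h. fd (transition d e) (chart_map d p) (fd (transition c d) (chart_map c p) h))" by (rule fd_eq)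
  moreover have "fd (\<lambda>x. transition d e (transition c d x)) (chart_map c p) = fd (transition c e) (chart_map c p)"
    by (rule fd_cong_open[OF open_overlap[OF cm dm] chart_map_overlap[OF c d]])
      (auto simp: transition_def chart_inv_map cm dm)
  ultimately show ?thesis by metis
qed

text \<open>For a chart \<open>c\<close> around \<open>p\<close> this inverts the evaluation of
  tangent vectors at \<open>c\<close>. It moves every statement about the manifold into the
  coordinates of a single chart.\<close>

definition tv :: "'a chart \<Rightarrow> 'a \<Rightarrow> real^3 \<Rightarrow> 'a tvec" where
  "tv c p \<xi> = (\<lambda>d. if d \<in> charts_at M p then fd (transition c d) (chart_map c p) \<xi> else 0)"

lemma coord_vec_tv: "coord_vec M c i p = tv c p (axis i 1)"
  by (simp add: coord_vec_def tv_def)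

lemma tv_self [simp]: "c \<in> charts_at M p \<Longrightarrow> tv c p \<xi> c = \<xi>"
  by (simp add: tv_def fd_transition_self)

lemma tv_in: "c \<in> charts_at M p \<Longrightarrow> tv c p \<xi> \<in> tangent_space M p"
  by (auto simp: tangent_space_def tv_def fd_transition_trans)

lemma tv_of: "v \<in> tangent_space M p \<Longrightarrow> c \<in> charts_at M p \<Longrightarrow> tv c p (v c) = v"
proof
  fix d assume v: "v \<in> tangent_space M p" and c: "c \<in> charts_at M p"
  then have "d \<in> charts_at M p \<Longrightarrow> v d = fd (transition c d) (chart_map c p) (v c)" "d \<notin> charts_at M p \<Longrightarrow> v d = 0"
    unfolding tangent_space_def by blast+
  then have "v d = (if d \<in> charts_at M p then fd (transition c d) (chart_map c p) (v c) else 0)" by simp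
  then show "tv c p (v c) d = v d" unfolding tv_def by (rule sym)
qed

lemma tangent_eqI: "u \<in> tangent_space M p \<Longrightarrow> v \<in> tangent_space M p \<Longrightarrow> c \<in> charts_at M p \<Longrightarrow> u c = v c \<Longrightarrow> u = v"
  using tv_of by metis

lemma tv_change: "c \<in> charts_at M p \<Longrightarrow> d \<in> charts_at M p \<Longrightarrow> tv d p (fd (transition c d) (chart_map c p) \<xi>) = tv c p \<xi>"
  by (rule ext) (simp add: tv_def fd_transition_trans)

lemma tv_lincomb:
  assumes c: "c \<in> charts_at M p"
  shows "(\<lambda>d. r *\<^sub>R tv c p a d + s *\<^sub>R tv c p b d) = tv c p (r *\<^sub>R a + s *\<^sub>R b)"
    and "(\<lambda>d. r *\<^sub>R tv c p a d) = tv c p (r *\<^sub>R a)" and "(\<lambda>d. 0) = tv c p 0"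
proof -
  note l = linear_fd_transition[OF c]
  show "(\<lambda>d. r *\<^sub>R tv c p a d + s *\<^sub>R tv c p b d) = tv c p (r *\<^sub>R a + s *\<^sub>R b)"
    by (rule ext) (simp add: tv_def linear_add[OF l] linear_scale[OF l])
  show "(\<lambda>d. r *\<^sub>R tv c p a d) = tv c p (r *\<^sub>R a)"
    by (rule ext) (simp add: tv_def linear_scale[OF l])
  show "(\<lambda>d. 0) = tv c p 0"
    by (rule ext) (simp add: tv_def linear_0[OF l])
qed

lemma lin_indep2_tv: assumes c: "c \<in> charts_at M p"
  shows "lin_indep2 (tv c p a) (tv c p b) \<longleftrightarrow> (\<forall>r s. r *\<^sub>R a + s *\<^sub>R b = 0 \<longrightarrow> r = 0 \<and> s = 0)"
proof -
  have "tv c p \<xi> = (\<lambda>d. 0) \<longleftrightarrow> \<xi> = 0" for \<xi>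
    using tv_self[OF c, of \<xi>] tv_lincomb(3)[OF c] by metis
  then show ?thesis by (simp add: lin_indep2_def tv_lincomb[OF c])
qed

lemma rmetric_tv:
  assumes c: "c \<in> charts_at M p"
  shows "rmetric M p (tv c p a) (tv c p b) = ip (metric_coeff M c) (chart_map c p) a b"
    and rmetric_sym: "rmetric M p (tv c p a) (tv c p b) = rmetric M p (tv c p b) (tv c p a)"
    and rmetric_pos: "a \<noteq> 0 \<Longrightarrow> rmetric M p (tv c p a) (tv c p a) > 0"
proof -
  have p: "p \<in> topspace (rtop M)" using c dom_topspace[of c] by (auto simp: charts_at_def)
  have ipt: "inner_product_on_tangent M p" using manifold p by (simp add: riemannian_3_manifold_def)
  note T = tv_in[OF c]
  have sym: "rmetric M p (tv c p a) (tv c p b) = rmetric M p (tv c p b) (tv c p a)" for a b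
    using ipt T unfolding inner_product_on_tangent_def by blast
  then show "rmetric M p (tv c p a) (tv c p b) = rmetric M p (tv c p b) (tv c p a)" .
  have lin: "rmetric M p (tv c p (r *\<^sub>R a + s *\<^sub>R b)) (tv c p w) = r * rmetric M p (tv c p a) (tv c p w) + s * rmetric M p (tv c p b) (tv c p w)" for r s a b w
    using ipt T unfolding inner_product_on_tangent_def tv_lincomb(1)[OF c, symmetric] by blast
  have l: "linear (\<lambda>a. rmetric M p (tv c p a) (tv c p w))" for w
    using lin[of 1 _ 1] lin[of _ _ 0 0] by (intro linearI) auto
  then have l2: "linear (\<lambda>b. rmetric M p (tv c p w) (tv c p b))" for w unfolding sym[of w] .
  have g: "rmetric M p (tv c p (axis i 1)) (tv c p (axis j 1)) = metric_coeff M c i j (chart_map c p)" for i j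
    using c by (simp add: metric_coeff_def coord_vec_tv chart_inv_map charts_atD)
  show "rmetric M p (tv c p a) (tv c p b) = ip (metric_coeff M c) (chart_map c p) a b"
  proof -
    have "rmetric M p (tv c p a) (tv c p b) = (\<Sum>i\<in>UNIV. a $ i * (\<Sum>j\<in>UNIV. b $ j * metric_coeff M c i j (chart_map c p)))"
      using linear_axis_expand[OF l[of b], of a] unfolding linear_axis_expand[OF l2, where a = b] g by simp
    then show ?thesis by (simp add: ip_def sum_distrib_left mult_ac)
  qed
  show "rmetric M p (tv c p a) (tv c p a) > 0" if "a \<noteq> 0"
  proof -
    have "tv c p a \<noteq> (\<lambda>d. 0)" using that tv_self[OF c, of a] by (metis)
    then show ?thesis using ipt T unfolding inner_product_on_tangent_def by blast
  qed
qed

lemma patch_chart: assumes c: "c \<in> charts M" shows "patch (chart_cod c) (metric_coeff M c)"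
proof
  show "open (chart_cod c)" by (rule open_cod[OF c])
  show "smooth_on (metric_coeff M c i j) (chart_cod c)" for i j
    using manifold c by (simp add: riemannian_3_manifold_def)
  fix x assume x: "x \<in> chart_cod c"
  note p = charts_at_inv[OF c x] and m = chart_map_inv[OF x]
  show "metric_coeff M c i j x = metric_coeff M c j i x" for i j
    by (simp add: metric_coeff_def coord_vec_tv rmetric_sym[OF p, of "axis i 1"])
  show "ip (metric_coeff M c) x \<xi> \<xi> > 0" if "\<xi> \<noteq> 0" for \<xi>
    using rmetric_pos[OF p that] by (simp add: rmetric_tv[OF p] m)
qed

text \<open>The metric is a function of tangent vectors, not of charts, and the differential of the
  transition map produces the components of the same tangent vector. All transformation laws then
  come from \<open>patch_isometry\<close>.\<close>

lemma isometry_transition: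
  assumes c: "c \<in> charts M" and d: "d \<in> charts M"
  shows "patch_isometry (overlap c d) (metric_coeff M c) (chart_cod d) (metric_coeff M d) (transition c d)"
proof -
  interpret p1: patch "overlap c d" "metric_coeff M c"
    by (rule patch.patch_subset[OF patch_chart[OF c] open_overlap[OF c d] overlap_cod[OF c d]])
  interpret p2: patch "chart_cod d" "metric_coeff M d" by (rule patch_chart[OF d])
  show ?thesis
  proof
    show "smooth_on (transition c d) (overlap c d)" by (rule smooth_transition[OF c d])
    show "transition c d ` overlap c d \<subseteq> chart_cod d" by (rule transition_cod[OF c d])
    fix x a b assume "x \<in> overlap c d"
    then obtain p where p: "x = chart_map c p" "p \<in> chart_dom c" "p \<in> chart_dom d" by blast
    have ca: "c \<in> charts_at M p" and da: "d \<in> charts_at M p" using p c d by (auto simp: charts_at_def)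
    have tr: "transition c d x = chart_map d p" using p by (simp add: transition_def chart_inv_map[OF c])
    show "ip (metric_coeff M d) (transition c d x) (fd (transition c d) x a) (fd (transition c d) x b) = ip (metric_coeff M c) x a b"
      unfolding tr rmetric_tv(1)[OF da, symmetric] unfolding p(1) tv_change[OF ca da] by (rule rmetric_tv(1)[OF ca])
  qed
qed

section \<open>Covariant derivative, curvature and space forms in charts\<close>

lemma christoffel_chr: "christoffel M c k i j x = chr (metric_coeff M c) k i j x"
  by (simp add: christoffel_def chr_def inverse_metric_coeff_def)

lemma cov_deriv_component:
  assumes c: "c \<in> charts_at M (\<alpha> t)"
  shows "cov_deriv M I \<alpha> V t c = covd (metric_coeff M c) (chart_map c (\<alpha> t)) (velocity M I \<alpha> t c)
     (V t c) (vector_derivative (\<lambda>s. V s c) (at t within I))"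
  using c by (simp add: cov_deriv_def covd_def Gam_def christoffel_chr vec_eq_iff)

lemma velocity_component:
  "c \<in> charts_at M (\<alpha> t) \<Longrightarrow> velocity M I \<alpha> t c = vector_derivative (\<lambda>s. chart_map c (\<alpha> s)) (at t within I)"
  by (simp add: velocity_def o_def)

lemma curv_coeff_Riem:
  assumes c: "c \<in> charts M" and x: "x \<in> chart_cod c"
  shows "curv_coeff M c l i j k x = Riem (metric_coeff M c) x (axis i 1) (axis j 1) (axis k 1) $ l"
proof -
  interpret patch "chart_cod c" "metric_coeff M c" by (rule patch_chart[OF c])
  have ax: "Gam (metric_coeff M c) y (axis j 1) (axis k 1) $ l = chr (metric_coeff M c) l j k y" for j k l y
    by (simp add: Gam_def axis_def if_distrib[of "(*) _"] if_distrib[of "\<lambda>z. z * _"] sum.delta cong: if_cong)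
  have G: "Gam (metric_coeff M c) y (axis i 1) v $ l = (\<Sum>m\<in>UNIV. chr (metric_coeff M c) l i m y * v $ m)" for i v l y
  proof -
    have "linear (\<lambda>v. Gam (metric_coeff M c) y (axis i 1) v $ l)" by (intro linearI) auto
    from linear_axis_expand[OF this, of v] show ?thesis by (simp add: ax mult.commute)
  qed
  have fdn: "fd (\<lambda>y. Gam (metric_coeff M c) y (axis j 1) (axis k 1)) x (axis i 1) $ l = partial i (chr (metric_coeff M c) l j k) x" for i j
  proof -
    have "smooth_on (\<lambda>y. Gam (metric_coeff M c) y (axis j 1) (axis k 1)) (chart_cod c)"
      by (intro smooth_on_Gam smooth_on_ident smooth_on_const open_U) simp
    from bounded_linear.has_derivative[OF bounded_linear_vec_nth[of l] smooth_on_has_derivative[OF this x]]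
    have "fd (\<lambda>y. Gam (metric_coeff M c) y (axis j 1) (axis k 1) $ l) x = (\<lambda>h. fd (\<lambda>y. Gam (metric_coeff M c) y (axis j 1) (axis k 1)) x h $ l)"
      by (rule fd_eq)
    then show ?thesis by (simp add: partial_def ax)
  qed
  show ?thesis
    by (simp add: curv_coeff_def Riem_def fdn G[of _ _ "Gam _ _ _ _"] ax christoffel_chr[abs_def] sum_subtractf)
qed

text \<open>\<open>riem_curv\<close> is given by a separate formula in each chart; that the values
  form one tangent vector is the tensor law \<open>Riem_transform\<close>.\<close>

lemma riem_curv_tv:
  assumes c: "c \<in> charts_at M p"
  shows "riem_curv M p (tv c p u) (tv c p v) (tv c p w) = tv c p (Riem (metric_coeff M c) (chart_map c p) u v w)"
proof
  fix d
  show "riem_curv M p (tv c p u) (tv c p v) (tv c p w) d = tv c p (Riem (metric_coeff M c) (chart_map c p) u v w) d"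
  proof (cases "d \<in> charts_at M p")
    case d: True
    note dm = charts_atD(1)[OF d] and cm = charts_atD(1)[OF c]
    interpret d: patch "chart_cod d" "metric_coeff M d" by (rule patch_chart[OF dm])
    interpret i: patch_isometry "overlap c d" "metric_coeff M c" "chart_cod d" "metric_coeff M d" "transition c d"
      by (rule isometry_transition[OF cm dm])
    have x: "chart_map d p \<in> chart_cod d" by (rule chart_map_cod[OF charts_atD(2)[OF d]])
    have t: "transition c d (chart_map c p) = chart_map d p" using c by (simp add: transition_def chart_inv_map charts_atD)
    let ?a = "\<lambda>u. fd (transition c d) (chart_map c p) u"
    have "riem_curv M p (tv c p u) (tv c p v) (tv c p w) d = Riem (metric_coeff M d) (chart_map d p) (?a u) (?a v) (?a w)"
      unfolding riem_curv_def d.Riem_expand[OF x, of "?a u" "?a v" "?a w"]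
      using d by (simp add: vec_eq_iff curv_coeff_Riem[OF dm x] tv_def mult_ac)
    also have "\<dots> = ?a (Riem (metric_coeff M c) (chart_map c p) u v w)"
      unfolding t[symmetric] by (rule i.Riem_transform[OF chart_map_overlap[OF c d], symmetric])
    finally show ?thesis using d by (simp add: tv_def)
  qed (simp_all add: riem_curv_def tv_def)
qed

text \<open>Sectional curvature is only prescribed on independent pairs. On dependent ones both
  sides of the polynomial identity vanish, so it holds for all pairs and polarisation determines the
  full curvature.\<close>

lemma space_form_iff:
  "space_form M \<longleftrightarrow> (\<exists>K. \<forall>c\<in>charts M. \<forall>x\<in>chart_cod c. \<forall>u v w.
     Riem (metric_coeff M c) x u v w = K *\<^sub>R (ip (metric_coeff M c) x v w *\<^sub>R u - ip (metric_coeff M c) x u w *\<^sub>R v))"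
  (is "_ \<longleftrightarrow> (\<exists>K. \<forall>c\<in>charts M. \<forall>x\<in>chart_cod c. ?P K c x)")
proof -
  have sec: "sectional_curv M p (tv c p u) (tv c p v) = (let g = metric_coeff M c; x = chart_map c p in
      ip g x (Riem g x u v v) u / (ip g x u u * ip g x v v - (ip g x u v)\<^sup>2))" if "c \<in> charts_at M p" for c p u v
    by (simp add: sectional_curv_def riem_curv_tv[OF that] rmetric_tv(1)[OF that] Let_def)
  have gram: "ip (metric_coeff M c) x u u * ip (metric_coeff M c) x v v - (ip (metric_coeff M c) x u v)\<^sup>2 \<noteq> 0"
    if c: "c \<in> charts M" and x: "x \<in> chart_cod c" and li: "\<forall>r s. r *\<^sub>R u + s *\<^sub>R v = 0 \<longrightarrow> r = 0 \<and> s = 0" for c x u v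
  proof
    interpret patch "chart_cod c" "metric_coeff M c" by (rule patch_chart[OF c])
    let ?i = "ip (metric_coeff M c) x"
    assume e: "?i u u * ?i v v - (?i u v)\<^sup>2 = 0"
    have v0: "?i v v > 0" using li[rule_format, of 0 1] by (intro pos_g[OF x]) auto
    \<comment> \<open>The square of the part of \<open>u\<close> orthogonal to \<open>v\<close>,
      scaled by the square of \<open>v\<close>: strict Cauchy-Schwarz for an independent
      pair.\<close>
    have "?i (?i v v *\<^sub>R u - ?i u v *\<^sub>R v) (?i v v *\<^sub>R u - ?i u v *\<^sub>R v) = ?i v v * (?i u u * ?i v v - (?i u v)\<^sup>2)"
      using ip_commute[OF x, of v u] by (simp add: power2_eq_square algebra_simps)
    then have "?i (?i v v *\<^sub>R u - ?i u v *\<^sub>R v) (?i v v *\<^sub>R u - ?i u v *\<^sub>R v) = 0" unfolding e by simp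
    then have "?i v v *\<^sub>R u - ?i u v *\<^sub>R v = 0" unfolding ip_eq_0[OF x] .
    then have "?i v v *\<^sub>R u + (- ?i u v) *\<^sub>R v = 0" by simp
    then show False using li v0 by fastforce
  qed
  have 1: "\<exists>K. \<forall>c\<in>charts M. \<forall>x\<in>chart_cod c. ?P K c x" if sf: "space_form M"
  proof -
    obtain K where K: "\<And>p u v. p \<in> topspace (rtop M) \<Longrightarrow> u \<in> tangent_space M p \<Longrightarrow> v \<in> tangent_space M p \<Longrightarrow> lin_indep2 u v \<Longrightarrow> sectional_curv M p u v = K"
      using sf unfolding space_form_def by blast
    have "?P K c x" if c: "c \<in> charts M" and x: "x \<in> chart_cod c" for c x
    proof -
      interpret patch "chart_cod c" "metric_coeff M c" by (rule patch_chart[OF c])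
      note ca = charts_at_inv[OF c x] and m = chart_map_inv[OF x]
      have pt: "chart_inv c x \<in> topspace (rtop M)" using chart_inv_dom[OF x] dom_topspace[OF c] by blast
      let ?i = "ip (metric_coeff M c) x" and ?R = "Riem (metric_coeff M c) x"
      have s: "?i (?R u v v) u = K * (?i u u * ?i v v - (?i u v)\<^sup>2)" for u v
      proof (cases "\<forall>r s. r *\<^sub>R u + s *\<^sub>R v = 0 \<longrightarrow> r = 0 \<and> s = 0")
        case True
        have "?i (?R u v v) u / (?i u u * ?i v v - (?i u v)\<^sup>2) = K"
          using K[OF pt tv_in[OF ca] tv_in[OF ca] lin_indep2_tv[OF ca, THEN iffD2, OF True]] by (simp add: sec[OF ca] m Let_def)
        then show ?thesis using gram[OF c x True] by (simp add: field_simps)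
      next
        case False
        then obtain r s where rs: "r *\<^sub>R u + s *\<^sub>R v = 0" "r \<noteq> 0 \<or> s \<noteq> 0" by blast
        have z: "?R a a b = 0" "?R a 0 b = 0" "?R 0 a b = 0" for a b
          using Riem_skew[of "metric_coeff M c" x a a b] linear_0[OF Riem_linear(1)[OF x]] linear_0[OF Riem_linear(2)[OF x]] by (simp_all add: vec_eq_iff)
        show ?thesis
        proof (cases "s = 0")
          case True
          then have "u = 0" using rs by auto
          then show ?thesis by (simp add: z)
        next
          case False
          have "v = (- r / s) *\<^sub>R u"
          proof -
            have "s *\<^sub>R v = (- r) *\<^sub>R u" using rs(1) by (simp add: eq_neg_iff_add_eq_0 add.commute)
            then have "(1 / s) *\<^sub>R (s *\<^sub>R v) = (1 / s) *\<^sub>R ((- r) *\<^sub>R u)" by simp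
            then show ?thesis using False by simp
          qed
          then obtain k where "v = k *\<^sub>R u" by blast
          then show ?thesis
            by (simp add: linear_scale[OF Riem_linear(2)[OF x]] z power2_eq_square)
        qed
      qed
      show ?thesis by (intro allI) (rule Riem_constant_at_of_sectional[OF x s])
    qed
    then show ?thesis by blast
  qed
  have 2: "space_form M" if "\<forall>c\<in>charts M. \<forall>x\<in>chart_cod c. ?P K c x" for K
    unfolding space_form_def
  proof (intro exI[of _ K] ballI impI)
    fix p u v assume p: "p \<in> topspace (rtop M)" and u: "u \<in> tangent_space M p" and v: "v \<in> tangent_space M p" and li: "lin_indep2 u v"
    obtain c where c: "c \<in> charts_at M p" using charts_at_exists[OF p] .
    note cm = charts_atD(1)[OF c] and x = chart_map_cod[OF charts_atD(2)[OF c]]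
    interpret patch "chart_cod c" "metric_coeff M c" by (rule patch_chart[OF cm])
    have li': "\<forall>r s. r *\<^sub>R u c + s *\<^sub>R v c = 0 \<longrightarrow> r = 0 \<and> s = 0"
      using li unfolding lin_indep2_tv[OF c, of "u c" "v c", symmetric] tv_of[OF u c] tv_of[OF v c] .
    let ?i = "ip (metric_coeff M c) (chart_map c p)" and ?R = "Riem (metric_coeff M c) (chart_map c p)"
    have R: "?R (u c) (v c) (v c) = K *\<^sub>R (?i (v c) (v c) *\<^sub>R u c - ?i (u c) (v c) *\<^sub>R v c)"
      using that cm x by blast
    have "?i (?R (u c) (v c) (v c)) (u c) = K * (?i (u c) (u c) * ?i (v c) (v c) - (?i (u c) (v c))\<^sup>2)"
      using ip_commute[OF x, of "v c" "u c"] by (simp add: R power2_eq_square algebra_simps)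
    then have "sectional_curv M p (tv c p (u c)) (tv c p (v c)) = K"
      using gram[OF cm x li'] by (simp add: sec[OF c] Let_def)
    then show "sectional_curv M p u v = K" unfolding tv_of[OF u c] tv_of[OF v c] .
  qed
  show ?thesis using 1 2 by blast
qed

end

section \<open>Curves and geodesics on a Riemannian manifold\<close>

text \<open>Curves on a closed interval are differentiated within it, one-sidedly at the ends. If a
  curve coincides there with a smooth map on an open set, these derivatives are the ordinary
  ones.\<close>

lemma iter_vderiv_smooth:
  fixes y :: "real \<Rightarrow> 'b::real_normed_vector"
  assumes J: "open J" and y: "smooth_on y J" and ab: "a < b" and f: "\<And>s. s \<in> {a..b} \<inter> J \<Longrightarrow> f s = y s"
  shows "smooth_on (iter_vderiv j UNIV y) J"
    and "s \<in> {a..b} \<inter> J \<Longrightarrow> iter_vderiv j {a..b} f s = iter_vderiv j UNIV y s"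
    and "s \<in> {a..b} \<inter> J \<Longrightarrow> (iter_vderiv j {a..b} f has_vector_derivative iter_vderiv (Suc j) UNIV y s) (at s within {a..b})"
proof -
  have sm: "smooth_on (iter_vderiv j UNIV y) J" for j
    by (induction j) (simp_all add: y smooth_on_real_derivative(2)[OF J])
  have step: "(iter_vderiv j {a..b} f has_vector_derivative iter_vderiv (Suc j) UNIV y s) (at s within {a..b})"
    if eq: "\<And>s. s \<in> {a..b} \<inter> J \<Longrightarrow> iter_vderiv j {a..b} f s = iter_vderiv j UNIV y s" and s: "s \<in> {a..b} \<inter> J" for j s
  proof -
    obtain e where e: "e > 0" "ball s e \<subseteq> J" using J s open_contains_ball by blast
    have "(iter_vderiv j UNIV y has_vector_derivative iter_vderiv (Suc j) UNIV y s) (at s within {a..b})"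
      using smooth_on_real_derivative(1)[OF J sm[of j], of s] s by (simp add: has_vector_derivative_at_within)
    then show ?thesis
    proof (rule has_vector_derivative_transform_within[OF _ e(1)])
      fix r assume "r \<in> {a..b}" "dist r s < e"
      then have "r \<in> {a..b} \<inter> J" using e(2) by (auto simp: dist_commute)
      then show "iter_vderiv j UNIV y r = iter_vderiv j {a..b} f r" by (rule eq[symmetric])
    qed (use s in blast)
  qed
  have eq: "iter_vderiv j {a..b} f s = iter_vderiv j UNIV y s" if "s \<in> {a..b} \<inter> J" for j s
    using that
  proof (induction j arbitrary: s)
    case 0 then show ?case using f by simp
  next
    case (Suc j)
    show ?case using vector_derivative_within_cbox[of a b s, OF _ _ step[OF Suc.IH Suc.prems, simplified box_real(2)[symmetric]]] ab Suc.prems by simp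
  qed
  show "smooth_on (iter_vderiv j UNIV y) J" by (rule sm)
  show "s \<in> {a..b} \<inter> J \<Longrightarrow> iter_vderiv j {a..b} f s = iter_vderiv j UNIV y s" by (rule eq)
  show "s \<in> {a..b} \<inter> J \<Longrightarrow> (iter_vderiv j {a..b} f has_vector_derivative iter_vderiv (Suc j) UNIV y s) (at s within {a..b})"
    by (rule step[OF eq])
qed

lemma vector_derivative_interval:
  fixes a b :: real
  assumes "a < b" "t \<in> {a..b}" "(f has_vector_derivative f') (at t within {a..b})"
  shows "vector_derivative f (at t within {a..b}) = f'"
  using vector_derivative_within_cbox[of a b t f f'] assms by simp

text \<open>Forward in time exp (- C t) w is nonincreasing, and exp (C t) w is nondecreasing, which
  settles times before \<open>s\<close>.\<close>

lemma zero_of_linear_bound: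
  fixes w :: "real \<Rightarrow> real"
  assumes T: "convex T" "s \<in> T" "s' \<in> T" and w: "\<And>t. t \<in> T \<Longrightarrow> (w has_real_derivative w' t) (at t within T)"
    and bd: "\<And>t. t \<in> T \<Longrightarrow> \<bar>w' t\<bar> \<le> C * w t" and nn: "\<And>t. t \<in> T \<Longrightarrow> w t \<ge> 0" and 0: "w s = 0"
  shows "w s' = 0"
proof -
  have sub: "{p..q} \<subseteq> T" if "p \<in> T" "q \<in> T" for p q :: real
    using T(1) that by (metis convex_contains_segment closed_segment_eq_real_ivl atLeastatMost_empty_iff empty_subsetI)
  have D: "((\<lambda>t. exp (\<epsilon> * C * t) * w t) has_real_derivative exp (\<epsilon> * C * t) * (\<epsilon> * C * w t + w' t)) (at t)"
    if t: "{p..q} \<subseteq> T" "p < t" "t < q" for p q t \<epsilon>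
  proof -
    have "(w has_real_derivative w' t) (at t within {p<..<q})"
      by (rule DERIV_subset[OF w]) (use t in \<open>auto simp: subset_iff\<close>)
    then have "(w has_real_derivative w' t) (at t)" using t by (simp add: at_within_open[OF _ open_greaterThanLessThan])
    then show ?thesis by (auto intro!: derivative_eq_intros simp: algebra_simps)
  qed
  have con: "continuous_on {p..q} (\<lambda>t. exp (\<epsilon> * C * t) * w t)" if "{p..q} \<subseteq> T" for p q \<epsilon>
    by (intro continuous_intros continuous_on_subset[OF DERIV_continuous_on that]) (rule w)
  consider "s \<le> s'" | "s' \<le> s" by linarith
  then show ?thesis
  proof cases
    case 1
    note S = sub[OF T(2,3)]
    have "exp (- 1 * C * s) * w s \<ge> exp (- 1 * C * s') * w s'"
    proof (rule DERIV_nonpos_imp_decreasing_open[OF 1 _ con[OF S]])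
      fix t assume t: "s < t" "t < s'"
      then have "t \<in> T" using S by auto
      then have "exp (- 1 * C * t) * (- 1 * C * w t + w' t) \<le> 0" using bd[of t] by (intro mult_nonneg_nonpos) auto
      then show "\<exists>y. ((\<lambda>t. exp (- 1 * C * t) * w t) has_real_derivative y) (at t) \<and> y \<le> 0" using D[OF S t] by blast
    qed
    then have "w s' \<le> 0" by (simp add: 0 mult_le_0_iff)
    then show ?thesis using nn[OF T(3)] by simp
  next
    case 2
    note S = sub[OF T(3,2)]
    have "exp (1 * C * s') * w s' \<le> exp (1 * C * s) * w s"
    proof (rule DERIV_nonneg_imp_increasing_open[OF 2 _ con[OF S]])
      fix t assume t: "s' < t" "t < s"
      then have "t \<in> T" using S by auto
      then have "exp (1 * C * t) * (1 * C * w t + w' t) \<ge> 0" using bd[of t] by (intro mult_nonneg_nonneg) auto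
      then show "\<exists>y. ((\<lambda>t. exp (1 * C * t) * w t) has_real_derivative y) (at t) \<and> y \<ge> 0" using D[OF S t] by blast
    qed
    then have "w s' \<le> 0" by (simp add: 0 mult_le_0_iff)
    then show ?thesis using nn[OF T(3)] by simp
  qed
qed

text \<open>The squared distance of two solutions satisfies the linear bound with constant 2 L. In
  contrast to \<open>ode_unique\<close>, neither the length of the interval nor the Lipschitz
  constant has to be small.\<close>

lemma autonomous_ode_unique:
  fixes z1 z2 :: "real \<Rightarrow> 'a::euclidean_space"
  assumes T: "convex T" "s \<in> T" "s' \<in> T" and K: "\<And>t. t \<in> T \<Longrightarrow> z1 t \<in> K" "\<And>t. t \<in> T \<Longrightarrow> z2 t \<in> K"
    and L: "\<And>x y. x \<in> K \<Longrightarrow> y \<in> K \<Longrightarrow> norm (F x - F y) \<le> L * norm (x - y)"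
    and z: "\<And>t. t \<in> T \<Longrightarrow> (z1 has_vector_derivative F (z1 t)) (at t within T)"
      "\<And>t. t \<in> T \<Longrightarrow> (z2 has_vector_derivative F (z2 t)) (at t within T)"
    and eq: "z1 s = z2 s"
  shows "z1 s' = z2 s'"
proof -
  let ?d = "\<lambda>t. z1 t - z2 t" and ?e = "\<lambda>t. F (z1 t) - F (z2 t)"
  have "?d s' \<bullet> ?d s' = 0"
  proof (rule zero_of_linear_bound[OF T])
    fix t assume t: "t \<in> T"
    have "(?d has_vector_derivative ?e t) (at t within T)" by (intro derivative_intros z t)
    from bounded_bilinear.has_vector_derivative[OF bounded_bilinear_inner this this]
    show "((\<lambda>t. ?d t \<bullet> ?d t) has_real_derivative 2 * (?d t \<bullet> ?e t)) (at t within T)"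
      by (simp add: has_real_derivative_iff_has_vector_derivative inner_commute[of "?e t" "?d t"])
    have "\<bar>?d t \<bullet> ?e t\<bar> \<le> norm (?d t) * norm (?e t)" by (rule Cauchy_Schwarz_ineq2)
    also have "\<dots> \<le> norm (?d t) * (L * norm (?d t))" by (intro mult_left_mono L K t) simp
    finally show "\<bar>2 * (?d t \<bullet> ?e t)\<bar> \<le> (2 * L) * (?d t \<bullet> ?d t)"
      by (simp add: dot_square_norm power2_eq_square mult_ac)
  qed (simp_all add: eq)
  then show ?thesis by simp
qed

context riemannian3
begin

lemma chart_curve_smooth:
  assumes c: "c \<in> charts M" and J: "open J" and X: "smooth_on X J" "X ` J \<subseteq> chart_cod c"
    and t: "t \<in> J" and d: "d \<in> charts_at M (chart_inv c (X t))"
  shows "open (J \<inter> X -` overlap c d)" and "smooth_on (chart_map d \<circ> (\<lambda>s. chart_inv c (X s))) (J \<inter> X -` overlap c d)"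
    and "t \<in> J \<inter> X -` overlap c d"
proof -
  note dm = charts_atD(1)[OF d]
  show oJ: "open (J \<inter> X -` overlap c d)"
    by (rule continuous_open_preimage[OF smooth_on_imp_continuous[OF X(1)] J open_overlap[OF c dm]])
  have "smooth_on (\<lambda>s. transition c d (X s)) (J \<inter> X -` overlap c d)"
    by (rule smooth_on_compose[OF oJ open_overlap[OF c dm] _ smooth_transition[OF c dm] smooth_on_subset[OF X(1)]]) auto
  then show "smooth_on (chart_map d \<circ> (\<lambda>s. chart_inv c (X s))) (J \<inter> X -` overlap c d)" by (simp add: transition_def o_def)
  have "X t \<in> chart_cod c" using t X(2) by blast
  then have "X t \<in> overlap c d" using chart_map_overlap[OF charts_at_inv[OF c] d] by (simp add: chart_map_inv)
  then show "t \<in> J \<inter> X -` overlap c d" using t by auto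
qed

lemma Ck_curve_smooth:
  assumes c: "c \<in> charts M" and ab: "a < b" and J: "open J" "{a..b} \<subseteq> J" and X: "smooth_on X J" "X ` J \<subseteq> chart_cod c"
  shows "Ck_curve M k {a..b} (\<lambda>s. chart_inv c (X s))"
  unfolding Ck_curve_def
proof (intro conjI ballI)
  show "continuous_map (top_of_set {a..b}) (rtop M) (\<lambda>s. chart_inv c (X s))"
    by (rule continuous_map_chart_inv[OF c]) (use J(2) X(2) continuous_on_subset[OF smooth_on_imp_continuous[OF X(1)]] in auto)
  fix t d assume t: "t \<in> {a..b}" and d: "d \<in> charts_at M (chart_inv c (X t))"
  have tJ: "t \<in> J" using t J(2) by blast
  note S = chart_curve_smooth[OF c J(1) X tJ d]
  let ?f = "chart_map d \<circ> (\<lambda>s. chart_inv c (X s))"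
  note I = iter_vderiv_smooth(3)[OF S(1,2) ab refl IntI[OF t S(3)]]
  show "continuous (at t within {a..b}) (iter_vderiv k {a..b} ?f)"
    by (rule has_vector_derivative_continuous[OF I])
  show "\<forall>j<k. iter_vderiv j {a..b} ?f differentiable at t within {a..b}"
    using I differentiableI_vector by blast
qed

text \<open>Both one-sided derivatives at the ends are ordinary derivatives of a periodic curve at
  parameters one period apart.\<close>

lemma closed_curve_smooth:
  assumes c: "c \<in> charts M" and l: "0 < l" and X: "smooth_on X UNIV" "range X \<subseteq> chart_cod c" and per: "\<And>s. X (s + l) = X s"
  shows "closed_C3_curve M 0 l (\<lambda>s. chart_inv c (X s))"
proof -
  have p: "iter_vderiv k UNIV f (s + l) = iter_vderiv k UNIV f s" if "\<And>s. f (s + l) = f s" for k s and f :: "real \<Rightarrow> real^3"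
  proof (induction k arbitrary: s)
    case (Suc k)
    show ?case using vector_derivative_periodic[of "iter_vderiv k UNIV f" l s] Suc by simp
  qed (simp add: that)
  have "iter_vderiv k {0..l} (chart_map d \<circ> (\<lambda>s. chart_inv c (X s))) 0 = iter_vderiv k {0..l} (chart_map d \<circ> (\<lambda>s. chart_inv c (X s))) l"
    if d: "d \<in> charts_at M (chart_inv c (X 0))" for d k
  proof -
    note S = chart_curve_smooth[OF c open_UNIV X UNIV_I d]
    have Xl: "X l = X 0" using per[of 0] by simp
    have "0 \<in> {0..l} \<inter> (UNIV \<inter> X -` overlap c d)" "l \<in> {0..l} \<inter> (UNIV \<inter> X -` overlap c d)" using S(3) l Xl by auto
    note I = this[THEN iter_vderiv_smooth(2)[OF S(1,2) l refl]]
    show ?thesis unfolding I using p[of "chart_map d \<circ> (\<lambda>s. chart_inv c (X s))" k 0] per by simp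
  qed
  moreover have "Ck_curve M 3 {0..l} (\<lambda>s. chart_inv c (X s))" by (rule Ck_curve_smooth[OF c l open_UNIV _ X]) simp
  moreover have "X 0 = X l" using per[of 0] by simp
  ultimately show ?thesis using l unfolding closed_C3_curve_def by simp
qed

context
  fixes a b :: real and \<alpha> :: "real \<Rightarrow> 'a"
  assumes ab: "a < b" and cont: "continuous_map (top_of_set {a..b}) (rtop M) \<alpha>"
begin

lemma chart_curve_derivative:
  assumes t: "t \<in> {a..b}" and c: "c \<in> charts_at M (\<alpha> t)" and d: "d \<in> charts_at M (\<alpha> t)"
    and x': "((\<lambda>s. chart_map c (\<alpha> s)) has_vector_derivative x') (at t within {a..b})"
  shows "((\<lambda>s. chart_map d (\<alpha> s)) has_vector_derivative fd (transition c d) (chart_map c (\<alpha> t)) x') (at t within {a..b})"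
proof -
  interpret i: patch_isometry "overlap c d" "metric_coeff M c" "chart_cod d" "metric_coeff M d" "transition c d"
    using isometry_transition c d charts_atD(1) by blast
  obtain e where e: "e > 0" "\<And>s. s \<in> {a..b} \<Longrightarrow> dist s t < e \<Longrightarrow> \<alpha> s \<in> chart_dom c"
    using curve_in_chart[OF cont t c] by blast
  from i.cov_transform(1)[OF x' chart_map_overlap[OF c d] x' t]
  show ?thesis
    by (rule has_vector_derivative_transform_within[OF _ e(1) t])
      (simp add: transition_def chart_inv_map charts_atD(1)[OF c] e(2))
qed

lemma velocity_tv:
  assumes t: "t \<in> {a..b}" and c: "c \<in> charts_at M (\<alpha> t)"
    and x': "((\<lambda>s. chart_map c (\<alpha> s)) has_vector_derivative x') (at t within {a..b})"
  shows "velocity M {a..b} \<alpha> t = tv c (\<alpha> t) x'"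
  using vector_derivative_interval[OF ab t chart_curve_derivative[OF t c _ x']]
  by (intro ext) (simp add: velocity_def tv_def o_def)

text \<open>Differentiability in one chart \<open>c\<close> suffices: on the overlap the components
  in \<open>d\<close> are the image under the transition isometry, so \<open>cov_transform\<close>
  gives their derivative.\<close>

lemma field_derivative:
  assumes t: "t \<in> {a..b}" and c: "c \<in> charts_at M (\<alpha> t)" and d: "d \<in> charts_at M (\<alpha> t)"
    and x': "((\<lambda>s. chart_map c (\<alpha> s)) has_vector_derivative x') (at t within {a..b})"
    and V: "\<And>s. s \<in> {a..b} \<Longrightarrow> V s \<in> tangent_space M (\<alpha> s)"
    and w: "((\<lambda>s. V s c) has_vector_derivative w) (at t within {a..b})"
  shows "((\<lambda>s. V s d) has_vector_derivative
     (fd (transition c d) (chart_map c (\<alpha> t)) (covd (metric_coeff M c) (chart_map c (\<alpha> t)) x' (V t c) w)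
      - Gam (metric_coeff M d) (chart_map d (\<alpha> t)) (fd (transition c d) (chart_map c (\<alpha> t)) x') (V t d))) (at t within {a..b})"
proof -
  interpret i: patch_isometry "overlap c d" "metric_coeff M c" "chart_cod d" "metric_coeff M d" "transition c d"
    using isometry_transition c d charts_atD(1) by blast
  obtain e where e: "e > 0" "\<And>s. s \<in> {a..b} \<Longrightarrow> dist s t < e \<Longrightarrow> \<alpha> s \<in> chart_dom c"
    using curve_in_chart[OF cont t c] by blast
  obtain e' where e': "e' > 0" "\<And>s. s \<in> {a..b} \<Longrightarrow> dist s t < e' \<Longrightarrow> \<alpha> s \<in> chart_dom d"
    using curve_in_chart[OF cont t d] by blast
  have m: "0 < min e e'" using e(1) e'(1) by simp
  have at: "transition c d (chart_map c (\<alpha> t)) = chart_map d (\<alpha> t)"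
    using c by (simp add: transition_def chart_inv_map charts_atD)
  have Vd: "fd (transition c d) (chart_map c (\<alpha> s)) (V s c) = V s d" if s: "s \<in> {a..b}" "dist s t < min e e'" for s
  proof -
    have cd: "c \<in> charts_at M (\<alpha> s)" "d \<in> charts_at M (\<alpha> s)"
      using e(2)[OF s(1)] e'(2)[OF s(1)] s(2) c d by (auto simp: charts_at_def)
    show ?thesis using fun_cong[OF tv_of[OF V[OF s(1)] cd(1)], of d] cd(2) by (simp add: tv_def)
  qed
  have Vt: "fd (transition c d) (chart_map c (\<alpha> t)) (V t c) = V t d" by (rule Vd[OF t]) (use m in simp)
  from has_vector_derivative_transform_within[OF i.cov_transform(2)[OF x' chart_map_overlap[OF c d] w t] m t Vd]
  show ?thesis unfolding at Vt covd_def .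
qed

lemma cov_deriv_tv:
  assumes t: "t \<in> {a..b}" and c: "c \<in> charts_at M (\<alpha> t)"
    and x': "((\<lambda>s. chart_map c (\<alpha> s)) has_vector_derivative x') (at t within {a..b})"
    and V: "\<And>s. s \<in> {a..b} \<Longrightarrow> V s \<in> tangent_space M (\<alpha> s)"
    and w: "((\<lambda>s. V s c) has_vector_derivative w) (at t within {a..b})"
  shows "cov_deriv M {a..b} \<alpha> V t = tv c (\<alpha> t) (covd (metric_coeff M c) (chart_map c (\<alpha> t)) x' (V t c) w)"
proof
  fix d
  show "cov_deriv M {a..b} \<alpha> V t d = tv c (\<alpha> t) (covd (metric_coeff M c) (chart_map c (\<alpha> t)) x' (V t c) w) d"
  proof (cases "d \<in> charts_at M (\<alpha> t)")
    case d: True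
    have "((\<lambda>s. V s d) has_vector_derivative
       (fd (transition c d) (chart_map c (\<alpha> t)) (covd (metric_coeff M c) (chart_map c (\<alpha> t)) x' (V t c) w)
        - Gam (metric_coeff M d) (chart_map d (\<alpha> t)) (fd (transition c d) (chart_map c (\<alpha> t)) x') (V t d))) (at t within {a..b})"
      by (rule field_derivative[OF t c d x' V w])
    from vector_derivative_interval[OF ab t this] show ?thesis
      unfolding cov_deriv_component[where \<alpha> = \<alpha> and t = t, OF d] velocity_tv[OF t c x'] covd_def
      using d by (simp add: tv_def)
  qed (simp_all add: cov_deriv_def tv_def)
qed

end

lemma Ck_curve_velocity:
  assumes ab: "a < b" and \<alpha>: "Ck_curve M k {a..b} \<alpha>" and k: "0 < k" and t: "t \<in> {a..b}" and c: "c \<in> charts_at M (\<alpha> t)"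
  shows "((\<lambda>s. chart_map c (\<alpha> s)) has_vector_derivative velocity M {a..b} \<alpha> t c) (at t within {a..b})"
    and "velocity M {a..b} \<alpha> t \<in> tangent_space M (\<alpha> t)"
proof -
  have "iter_vderiv 0 {a..b} (chart_map c \<circ> \<alpha>) differentiable (at t within {a..b})"
    using \<alpha> k t c unfolding Ck_curve_def by blast
  then have D: "((\<lambda>s. chart_map c (\<alpha> s)) has_vector_derivative vector_derivative (\<lambda>s. chart_map c (\<alpha> s)) (at t within {a..b})) (at t within {a..b})"
    by (simp add: o_def vector_derivative_works)
  then show "((\<lambda>s. chart_map c (\<alpha> s)) has_vector_derivative velocity M {a..b} \<alpha> t c) (at t within {a..b})"
    unfolding velocity_component[where \<alpha> = \<alpha> and t = t, OF c] .
  have "continuous_map (top_of_set {a..b}) (rtop M) \<alpha>" using \<alpha> unfolding Ck_curve_def by blast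
  from velocity_tv[OF ab this t c D] show "velocity M {a..b} \<alpha> t \<in> tangent_space M (\<alpha> t)"
    using tv_in[OF c] by simp
qed

lemma Ck_curve_velocity_derivative:
  assumes ab: "a < b" and \<alpha>: "Ck_curve M k {a..b} \<alpha>" and k: "1 < k" and t: "t \<in> {a..b}" and c: "c \<in> charts_at M (\<alpha> t)"
  shows "((\<lambda>s. velocity M {a..b} \<alpha> s c) has_vector_derivative iter_vderiv 2 {a..b} (chart_map c \<circ> \<alpha>) t) (at t within {a..b})"
proof -
  have "iter_vderiv 1 {a..b} (chart_map c \<circ> \<alpha>) differentiable (at t within {a..b})"
    using \<alpha> k t c unfolding Ck_curve_def by blast
  then have D: "(iter_vderiv 1 {a..b} (chart_map c \<circ> \<alpha>) has_vector_derivative iter_vderiv 2 {a..b} (chart_map c \<circ> \<alpha>) t) (at t within {a..b})"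
    by (simp add: vector_derivative_works numeral_2_eq_2)
  have cont: "continuous_map (top_of_set {a..b}) (rtop M) \<alpha>" using \<alpha> unfolding Ck_curve_def by blast
  obtain e where e: "e > 0" "\<And>s. s \<in> {a..b} \<Longrightarrow> dist s t < e \<Longrightarrow> \<alpha> s \<in> chart_dom c"
    using curve_in_chart[OF cont t c] by blast
  show ?thesis
    by (rule has_vector_derivative_transform_within[OF D e(1) t])
      (use e(2) charts_atD(1)[OF c] in \<open>simp add: velocity_def charts_at_def\<close>)
qed

section \<open>Uniqueness of geodesics\<close>

lemma geodesic_equation:
  assumes ab: "a < b" and \<gamma>: "geodesic M {a..b} \<gamma>" and t: "t \<in> {a..b}" and c: "c \<in> charts_at M (\<gamma> t)"
  shows "((\<lambda>s. velocity M {a..b} \<gamma> s c) has_vector_derivative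
     - Gam (metric_coeff M c) (chart_map c (\<gamma> t)) (velocity M {a..b} \<gamma> t c) (velocity M {a..b} \<gamma> t c)) (at t within {a..b})"
proof -
  have C: "Ck_curve M 2 {a..b} \<gamma>" using \<gamma> by (simp add: geodesic_def)
  note D = Ck_curve_velocity_derivative[OF ab C _ t c]
  have "cov_deriv M {a..b} \<gamma> (velocity M {a..b} \<gamma>) t c = 0" using \<gamma> t by (simp add: geodesic_def)
  then have "iter_vderiv 2 {a..b} (chart_map c \<circ> \<gamma>) t = - Gam (metric_coeff M c) (chart_map c (\<gamma> t)) (velocity M {a..b} \<gamma> t c) (velocity M {a..b} \<gamma> t c)"
    unfolding cov_deriv_component[where \<alpha> = \<gamma> and t = t, OF c] vector_derivative_interval[OF ab t D, simplified] covd_def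
    by (simp add: eq_neg_iff_add_eq_0)
  then show ?thesis using D by simp
qed

text \<open>In a chart both curves solve one first-order system for position and velocity, which is
  Lipschitz on a compact convex set containing both near \<open>t\<close>. The velocities at
  \<open>t\<close> may still differ, so the ball for velocities is chosen large enough for both.
  Indexing by \<open>bool\<close> treats the two curves at once.\<close>

lemma geodesics_locally_agree:
  fixes \<gamma> :: "bool \<Rightarrow> real \<Rightarrow> 'a"
  assumes ab: "a < b" and \<gamma>: "\<And>i. geodesic M {a..b} (\<gamma> i)" and t: "t \<in> {a..b}" and eq: "\<gamma> True t = \<gamma> False t"
  shows "\<exists>T. openin (top_of_set {a..b}) T \<and> t \<in> T \<and> (\<forall>s\<in>T. \<forall>s'\<in>T.
     \<gamma> True s = \<gamma> False s \<and> velocity M {a..b} (\<gamma> True) s = velocity M {a..b} (\<gamma> False) s \<longrightarrow>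
     \<gamma> True s' = \<gamma> False s' \<and> velocity M {a..b} (\<gamma> True) s' = velocity M {a..b} (\<gamma> False) s')"
proof -
  let ?I = "{a..b}"
  let ?v = "\<lambda>i. velocity M ?I (\<gamma> i)"
  have C: "Ck_curve M 2 ?I (\<gamma> i)" for i using \<gamma>[of i] by (simp add: geodesic_def)
  have cont: "continuous_map (top_of_set ?I) (rtop M) (\<gamma> i)" for i using C[of i] unfolding Ck_curve_def by blast
  have "\<gamma> True t \<in> topspace (rtop M)" using cont[of True] t by (auto simp: continuous_map_def)
  then obtain c where c: "c \<in> charts_at M (\<gamma> True t)" by (rule charts_at_exists)
  note cm = charts_atD(1)[OF c]
  interpret patch "chart_cod c" "metric_coeff M c" by (rule patch_chart[OF cm])
  let ?g = "metric_coeff M c"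
  have ct: "c \<in> charts_at M (\<gamma> i t)" for i using c eq by (cases i) auto
  define z where "z = (\<lambda>i s. (chart_map c (\<gamma> i s), ?v i s c))"
  define F where "F = (\<lambda>p :: (real^3) \<times> (real^3). (snd p, - Gam ?g (fst p) (snd p) (snd p)))"
  have zd: "(z i has_vector_derivative F (z i s)) (at s within ?I)" if "s \<in> ?I" "c \<in> charts_at M (\<gamma> i s)" for i s
    using has_vector_derivative_Pair[OF Ck_curve_velocity(1)[OF ab C _ that] geodesic_equation[OF ab \<gamma> that]]
    by (simp add: z_def F_def)
  obtain r where r: "r > 0" "cball (chart_map c (\<gamma> True t)) r \<subseteq> chart_cod c"
    using open_contains_cball open_U chart_map_cod[OF charts_atD(2)[OF c]] by blast
  define R where "R = norm (?v True t c) + norm (?v False t c) + 1"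
  define K where "K = cball (chart_map c (\<gamma> True t)) r \<times> cball (0::real^3) R"
  have F: "smooth_on F (chart_cod c \<times> UNIV)"
    unfolding F_def
    by (intro smooth_on_Pair smooth_on_minus smooth_on_Gam smooth_on_snd smooth_on_fst smooth_on_ident open_Times open_U open_UNIV) auto
  have "\<exists>L>0. \<forall>x\<in>K. \<forall>y\<in>K. norm (F x - F y) \<le> L * norm (x - y)"
    by (rule C1_lipschitz_on_compact_convex[OF open_Times[OF open_U open_UNIV] smooth_on_Ck[OF F]])
      (use r(2) in \<open>auto simp: K_def intro!: compact_Times convex_Times\<close>)
  then obtain L where L: "\<And>x y. x \<in> K \<Longrightarrow> y \<in> K \<Longrightarrow> norm (F x - F y) \<le> L * norm (x - y)" by blast
  have "\<exists>e>0. \<forall>s\<in>?I. dist s t < e \<longrightarrow> c \<in> charts_at M (\<gamma> i s) \<and> z i s \<in> K" for i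
  proof -
    obtain e where e: "e > 0" "\<And>s. s \<in> ?I \<Longrightarrow> dist s t < e \<Longrightarrow> \<gamma> i s \<in> chart_dom c"
      using curve_in_chart[OF cont t ct] by blast
    have cz: "continuous (at t within ?I) (z i)" by (rule has_vector_derivative_continuous[OF zd[OF t ct]])
    define N where "N = ball (chart_map c (\<gamma> True t)) r \<times> ball (0::real^3) R"
    have "norm (?v i t c) < R" by (cases i) (simp_all add: R_def add_strict_increasing2 add_strict_increasing)
    then have "z i t \<in> N" using eq r(1) by (cases i) (simp_all add: z_def N_def)
    moreover have oN: "open N" by (simp add: N_def open_Times)
    ultimately have "\<forall>\<^sub>F s in at t within ?I. z i s \<in> N"
      using topological_tendstoD[OF cz[unfolded continuous_within] oN] by blast
    then obtain e' where e': "e' > 0" "\<And>s. s \<in> ?I \<Longrightarrow> dist s t < e' \<Longrightarrow> z i s \<in> N"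
      using \<open>z i t \<in> N\<close> unfolding eventually_at by metis
    have "N \<subseteq> K" by (auto simp: N_def K_def)
    then have "\<forall>s\<in>?I. dist s t < min e e' \<longrightarrow> c \<in> charts_at M (\<gamma> i s) \<and> z i s \<in> K"
      using e(2) e'(2) cm by (auto simp: charts_at_def)
    moreover have "min e e' > 0" using e(1) e'(1) by simp
    ultimately show ?thesis by blast
  qed
  then obtain \<epsilon> where \<epsilon>: "\<And>i. \<epsilon> i > 0" "\<And>i s. s \<in> ?I \<Longrightarrow> dist s t < \<epsilon> i \<Longrightarrow> c \<in> charts_at M (\<gamma> i s) \<and> z i s \<in> K"
    by metis
  define T where "T = ?I \<inter> ball t (min (\<epsilon> True) (\<epsilon> False))"
  have Ti: "c \<in> charts_at M (\<gamma> i s)" "z i s \<in> K" if "s \<in> T" for i s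
    using \<epsilon>(2)[of s i] that by (cases i; auto simp: T_def dist_commute)+
  have TI: "T \<subseteq> ?I" by (auto simp: T_def)
  have Tc: "convex T" by (simp add: T_def convex_Int)
  have zT: "(z i has_vector_derivative F (z i s)) (at s within T)" if "s \<in> T" for i s
    using has_vector_derivative_within_subset[OF zd TI] Ti[OF that] TI that by blast
  have zeq: "z True s = z False s \<longleftrightarrow> \<gamma> True s = \<gamma> False s \<and> ?v True s = ?v False s" if s: "s \<in> T" for s
  proof
    assume e: "z True s = z False s"
    have sI: "s \<in> ?I" using s TI by blast
    have g: "\<gamma> True s = \<gamma> False s"
      using e chart_inv_map[OF cm charts_atD(2)[OF Ti(1)[OF s]]] unfolding z_def by (metis prod.inject)
    moreover have "?v True s = ?v False s"
    proof (rule tangent_eqI[where p = "\<gamma> True s" and c = c])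
      show "?v True s \<in> tangent_space M (\<gamma> True s)" by (rule Ck_curve_velocity(2)[OF ab C _ sI Ti(1)[OF s]]) simp
      show "?v False s \<in> tangent_space M (\<gamma> True s)" unfolding g by (rule Ck_curve_velocity(2)[OF ab C _ sI Ti(1)[OF s]]) simp
      show "c \<in> charts_at M (\<gamma> True s)" by (rule Ti(1)[OF s])
      show "?v True s c = ?v False s c" using e by (simp add: z_def)
    qed
    ultimately show "\<gamma> True s = \<gamma> False s \<and> ?v True s = ?v False s" by blast
  qed (simp add: z_def)
  have "z True s' = z False s'" if s: "s \<in> T" and s': "s' \<in> T" and e: "z True s = z False s" for s s'
    by (rule autonomous_ode_unique[OF Tc s s' Ti(2) Ti(2) L zT zT e])
  moreover have "t \<in> T" using t \<epsilon>(1) by (simp add: T_def)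
  moreover have "openin (top_of_set ?I) T" unfolding T_def by (rule openin_open_Int[OF open_ball])
  ultimately show ?thesis using zeq by blast
qed

text \<open>Induction along the connected interval: agreement of position and velocity spreads
  locally. Near a time at which the positions differ, the Hausdorff property keeps them different,
  so that agreement there is excluded.\<close>

lemma geodesic_unique:
  fixes \<gamma> :: "bool \<Rightarrow> real \<Rightarrow> 'a"
  assumes ab: "a < b" and \<gamma>: "\<And>i. geodesic M {a..b} (\<gamma> i)"
    and 0: "\<gamma> True a = \<gamma> False a" "velocity M {a..b} (\<gamma> True) a = velocity M {a..b} (\<gamma> False) a"
  shows "\<gamma> True b = \<gamma> False b"
proof -
  let ?P = "\<lambda>s. \<gamma> True s = \<gamma> False s \<and> velocity M {a..b} (\<gamma> True) s = velocity M {a..b} (\<gamma> False) s"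
  have cont: "continuous_map (top_of_set {a..b}) (rtop M) (\<gamma> i)" for i
    using \<gamma>[of i] unfolding geodesic_def Ck_curve_def by blast
  have "?P b"
  proof (rule connected_induction_simple[of "{a..b}" a b ?P])
    fix t assume t: "t \<in> {a..b}"
    show "\<exists>T. openin (top_of_set {a..b}) T \<and> t \<in> T \<and> (\<forall>s\<in>T. \<forall>s'\<in>T. ?P s \<longrightarrow> ?P s')"
    proof (cases "\<gamma> True t = \<gamma> False t")
      case True then show ?thesis by (rule geodesics_locally_agree[OF ab \<gamma> t])
    next
      case False
      have "\<gamma> i t \<in> topspace (rtop M)" for i using cont[of i] t by (auto simp: continuous_map_def)
      moreover have "Hausdorff_space (rtop M)" using manifold by (simp add: riemannian_3_manifold_def)
      ultimately obtain V W where V: "openin (rtop M) V" "openin (rtop M) W" "\<gamma> True t \<in> V" "\<gamma> False t \<in> W" "disjnt V W"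
        using False unfolding Hausdorff_space_def by metis
      define T where "T = {s \<in> topspace (top_of_set {a..b}). \<gamma> True s \<in> V} \<inter> {s \<in> topspace (top_of_set {a..b}). \<gamma> False s \<in> W}"
      have "openin (top_of_set {a..b}) T" unfolding T_def
        by (intro openin_Int openin_continuous_map_preimage[OF cont] V)
      moreover have "t \<in> T" using V t by (simp add: T_def)
      moreover have "\<gamma> True s \<noteq> \<gamma> False s" if "s \<in> T" for s using that V(5) by (auto simp: T_def disjnt_def)
      ultimately show ?thesis by blast
    qed
  qed (use ab 0 in auto)
  then show ?thesis by blast
qed

text \<open>Uniqueness of geodesics is what gives the definite description a value.\<close>

lemma exp_map_eq:
  assumes "geodesic M {0..1} \<gamma>"
  shows "exp_map M (\<gamma> 0) (velocity M {0..1} \<gamma> 0) = \<gamma> 1"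
  unfolding exp_map_def
proof (rule the_equality)
  fix q assume "\<exists>\<gamma>'. geodesic M {0..1} \<gamma>' \<and> \<gamma>' 0 = \<gamma> 0 \<and> velocity M {0..1} \<gamma>' 0 = velocity M {0..1} \<gamma> 0 \<and> \<gamma>' 1 = q"
  then obtain \<gamma>' where "geodesic M {0..1} \<gamma>'" "\<gamma>' 0 = \<gamma> 0" "velocity M {0..1} \<gamma>' 0 = velocity M {0..1} \<gamma> 0" "\<gamma>' 1 = q"
    by blast
  then show "q = \<gamma> 1"
    using geodesic_unique[of 0 1 "\<lambda>i. if i then \<gamma>' else \<gamma>"] assms by auto
qed (use assms in blast)

end

section \<open>Normal coordinates and geodesic spheres\<close>

text \<open>Normal coordinates inside one chart \<open>c\<close>: \<open>E\<close> goes from normal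
  coordinates to those of \<open>c\<close>, and \<open>Ei\<close> is its inverse on the image
  \<open>V\<close>.\<close>

locale normal_chart = riemannian3 M + N: normal_patch \<rho> gh
    + E: patch_isometry "ball 0 \<rho>" gh "chart_cod c" "metric_coeff M c" E
    + Ei: patch_isometry V "metric_coeff M c" "ball 0 \<rho>" gh Ei
  for M :: "('a, 'z) riem_scheme" and \<rho> gh c V E Ei +
  assumes c: "c \<in> charts M" and V_cod: "V \<subseteq> chart_cod c" and homeo: "homeomorphism (ball 0 \<rho>) V E Ei"

lemma (in riemannian3) normal_chart_exists:
  assumes "p \<in> topspace (rtop M)"
  obtains \<rho> gh c V E Ei where "normal_chart M \<rho> gh c V E Ei" "chart_inv c (E 0) = p"
proof -
  obtain c where c: "c \<in> charts_at M p" using charts_at_exists[OF assms] .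
  note cm = charts_atD(1)[OF c] and cd = charts_atD(2)[OF c]
  interpret patch "chart_cod c" "metric_coeff M c" by (rule patch_chart[OF cm])
  obtain \<rho> E Ei V gh where N: "normal_patch \<rho> gh" "patch_isometry (ball 0 \<rho>) gh (chart_cod c) (metric_coeff M c) E"
    "V \<subseteq> chart_cod c" "patch_isometry V (metric_coeff M c) (ball 0 \<rho>) gh Ei" "homeomorphism (ball 0 \<rho>) V E Ei"
    and E0: "E 0 = chart_map c p"
    using normal_coordinates_exist[OF chart_map_cod[OF cd]] by metis
  have "normal_chart M \<rho> gh c V E Ei"
    unfolding normal_chart_def normal_chart_axioms_def using N cm riemannian3_axioms by blast
  then show thesis by (rule that) (simp add: E0 chart_inv_map[OF cm cd])
qed

context normal_chart
begin

abbreviation "B \<equiv> ball (0::real^3) \<rho>"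

abbreviation pt :: "real^3 \<Rightarrow> 'a" where "pt v \<equiv> chart_inv c (E v)"

definition lift :: "real^3 \<Rightarrow> real^3 \<Rightarrow> 'a tvec" where "lift v \<xi> = tv c (pt v) (fd E v \<xi>)"

lemma E_in: "v \<in> B \<Longrightarrow> E v \<in> V" and Ei_E: "v \<in> B \<Longrightarrow> Ei (E v) = v"
  and Ei_in: "x \<in> V \<Longrightarrow> Ei x \<in> B" and E_Ei: "x \<in> V \<Longrightarrow> E (Ei x) = x"
  using homeo by (auto simp: homeomorphism_def)

lemma chart_pt: "v \<in> B \<Longrightarrow> chart_map c (pt v) = E v"
  by (rule chart_map_inv[OF E.phi_in])

lemma chart_at_pt: "v \<in> B \<Longrightarrow> c \<in> charts_at M (pt v)"
  by (rule charts_at_inv[OF c E.phi_in])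

lemma lift_c: "v \<in> B \<Longrightarrow> lift v \<xi> c = fd E v \<xi>"
  by (simp add: lift_def chart_at_pt)

lemma lift_in: "v \<in> B \<Longrightarrow> lift v \<xi> \<in> tangent_space M (pt v)"
  unfolding lift_def by (rule tv_in[OF chart_at_pt])

lemma lift_lincomb:
  assumes v: "v \<in> B"
  shows "lift v (r *\<^sub>R a + s *\<^sub>R b) = (\<lambda>d. r *\<^sub>R lift v a d + s *\<^sub>R lift v b d)"
    and "lift v (r *\<^sub>R a) = (\<lambda>d. r *\<^sub>R lift v a d)" and "lift v 0 = (\<lambda>d. 0)"
  unfolding lift_def tv_lincomb[OF chart_at_pt[OF v]]
  by (simp_all add: linear_add[OF E.linear_fd_phi[OF v]] linear_scale[OF E.linear_fd_phi[OF v]] linear_0[OF E.linear_fd_phi[OF v]])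

lemma rmetric_lift: "v \<in> B \<Longrightarrow> rmetric M (pt v) (lift v a) (lift v b) = ip gh v a b"
  unfolding lift_def by (simp add: rmetric_tv(1)[OF chart_at_pt] chart_pt E.iso)

lemma lift_surj:
  assumes v: "v \<in> B" and u: "u \<in> tangent_space M (pt v)"
  obtains \<xi> where "u = lift v \<xi>"
proof -
  obtain \<xi> where "fd E v \<xi> = u c" using bij_is_surj[OF E.bij_fd_phi[OF v]] by (metis surjD)
  then have "u = lift v \<xi>" unfolding lift_def using tv_of[OF u chart_at_pt[OF v]] by simp
  then show thesis by (rule that)
qed

lemma lift_inject: assumes v: "v \<in> B" and e: "lift v a = lift v b" shows "a = b"
  using injD[OF bij_is_inj[OF E.bij_fd_phi[OF v]]] fun_cong[OF e, of c] by (simp add: lift_c[OF v])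

lemma fd_E_Ei: assumes x: "x \<in> V" shows "fd E (Ei x) (fd Ei x \<xi>) = \<xi>"
proof -
  have "((\<lambda>x. E (Ei x)) has_derivative (\<lambda>h. fd E (Ei x) (fd Ei x h))) (at x)"
    by (rule has_derivative_compose[OF Ei.phi_derivative[OF x] E.phi_derivative[OF Ei_in[OF x]]])
  moreover have "((\<lambda>x. E (Ei x)) has_derivative (\<lambda>h. h)) (at x)"
    by (rule has_derivative_transform_within_open[OF has_derivative_ident Ei.p1.open_U x]) (simp add: E_Ei)
  ultimately show ?thesis using has_derivative_unique by metis
qed

context
  fixes a b :: real and \<alpha> :: "real \<Rightarrow> 'a" and Y :: "real \<Rightarrow> real^3"
  assumes ab: "a < b" and cont: "continuous_map (top_of_set {a..b}) (rtop M) \<alpha>"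
    and Y: "\<And>s. s \<in> {a..b} \<Longrightarrow> Y s \<in> B" "\<And>s. s \<in> {a..b} \<Longrightarrow> \<alpha> s = pt (Y s)"
begin

lemma lift_curve:
  assumes t: "t \<in> {a..b}" and Y': "(Y has_vector_derivative Y') (at t within {a..b})"
  shows "((\<lambda>s. chart_map c (\<alpha> s)) has_vector_derivative fd E (Y t) Y') (at t within {a..b})"
  by (rule has_vector_derivative_transform[OF t _ E.cov_transform(1)[OF Y' Y(1)[OF t] Y' t]])
    (simp add: Y(2) chart_pt[OF Y(1)])

lemma velocity_lift:
  assumes t: "t \<in> {a..b}" and Y': "(Y has_vector_derivative Y') (at t within {a..b})"
  shows "velocity M {a..b} \<alpha> t = lift (Y t) Y'"
proof -
  have "c \<in> charts_at M (\<alpha> t)" using chart_at_pt[OF Y(1)[OF t]] by (simp add: Y(2)[OF t])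
  from velocity_tv[OF ab cont t this lift_curve[OF t Y']] show ?thesis by (simp add: lift_def Y(2)[OF t])
qed

context
  fixes F :: "real \<Rightarrow> 'a tvec" and W :: "real \<Rightarrow> real^3"
  assumes F: "\<And>s. s \<in> {a..b} \<Longrightarrow> F s = lift (Y s) (W s)"
begin

lemma field_lift_derivative:
  assumes t: "t \<in> {a..b}" and Y': "(Y has_vector_derivative Y') (at t within {a..b})" and W': "(W has_vector_derivative W') (at t within {a..b})"
  shows "((\<lambda>s. F s c) has_vector_derivative
     fd E (Y t) (covd gh (Y t) Y' (W t) W') - Gam (metric_coeff M c) (E (Y t)) (fd E (Y t) Y') (fd E (Y t) (W t))) (at t within {a..b})"
  by (rule has_vector_derivative_transform[OF t _ E.cov_transform(2)[OF Y' Y(1)[OF t] W' t, folded covd_def]])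
    (simp add: F lift_c[OF Y(1)])

lemma cov_deriv_lift:
  assumes t: "t \<in> {a..b}" and Y': "(Y has_vector_derivative Y') (at t within {a..b})" and W': "(W has_vector_derivative W') (at t within {a..b})"
  shows "cov_deriv M {a..b} \<alpha> F t = lift (Y t) (covd gh (Y t) Y' (W t) W')"
proof -
  have ca: "c \<in> charts_at M (\<alpha> t)" using chart_at_pt[OF Y(1)[OF t]] by (simp add: Y(2)[OF t])
  have FT: "F s \<in> tangent_space M (\<alpha> s)" if "s \<in> {a..b}" for s
    using lift_in[OF Y(1)[OF that]] by (simp add: F[OF that] Y(2)[OF that])
  from cov_deriv_tv[where \<alpha> = \<alpha> and V = F and t = t, OF ab cont t ca lift_curve[OF t Y'] FT field_lift_derivative[OF t Y' W']]
  show ?thesis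
    by (simp add: Y(2)[OF t] chart_pt[OF Y(1)[OF t]] F[OF t] lift_c[OF Y(1)[OF t]] covd_def) (simp add: lift_def)
qed

lemma diff_field_lift:
  assumes Y': "\<And>t. t \<in> {a..b} \<Longrightarrow> (Y has_vector_derivative Y' t) (at t within {a..b})"
    and W': "\<And>t. t \<in> {a..b} \<Longrightarrow> (W has_vector_derivative W' t) (at t within {a..b})"
  shows "diff_field_along M {a..b} \<alpha> F"
proof -
  have FT: "F s \<in> tangent_space M (\<alpha> s)" if "s \<in> {a..b}" for s
    using lift_in[OF Y(1)[OF that]] by (simp add: F[OF that] Y(2)[OF that])
  have "(\<lambda>s. F s d) differentiable (at t within {a..b})" if t: "t \<in> {a..b}" and d: "d \<in> charts_at M (\<alpha> t)" for t d
  proof -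
    have ca: "c \<in> charts_at M (\<alpha> t)" using chart_at_pt[OF Y(1)[OF t]] by (simp add: Y(2)[OF t])
    show ?thesis
      by (rule differentiableI_vector[OF field_derivative[where V = F and \<alpha> = \<alpha>, OF ab cont t ca d lift_curve[OF t Y'[OF t]] FT
            field_lift_derivative[OF t Y'[OF t] W'[OF t]]]])
  qed
  then show ?thesis unfolding diff_field_along_def field_along_def using FT by blast
qed

end

end

text \<open>The constant field \<open>v\<close> has covariant derivative Gam (t v) v v along its
  ray, which vanishes in normal coordinates.\<close>

lemma ray_geodesic:
  assumes v: "v \<in> B"
  shows "geodesic M {0..1} (\<lambda>t. pt (t *\<^sub>R v))" and "velocity M {0..1} (\<lambda>t. pt (t *\<^sub>R v)) 0 = lift 0 v"
proof -
  define J where "J = {t. t *\<^sub>R v \<in> B}"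
  have oJ: "open J"
    using continuous_open_preimage[of UNIV "\<lambda>t. t *\<^sub>R v" B] by (simp add: J_def vimage_def continuous_intros)
  have JI: "{0..1} \<subseteq> J" unfolding J_def using N.scale_in[OF v] by (metis (mono_tags) abs_of_nonneg atLeastAtMost_iff mem_Collect_eq subsetI)
  have sX: "smooth_on (\<lambda>t. E (t *\<^sub>R v)) J"
    by (rule smooth_on_compose[OF oJ open_ball _ E.smooth_phi])
      (use J_def in blast, intro smooth_on_scaleR smooth_on_ident smooth_on_const oJ)
  have C: "Ck_curve M k {0..1} (\<lambda>t. pt (t *\<^sub>R v))" for k
    by (rule Ck_curve_smooth[OF c _ oJ JI sX]) (use E.phi_in in \<open>auto simp: J_def\<close>)
  have cont: "continuous_map (top_of_set {0..1}) (rtop M) (\<lambda>t. pt (t *\<^sub>R v))" using C unfolding Ck_curve_def by blast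
  have Y: "t *\<^sub>R v \<in> B" if "t \<in> {0..1}" for t using that JI by (auto simp: J_def)
  have Y': "((\<lambda>t. t *\<^sub>R v) has_vector_derivative v) (at t within {0..1})" for t :: real
    by (auto intro!: derivative_eq_intros simp: has_vector_derivative_def)
  have vel: "velocity M {0..1} (\<lambda>t. pt (t *\<^sub>R v)) t = lift (t *\<^sub>R v) v" if "t \<in> {0..1}" for t
    by (rule velocity_lift[where a = 0 and b = 1, OF _ cont Y refl that Y']) auto
  show "velocity M {0..1} (\<lambda>t. pt (t *\<^sub>R v)) 0 = lift 0 v" using vel[of 0] by simp
  have "cov_deriv M {0..1} (\<lambda>t. pt (t *\<^sub>R v)) (velocity M {0..1} (\<lambda>t. pt (t *\<^sub>R v))) t = (\<lambda>c. 0)" if t: "t \<in> {0..1}" for t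
  proof -
    have "cov_deriv M {0..1} (\<lambda>t. pt (t *\<^sub>R v)) (velocity M {0..1} (\<lambda>t. pt (t *\<^sub>R v))) t = lift (t *\<^sub>R v) (covd gh (t *\<^sub>R v) v v 0)"
      by (rule cov_deriv_lift[where a = 0 and b = 1 and W = "\<lambda>t. v", OF _ cont Y refl vel t Y']) auto
    also have "covd gh (t *\<^sub>R v) v v 0 = 0" by (simp add: covd_def N.Gam_ray[OF Y[OF t]])
    finally show ?thesis by (simp add: lift_lincomb(3)[OF Y[OF t]])
  qed
  then show "geodesic M {0..1} (\<lambda>t. pt (t *\<^sub>R v))" using C by (simp add: geodesic_def)
qed

lemma origin_in: "0 \<in> B" using N.rho_pos by simp

lemma exp_map_lift:
  assumes v: "v \<in> B" shows "exp_map M (pt 0) (lift 0 v) = pt v" and "lift 0 v \<in> exp_dom M (pt 0)"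
proof -
  show "exp_map M (pt 0) (lift 0 v) = pt v" using exp_map_eq[OF ray_geodesic(1)[OF v]] by (simp add: ray_geodesic(2)[OF v])
  show "lift 0 v \<in> exp_dom M (pt 0)"
    unfolding exp_dom_def using lift_in[OF origin_in] ray_geodesic[OF v] by force
qed

lemma unit_vectors_lift: "unit_vectors M (pt 0) = lift 0 ` sphere 0 1"
proof -
  have n: "tnorm M (pt 0) (lift 0 v) = norm v" for v
    by (simp add: tnorm_def rmetric_lift[OF origin_in] N.ip_origin norm_eq_sqrt_inner)
  show ?thesis
  proof
    show "unit_vectors M (pt 0) \<subseteq> lift 0 ` sphere 0 1"
    proof
      fix u assume u: "u \<in> unit_vectors M (pt 0)"
      then obtain \<xi> where "u = lift 0 \<xi>" using lift_surj[OF origin_in] unfolding unit_vectors_def by blast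
      then show "u \<in> lift 0 ` sphere 0 1" using u n by (auto simp: unit_vectors_def)
    qed
  qed (use n lift_in[OF origin_in] in \<open>auto simp: unit_vectors_def\<close>)
qed

lemma scaled_in: "v \<in> sphere 0 1 \<Longrightarrow> 0 < R \<Longrightarrow> R < \<rho> \<Longrightarrow> R *\<^sub>R v \<in> B" by simp

text \<open>Through \<open>lift 0\<close> the exponential map at the centre is the coordinate map
  \<open>pt\<close> itself, so geodesic spheres are images of Euclidean ones.\<close>

lemma geodesic_sphere_pt:
  assumes R: "0 < R" "R < \<rho>" shows "geodesic_sphere M (pt 0) R = pt ` sphere 0 R"
proof -
  have "geodesic_sphere M (pt 0) R = (\<lambda>v. pt (R *\<^sub>R v)) ` sphere 0 1"
  proof -
    have "exp_map M (pt 0) (\<lambda>d. R *\<^sub>R lift 0 v d) = pt (R *\<^sub>R v)" if "v \<in> sphere 0 1" for v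
      using exp_map_lift(1)[OF scaled_in[OF that R]] by (simp add: lift_lincomb(2)[OF origin_in])
    then have "(\<lambda>v. exp_map M (pt 0) (\<lambda>d. R *\<^sub>R lift 0 v d)) ` sphere 0 1 = (\<lambda>v. pt (R *\<^sub>R v)) ` sphere 0 1"
      by (rule image_cong[OF refl])
    moreover have "geodesic_sphere M (pt 0) R = (\<lambda>v. exp_map M (pt 0) (\<lambda>d. R *\<^sub>R lift 0 v d)) ` sphere 0 1"
      unfolding geodesic_sphere_def unit_vectors_lift by blast
    ultimately show ?thesis by simp
  qed
  also have "\<dots> = pt ` ((*\<^sub>R) R ` sphere 0 1)" by (simp add: image_image)
  also have "(*\<^sub>R) R ` sphere 0 1 = (sphere 0 R :: (real^3) set)" using sphere_scale[of R "0::real^3" 1] R by simp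
  finally show ?thesis .
qed

lemma smooth_surface_sphere:
  assumes R: "0 < R" "R < \<rho>" shows "smooth_surface M (geodesic_sphere M (pt 0) R)"
  unfolding smooth_surface_def geodesic_sphere_pt[OF R]
proof (intro conjI ballI)
  have SB: "v \<in> B" if "v \<in> sphere 0 R" for v :: "real^3" using that R by simp
  show "pt ` sphere 0 R \<subseteq> topspace (rtop M)"
    using charts_atD(2)[OF chart_at_pt[OF SB]] dom_topspace[OF c] by blast
  fix q assume "q \<in> pt ` sphere 0 R"
  then obtain v where v: "v \<in> sphere 0 R" "q = pt v" by blast
  \<comment> \<open>The centre is removed because the differential of the squared radius vanishes
    there, while a defining function must be regular on all of its domain.\<close>
  define W where "W = V - {E 0}"
  define h where "h = (\<lambda>x. Ei x \<bullet> Ei x - R\<^sup>2)"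
  have W: "open W" "W \<subseteq> V" unfolding W_def using Ei.p1.open_U by auto
  have "v \<noteq> 0" using v R by auto
  then have qW: "chart_map c q \<in> W"
    using Ei_E[OF SB[OF v(1)]] Ei_E[OF origin_in] E_in[OF SB[OF v(1)]] unfolding W_def v(2) chart_pt[OF SB[OF v(1)]] by force
  have sEi: "smooth_on Ei W" by (rule smooth_on_subset[OF Ei.smooth_phi W(2)])
  have sh: "smooth_on h W" unfolding h_def by (intro smooth_on_diff smooth_on_inner smooth_on_const sEi W(1))
  have "fd h x \<noteq> (\<lambda>v. 0)" if x: "x \<in> W" for x
  proof -
    have xV: "x \<in> V" using x W by blast
    have "(h has_derivative (\<lambda>k. Ei x \<bullet> fd Ei x k + fd Ei x k \<bullet> Ei x)) (at x)"
      unfolding h_def using has_derivative_inner[OF Ei.phi_derivative[OF xV] Ei.phi_derivative[OF xV]]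
      by (rule has_derivative_diff[OF _ has_derivative_const, simplified])
    then have D: "fd h x = (\<lambda>k. Ei x \<bullet> fd Ei x k + fd Ei x k \<bullet> Ei x)" by (rule fd_eq)
    have "Ei x \<noteq> 0" using x E_Ei[OF xV] by (auto simp: W_def)
    moreover obtain k where "fd Ei x k = Ei x" using bij_is_surj[OF Ei.bij_fd_phi[OF xV]] by (metis surjD)
    ultimately have "fd h x k \<noteq> 0" unfolding D by simp
    then show ?thesis by auto
  qed
  note fdh = this
  have zero: "chart_map c ` (pt ` sphere 0 R \<inter> chart_dom c) \<inter> W = {x \<in> W. h x = 0}"
  proof
    show "chart_map c ` (pt ` sphere 0 R \<inter> chart_dom c) \<inter> W \<subseteq> {x \<in> W. h x = 0}"
      using chart_pt[OF SB] Ei_E[OF SB] by (auto simp: h_def dot_square_norm)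
    show "{x \<in> W. h x = 0} \<subseteq> chart_map c ` (pt ` sphere 0 R \<inter> chart_dom c) \<inter> W"
    proof
      fix x assume x: "x \<in> {x \<in> W. h x = 0}"
      then have xV: "x \<in> V" using W by blast
      have "Ei x \<in> sphere 0 R" using x R by (simp add: h_def dot_square_norm)
      moreover have "chart_map c (pt (Ei x)) = x" "pt (Ei x) \<in> chart_dom c"
        using chart_pt[OF Ei_in[OF xV]] charts_atD(2)[OF chart_at_pt[OF Ei_in[OF xV]]] E_Ei[OF xV] by auto
      ultimately have "chart_map c (pt (Ei x)) \<in> chart_map c ` (pt ` sphere 0 R \<inter> chart_dom c)" by blast
      then show "x \<in> chart_map c ` (pt ` sphere 0 R \<inter> chart_dom c) \<inter> W" using x \<open>chart_map c (pt (Ei x)) = x\<close> by simp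
    qed
  qed
  show "\<exists>c\<in>charts_at M q. \<exists>W h. open W \<and> chart_map c q \<in> W \<and> W \<subseteq> chart_cod c \<and>
     smooth_on (h :: real^3 \<Rightarrow> real) W \<and> (\<forall>x\<in>W. fd h x \<noteq> (\<lambda>v. 0)) \<and>
     chart_map c ` (pt ` sphere 0 R \<inter> chart_dom c) \<inter> W = {x\<in>W. h x = 0}"
    by (intro bexI[of _ c] exI[of _ W] exI[of _ h] conjI ballI fdh zero W(1) qW sh order_trans[OF W(2) V_cod])
      (simp_all add: v(2) chart_at_pt[OF SB[OF v(1)]])
qed

lemma sphere_radius_bound_normal:
  assumes r: "0 < r" "r \<le> \<rho>" shows "sphere_radius_bound M (pt 0) r"
  unfolding sphere_radius_bound_def
proof (intro conjI allI impI ballI)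
  fix R assume R: "0 < R \<and> R < r"
  then have R': "0 < R" "R < \<rho>" using r by auto
  show "smooth_surface M (geodesic_sphere M (pt 0) R)" by (rule smooth_surface_sphere[OF R'])
  fix u assume "u \<in> unit_vectors M (pt 0)"
  then obtain v where v: "v \<in> sphere 0 1" "u = lift 0 v" unfolding unit_vectors_lift by blast
  show "(\<lambda>c. R *\<^sub>R u c) \<in> exp_dom M (pt 0)"
    using exp_map_lift(2)[OF scaled_in[OF v(1) R']] unfolding lift_lincomb(2)[OF origin_in] v(2) .
qed (rule r)

end

section \<open>Total torsion on geodesic spheres\<close>

context normal_chart
begin

lemma constant_curvature_normal:
  assumes v: "v \<in> B"
  shows "(\<forall>a b d. Riem gh v a b d = k *\<^sub>R (ip gh v b d *\<^sub>R a - ip gh v a d *\<^sub>R b)) \<longleftrightarrow>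
    (\<forall>a b d. Riem (metric_coeff M c) (E v) a b d =
       k *\<^sub>R (ip (metric_coeff M c) (E v) b d *\<^sub>R a - ip (metric_coeff M c) (E v) a d *\<^sub>R b))"
  (is "(\<forall>a b d. ?L a b d) \<longleftrightarrow> (\<forall>a b d. ?R a b d)")
proof -
  have inj: "fd E v x = fd E v y \<longleftrightarrow> x = y" for x y using bij_is_inj[OF E.bij_fd_phi[OF v]] by (simp add: inj_eq)
  have "?L a b d \<longleftrightarrow> ?R (fd E v a) (fd E v b) (fd E v d)" for a b d
    unfolding inj[of "Riem gh v a b d", symmetric] E.Riem_transform[OF v] E.iso[OF v]
    by (simp add: linear_scale[OF E.linear_fd_phi[OF v]] linear_diff[OF E.linear_fd_phi[OF v]])
  moreover have "(\<forall>a b d. ?R (fd E v a) (fd E v b) (fd E v d)) \<longleftrightarrow> (\<forall>a b d. ?R a b d)"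
  proof (intro iffI allI)
    fix a b d assume R: "\<forall>a b d. ?R (fd E v a) (fd E v b) (fd E v d)"
    note surj = surjD[OF bij_is_surj[OF E.bij_fd_phi[OF v]]]
    obtain a' b' d' where "a = fd E v a'" "b = fd E v b'" "d = fd E v d'" using surj[of a] surj[of b] surj[of d] by blast
    then show "?R a b d" using R[rule_format, of a' b' d'] by (simp only:)
  qed blast
  ultimately show ?thesis by presburger
qed

section \<open>Transfer of curves and frames between the manifold and normal coordinates\<close>

context
  fixes a b :: real and \<alpha> :: "real \<Rightarrow> 'a"
  assumes ab: "a < b" and C2: "Ck_curve M 2 {a..b} \<alpha>" and im: "\<alpha> ` {a..b} \<subseteq> pt ` B"
begin

definition pull_curve :: "real \<Rightarrow> real^3" where "pull_curve s = Ei (chart_map c (\<alpha> s))"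

definition pull :: "(real \<Rightarrow> 'a tvec) \<Rightarrow> real \<Rightarrow> real^3" where
  "pull F s = fd Ei (chart_map c (\<alpha> s)) (F s c)"

lemma pull_curve:
  assumes s: "s \<in> {a..b}"
  shows pull_curve_in: "pull_curve s \<in> B" and pt_pull_curve: "\<alpha> s = pt (pull_curve s)"
    and chart_curve_in: "chart_map c (\<alpha> s) \<in> V" and chart_at_curve: "c \<in> charts_at M (\<alpha> s)"
    and pull_curve_sphere: "\<alpha> s \<in> pt ` sphere 0 R \<Longrightarrow> R < \<rho> \<Longrightarrow> norm (pull_curve s) = R"
proof -
  obtain v where v: "v \<in> B" "\<alpha> s = pt v" using im s by blast
  have "pull_curve s = v" unfolding pull_curve_def v(2) chart_pt[OF v(1)] by (rule Ei_E[OF v(1)])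
  then show "pull_curve s \<in> B" "\<alpha> s = pt (pull_curve s)" using v by auto
  show "chart_map c (\<alpha> s) \<in> V" "c \<in> charts_at M (\<alpha> s)"
    unfolding v(2) chart_pt[OF v(1)] using E_in[OF v(1)] chart_at_pt[OF v(1)] by auto
  assume "\<alpha> s \<in> pt ` sphere 0 R" "R < \<rho>"
  then obtain w where w: "norm w = R" "w \<in> B" "\<alpha> s = pt w" by auto
  have "pull_curve s = w" unfolding pull_curve_def w(3) chart_pt[OF w(2)] by (rule Ei_E[OF w(2)])
  then show "norm (pull_curve s) = R" using w by simp
qed

lemma cont_curve: "continuous_map (top_of_set {a..b}) (rtop M) \<alpha>"
  using C2 unfolding Ck_curve_def by blast

lemma pull_curve_derivative:
  assumes s: "s \<in> {a..b}"
  shows "(pull_curve has_vector_derivative pull (velocity M {a..b} \<alpha>) s) (at s within {a..b})"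
proof -
  note D = Ck_curve_velocity(1)[OF ab C2 _ s chart_at_curve[OF s]]
  have "((\<lambda>s. Ei (chart_map c (\<alpha> s))) has_vector_derivative fd Ei (chart_map c (\<alpha> s)) (velocity M {a..b} \<alpha> s c)) (at s within {a..b})"
    by (rule Ei.cov_transform(1)[where S = "{a..b}", OF D chart_curve_in[OF s] D s]) simp_all
  then show ?thesis unfolding pull_def pull_curve_def[abs_def] .
qed

context
  fixes F assumes F: "diff_field_along M {a..b} \<alpha> F"
begin

lemma lift_pull: assumes s: "s \<in> {a..b}" shows "F s = lift (pull_curve s) (pull F s)"
proof -
  have "F s \<in> tangent_space M (\<alpha> s)" using F s by (auto simp: diff_field_along_def field_along_def)
  from tv_of[OF this chart_at_curve[OF s]] show ?thesis
    unfolding lift_def pull_def pt_pull_curve[OF s, symmetric]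
    by (simp add: pull_curve_def fd_E_Ei[OF chart_curve_in[OF s]])
qed

lemma pull_derivative:
  assumes s: "s \<in> {a..b}" shows "(pull F has_vector_derivative vector_derivative (pull F) (at s within {a..b})) (at s within {a..b})"
proof -
  have "(\<lambda>s. F s c) differentiable (at s within {a..b})" using F s chart_at_curve[OF s] by (auto simp: diff_field_along_def)
  then have D: "((\<lambda>s. F s c) has_vector_derivative vector_derivative (\<lambda>s. F s c) (at s within {a..b})) (at s within {a..b})"
    by (simp add: vector_derivative_works)
  note D' = Ck_curve_velocity(1)[OF ab C2 _ s chart_at_curve[OF s], simplified]
  show ?thesis
    using Ei.cov_transform(2)[where S = "{a..b}", OF D' chart_curve_in[OF s] D s] differentiableI_vector
    unfolding pull_def[abs_def] vector_derivative_works by blast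
qed

lemma cov_deriv_pull:
  assumes s: "s \<in> {a..b}"
  shows "cov_deriv M {a..b} \<alpha> F s = lift (pull_curve s)
     (covd gh (pull_curve s) (pull (velocity M {a..b} \<alpha>) s) (pull F s) (vector_derivative (pull F) (at s within {a..b})))"
  by (rule cov_deriv_lift[where Y = pull_curve and W = "pull F", OF ab cont_curve pull_curve_in pt_pull_curve lift_pull s
        pull_curve_derivative[OF s] pull_derivative[OF s]])

end

end

text \<open>The curve and its frame are pulled back to the Euclidean sphere, where the comparison
  formula applies and its volume term vanishes in constant curvature. The work lies in closing up
  tangent and normal at the end points.\<close>

lemma total_torsion_zero:
  assumes K: "\<And>x u v w. x \<in> chart_cod c \<Longrightarrow> Riem (metric_coeff M c) x u v w =
      K *\<^sub>R (ip (metric_coeff M c) x v w *\<^sub>R u - ip (metric_coeff M c) x u w *\<^sub>R v)"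
    and r: "r \<le> \<rho>" "\<And>v w. v \<in> ball 0 r \<Longrightarrow> w \<noteq> 0 \<Longrightarrow> ip gh v w (w + Gam gh v w v) > 0"
    and R: "0 < R" "R < r" and cl: "closed_C3_curve M a b \<alpha>" and im: "\<alpha> ` {a..b} \<subseteq> geodesic_sphere M (pt 0) R"
  shows "vanishing_total_torsion M a b \<alpha>"
  unfolding vanishing_total_torsion_def
proof (intro allI impI)
  fix tt nn bb \<tau> assume fr: "frenet_frame M a b \<alpha> tt nn bb \<tau>"
  let ?I = "{a..b}"
  have ab: "a < b" and C3: "Ck_curve M 3 ?I \<alpha>" and \<alpha>ab: "\<alpha> a = \<alpha> b"
    and ends: "\<And>d k. d \<in> charts_at M (\<alpha> a) \<Longrightarrow> k \<in> {1,2,3} \<Longrightarrow> iter_vderiv k ?I (chart_map d \<circ> \<alpha>) a = iter_vderiv k ?I (chart_map d \<circ> \<alpha>) b"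
    using cl unfolding closed_C3_curve_def by blast+
  have C2: "Ck_curve M 2 ?I \<alpha>"
    unfolding Ck_curve_def
  proof (intro conjI ballI)
    fix t d assume t: "t \<in> ?I" and d: "d \<in> charts_at M (\<alpha> t)"
    have D: "\<forall>j<3. iter_vderiv j ?I (chart_map d \<circ> \<alpha>) differentiable (at t within ?I)" using C3 t d unfolding Ck_curve_def by blast
    then show "\<forall>j<2. iter_vderiv j ?I (chart_map d \<circ> \<alpha>) differentiable (at t within ?I)" by simp
    have "iter_vderiv 2 ?I (chart_map d \<circ> \<alpha>) differentiable (at t within ?I)" using D by simp
    then show "continuous (at t within ?I) (iter_vderiv 2 ?I (chart_map d \<circ> \<alpha>))" by (rule differentiable_imp_continuous_within)
  qed (use C3 in \<open>simp add: Ck_curve_def\<close>)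
  have R\<rho>: "R < \<rho>" using R r by simp
  have im': "\<alpha> ` ?I \<subseteq> pt ` sphere 0 R" using im geodesic_sphere_pt[OF R(1) R\<rho>] by simp
  have imB: "\<alpha> ` ?I \<subseteq> pt ` B" using im' R\<rho> by force
  define X where "X = pull_curve \<alpha>"
  define T where "T = pull \<alpha> tt"
  define n where "n = pull \<alpha> nn"
  define e where "e = pull \<alpha> bb"
  define \<kappa> where "\<kappa> = curve_curvature M a b \<alpha>"
  have XB: "X s \<in> B" if "s \<in> ?I" for s unfolding X_def by (rule pull_curve_in[OF ab C2 imB that])
  have \<alpha>X: "\<alpha> s = pt (X s)" if "s \<in> ?I" for s unfolding X_def by (rule pt_pull_curve[OF ab C2 imB that])
  have nX: "norm (X s) = R" if "s \<in> ?I" for s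
    unfolding X_def by (rule pull_curve_sphere[OF ab C2 imB that _ R\<rho>]) (use im' that in blast)
  have tt: "tt = velocity M ?I \<alpha>" and D: "diff_field_along M ?I \<alpha> tt" "diff_field_along M ?I \<alpha> nn" "diff_field_along M ?I \<alpha> bb"
    and F: "\<And>s. s \<in> ?I \<Longrightarrow> \<kappa> s \<noteq> 0 \<and> orthonormal3 M (\<alpha> s) (tt s) (nn s) (bb s) \<and>
        cov_deriv M ?I \<alpha> tt s = (\<lambda>d. \<kappa> s *\<^sub>R nn s d) \<and>
        cov_deriv M ?I \<alpha> nn s = (\<lambda>d. - \<kappa> s *\<^sub>R tt s d + \<tau> s *\<^sub>R bb s d) \<and>
        cov_deriv M ?I \<alpha> bb s = (\<lambda>d. - \<tau> s *\<^sub>R nn s d)"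
    using fr unfolding frenet_frame_def \<kappa>_def by blast+
  note lp = lift_pull[OF ab C2 imB, folded X_def] and cp = cov_deriv_pull[OF ab C2 imB, folded X_def tt, folded T_def]
    and pd = pull_derivative[OF ab C2 imB]
  have L: "tt s = lift (X s) (T s)" "nn s = lift (X s) (n s)" "bb s = lift (X s) (e s)" if "s \<in> ?I" for s
    unfolding T_def n_def e_def by (rule lp[OF D(1) that] lp[OF D(2) that] lp[OF D(3) that])+
  define T' n' e' where "T' = (\<lambda>s. vector_derivative T (at s within ?I))" and "n' = (\<lambda>s. vector_derivative n (at s within ?I))"
    and "e' = (\<lambda>s. vector_derivative e (at s within ?I))"
  have Xd: "(X has_vector_derivative T s) (at s within ?I)" if "s \<in> ?I" for s
    unfolding X_def T_def tt by (rule pull_curve_derivative[OF ab C2 imB that])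
  have d: "(T has_vector_derivative T' s) (at s within ?I)" "(n has_vector_derivative n' s) (at s within ?I)"
    "(e has_vector_derivative e' s) (at s within ?I)" if "s \<in> ?I" for s
    unfolding T'_def n'_def e'_def T_def n_def e_def by (rule pd[OF D(1) that] pd[OF D(2) that] pd[OF D(3) that])+
  have o: "onb gh (X s) (T s) (n s) (e s)" if s: "s \<in> ?I" for s
    using F[OF s] unfolding orthonormal3_def \<alpha>X[OF s] L[OF s] rmetric_lift[OF XB[OF s]] onb_def by blast
  have cT: "cov_deriv M ?I \<alpha> tt s = lift (X s) (covd gh (X s) (T s) (T s) (T' s))"
    and cn: "cov_deriv M ?I \<alpha> nn s = lift (X s) (covd gh (X s) (T s) (n s) (n' s))"
    and ce: "cov_deriv M ?I \<alpha> bb s = lift (X s) (covd gh (X s) (T s) (e s) (e' s))" if "s \<in> ?I" for s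
    unfolding T'_def n'_def e'_def
    by (rule cp[OF D(1) that, folded T_def] cp[OF D(2) that, folded n_def] cp[OF D(3) that, folded e_def])+
  have eqs: "covd gh (X s) (T s) (T s) (T' s) = \<kappa> s *\<^sub>R n s" "covd gh (X s) (T s) (n s) (n' s) = - \<kappa> s *\<^sub>R T s + \<tau> s *\<^sub>R e s"
    "covd gh (X s) (T s) (e s) (e' s) = - \<tau> s *\<^sub>R n s" if s: "s \<in> ?I" for s
    using F[OF s] unfolding cT[OF s] cn[OF s] ce[OF s] L[OF s] lift_lincomb(1,2)[OF XB[OF s], symmetric]
    by (blast intro: lift_inject[OF XB[OF s]])+
  have aI: "a \<in> ?I" "b \<in> ?I" using ab by auto
  have Xab: "X a = X b" unfolding X_def pull_curve_def[OF ab C2 imB] \<alpha>ab ..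
  have ca: "c \<in> charts_at M (\<alpha> a)" unfolding \<alpha>X[OF aI(1)] by (rule chart_at_pt[OF XB[OF aI(1)]])
  then have cb: "c \<in> charts_at M (\<alpha> b)" by (simp add: \<alpha>ab)
  have ttab: "tt a c = tt b c" using ends[OF ca, of 1] ca cb by (simp add: tt velocity_def)
  then have Tab: "T a = T b" unfolding T_def pull_def[OF ab C2 imB] \<alpha>ab by simp
  \<comment> \<open>Agreement of the derivatives of orders one and two makes the acceleration close
    up, and with it \<kappa> n.\<close>
  have "cov_deriv M ?I \<alpha> tt a c = cov_deriv M ?I \<alpha> tt b c"
  proof -
    have vd: "vector_derivative (\<lambda>s. tt s c) (at t within ?I) = iter_vderiv 2 ?I (chart_map c \<circ> \<alpha>) t"
      if t: "t \<in> ?I" "c \<in> charts_at M (\<alpha> t)" for t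
      unfolding tt by (rule vector_derivative_interval[OF ab t(1) Ck_curve_velocity_derivative[OF ab C2 _ t]]) simp
    show ?thesis
      unfolding cov_deriv_component[where \<alpha> = \<alpha> and t = a, OF ca] cov_deriv_component[where \<alpha> = \<alpha> and t = b, OF cb]
        vd[OF aI(1) ca] vd[OF aI(2) cb] tt[symmetric] ttab \<alpha>ab
      using ends[OF ca, of 2] by simp
  qed
  then have "fd E (X b) (\<kappa> a *\<^sub>R n a) = fd E (X b) (\<kappa> b *\<^sub>R n b)"
    unfolding cT[OF aI(1)] cT[OF aI(2)] eqs(1)[OF aI(1)] eqs(1)[OF aI(2)] unfolding Xab lift_c[OF XB[OF aI(2)]] .
  then have kn: "\<kappa> a *\<^sub>R n a = \<kappa> b *\<^sub>R n b"
    using injD[OF bij_is_inj[OF E.bij_fd_phi[OF XB[OF aI(2)]]]] by blast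
  \<comment> \<open>The curvature is the length of \<kappa> n, so it closes up together with that
    vector; division by it then closes \<open>n\<close>.\<close>
  have \<kappa>s: "\<kappa> s = sqrt (ip gh (X s) (\<kappa> s *\<^sub>R n s) (\<kappa> s *\<^sub>R n s))" if s: "s \<in> ?I" for s
  proof -
    have "\<kappa> s = sqrt (rmetric M (pt (X s)) (lift (X s) (covd gh (X s) (T s) (T s) (T' s))) (lift (X s) (covd gh (X s) (T s) (T s) (T' s))))"
      unfolding \<kappa>_def curve_curvature_def tnorm_def tt[symmetric] cT[OF s] \<alpha>X[OF s] ..
    then show ?thesis unfolding rmetric_lift[OF XB[OF s]] eqs(1)[OF s] .
  qed
  have "\<kappa> a = \<kappa> b" using \<kappa>s[OF aI(1)] \<kappa>s[OF aI(2)] unfolding kn Xab by simp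
  then have nab: "n a = n b" using kn F[OF aI(2)] by simp
  obtain \<sigma> where I: "((\<lambda>s. \<tau> s + \<sigma> * (vol gh (X s) (X s) (T s) (Gam gh (X s) (T s) (X s)) / R\<^sup>2)) has_integral 0) {a..b}"
    using N.total_torsion_on_sphere[OF r ab R nX Xd d o eqs Xab Tab nab] by blast
  have "vol gh (X s) (X s) (T s) (Gam gh (X s) (T s) (X s)) = 0" if s: "s \<in> ?I" for s
  proof (rule N.vol_Gam_zero[OF _ XB[OF s]])
    fix v x y z assume v: "v \<in> B"
    show "Riem gh v x y z = K *\<^sub>R (ip gh v y z *\<^sub>R x - ip gh v x z *\<^sub>R y)"
      using constant_curvature_normal[OF v, of K] K[OF E.phi_in[OF v]] by blast
  qed
  then show "(\<tau> has_integral 0) {a..b}" by (intro has_integral_eq[OF _ I]) simp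
qed

text \<open>The opposite transfer: a periodic curve and frame in normal coordinates are lifted to
  the manifold, where they form a closed unit speed curve with a Frenet frame of the same \<kappa>
  and \<tau>.\<close>

lemma torsion_free_normal:
  assumes H: "\<And>R a b \<alpha>. 0 < R \<Longrightarrow> R < R0 \<Longrightarrow> closed_C3_curve M a b \<alpha> \<Longrightarrow> arc_length_param M a b \<alpha> \<Longrightarrow>
      \<alpha> ` {a..b} \<subseteq> geodesic_sphere M (pt 0) R \<Longrightarrow> vanishing_total_torsion M a b \<alpha>"
  shows "N.torsion_free_spheres (min R0 \<rho>)"
  unfolding N.torsion_free_spheres_def
proof (intro allI impI)
  fix R l X T n e \<kappa> \<tau>
  assume A: "0 < R \<and> R < min R0 \<rho> \<and> 0 < l \<and>
     smooth_on X UNIV \<and> smooth_on n UNIV \<and> smooth_on e UNIV \<and> (\<forall>s. norm (X s) = R) \<and> (\<forall>s. X (s + l) = X s) \<and>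
     T = (\<lambda>s. vector_derivative X (at s)) \<and> (\<forall>s. \<kappa> s > 0 \<and> onb gh (X s) (T s) (n s) (e s) \<and>
       covd gh (X s) (T s) (T s) (vector_derivative T (at s)) = \<kappa> s *\<^sub>R n s \<and>
       covd gh (X s) (T s) (n s) (vector_derivative n (at s)) = - \<kappa> s *\<^sub>R T s + \<tau> s *\<^sub>R e s \<and>
       covd gh (X s) (T s) (e s) (vector_derivative e (at s)) = - \<tau> s *\<^sub>R n s)"
  then have R: "0 < R" "R < R0" "R < \<rho>" and l: "0 < l" and sm: "smooth_on X UNIV" "smooth_on n UNIV" "smooth_on e UNIV"
    and nX: "\<And>s. norm (X s) = R" and per: "\<And>s. X (s + l) = X s" and T: "T = (\<lambda>s. vector_derivative X (at s))"
    and \<kappa>: "\<And>s. \<kappa> s > 0" and o: "\<And>s. onb gh (X s) (T s) (n s) (e s)"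
    and eqs: "\<And>s. covd gh (X s) (T s) (T s) (vector_derivative T (at s)) = \<kappa> s *\<^sub>R n s"
       "\<And>s. covd gh (X s) (T s) (n s) (vector_derivative n (at s)) = - \<kappa> s *\<^sub>R T s + \<tau> s *\<^sub>R e s"
       "\<And>s. covd gh (X s) (T s) (e s) (vector_derivative e (at s)) = - \<tau> s *\<^sub>R n s"
    by (auto simp del: covd_def)
  define \<alpha> where "\<alpha> = (\<lambda>s. pt (X s))"
  let ?I = "{0..l}"
  have XB: "X s \<in> B" for s using nX R by simp
  have EX: "smooth_on (\<lambda>s. E (X s)) UNIV" "range (\<lambda>s. E (X s)) \<subseteq> chart_cod c"
    using smooth_on_compose[OF open_UNIV open_ball _ E.smooth_phi sm(1)] XB E.phi_in[OF XB] by (auto simp: image_subset_iff)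
  have cl: "closed_C3_curve M 0 l \<alpha>"
    unfolding \<alpha>_def by (rule closed_curve_smooth[OF c l EX]) (simp add: per)
  have cont: "continuous_map (top_of_set ?I) (rtop M) \<alpha>" using cl unfolding closed_C3_curve_def Ck_curve_def by blast
  have smT: "smooth_on T UNIV" unfolding T by (rule smooth_on_real_derivative(2)[OF open_UNIV sm(1)])
  have Xd: "(X has_vector_derivative T s) (at s within ?I)" for s
    unfolding T by (rule has_vector_derivative_at_within[OF smooth_on_real_derivative(1)[OF open_UNIV sm(1) UNIV_I]])
  have d: "(f has_vector_derivative vector_derivative f (at s)) (at s within ?I)" if "smooth_on f UNIV" for f :: "real \<Rightarrow> real^3" and s
    by (rule has_vector_derivative_at_within[OF smooth_on_real_derivative(1)[OF open_UNIV that UNIV_I]])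
  let ?t = "velocity M ?I \<alpha>"
  have vel: "?t s = lift (X s) (T s)" if "s \<in> ?I" for s
    by (rule velocity_lift[OF l cont XB _ that Xd]) (simp add: \<alpha>_def)
  have \<alpha>s: "\<alpha> s = pt (X s)" for s by (simp add: \<alpha>_def)
  define nn ee where "nn = (\<lambda>s. lift (X s) (n s))" and "ee = (\<lambda>s. lift (X s) (e s))"
  have cov: "cov_deriv M ?I \<alpha> F s = lift (X s) (covd gh (X s) (T s) (W s) (vector_derivative W (at s)))"
    and dif: "diff_field_along M ?I \<alpha> F"
    if F: "\<And>s. s \<in> ?I \<Longrightarrow> F s = lift (X s) (W s)" and W: "smooth_on W UNIV" and s: "s \<in> ?I" for F W s
    by (rule cov_deriv_lift[OF l cont XB \<alpha>s F s Xd d[OF W]] diff_field_lift[OF l cont XB \<alpha>s F Xd d[OF W]]; assumption)+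
  have ct: "cov_deriv M ?I \<alpha> ?t s = lift (X s) (\<kappa> s *\<^sub>R n s)" if "s \<in> ?I" for s
    using cov[OF vel smT that] by (simp add: eqs)
  have curv: "curve_curvature M 0 l \<alpha> s = \<kappa> s" if s: "s \<in> ?I" for s
    unfolding curve_curvature_def tnorm_def ct[OF s] \<alpha>s rmetric_lift[OF XB]
    using o[of s] \<kappa>[of s] by (simp add: onb_def)
  have zI: "0 \<in> ?I" using l by simp
  have "frenet_frame M 0 l \<alpha> ?t nn ee \<tau>"
    unfolding frenet_frame_def
  proof (intro conjI ballI refl)
    show "diff_field_along M ?I \<alpha> ?t" by (rule dif[OF vel smT zI])
    show "diff_field_along M ?I \<alpha> nn" by (rule dif[OF _ sm(2) zI]) (simp add: nn_def)
    show "diff_field_along M ?I \<alpha> ee" by (rule dif[OF _ sm(3) zI]) (simp add: ee_def)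
    fix s assume s: "s \<in> ?I"
    show "curve_curvature M 0 l \<alpha> s \<noteq> 0" using \<kappa>[of s] by (simp add: curv[OF s])
    show "orthonormal3 M (\<alpha> s) (?t s) (nn s) (ee s)"
      unfolding orthonormal3_def vel[OF s] nn_def ee_def \<alpha>s rmetric_lift[OF XB] using o[of s] by (simp add: onb_def)
    show "cov_deriv M ?I \<alpha> ?t s = (\<lambda>c. curve_curvature M 0 l \<alpha> s *\<^sub>R nn s c)"
      unfolding ct[OF s] curv[OF s] nn_def by (rule lift_lincomb(2)[OF XB])
    have "cov_deriv M ?I \<alpha> nn s = lift (X s) (- \<kappa> s *\<^sub>R T s + \<tau> s *\<^sub>R e s)"
      using cov[OF _ sm(2) s, of nn] unfolding eqs by (simp add: nn_def)
    then show "cov_deriv M ?I \<alpha> nn s = (\<lambda>c. - curve_curvature M 0 l \<alpha> s *\<^sub>R ?t s c + \<tau> s *\<^sub>R ee s c)"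
      unfolding lift_lincomb(1)[OF XB] curv[OF s] vel[OF s] ee_def .
    have "cov_deriv M ?I \<alpha> ee s = lift (X s) (- \<tau> s *\<^sub>R n s)"
      using cov[OF _ sm(3) s, of ee] unfolding eqs by (simp add: ee_def)
    then show "cov_deriv M ?I \<alpha> ee s = (\<lambda>c. - \<tau> s *\<^sub>R nn s c)"
      unfolding lift_lincomb(2)[OF XB] nn_def .
  qed
  moreover have "arc_length_param M 0 l \<alpha>"
    unfolding arc_length_param_def tnorm_def using vel o by (simp add: \<alpha>s rmetric_lift[OF XB] onb_def)
  moreover have "\<alpha> ` ?I \<subseteq> geodesic_sphere M (pt 0) R"
    unfolding geodesic_sphere_pt[OF R(1,3)] \<alpha>_def using nX by auto
  ultimately show "(\<tau> has_integral 0) {0..l}"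
    using H[OF R(1,2) cl] unfolding vanishing_total_torsion_def by blast
qed

end

section \<open>From pointwise to global constant curvature\<close>

context riemannian3
begin

definition constant_curvature_at :: "'a \<Rightarrow> real \<Rightarrow> 'a chart \<Rightarrow> bool" where
  "constant_curvature_at p k c \<longleftrightarrow> (\<forall>u v w. Riem (metric_coeff M c) (chart_map c p) u v w =
     k *\<^sub>R (ip (metric_coeff M c) (chart_map c p) v w *\<^sub>R u - ip (metric_coeff M c) (chart_map c p) u w *\<^sub>R v))"

lemma constant_curvature_at_chart:
  assumes c: "c \<in> charts_at M p" and d: "d \<in> charts_at M p" and K: "constant_curvature_at p k c"
  shows "constant_curvature_at p k d"
  unfolding constant_curvature_at_def
proof (intro allI)
  fix u v w
  interpret i: patch_isometry "overlap c d" "metric_coeff M c" "chart_cod d" "metric_coeff M d" "transition c d"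
    using isometry_transition c d charts_atD(1) by blast
  note x = chart_map_overlap[OF c d]
  let ?x = "chart_map c p" and ?f = "fd (transition c d) (chart_map c p)"
  obtain u' v' w' where u: "u = ?f u'" "v = ?f v'" "w = ?f w'"
    using surjD[OF bij_is_surj[OF i.bij_fd_phi[OF x]], of u] surjD[OF bij_is_surj[OF i.bij_fd_phi[OF x]], of v]
      surjD[OF bij_is_surj[OF i.bij_fd_phi[OF x]], of w] by blast
  have t: "transition c d ?x = chart_map d p" using c by (simp add: transition_def chart_inv_map charts_atD)
  show "Riem (metric_coeff M d) (chart_map d p) u v w =
     k *\<^sub>R (ip (metric_coeff M d) (chart_map d p) v w *\<^sub>R u - ip (metric_coeff M d) (chart_map d p) u w *\<^sub>R v)"
    using K unfolding u t[symmetric] i.Riem_transform[OF x, symmetric] i.iso[OF x] constant_curvature_at_def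
    by (simp add: linear_scale[OF i.linear_fd_phi[OF x]] linear_diff[OF i.linear_fd_phi[OF x]])
qed

text \<open>Schur's lemma makes the pointwise curvature \<open>k\<close> constant on coordinate
  balls, so all its preimages are open, and connectedness leaves a single value.\<close>

lemma space_form_of_pointwise:
  assumes conn: "connected_space (rtop M)"
    and K: "\<And>p. p \<in> topspace (rtop M) \<Longrightarrow> \<exists>k. \<exists>c\<in>charts_at M p. constant_curvature_at p k c"
  shows "space_form M"
proof -
  let ?X = "topspace (rtop M)"
  have "\<exists>k. \<forall>c\<in>charts_at M p. constant_curvature_at p k c" if p: "p \<in> ?X" for p
  proof -
    obtain k c where "c \<in> charts_at M p" "constant_curvature_at p k c" using K[OF p] by blast
    then show ?thesis using constant_curvature_at_chart[of c p _ k] by blast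
  qed
  then obtain k where k: "\<And>p c. p \<in> ?X \<Longrightarrow> c \<in> charts_at M p \<Longrightarrow> constant_curvature_at p (k p) c" by metis
  have loc: "\<exists>T. openin (rtop M) T \<and> p \<in> T \<and> (\<forall>q\<in>T. k q = k p)" if p: "p \<in> ?X" for p
  proof -
    obtain c where c: "c \<in> charts_at M p" using charts_at_exists[OF p] .
    note cm = charts_atD(1)[OF c] and cd = charts_atD(2)[OF c]
    interpret patch "chart_cod c" "metric_coeff M c" by (rule patch_chart[OF cm])
    have f: "Riem (metric_coeff M c) x u v w = k (chart_inv c x) *\<^sub>R (ip (metric_coeff M c) x v w *\<^sub>R u - ip (metric_coeff M c) x u w *\<^sub>R v)"
      if x: "x \<in> chart_cod c" for x u v w
    proof -
      have "chart_inv c x \<in> ?X" using chart_inv_dom[OF x] dom_topspace[OF cm] by blast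
      from k[OF this charts_at_inv[OF cm x]] show ?thesis unfolding constant_curvature_at_def chart_map_inv[OF x] by blast
    qed
    obtain e where e: "e > 0" "ball (chart_map c p) e \<subseteq> chart_cod c"
      using open_contains_ball open_U chart_map_cod[OF cd] by blast
    have "\<exists>z. \<forall>x\<in>ball (chart_map c p) e. k (chart_inv c x) = z"
    proof (rule has_derivative_zero_constant)
      fix x assume "x \<in> ball (chart_map c p) e"
      then show "((\<lambda>x. k (chart_inv c x)) has_derivative (\<lambda>h. 0)) (at x within ball (chart_map c p) e)"
        using schur[OF f, of x] e(2) has_derivative_at_withinI by blast
    qed simp
    then obtain z where z: "\<And>x. x \<in> ball (chart_map c p) e \<Longrightarrow> k (chart_inv c x) = z" by blast
    have kz: "k q = z" if "q \<in> chart_dom c" "chart_map c q \<in> ball (chart_map c p) e" for q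
      using z[OF that(2)] by (simp add: chart_inv_map[OF cm that(1)])
    have "k p = z" by (rule kz[OF cd]) (use e(1) in simp)
    then show ?thesis using openin_chart_preimage[OF cm open_ball, of "chart_map c p" e] kz cd e(1)
      by (intro exI[of _ "{q \<in> chart_dom c. chart_map c q \<in> ball (chart_map c p) e}"]) auto
  qed
  have op: "openin (rtop M) {p \<in> ?X. k p \<in> S}" for S
  proof (subst openin_subopen, intro ballI)
    fix p assume p: "p \<in> {p \<in> ?X. k p \<in> S}"
    then have "p \<in> ?X" by blast
    from loc[OF this] obtain T where T: "openin (rtop M) T" "p \<in> T" "\<forall>q\<in>T. k q = k p" by blast
    have "q \<in> {p \<in> ?X. k p \<in> S}" if q: "q \<in> T" for q
    proof -
      have "k q = k p" "q \<in> ?X" using T(3) q openin_subset[OF T(1)] by blast+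
      then show ?thesis using p by simp
    qed
    then have "T \<subseteq> {p \<in> ?X. k p \<in> S}" by blast
    then show "\<exists>T. openin (rtop M) T \<and> p \<in> T \<and> T \<subseteq> {p \<in> ?X. k p \<in> S}" using T by blast
  qed
  have const: "k p = k q" if pq: "p \<in> ?X" "q \<in> ?X" for p q
  proof (rule ccontr)
    assume ne: "k p \<noteq> k q"
    have "?X \<subseteq> {x \<in> ?X. k x \<in> {k p}} \<union> {x \<in> ?X. k x \<in> - {k p}}"
      "{x \<in> ?X. k x \<in> {k p}} \<inter> {x \<in> ?X. k x \<in> - {k p}} = {}" "{x \<in> ?X. k x \<in> {k p}} \<noteq> {}" "{x \<in> ?X. k x \<in> - {k p}} \<noteq> {}"
      using pq ne by auto
    then show False using conn op[of "{k p}"] op[of "- {k p}"] unfolding connected_space_def by blast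
  qed
  show ?thesis
  proof (cases "?X = {}")
    case True then show ?thesis unfolding space_form_def by simp
  next
    case False
    then obtain p where p: "p \<in> ?X" by blast
    have "Riem (metric_coeff M c) x u v w = k p *\<^sub>R (ip (metric_coeff M c) x v w *\<^sub>R u - ip (metric_coeff M c) x u w *\<^sub>R v)"
      if c: "c \<in> charts M" and x: "x \<in> chart_cod c" for c x u v w
    proof -
      have q: "chart_inv c x \<in> ?X" using chart_inv_dom[OF x] dom_topspace[OF c] by blast
      from k[OF q charts_at_inv[OF c x]] show ?thesis
        unfolding constant_curvature_at_def chart_map_inv[OF x] const[OF q p] by blast
    qed
    then show ?thesis unfolding space_form_iff by blast
  qed
qed

end

theorem theorem6:
  fixes M :: "'a riem"
  assumes "riemannian_3_manifold M"
    and "connected_space (rtop M)"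
  shows "space_form M \<longleftrightarrow>
    (\<forall>p\<in>topspace (rtop M). \<exists>R0. sphere_radius_bound M p R0 \<and>
       (\<forall>R. 0 < R \<and> R < R0 \<longrightarrow>
          (\<forall>a b \<alpha>. closed_C3_curve M a b \<alpha> \<and> arc_length_param M a b \<alpha> \<and>
                   \<alpha> ` {a..b} \<subseteq> geodesic_sphere M p R \<longrightarrow>
                   vanishing_total_torsion M a b \<alpha>)))"
proof -
  interpret riemannian3 M by (rule riemannian3.intro[OF assms(1)])
  show ?thesis (is "_ \<longleftrightarrow> (\<forall>p\<in>_. \<exists>R0. ?P p R0)")
  proof
    assume "space_form M"
    then obtain K where K: "\<And>c x u v w. c \<in> charts M \<Longrightarrow> x \<in> chart_cod c \<Longrightarrow> Riem (metric_coeff M c) x u v w =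
        K *\<^sub>R (ip (metric_coeff M c) x v w *\<^sub>R u - ip (metric_coeff M c) x u w *\<^sub>R v)" unfolding space_form_iff by blast
    show "\<forall>p\<in>topspace (rtop M). \<exists>R0. ?P p R0"
    proof
      fix p assume "p \<in> topspace (rtop M)"
      then obtain \<rho> gh c V E Ei where n: "normal_chart M \<rho> gh c V E Ei" and p: "chart_inv c (E 0) = p" by (rule normal_chart_exists)
      interpret n: normal_chart M \<rho> gh c V E Ei by (rule n)
      obtain r where r: "0 < r" "r \<le> \<rho>" "\<And>v w. v \<in> ball 0 r \<Longrightarrow> w \<noteq> 0 \<Longrightarrow> ip gh v w (w + Gam gh v w v) > 0"
        using n.N.shape_positive by blast
      have "vanishing_total_torsion M a b \<alpha>" if "0 < R" "R < r" "closed_C3_curve M a b \<alpha>" "\<alpha> ` {a..b} \<subseteq> geodesic_sphere M p R" for R a b \<alpha>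
        by (rule n.total_torsion_zero[OF K[OF n.c] r(2,3) that(1-3) that(4)[folded p]])
      then have "?P p r" using n.sphere_radius_bound_normal[OF r(1,2)] unfolding p by blast
      then show "\<exists>R0. ?P p R0" ..
    qed
  next
    assume H: "\<forall>p\<in>topspace (rtop M). \<exists>R0. ?P p R0"
    show "space_form M"
    proof (rule space_form_of_pointwise[OF assms(2)])
      fix p assume pt: "p \<in> topspace (rtop M)"
      then obtain \<rho> gh c V E Ei where n: "normal_chart M \<rho> gh c V E Ei" and p: "chart_inv c (E 0) = p" by (rule normal_chart_exists)
      interpret n: normal_chart M \<rho> gh c V E Ei by (rule n)
      obtain R0 where R0: "?P p R0" using H pt by blast
      then have pos: "R0 > 0" by (simp add: sphere_radius_bound_def)
      \<comment> \<open>The given bound may exceed the radius of the normal coordinates, in which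
        alone the spheres are identified with Euclidean ones; hence the minimum.\<close>
      have "n.N.torsion_free_spheres (min R0 \<rho>)"
        by (rule n.torsion_free_normal[where ?R0.0 = R0]) (use R0 p in blast)
      then obtain k where "\<forall>a b d. Riem gh 0 a b d = k *\<^sub>R (ip gh 0 b d *\<^sub>R a - ip gh 0 a d *\<^sub>R b)"
        using n.N.Riem_origin_constant pos n.N.rho_pos by (metis min_less_iff_conj)
      then have "constant_curvature_at p k c"
        using n.constant_curvature_normal[OF n.origin_in, of k] n.chart_pt[OF n.origin_in] unfolding p constant_curvature_at_def by simp
      then show "\<exists>k. \<exists>c\<in>charts_at M p. constant_curvature_at p k c" using n.chart_at_pt[OF n.origin_in] p by blast
    qed
  qed
qed

end
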